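(* Let $n$ be an even natural number, let $0<\gamma<1$, and let $G\sim\mathcal{G}(n;p,q)$ with planted communities $\{S_1,S_2\}$, where $p=\alpha\frac{\log n}{n}$ and $q=\beta\frac{\log n}{n}$ with $\beta>0$ and $p>q$. Draw a vertex set $V^{\natural}\subset V(G)$ at random by sampling each node of $G$ independently at random with probability $\gamma$. Let $H$ be the subgraph of $G$ induced by $V^{\natural}$, with adjacency matrix $A$, and let $R_i=S_i\cap V^{\natural}$ for $i\in\{1,2\}$. Define $\lambda^{*}$ as follows: if $|V^{\natural}|\ge 2$, put $\alpha_H:=\frac{p|V^{\natural}|}{\log|V^{\natural}|}$, $\beta_H:=\frac{q|V^{\natural}|}{\log|V^{\natural}|}$ and $$\lambda^{*}=\frac{\alpha_H-\beta_H}{\log\alpha_H-\log\beta_H}\cdot\frac{\log|V^{\natural}|}{|V^{\natural}|};$$ otherwise put $\lambda^{*}=0$. Let $\hat{R}_1,\hat{R}_2$ be the estimators of $R_1,R_2$ obtained by solving the semidefinite program $$\max_{X\in\mathbb{R}^{V^{\natural}\times V^{\natural}}}\ \mathrm{Tr}(AX)-\lambda^{*}\,\mathrm{Tr}(X\mathbf{J})\quad\text{s.t.}\quad X_{ii}=1\ \text{for all } i\in V^{\natural},\quad X\succeq 0 .$$ Set $$\hat{S}_1=\hat{R}_1\cup\{v\in V(G)\setminus V^{\natural}: e(v,\hat{R}_1)>e(v,\hat{R}_2)\},$$ $$\hat{S}_2=\hat{R}_2\cup\{v\in V(G)\setminus V^{\natural}: e(v,\hat{R}_2)>e(v,\hat{R}_1)\}.$$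 Then there exist absolute constants $C,c>0$ such that, with probability $$1-Cn^{-c\left((\alpha+\beta)\frac{\gamma}{2}-\gamma\sqrt{\alpha\beta}-1\right)},$$ $(\hat{S}_1,\hat{S}_2)=(S_1,S_2)$ (up to exchanging the names of the two communities). In particular, $(\hat{S}_1,\hat{S}_2)=(S_1,S_2)$ (in the same sense) with probability $1-o(1)$ as $n\to\infty$, as long as $$\gamma>\frac{2}{(\sqrt{\alpha}-\sqrt{\beta})^2}.$$
   Context: Stochastic block model: for $n$ even and $0\le q<p\le 1$, $G\sim\mathcal{G}(n;p,q)$ is the random graph on a vertex set $V(G)$ of $n$ nodes drawn as follows. Randomly partition $V(G)$ into two equally sized communities $S_1\cup S_2$ (the planted communities). For each pair of distinct vertices, an edge is placed with probability $p$ if both lie in the same community and with probability $q$ otherwise, all independently. The sampling of $V^{\natural}$ is independent of $G$. For a vertex $v$ and a set $S\subset V(G)$, $e(v,S)$ is the number of edges of $G$ between $v$ and $S$. $\mathbf{J}$ is the all-ones matrix of the appropriate size and $X\succeq 0$ means $X$ is symmetric positive semidefinite. Reading off communities from the semidefinite program: $X$ is a surrogate for $xx^{T}$ with $x\in\{\pm1\}^{V^{\natural}}$ a vector of community labels. When the program has a unique solution of the form $X=xx^{T}$ with $x\in\{\pm1\}^{V^{\natural}}$, then $\hat R_1,\hat R_2$ are the two sets $\{i: x_i=1\}$ and $\{i: x_i=-1\}$. The program exactly recovers the communities $R_1,R_2$ when its unique solution is $x^{\natural}(x^{\natural})^{T}$, where $x^{\natural}$ equals $1$ on $R_1$ and $-1$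 on $R_2$. Since $x$ is determined only up to a global sign, the goal is recovery of the partition $\{S_1,S_2\}$, and equality with $(S_1,S_2)$ is understood up to exchanging the names of the two communities. The parameters $\alpha,\beta,\gamma$ are constants not depending on $n$; asymptotic notation is as $n\to\infty$. *)

theory Defs
  imports "HOL-Probability.Probability"
begin

section \<open>The stochastic block model and node sampling\<close>

text \<open>
  The vertex set is \<open>{..<n}\<close>. A graph is given by its set of edges, each edge being a
  two-element set of vertices.
\<close>

definition vertex_pairs :: "nat \<Rightarrow> nat set set" where
  "vertex_pairs n = {e. e \<subseteq> {..<n} \<and> card e = 2}"

text \<open>
  Ordered pairs of communities; each unordered partition is counted twice, so the induced
  partition is uniform. The set of choices is nonempty exactly when \<open>n\<close> is even.
\<close>

definition balanced_partitions :: "nat \<Rightarrow> (nat set \<times> nat set) set" where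
  "balanced_partitions n =
     {(S1, S2). S1 \<union> S2 = {..<n} \<and> S1 \<inter> S2 = {} \<and> card S1 = card S2}"

definition edge_pmf :: "nat \<Rightarrow> real \<Rightarrow> real \<Rightarrow> nat set \<Rightarrow> nat set \<Rightarrow> nat set set pmf" where
  "edge_pmf n p q S1 S2 =
     map_pmf (\<lambda>f. {e \<in> vertex_pairs n. f e})
       (Pi_pmf (vertex_pairs n) False
          (\<lambda>e. bernoulli_pmf (if e \<subseteq> S1 \<or> e \<subseteq> S2 then p else q)))"

definition sbm_pmf :: "nat \<Rightarrow> real \<Rightarrow> real \<Rightarrow> ((nat set \<times> nat set) \<times> nat set set) pmf" where
  "sbm_pmf n p q =
     bind_pmf (pmf_of_set (balanced_partitions n))
       (\<lambda>(S1, S2). map_pmf (\<lambda>E. ((S1, S2), E)) (edge_pmf n p q S1 S2))"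

definition node_sample_pmf :: "nat \<Rightarrow> real \<Rightarrow> nat set pmf" where
  "node_sample_pmf n \<gamma> =
     map_pmf (\<lambda>f. {v \<in> {..<n}. f v}) (Pi_pmf {..<n} False (\<lambda>_. bernoulli_pmf \<gamma>))"

definition sampled_sbm_pmf ::
    "nat \<Rightarrow> real \<Rightarrow> real \<Rightarrow> real \<Rightarrow> (((nat set \<times> nat set) \<times> nat set set) \<times> nat set) pmf" where
  "sampled_sbm_pmf n p q \<gamma> = pair_pmf (sbm_pmf n p q) (node_sample_pmf n \<gamma>)"

definition edge_count :: "nat set set \<Rightarrow> nat \<Rightarrow> nat set \<Rightarrow> nat" where
  "edge_count E v S = card {u \<in> S. {v, u} \<in> E}"

definition induced_edges :: "nat set set \<Rightarrow> nat set \<Rightarrow> nat set set" where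
  "induced_edges E V = {e \<in> E. e \<subseteq> V}"

section \<open>Matrices indexed by a finite set of vertices\<close>

text \<open>
  A real matrix with rows and columns indexed by \<open>V\<close> is a function that vanishes outside
  \<open>V \<times> V\<close>, so that equality of functions is equality of matrices.
\<close>

type_synonym vmat = "nat \<Rightarrow> nat \<Rightarrow> real"

definition is_vmat :: "nat set \<Rightarrow> vmat \<Rightarrow> bool" where
  "is_vmat V X \<longleftrightarrow> (\<forall>i j. i \<notin> V \<or> j \<notin> V \<longrightarrow> X i j = 0)"

definition vmat_trace :: "nat set \<Rightarrow> vmat \<Rightarrow> real" where
  "vmat_trace V X = (\<Sum>i\<in>V. X i i)"

definition vmat_mult :: "nat set \<Rightarrow> vmat \<Rightarrow> vmat \<Rightarrow> vmat" where
  "vmat_mult V X Y = (\<lambda>i j. \<Sum>k\<in>V. X i k * Y k j)"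

definition all_ones :: "nat set \<Rightarrow> vmat" where
  "all_ones V = (\<lambda>i j. if i \<in> V \<and> j \<in> V then 1 else 0)"

definition outer :: "nat set \<Rightarrow> (nat \<Rightarrow> real) \<Rightarrow> vmat" where
  "outer V x = (\<lambda>i j. if i \<in> V \<and> j \<in> V then x i * x j else 0)"

definition sym_psd :: "nat set \<Rightarrow> vmat \<Rightarrow> bool" where
  "sym_psd V X \<longleftrightarrow>
     (\<forall>i\<in>V. \<forall>j\<in>V. X i j = X j i) \<and>
     (\<forall>u :: nat \<Rightarrow> real. 0 \<le> (\<Sum>i\<in>V. \<Sum>j\<in>V. u i * X i j * u j))"

definition adjacency :: "nat set \<Rightarrow> nat set set \<Rightarrow> vmat" where
  "adjacency V F = (\<lambda>i j. if i \<in> V \<and> j \<in> V \<and> {i, j} \<in> F then 1 else 0)"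

section \<open>The semidefinite program and the estimators\<close>

definition sdp_feasible :: "nat set \<Rightarrow> vmat \<Rightarrow> bool" where
  "sdp_feasible V X \<longleftrightarrow> is_vmat V X \<and> (\<forall>i\<in>V. X i i = 1) \<and> sym_psd V X"

definition sdp_objective :: "nat set \<Rightarrow> vmat \<Rightarrow> real \<Rightarrow> vmat \<Rightarrow> real" where
  "sdp_objective V A lam X =
     vmat_trace V (vmat_mult V A X) - lam * vmat_trace V (vmat_mult V X (all_ones V))"

definition sdp_solutions :: "nat set \<Rightarrow> vmat \<Rightarrow> real \<Rightarrow> vmat set" where
  "sdp_solutions V A lam =
     {X. sdp_feasible V X \<and>
         (\<forall>Y. sdp_feasible V Y \<longrightarrow> sdp_objective V A lam Y \<le> sdp_objective V A lam X)}"

text \<open>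
  The estimators are a relation: the labelling \<open>x\<close> is only determined up to a global sign, and no
  pair \<open>(R1, R2)\<close> is related when the program has no unique solution of the form \<open>x x\<^sup>T\<close>.
\<close>

definition sdp_communities ::
    "nat set \<Rightarrow> vmat \<Rightarrow> real \<Rightarrow> nat set \<Rightarrow> nat set \<Rightarrow> bool" where
  "sdp_communities V A lam R1 R2 \<longleftrightarrow>
     (\<exists>x :: nat \<Rightarrow> real. (\<forall>i\<in>V. x i = 1 \<or> x i = -1) \<and>
        sdp_solutions V A lam = {outer V x} \<and>
        R1 = {i \<in> V. x i = 1} \<and> R2 = {i \<in> V. x i = -1})"

definition lambda_star :: "real \<Rightarrow> real \<Rightarrow> nat set \<Rightarrow> real" where
  "lambda_star p q V =
     (if card V \<ge> 2 then
        (let m = real (card V);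
             \<alpha>H = p * m / ln m;
             \<beta>H = q * m / ln m
         in (\<alpha>H - \<beta>H) / (ln \<alpha>H - ln \<beta>H) * (ln m / m))
      else 0)"

text \<open>\<open>majority_extend n E V R R'\<close> is the extension of \<open>R\<close> when the competing community is \<open>R'\<close>.\<close>

definition majority_extend ::
    "nat \<Rightarrow> nat set set \<Rightarrow> nat set \<Rightarrow> nat set \<Rightarrow> nat set \<Rightarrow> nat set" where
  "majority_extend n E V R R' =
     R \<union> {v \<in> {..<n} - V. edge_count E v R > edge_count E v R'}"

text \<open>
  Success requires the program to have a unique solution of the form \<open>x x\<^sup>T\<close>; outcomes for which
  the estimators are undefined count as failures.
\<close>

definition recovers ::
    "nat \<Rightarrow> real \<Rightarrow> real \<Rightarrow> nat set \<Rightarrow> nat set \<Rightarrow> nat set set \<Rightarrow> nat set \<Rightarrow> bool" where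
  "recovers n p q S1 S2 E V \<longleftrightarrow>
     (\<exists>R1 R2. sdp_communities V (adjacency V (induced_edges E V)) (lambda_star p q V) R1 R2 \<and>
        (let T1 = majority_extend n E V R1 R2;
             T2 = majority_extend n E V R2 R1
         in (T1 = S1 \<and> T2 = S2) \<or> (T1 = S2 \<and> T2 = S1)))"

definition recovery_prob :: "nat \<Rightarrow> real \<Rightarrow> real \<Rightarrow> real \<Rightarrow> real" where
  "recovery_prob n p q \<gamma> =
     measure_pmf.prob (sampled_sbm_pmf n p q \<gamma>)
       {(((S1, S2), E), V). recovers n p q S1 S2 E V}"

end

theory Submission
  imports Defs "HOL-Library.Discrete_Functions" "HOL-Real_Asymp.Real_Asymp"
begin

text \<open>
  Fix the sample \<open>V\<close> and let \<open>m = card V\<close> and \<open>R = m * (sqrt p - sqrt q)\<^sup>2 / 2\<close>. For samples of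
  equal size from the two communities, Chernoff's bound for a vertex to have at least as many
  neighbours in the other community as in its own one has the exponent \<open>R\<close>, so a given vertex
  looks misplaced with probability about \<open>exp (- R)\<close>, and some vertex does with probability at
  most about \<open>m * exp (- R)\<close>. With the mean sample size \<open>\<gamma> * n\<close> in place of \<open>m\<close>, this is at most
  \<open>n powr (1 - ((\<alpha> + \<beta>) * (\<gamma> / 2) - \<gamma> * sqrt (\<alpha> * \<beta>)))\<close>. The theorem says that both stages
  succeed except with a probability that is at most a constant times a constant power of this
  quantity.

  For the majority step this is a direct computation with exponential moments, taken over the
  edges and the sample at the same time (\<open>prob_extension_vertex\<close>).

  For the semidefinite program, let \<open>x\<close> be the true labelling. A feasible matrix is a sum of
  \<open>v v\<^sup>T\<close>, and it loses against \<open>x x\<^sup>T\<close> the sum of the values of a signed Laplacian \<open>Q\<close> at the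
  vectors \<open>x v\<close>, so it is enough that \<open>Q\<close> is positive on nonconstant vectors
  (\<open>sdp_unique_solution\<close>). After separating the difference of the two community means, \<open>Q\<close>
  consists of the dual variables \<open>D i\<close> (edges to the own community minus edges to the other one,
  with a penalty), the noise matrix \<open>W\<close> (adjacency minus its mean), and a coupling to the cut
  between the communities (\<open>signed_laplacian_pos\<close>). The penalty \<open>(p - q) / ln (p / q)\<close>, which
  equals \<open>\<lambda>\<^sup>*\<close>, is the value at which \<open>D i \<le> 0\<close> has the exponent \<open>R\<close> whatever the balance of the
  two samples (\<open>crude_exponent_t\<close>).

  The operator norm of \<open>W\<close> is at most a small fraction of the typical size
  \<open>m * (sqrt p - sqrt q) * sqrt p\<close> of the dual variables, except with probability of order
  \<open>exp (- R)\<close> (\<open>prob_norm\<close>). If \<open>R > 3 * ln m\<close>, all dual variables are likely to be typical and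
  this settles the matter. If \<open>ln m \<le> R \<le> 3 * ln m\<close>, there are a few exceptional vertices, and
  for those it must be shown that a barely positive dual variable is enough. Their rows of \<open>W\<close>
  are almost orthogonal, either because exceptional vertices are far apart or by concentration,
  so that their interaction with the rest is governed by their degrees instead of the operator
  norm. For comparable \<open>p\<close> and \<open>q\<close> a gap of order \<open>sqrt p / (sqrt p - sqrt q)\<close> suffices
  (\<open>prob_fail_similar\<close>); for \<open>q\<close> much smaller than \<open>p\<close> the gap has to be proportional to the
  degree (\<open>prob_fail_far\<close>). In both cases requiring it multiplies the probability of failure by
  a constant only. Together the regimes give the failure probability
  \<open>C * (m * exp (- R)) powr (1/64)\<close> (\<open>prob_fail_uniform\<close>).

  This small power can be averaged over the sample, since the fluctuations of \<open>m\<close> enter at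
  second order only, and samples that are far from balanced are improbable
  (\<open>prob_not_recovers_le\<close>). If \<open>\<gamma> > 2 / (sqrt \<alpha> - sqrt \<beta>)\<^sup>2\<close>, the resulting power of \<open>n\<close> is
  negative, which is the second claim.
\<close>

section \<open>Optimality in the semidefinite program\<close>

text \<open>
  The factorisation is Gaussian elimination on one index \<open>a\<close>: either \<open>X a a\<close> vanishes, and then
  positivity forces the whole row to vanish, or subtracting the rank-one matrix built from that
  row leaves a positive semidefinite matrix on the remaining indices.
\<close>

lemma psd_gram:
  assumes "finite V" "sym_psd V X"
  shows "\<exists>(K::nat) v. \<forall>i\<in>V. \<forall>j\<in>V. X i j = (\<Sum>k<K. v k i * v k j)"
  using assms
proof (induction V arbitrary: X rule: finite_induct)
  case empty
  then show ?case by auto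
next
  case (insert a V)
  have sym: "X i j = X j i" if "i \<in> insert a V" "j \<in> insert a V" for i j
    using insert.prems that unfolding sym_psd_def by blast
  have psd: "0 \<le> (\<Sum>i\<in>insert a V. \<Sum>j\<in>insert a V. u i * X i j * u j)" for u
    using insert.prems unfolding sym_psd_def by blast
  have split: "(\<Sum>i\<in>insert a V. \<Sum>j\<in>insert a V. u i * X i j * u j)
      = X a a * (u a)\<^sup>2 + 2 * u a * (\<Sum>j\<in>V. X a j * u j) + (\<Sum>i\<in>V. \<Sum>j\<in>V. u i * X i j * u j)" for u
  proof -
    have "(\<Sum>i\<in>V. u i * X i a * u a) = u a * (\<Sum>j\<in>V. X a j * u j)"
      unfolding sum_distrib_left by (rule sum.cong) (auto simp: sym[of _ a])
    moreover have "(\<Sum>j\<in>V. u a * X a j * u j) = u a * (\<Sum>j\<in>V. X a j * u j)"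
      unfolding sum_distrib_left by (rule sum.cong) auto
    ultimately show ?thesis
      using insert.hyps by (simp add: sum.distrib power2_eq_square algebra_simps)
  qed
  have quad: "0 \<le> X a a * s\<^sup>2 + 2 * s * (\<Sum>j\<in>V. X a j * u j) + (\<Sum>i\<in>V. \<Sum>j\<in>V. u i * X i j * u j)" for s u
  proof -
    let ?u = "u(a := s)"
    have "(\<Sum>j\<in>V. X a j * ?u j) = (\<Sum>j\<in>V. X a j * u j)"
      by (rule sum.cong) (use insert.hyps in auto)
    moreover have "(\<Sum>i\<in>V. \<Sum>j\<in>V. ?u i * X i j * ?u j) = (\<Sum>i\<in>V. \<Sum>j\<in>V. u i * X i j * u j)"
      by (intro sum.cong refl) (use insert.hyps in auto)
    ultimately show ?thesis using psd[of ?u] split[of ?u] by simp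
  qed
  show ?case
  proof (cases "X a a = 0")
    case True
    have row: "X a j = 0" if "j \<in> V" for j
    proof (rule ccontr)
      assume nz: "X a j \<noteq> 0"
      let ?u = "\<lambda>k. of_bool (k = j) :: real"
      have e1: "(\<Sum>k\<in>V. X a k * ?u k) = X a j"
        using insert.hyps that by (simp add: of_bool_def if_distrib cong: if_cong)
      have e2: "(\<Sum>i\<in>V. \<Sum>k\<in>V. ?u i * X i k * ?u k) = X j j"
      proof -
        have "(\<Sum>i\<in>V. \<Sum>k\<in>V. ?u i * X i k * ?u k) = (\<Sum>i\<in>V. if i = j then X j j else 0)"
          by (intro sum.cong refl) (use insert.hyps that in \<open>auto simp: of_bool_def if_distrib cong: if_cong\<close>)
        then show ?thesis using insert.hyps that by simp
      qed
      (* This value of the coordinate at \<open>a\<close> makes the form equal to \<open>-1\<close>. *)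
      have "0 \<le> 2 * (-(X j j + 1) / (2 * X a j)) * X a j + X j j"
        using quad[of "-(X j j + 1) / (2 * X a j)" ?u] True unfolding e1 e2 by simp
      also have "\<dots> = -1" using nz by (simp add: field_simps)
      finally show False by simp
    qed
    have "sym_psd V X"
      unfolding sym_psd_def using sym quad[of 0] by (auto simp: True)
    from insert.IH[OF this] obtain K :: nat and v
      where v: "\<forall>i\<in>V. \<forall>j\<in>V. X i j = (\<Sum>k<K. v k i * v k j)" by blast
    let ?v = "\<lambda>k. (v k)(a := 0)"
    have "\<forall>i\<in>insert a V. \<forall>j\<in>insert a V. X i j = (\<Sum>k<K. ?v k i * ?v k j)"
      using v row sym True insert.hyps by (auto intro!: sum.cong)
    then show ?thesis by (intro exI)
  next
    case False
    have pos: "X a a > 0"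
      using quad[of 1 "\<lambda>_. 0"] False by simp
    define Y where "Y = (\<lambda>i j. X i j - X a i * X a j / X a a)"
    have "sym_psd V Y"
      unfolding sym_psd_def
    proof (intro conjI allI ballI)
      fix i j assume "i \<in> V" "j \<in> V"
      then show "Y i j = Y j i" using sym by (simp add: Y_def)
    next
      fix u :: "nat \<Rightarrow> real"
      define S where "S = (\<Sum>j\<in>V. X a j * u j)"
      have "(\<Sum>i\<in>V. \<Sum>j\<in>V. u i * Y i j * u j)
          = (\<Sum>i\<in>V. \<Sum>j\<in>V. u i * X i j * u j) - (\<Sum>i\<in>V. \<Sum>j\<in>V. (X a i * u i) * (X a j * u j)) / X a a"
        unfolding sum_divide_distrib sum_subtractf[symmetric] Y_def
        by (intro sum.cong refl) (simp add: algebra_simps)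
      also have "(\<Sum>i\<in>V. \<Sum>j\<in>V. (X a i * u i) * (X a j * u j)) = S * S"
        unfolding S_def sum_product ..
      finally have eq: "(\<Sum>i\<in>V. \<Sum>j\<in>V. u i * Y i j * u j) = (\<Sum>i\<in>V. \<Sum>j\<in>V. u i * X i j * u j) - S * S / X a a" .
      (* The value \<open>- S / X a a\<close> minimises the form over the coordinate at \<open>a\<close>. *)
      have "0 \<le> X a a * (- S / X a a)\<^sup>2 + 2 * (- S / X a a) * S + (\<Sum>i\<in>V. \<Sum>j\<in>V. u i * X i j * u j)"
        using quad[of "- S / X a a" u] unfolding S_def .
      also have "\<dots> = (\<Sum>i\<in>V. \<Sum>j\<in>V. u i * X i j * u j) - S * S / X a a"
        using pos by (simp add: field_simps power2_eq_square)
      finally show "0 \<le> (\<Sum>i\<in>V. \<Sum>j\<in>V. u i * Y i j * u j)" unfolding eq .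
    qed
    from insert.IH[OF this] obtain K :: nat and v
      where v: "\<forall>i\<in>V. \<forall>j\<in>V. Y i j = (\<Sum>k<K. v k i * v k j)" by blast
    let ?v = "\<lambda>k. if k < K then (v k)(a := 0) else (\<lambda>i. X a i / sqrt (X a a))"
    have aa: "sqrt (X a a) * sqrt (X a a) = X a a" using pos by simp
    have "X i j = (\<Sum>k<Suc K. ?v k i * ?v k j)" if "i \<in> insert a V" "j \<in> insert a V" for i j
    proof -
      have "(\<Sum>k<Suc K. ?v k i * ?v k j) = (\<Sum>k<K. ((v k)(a := 0)) i * ((v k)(a := 0)) j) + X a i * X a j / X a a"
        using aa by simp
      also have "(\<Sum>k<K. ((v k)(a := 0)) i * ((v k)(a := 0)) j) = (if i = a \<or> j = a then 0 else Y i j)"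
        using v that by (auto intro!: sum.cong)
      finally show ?thesis using that sym pos by (auto simp: Y_def)
    qed
    then show ?thesis by (intro exI[of _ "Suc K"] exI[of _ ?v]) blast
  qed
qed

text \<open>
  The Laplacian form of the complete graph on \<open>V\<close> with weights \<open>(A i j - lam) * x i * x j\<close>. The
  row sums of these weights are the dual variables of the diagonal constraints, so this form is
  the dual certificate of \<open>x x\<^sup>T\<close>, evaluated after the change of sign \<open>y i \<mapsto> x i * y i\<close>.
\<close>

definition signed_laplacian :: "nat set \<Rightarrow> vmat \<Rightarrow> real \<Rightarrow> (nat \<Rightarrow> real) \<Rightarrow> (nat \<Rightarrow> real) \<Rightarrow> real" where
  "signed_laplacian V A lam x y =
     (\<Sum>i\<in>V. \<Sum>j\<in>V. (A i j - lam) * x i * x j * (y i - y j)\<^sup>2) / 2"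

text \<open>
  If a feasible \<open>X\<close> is the sum of the \<open>v k v k\<^sup>T\<close>, then the amount by which \<open>x x\<^sup>T\<close> beats \<open>X\<close> is
  the sum over \<open>k\<close> of the form at \<open>\<lambda>i. x i * v k i\<close>. It is zero only if each of these vectors is
  constant, and then \<open>X = x x\<^sup>T\<close>.
\<close>

lemma sdp_unique_solution:
  assumes fin: "finite V" and x: "\<And>i. i \<in> V \<Longrightarrow> x i = 1 \<or> x i = (-1::real)"
    and symA: "\<And>i j. i \<in> V \<Longrightarrow> j \<in> V \<Longrightarrow> A i j = A j i"
    and pos: "\<And>y. (\<exists>i\<in>V. \<exists>j\<in>V. y i \<noteq> y j) \<Longrightarrow> signed_laplacian V A lam x y > 0"
  shows "sdp_solutions V A lam = {outer V x}"
proof -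
  define obj where "obj = (\<lambda>X. \<Sum>i\<in>V. \<Sum>j\<in>V. (A i j - lam) * X j i)"
  have obj: "sdp_objective V A lam X = obj X" for X
  proof -
    have "(\<Sum>i\<in>V. \<Sum>k\<in>V. X i k * all_ones V k i) = (\<Sum>i\<in>V. \<Sum>k\<in>V. X k i)"
      by (subst sum.swap) (intro sum.cong refl, auto simp: all_ones_def)
    then show ?thesis
      unfolding sdp_objective_def obj_def vmat_trace_def vmat_mult_def
      by (simp add: algebra_simps sum_subtractf sum_distrib_left)
  qed
  have x2: "x i * x i = 1" if "i \<in> V" for i using x[OF that] by auto
  have feas: "sdp_feasible V (outer V x)"
    unfolding sdp_feasible_def is_vmat_def sym_psd_def
  proof (intro conjI allI ballI)
    fix u :: "nat \<Rightarrow> real"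
    have "(\<Sum>i\<in>V. \<Sum>j\<in>V. u i * outer V x i j * u j) = (\<Sum>i\<in>V. u i * x i) * (\<Sum>j\<in>V. u j * x j)"
      unfolding sum_product by (intro sum.cong refl) (auto simp: outer_def)
    then show "0 \<le> (\<Sum>i\<in>V. \<Sum>j\<in>V. u i * outer V x i j * u j)" by simp
  qed (auto simp: outer_def x2)
  have key: "obj (outer V x) - obj X \<ge> 0 \<and> (obj (outer V x) - obj X = 0 \<longrightarrow> X = outer V x)"
    if X: "sdp_feasible V X" for X
  proof -
    from X have psd: "sym_psd V X" and diag: "\<And>i. i \<in> V \<Longrightarrow> X i i = 1" and vm: "is_vmat V X"
      unfolding sdp_feasible_def by auto
    from psd_gram[OF fin psd] obtain K :: nat and v
      where v: "\<And>i j. i \<in> V \<Longrightarrow> j \<in> V \<Longrightarrow> X i j = (\<Sum>k<K. v k i * v k j)" by blast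
    define L where "L = (\<lambda>k. signed_laplacian V A lam x (\<lambda>i. x i * v k i))"
    have "(\<Sum>k<K. L k) = (\<Sum>i\<in>V. \<Sum>j\<in>V. (A i j - lam) * x i * x j * (\<Sum>k<K. (x i * v k i - x j * v k j)\<^sup>2)) / 2"
      unfolding L_def signed_laplacian_def
      apply (simp add: sum_divide_distrib[symmetric] sum_distrib_left)
      apply (subst sum.swap, rule sum.cong, rule refl)
      apply (subst sum.swap, rule sum.cong, rule refl)
      apply simp
      done
    also have "\<dots> = (\<Sum>i\<in>V. \<Sum>j\<in>V. (A i j - lam) * (x i * x j - X j i))"
      unfolding sum_divide_distrib
    proof (intro sum.cong refl)
      fix i j assume i: "i \<in> V" and j: "j \<in> V"
      have "(\<Sum>k<K. (x i * v k i - x j * v k j)\<^sup>2) = x i * x i * X i i + x j * x j * X j j - 2 * x i * x j * X j i"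
        unfolding v[OF i i] v[OF j j] v[OF j i]
        by (simp add: power2_eq_square sum_distrib_left sum.distrib[symmetric] sum_subtractf[symmetric] algebra_simps)
      also have "\<dots> = 2 - 2 * x i * x j * X j i" using i j diag x2 by simp
      finally have sq: "(\<Sum>k<K. (x i * v k i - x j * v k j)\<^sup>2) = 2 - 2 * x i * x j * X j i" .
      have "(A i j - lam) * x i * x j * (\<Sum>k<K. (x i * v k i - x j * v k j)\<^sup>2) / 2
         = (A i j - lam) * (x i * x j - (x i * x i) * (x j * x j) * X j i)"
        unfolding sq by (simp add: field_simps)
      then show "(A i j - lam) * x i * x j * (\<Sum>k<K. (x i * v k i - x j * v k j)\<^sup>2) / 2
         = (A i j - lam) * (x i * x j - X j i)" using x2 i j by simp
    qed
    also have "\<dots> = obj (outer V x) - obj X"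
      unfolding obj_def outer_def
      by (simp add: sum_subtractf[symmetric] algebra_simps cong: sum.cong)
    finally have sumL: "(\<Sum>k<K. L k) = obj (outer V x) - obj X" .
    have L0: "L k \<ge> 0" for k
    proof (cases "\<exists>i\<in>V. \<exists>j\<in>V. x i * v k i \<noteq> x j * v k j")
      case True
      from pos[OF this] show ?thesis unfolding L_def by (rule less_imp_le)
    next
      case False
      then have z: "(A i j - lam) * x i * x j * (x i * v k i - x j * v k j)\<^sup>2 = 0" if "i \<in> V" "j \<in> V" for i j
        using that by (metis cancel_comm_monoid_add_class.diff_cancel mult_zero_right zero_power2)
      have "signed_laplacian V A lam x (\<lambda>i. x i * v k i) = 0"
      proof -
        have "(\<Sum>i\<in>V. \<Sum>j\<in>V. (A i j - lam) * x i * x j * (x i * v k i - x j * v k j)\<^sup>2) = 0"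
          by (intro sum.neutral ballI z)
        then show ?thesis unfolding signed_laplacian_def by (simp only: div_0)
      qed
      then show ?thesis unfolding L_def by simp
    qed
    have "X = outer V x" if "obj (outer V x) - obj X = 0"
    proof -
      have "L k = 0" if "k < K" for k
        using sumL \<open>obj (outer V x) - obj X = 0\<close> L0 that by (simp add: sum_nonneg_eq_0_iff)
      then have const: "x i * v k i = x j * v k j" if "k < K" "i \<in> V" "j \<in> V" for k i j
        using that pos[of "\<lambda>i. x i * v k i"] unfolding L_def by (metis less_irrefl)
      have "X i j = x i * x j" if i: "i \<in> V" and j: "j \<in> V" for i j
      proof -
        have "v k j = x i * x j * v k i" if "k < K" for k
        proof -
          have "v k j = x j * (x j * v k j)" using x2[OF j] by (metis mult.assoc mult_1)
          also have "x j * v k j = x i * v k i" using const[OF that j i] .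
          finally show ?thesis by simp
        qed
        then have "X i j = (\<Sum>k<K. x i * x j * (v k i * v k i))"
          unfolding v[OF i j] by (intro sum.cong) auto
        also have "\<dots> = x i * x j * X i i" unfolding v[OF i i] sum_distrib_left ..
        finally show ?thesis using diag[OF i] by simp
      qed
      then show ?thesis
        using vm unfolding is_vmat_def outer_def by (intro ext) auto
    qed
    moreover have "0 \<le> (\<Sum>k<K. L k)" using L0 by (intro sum_nonneg) auto
    ultimately show ?thesis using sumL by simp
  qed
  show ?thesis
  proof (intro equalityI subsetI)
    fix X assume "X \<in> sdp_solutions V A lam"
    then have "sdp_feasible V X" "obj (outer V x) \<le> obj X"
      using feas unfolding sdp_solutions_def obj by auto
    with key[of X] show "X \<in> {outer V x}" by auto
  next
    fix X assume "X \<in> {outer V x}"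
    then show "X \<in> sdp_solutions V A lam"
      using feas key unfolding sdp_solutions_def obj by auto
  qed
qed

section \<open>A deterministic criterion for positivity of the signed Laplacian\<close>

lemma sum_cross_blocks:
  fixes F :: "nat \<Rightarrow> nat \<Rightarrow> real"
  assumes "finite R1" "finite R2" "R1 \<inter> R2 = {}"
    and "\<And>i j. F i j = F j i"
    and "\<And>i j. i \<in> R1 \<Longrightarrow> j \<in> R1 \<Longrightarrow> F i j = 0" "\<And>i j. i \<in> R2 \<Longrightarrow> j \<in> R2 \<Longrightarrow> F i j = 0"
  shows "(\<Sum>i\<in>R1 \<union> R2. \<Sum>j\<in>R1 \<union> R2. F i j) = 2 * (\<Sum>i\<in>R1. \<Sum>j\<in>R2. F i j)"
proof -
  have "(\<Sum>i\<in>R2. \<Sum>j\<in>R1. F i j) = (\<Sum>i\<in>R1. \<Sum>j\<in>R2. F i j)"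
    by (subst sum.swap) (intro sum.cong refl assms(4))
  then show ?thesis
    using assms by (simp add: sum.union_disjoint sum.distrib)
qed

text \<open>
  The dual variable of the constraint \<open>X i i = 1\<close>: edges from \<open>i\<close> into its own community minus
  edges into the other one, both counted with the penalty \<open>lam\<close>.
\<close>

definition dual_diag :: "nat set \<Rightarrow> vmat \<Rightarrow> real \<Rightarrow> (nat \<Rightarrow> real) \<Rightarrow> nat \<Rightarrow> real" where
  "dual_diag V A lam x i = (\<Sum>j\<in>V. (A i j - lam) * x i * x j)"

definition mean_adj :: "nat set \<Rightarrow> nat set \<Rightarrow> real \<Rightarrow> real \<Rightarrow> vmat" where
  "mean_adj R1 R2 p q = (\<lambda>i j. if i = j then 0
      else if i \<in> R1 \<and> j \<in> R1 \<or> i \<in> R2 \<and> j \<in> R2 then p else q)"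

text \<open>
  Up to a constant every vector has the form \<open>\<alpha> * of_bool (i \<in> R1) + u i\<close> with \<open>u\<close> summing to
  zero on both communities. For such \<open>u\<close> the penalty \<open>lam\<close> disappears from the quadratic term,
  and what is left is the cut between the communities, a coupling term linear in \<open>\<alpha>\<close>, the dual
  variables, and the adjacency matrix conjugated by the signs \<open>x\<close>.
\<close>

lemma signed_laplacian_decomp:
  fixes A :: vmat and u x :: "nat \<Rightarrow> real"
  assumes fin: "finite R1" "finite R2" and disj: "R1 \<inter> R2 = {}"
    and symA: "\<And>i j. A i j = A j i"
    and x: "x = (\<lambda>i. if i \<in> R1 then 1 else -1)"
    and u1: "(\<Sum>i\<in>R1. u i) = 0" and u2: "(\<Sum>i\<in>R2. u i) = 0"
  shows "signed_laplacian (R1 \<union> R2) A lam x (\<lambda>i. \<alpha> * of_bool (i \<in> R1) + u i)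
    = \<alpha>\<^sup>2 * (\<Sum>i\<in>R1. \<Sum>j\<in>R2. lam - A i j)
      + 2 * \<alpha> * (\<Sum>i\<in>R1. \<Sum>j\<in>R2. (lam - A i j) * (u i - u j))
      + (\<Sum>i\<in>R1 \<union> R2. dual_diag (R1 \<union> R2) A lam x i * (u i)\<^sup>2)
      - (\<Sum>i\<in>R1 \<union> R2. \<Sum>j\<in>R1 \<union> R2. A i j * (x i * u i) * (x j * u j))"
proof -
  let ?V = "R1 \<union> R2"
  define w where "w = (\<lambda>i j. (A i j - lam) * x i * x j)"
  define h :: "nat \<Rightarrow> real" where "h = (\<lambda>i. of_bool (i \<in> R1))"
  have wsym: "w i j = w j i" for i j by (simp add: w_def symA[of i j])
  have cross: "w i j = lam - A i j" "h i = 1" "h j = 0" if "i \<in> R1" "j \<in> R2" for i j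
    using that disj by (auto simp: w_def x h_def)
  have same1: "h i = 1" if "i \<in> R1" for i using that by (simp add: h_def)
  have same2: "h i = 0" if "i \<in> R2" for i using that disj by (auto simp: h_def)
  have t1: "(\<Sum>i\<in>?V. \<Sum>j\<in>?V. w i j * (h i - h j)\<^sup>2) = 2 * (\<Sum>i\<in>R1. \<Sum>j\<in>R2. lam - A i j)"
  proof (subst sum_cross_blocks)
    fix i j show "w i j * (h i - h j)\<^sup>2 = w j i * (h j - h i)\<^sup>2"
      by (simp add: wsym[of i j] power2_commute)
  qed (use fin disj in \<open>auto simp: same1 same2 cross\<close>)
  have t2: "(\<Sum>i\<in>?V. \<Sum>j\<in>?V. w i j * ((h i - h j) * (u i - u j)))
      = 2 * (\<Sum>i\<in>R1. \<Sum>j\<in>R2. (lam - A i j) * (u i - u j))"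
  proof (subst sum_cross_blocks)
    fix i j show "w i j * ((h i - h j) * (u i - u j)) = w j i * ((h j - h i) * (u j - u i))"
      by (simp add: wsym[of i j] algebra_simps)
  qed (use fin disj in \<open>auto simp: same1 same2 cross\<close>)
  have t3: "(\<Sum>i\<in>?V. \<Sum>j\<in>?V. w i j * (u i - u j)\<^sup>2)
     = 2 * (\<Sum>i\<in>?V. dual_diag ?V A lam x i * (u i)\<^sup>2) - 2 * (\<Sum>i\<in>?V. \<Sum>j\<in>?V. w i j * (u i * u j))"
  proof -
    have a: "(\<Sum>i\<in>?V. \<Sum>j\<in>?V. w i j * (u i)\<^sup>2) = (\<Sum>i\<in>?V. dual_diag ?V A lam x i * (u i)\<^sup>2)"
      unfolding dual_diag_def w_def sum_distrib_right ..
    have b: "(\<Sum>i\<in>?V. \<Sum>j\<in>?V. w i j * (u j)\<^sup>2) = (\<Sum>i\<in>?V. \<Sum>j\<in>?V. w i j * (u i)\<^sup>2)"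
      by (subst sum.swap) (intro sum.cong refl, simp add: wsym)
    have "(\<Sum>i\<in>?V. \<Sum>j\<in>?V. w i j * (u i - u j)\<^sup>2)
      = (\<Sum>i\<in>?V. \<Sum>j\<in>?V. w i j * (u i)\<^sup>2) + (\<Sum>i\<in>?V. \<Sum>j\<in>?V. w i j * (u j)\<^sup>2)
        - 2 * (\<Sum>i\<in>?V. \<Sum>j\<in>?V. w i j * (u i * u j))"
      unfolding sum_distrib_left sum.distrib[symmetric] sum_subtractf[symmetric]
      by (intro sum.cong refl) (simp add: power2_eq_square algebra_simps)
    then show ?thesis using a b by simp
  qed
  have xu: "(\<Sum>i\<in>?V. x i * u i) = 0"
  proof -
    have "(\<Sum>i\<in>R1. x i * u i) = 0" using u1 by (simp add: x)
    moreover have "(\<Sum>i\<in>R2. x i * u i) = (\<Sum>i\<in>R2. - u i)"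
      using disj by (intro sum.cong refl) (auto simp: x)
    ultimately show ?thesis using u2 fin disj by (simp add: sum.union_disjoint sum_negf)
  qed
  have t4: "(\<Sum>i\<in>?V. \<Sum>j\<in>?V. w i j * (u i * u j))
     = (\<Sum>i\<in>?V. \<Sum>j\<in>?V. A i j * (x i * u i) * (x j * u j))"
  proof -
    have "(\<Sum>i\<in>?V. \<Sum>j\<in>?V. (x i * u i) * (x j * u j)) = 0"
      unfolding sum_product[symmetric] xu by simp
    then have "(\<Sum>i\<in>?V. \<Sum>j\<in>?V. A i j * (x i * u i) * (x j * u j))
      = (\<Sum>i\<in>?V. \<Sum>j\<in>?V. A i j * (x i * u i) * (x j * u j)) - lam * (\<Sum>i\<in>?V. \<Sum>j\<in>?V. (x i * u i) * (x j * u j))"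
      by simp
    also have "\<dots> = (\<Sum>i\<in>?V. \<Sum>j\<in>?V. w i j * (u i * u j))"
      unfolding sum_distrib_left sum_subtractf[symmetric] w_def
      by (intro sum.cong refl) (simp add: algebra_simps)
    finally show ?thesis by simp
  qed
  have "2 * signed_laplacian ?V A lam x (\<lambda>i. \<alpha> * of_bool (i \<in> R1) + u i)
    = (\<Sum>i\<in>?V. \<Sum>j\<in>?V. w i j * ((\<alpha> * h i + u i) - (\<alpha> * h j + u j))\<^sup>2)"
    unfolding signed_laplacian_def w_def h_def by simp
  also have "\<dots> = \<alpha>\<^sup>2 * (\<Sum>i\<in>?V. \<Sum>j\<in>?V. w i j * (h i - h j)\<^sup>2)
      + 2 * \<alpha> * (\<Sum>i\<in>?V. \<Sum>j\<in>?V. w i j * ((h i - h j) * (u i - u j)))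
      + (\<Sum>i\<in>?V. \<Sum>j\<in>?V. w i j * (u i - u j)\<^sup>2)"
    unfolding sum_distrib_left sum.distrib[symmetric]
    by (intro sum.cong refl) (simp add: power2_eq_square algebra_simps)
  finally show ?thesis unfolding t1 t2 t3 t4 by simp
qed

text \<open>
  Vectors with vanishing community sums do not see a block-constant matrix; the value that
  remains comes from the missing diagonal, and its sign is favourable.
\<close>

lemma mean_adj_quadratic_form:
  fixes v :: "nat \<Rightarrow> real"
  assumes fin: "finite R1" "finite R2" and disj: "R1 \<inter> R2 = {}"
    and v1: "(\<Sum>i\<in>R1. v i) = 0" and v2: "(\<Sum>i\<in>R2. v i) = 0"
  shows "(\<Sum>i\<in>R1 \<union> R2. \<Sum>j\<in>R1 \<union> R2. mean_adj R1 R2 p q i j * v i * v j)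
     = - p * (\<Sum>i\<in>R1 \<union> R2. (v i)\<^sup>2)"
proof -
  let ?V = "R1 \<union> R2"
  have row: "(\<Sum>j\<in>?V. mean_adj R1 R2 p q i j * v i * v j) = - p * (v i)\<^sup>2" if i: "i \<in> ?V" for i
  proof -
    define a b where "a = (if i \<in> R1 then p else q)" and "b = (if i \<in> R1 then q else p)"
    have "(\<Sum>j\<in>?V. mean_adj R1 R2 p q i j * v i * v j)
       = (\<Sum>j\<in>?V. ((if j \<in> R1 then a else b) * v i * v j) - (if j = i then p * (v i)\<^sup>2 else 0))"
      by (intro sum.cong refl)
         (use i disj in \<open>auto simp: mean_adj_def a_def b_def power2_eq_square\<close>)
    also have "\<dots> = (\<Sum>j\<in>?V. (if j \<in> R1 then a else b) * v i * v j) - p * (v i)\<^sup>2"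
      using i fin by (simp add: sum_subtractf)
    also have "(\<Sum>j\<in>?V. (if j \<in> R1 then a else b) * v i * v j) =
       (\<Sum>j\<in>R1. a * v i * v j) + (\<Sum>j\<in>R2. b * v i * v j)"
      using fin disj by (subst sum.union_disjoint) (auto intro!: sum.cong arg_cong2[of _ _ _ _ "(+)"])
    also have "\<dots> = 0" unfolding sum_distrib_left[symmetric] v1 v2 by simp
    finally show ?thesis by simp
  qed
  show ?thesis unfolding sum_distrib_left using row by (intro sum.cong) auto
qed

lemma two_mult_ge:
  fixes a g k :: real
  assumes "k > 0"
  shows "2 * a * g \<ge> - (k / 4 * a\<^sup>2) - 4 / k * g\<^sup>2"
proof -
  have "0 \<le> (k / 2 * a + 2 * g)\<^sup>2" by simp
  also have "\<dots> = k * (k / 4 * a\<^sup>2 + 2 * a * g + 4 / k * g\<^sup>2)"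
    using assms by (simp add: power2_eq_square field_simps)
  finally show ?thesis using assms by (simp add: zero_le_mult_iff)
qed

text \<open>
  The exceptional set \<open>B\<close> contains the vertices whose dual variable is too small to dominate the
  noise \<open>W\<close> by its operator norm alone. Away from \<open>B\<close> the threshold \<open>Th\<close> absorbs the noise, the
  interaction with \<open>B\<close> (by completing squares, which produces the factor \<open>4 / Th\<close>) and the
  coupling with \<open>\<alpha>\<close>; half of the cut \<open>k1\<close> absorbs the coupling of \<open>\<alpha>\<close> with both parts (whence
  \<open>4 / k1\<close>). The assumption \<open>bad\<close> is what then remains to be paid by the dual variables on \<open>B\<close>
  themselves. It is stated for \<open>v = x u\<close>, so the signs \<open>x\<close> occur only in the coupling.
\<close>

lemma signed_laplacian_pos:
  fixes A :: vmat and c x :: "nat \<Rightarrow> real"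
  assumes fin: "finite R1" "finite R2" and disj: "R1 \<inter> R2 = {}"
    and symA: "\<And>i j. A i j = A j i"
    and x: "x = (\<lambda>i. if i \<in> R1 then 1 else -1)"
    and W: "W = (\<lambda>i j. A i j - mean_adj R1 R2 p q i j)"
    and p: "0 \<le> p" and Th: "Th > 0" and k1: "k1 > 0"
    and kappa: "k1 \<le> (\<Sum>i\<in>R1. \<Sum>j\<in>R2. lam - A i j)"
    and B: "B \<subseteq> R1 \<union> R2"
    and good: "\<And>i. i \<in> R1 \<union> R2 - B \<Longrightarrow> Th \<le> dual_diag (R1 \<union> R2) A lam x i"
    and norm: "\<And>u. \<bar>\<Sum>i\<in>R1 \<union> R2. \<Sum>j\<in>R1 \<union> R2. W i j * u i * u j\<bar> \<le> Th / 8 * (\<Sum>i\<in>R1 \<union> R2. (u i)\<^sup>2)"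
    and coup: "\<And>u. (\<Sum>i\<in>R1. u i) = 0 \<Longrightarrow> (\<Sum>i\<in>R2. u i) = 0 \<Longrightarrow>
        (\<Sum>i\<in>R1. \<Sum>j\<in>R2. (lam - A i j) * (u i - u j)) = (\<Sum>i\<in>R1 \<union> R2. c i * u i)"
    and coupG: "\<And>u. (\<Sum>i\<in>R1 \<union> R2 - B. c i * u i)\<^sup>2 \<le> k1 * Th / 16 * (\<Sum>i\<in>R1 \<union> R2 - B. (u i)\<^sup>2)"
    and bad: "\<And>u. (\<exists>i\<in>B. u i \<noteq> 0) \<Longrightarrow>
        4 / Th * (\<Sum>j\<in>R1 \<union> R2. (\<Sum>i\<in>B. W i j * u i)\<^sup>2) + (\<Sum>i\<in>B. \<Sum>j\<in>B. W i j * u i * u j)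
          + 4 / k1 * (\<Sum>i\<in>B. c i * x i * u i)\<^sup>2 < (\<Sum>i\<in>B. dual_diag (R1 \<union> R2) A lam x i * (u i)\<^sup>2)"
    and nonconst: "\<exists>i\<in>R1 \<union> R2. \<exists>j\<in>R1 \<union> R2. y i \<noteq> y j"
  shows "signed_laplacian (R1 \<union> R2) A lam x y > 0"
proof -
  let ?V = "R1 \<union> R2"
  define G where "G = ?V - B"
  have finV: "finite ?V" and finB: "finite B" and finG: "finite G" and VGB: "?V = G \<union> B" "G \<inter> B = {}"
    using fin B finite_subset[OF B] by (auto simp: G_def)
  have ne: "R1 \<noteq> {}" "R2 \<noteq> {}" using kappa k1 by auto
  define a1 where "a1 = (\<Sum>i\<in>R1. y i) / card R1"
  define a2 where "a2 = (\<Sum>i\<in>R2. y i) / card R2"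
  define \<alpha> where "\<alpha> = a1 - a2"
  define u where "u = (\<lambda>i. y i - (if i \<in> R1 then a1 else a2))"
  have u1: "(\<Sum>i\<in>R1. u i) = 0"
    using fin ne by (simp add: u_def sum_subtractf a1_def)
  have "(\<Sum>i\<in>R2. u i) = (\<Sum>i\<in>R2. y i - a2)"
    using disj by (intro sum.cong refl) (auto simp: u_def)
  then have u2: "(\<Sum>i\<in>R2. u i) = 0"
    using fin ne by (simp add: sum_subtractf a2_def)
  define v where "v = (\<lambda>i. x i * u i)"
  have v2: "(v i)\<^sup>2 = (u i)\<^sup>2" for i by (simp add: v_def x)
  have v1s: "(\<Sum>i\<in>R1. v i) = 0" using u1 by (simp add: v_def x)
  have "(\<Sum>i\<in>R2. v i) = (\<Sum>i\<in>R2. - u i)"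
    using disj by (intro sum.cong refl) (auto simp: v_def x)
  then have v2s: "(\<Sum>i\<in>R2. v i) = 0" using u2 by (simp add: sum_negf)
  have meansym: "mean_adj R1 R2 p q i j = mean_adj R1 R2 p q j i" for i j
    by (auto simp: mean_adj_def)
  have symW: "W i j = W j i" for i j by (simp add: W symA[of i j] meansym[of i j])
  have xv: "x i * v i = u i" for i by (simp add: v_def x)
  define D where "D = dual_diag ?V A lam x"
  define kp where "kp = (\<Sum>i\<in>R1. \<Sum>j\<in>R2. lam - A i j)"
  define gG where "gG = (\<Sum>i\<in>G. c i * u i)"
  define gB where "gB = (\<Sum>i\<in>B. c i * u i)"
  define G2 where "G2 = (\<Sum>i\<in>G. (u i)\<^sup>2)"
  define b where "b = (\<lambda>j. \<Sum>i\<in>B. W i j * v i)"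
  have eq1: "signed_laplacian ?V A lam x y = signed_laplacian ?V A lam x (\<lambda>i. \<alpha> * of_bool (i \<in> R1) + u i)"
    unfolding signed_laplacian_def
    by (intro arg_cong[of _ _ "\<lambda>z. z / 2"] sum.cong refl) (auto simp: u_def \<alpha>_def)
  have AW: "(\<Sum>i\<in>?V. \<Sum>j\<in>?V. A i j * v i * v j) \<le> (\<Sum>i\<in>?V. \<Sum>j\<in>?V. W i j * v i * v j)"
  proof -
    have "(\<Sum>i\<in>?V. \<Sum>j\<in>?V. A i j * v i * v j) = (\<Sum>i\<in>?V. \<Sum>j\<in>?V. W i j * v i * v j)
       + (\<Sum>i\<in>?V. \<Sum>j\<in>?V. mean_adj R1 R2 p q i j * v i * v j)"
      unfolding sum.distrib[symmetric] W by (intro sum.cong refl) (simp add: algebra_simps)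
    also have "(\<Sum>i\<in>?V. \<Sum>j\<in>?V. mean_adj R1 R2 p q i j * v i * v j) \<le> 0"
      unfolding mean_adj_quadratic_form[OF fin disj v1s v2s]
      using p by (simp add: sum_nonneg)
    finally show ?thesis by simp
  qed
  have Wsplit: "(\<Sum>i\<in>?V. \<Sum>j\<in>?V. W i j * v i * v j)
     = (\<Sum>i\<in>G. \<Sum>j\<in>G. W i j * v i * v j) + 2 * (\<Sum>j\<in>G. v j * b j) + (\<Sum>i\<in>B. \<Sum>j\<in>B. W i j * v i * v j)"
  proof -
    have e1: "(\<Sum>i\<in>B. \<Sum>j\<in>G. W i j * v i * v j) = (\<Sum>j\<in>G. v j * b j)"
      unfolding b_def sum_distrib_left by (subst sum.swap) (intro sum.cong refl, simp)
    have e2: "(\<Sum>i\<in>G. \<Sum>j\<in>B. W i j * v i * v j) = (\<Sum>j\<in>G. v j * b j)"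
      unfolding b_def sum_distrib_left by (intro sum.cong refl) (simp add: symW)
    show ?thesis
      unfolding VGB(1) sum.union_disjoint[OF finG finB VGB(2)] sum.distrib e1 e2 by linarith
  qed
  have GG: "(\<Sum>i\<in>G. \<Sum>j\<in>G. W i j * v i * v j) \<le> Th / 8 * G2"
  proof -
    define v' where "v' = (\<lambda>i. if i \<in> G then v i else 0)"
    have "(\<Sum>i\<in>?V. \<Sum>j\<in>?V. W i j * v' i * v' j) = (\<Sum>i\<in>G. \<Sum>j\<in>?V. W i j * v' i * v' j)"
      by (rule sum.mono_neutral_right) (use finV in \<open>auto simp: v'_def G_def\<close>)
    also have "\<dots> = (\<Sum>i\<in>G. \<Sum>j\<in>G. W i j * v' i * v' j)"
      by (intro sum.cong refl sum.mono_neutral_right) (use finV in \<open>auto simp: v'_def G_def\<close>)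
    also have "\<dots> = (\<Sum>i\<in>G. \<Sum>j\<in>G. W i j * v i * v j)"
      by (intro sum.cong refl) (auto simp: v'_def)
    finally have l: "(\<Sum>i\<in>?V. \<Sum>j\<in>?V. W i j * v' i * v' j) = (\<Sum>i\<in>G. \<Sum>j\<in>G. W i j * v i * v j)" .
    have "(\<Sum>i\<in>?V. (v' i)\<^sup>2) = (\<Sum>i\<in>G. (v' i)\<^sup>2)"
      by (rule sum.mono_neutral_right) (use finV in \<open>auto simp: v'_def G_def\<close>)
    also have "\<dots> = G2" unfolding G2_def by (intro sum.cong refl) (auto simp: v'_def v2)
    finally have r: "(\<Sum>i\<in>?V. (v' i)\<^sup>2) = G2" .
    show ?thesis using norm[of v'] unfolding l r by (rule abs_le_D1)
  qed
  have GB: "2 * (\<Sum>j\<in>G. v j * b j) \<le> Th / 4 * G2 + 4 / Th * (\<Sum>j\<in>?V. (b j)\<^sup>2)"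
  proof -
    have "2 * (\<Sum>j\<in>G. v j * b j) \<le> (\<Sum>j\<in>G. Th / 4 * (v j)\<^sup>2 + 4 / Th * (b j)\<^sup>2)"
      unfolding sum_distrib_left
    proof (rule sum_mono)
      fix j show "2 * (v j * b j) \<le> Th / 4 * (v j)\<^sup>2 + 4 / Th * (b j)\<^sup>2"
        using two_mult_ge[OF Th, of "v j" "- b j"] by simp
    qed
    also have "\<dots> = Th / 4 * G2 + 4 / Th * (\<Sum>j\<in>G. (b j)\<^sup>2)"
      by (simp add: sum.distrib sum_distrib_left G2_def v2)
    also have "(\<Sum>j\<in>G. (b j)\<^sup>2) \<le> (\<Sum>j\<in>?V. (b j)\<^sup>2)"
      by (rule sum_mono2) (use finV in \<open>auto simp: G_def\<close>)
    finally show ?thesis using Th by (simp add: mult_left_mono divide_right_mono)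
  qed
  have DG: "Th * G2 \<le> (\<Sum>i\<in>G. D i * (u i)\<^sup>2)"
    unfolding G2_def sum_distrib_left D_def
    by (intro sum_mono mult_right_mono good) (auto simp: G_def)
  have cG: "2 * \<alpha> * gG \<ge> - (k1 / 4 * \<alpha>\<^sup>2) - Th / 4 * G2"
  proof -
    have "gG\<^sup>2 \<le> k1 * Th / 16 * G2" using coupG[of u] by (simp add: gG_def G2_def G_def)
    then have "4 / k1 * gG\<^sup>2 \<le> 4 / k1 * (k1 * Th / 16 * G2)" using k1 by (intro mult_left_mono) auto
    also have "\<dots> = Th / 4 * G2" using k1 by simp
    finally show ?thesis using two_mult_ge[OF k1, of \<alpha> gG] by linarith
  qed
  have cB: "2 * \<alpha> * gB \<ge> - (k1 / 4 * \<alpha>\<^sup>2) - 4 / k1 * gB\<^sup>2"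
    by (rule two_mult_ge[OF k1])
  have gBv: "gB = (\<Sum>i\<in>B. c i * x i * v i)"
    unfolding gB_def by (simp add: mult.assoc xv)
  define BB where "BB = (\<Sum>i\<in>B. D i * (u i)\<^sup>2) - (4 / Th * (\<Sum>j\<in>?V. (b j)\<^sup>2) + (\<Sum>i\<in>B. \<Sum>j\<in>B. W i j * v i * v j) + 4 / k1 * gB\<^sup>2)"
  have BBpos: "BB > 0" if "\<exists>i\<in>B. u i \<noteq> 0"
  proof -
    have "\<exists>i\<in>B. v i \<noteq> 0" using that by (auto simp: v_def x)
    from bad[OF this] show ?thesis
      unfolding BB_def gBv b_def D_def by (simp add: v2)
  qed
  have BB0: "BB = 0" if "\<not> (\<exists>i\<in>B. u i \<noteq> 0)"
  proof -
    have "u i = 0" "v i = 0" if "i \<in> B" for i using \<open>\<not> (\<exists>i\<in>B. u i \<noteq> 0)\<close> that by (auto simp: v_def)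
    then show ?thesis unfolding BB_def gB_def b_def by (simp cong: sum.cong)
  qed
  have G20: "G2 \<ge> 0" unfolding G2_def by (simp add: sum_nonneg)
  have ThG2: "Th * G2 \<ge> 0" using G20 Th by simp
  have main: "signed_laplacian ?V A lam x y \<ge> k1 / 2 * \<alpha>\<^sup>2 + Th / 8 * G2 + BB"
  proof -
    have "signed_laplacian ?V A lam x y = \<alpha>\<^sup>2 * kp + 2 * \<alpha> * (gG + gB)
        + ((\<Sum>i\<in>G. D i * (u i)\<^sup>2) + (\<Sum>i\<in>B. D i * (u i)\<^sup>2)) - (\<Sum>i\<in>?V. \<Sum>j\<in>?V. A i j * v i * v j)"
    proof -
      have "(\<Sum>i\<in>?V. c i * u i) = gG + gB" "(\<Sum>i\<in>?V. D i * (u i)\<^sup>2) = (\<Sum>i\<in>G. D i * (u i)\<^sup>2) + (\<Sum>i\<in>B. D i * (u i)\<^sup>2)"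
        unfolding gG_def gB_def by (simp_all only: VGB(1) sum.union_disjoint[OF finG finB VGB(2)])
      then show ?thesis
        unfolding eq1 signed_laplacian_decomp[OF fin disj symA x u1 u2] coup[OF u1 u2] D_def kp_def v_def
        by simp
    qed
    moreover have "\<alpha>\<^sup>2 * kp \<ge> k1 * \<alpha>\<^sup>2"
      using mult_right_mono[OF kappa, of "\<alpha>\<^sup>2"] by (simp add: kp_def mult.commute)
    ultimately show ?thesis
      using AW Wsplit GG GB DG cG cB G20 ThG2 distrib_left[of "2 * \<alpha>" gG gB] mult.commute[of "\<alpha>\<^sup>2" kp]
      unfolding BB_def by linarith
  qed
  show ?thesis
  proof (cases "\<exists>i\<in>B. u i \<noteq> 0")
    case True
    moreover have "k1 / 2 * \<alpha>\<^sup>2 \<ge> 0" "Th / 8 * G2 \<ge> 0" using k1 Th G20 by simp_all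
    ultimately show ?thesis using main BBpos by linarith
  next
    case False
    have "\<alpha> \<noteq> 0 \<or> G2 > 0"
    proof (rule ccontr)
      assume "\<not> (\<alpha> \<noteq> 0 \<or> G2 > 0)"
      then have a0: "\<alpha> = 0" and "G2 = 0" using G20 by auto
      then have "\<forall>i\<in>G. u i = 0" unfolding G2_def using finG by (simp add: sum_nonneg_eq_0_iff)
      then have u0: "u i = 0" if "i \<in> ?V" for i using False VGB that by auto
      have "y i = a2" if "i \<in> ?V" for i
        using a0 u0[OF that] unfolding u_def \<alpha>_def by (auto split: if_splits)
      then show False using nonconst by auto
    qed
    then have "k1 / 2 * \<alpha>\<^sup>2 + Th / 8 * G2 > 0"
    proof
      assume "\<alpha> \<noteq> 0"
      then have "k1 / 2 * \<alpha>\<^sup>2 > 0" "Th / 8 * G2 \<ge> 0" using k1 Th G20 by simp_all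
      then show ?thesis by linarith
    next
      assume "G2 > 0"
      then have "k1 / 2 * \<alpha>\<^sup>2 \<ge> 0" "Th / 8 * G2 > 0" using k1 Th by simp_all
      then show ?thesis by linarith
    qed
    then show ?thesis using main BB0[OF False] by linarith
  qed
qed

section \<open>Probability estimates for independent Bernoulli variables\<close>

abbreviation bernoulli_product :: "'e set \<Rightarrow> ('e \<Rightarrow> real) \<Rightarrow> ('e \<Rightarrow> bool) pmf" where
  "bernoulli_product I pe \<equiv> Pi_pmf I False (\<lambda>e. bernoulli_pmf (pe e))"

lemma finite_set_bernoulli_product:
  assumes "finite I"
  shows "finite (set_pmf (bernoulli_product I pe))"
  unfolding set_Pi_pmf[OF assms] by (rule finite_PiE_dflt) (use assms in auto)

lemma prob_le_expectation:
  assumes fin: "finite (set_pmf M)"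
    and nonneg: "\<And>x. 0 \<le> (h x :: real)" and one: "\<And>x. Q x \<Longrightarrow> 1 \<le> h x"
  shows "measure_pmf.prob M {x. Q x} \<le> measure_pmf.expectation M h"
proof -
  have "measure_pmf.prob M {x. Q x} = measure_pmf.expectation M (indicator {x. Q x})"
    by simp
  also have "\<dots> \<le> measure_pmf.expectation M h"
    using fin nonneg one
    by (intro integral_mono integrable_measure_pmf_finite) (auto simp: indicator_def)
  finally show ?thesis .
qed

lemma prob_mono:
  assumes "\<And>x. x \<in> set_pmf M \<Longrightarrow> P x \<Longrightarrow> Q x"
  shows "measure_pmf.prob M {x. P x} \<le> measure_pmf.prob M {x. Q x}"
proof -
  have "measure_pmf.prob M {x. P x} = measure_pmf.prob M ({x. P x} \<inter> set_pmf M)"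
    by (simp add: measure_Int_set_pmf)
  also have "\<dots> \<le> measure_pmf.prob M {x. Q x}"
    by (rule measure_pmf.finite_measure_mono) (use assms in auto)
  finally show ?thesis .
qed

lemma prob_disj_le:
  "measure_pmf.prob M {x. P x \<or> Q x} \<le> measure_pmf.prob M {x. P x} + measure_pmf.prob M {x. Q x}"
proof -
  have "{x. P x \<or> Q x} = {x. P x} \<union> {x. Q x}" by auto
  then show ?thesis by (simp add: measure_Un_le)
qed

lemma prob_bex_le:
  assumes "finite X" and "\<And>i. i \<in> X \<Longrightarrow> measure_pmf.prob M {x. Q i x} \<le> b i"
  shows "measure_pmf.prob M {x. \<exists>i\<in>X. Q i x} \<le> (\<Sum>i\<in>X. b i)"
proof -
  have "{x. \<exists>i\<in>X. Q i x} = (\<Union>i\<in>X. {x. Q i x})" by auto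
  then have "measure_pmf.prob M {x. \<exists>i\<in>X. Q i x} \<le> (\<Sum>i\<in>X. measure_pmf.prob M {x. Q i x})"
    using measure_pmf.finite_measure_subadditive_finite[OF assms(1), of "\<lambda>i. {x. Q i x}" M] by simp
  also have "\<dots> \<le> (\<Sum>i\<in>X. b i)" by (rule sum_mono) (rule assms(2))
  finally show ?thesis .
qed

lemma prob_bind_le:
  assumes fin: "finite (set_pmf M)" and b: "\<And>x. x \<in> set_pmf M \<Longrightarrow> measure_pmf.prob (N x) S \<le> b x"
    and b0: "\<And>x. (0::real) \<le> b x"
  shows "measure_pmf.prob (bind_pmf M N) S \<le> measure_pmf.expectation M b"
proof -
  have "ennreal (measure_pmf.prob (bind_pmf M N) S) = emeasure (bind_pmf M N) S"
    by (simp add: measure_pmf.emeasure_eq_measure)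
  also have "\<dots> = (\<integral>\<^sup>+x. emeasure (N x) S \<partial>M)" by simp
  also have "\<dots> \<le> (\<integral>\<^sup>+x. ennreal (b x) \<partial>M)"
    using b by (intro nn_integral_mono_AE) (auto simp: AE_measure_pmf_iff measure_pmf.emeasure_eq_measure intro!: ennreal_leI)
  also have "\<dots> = ennreal (measure_pmf.expectation M b)"
    using fin b0 by (intro nn_integral_eq_integral integrable_measure_pmf_finite) auto
  finally show ?thesis using b0 by (simp add: integral_nonneg_AE)
qed

lemma prob_count_le:
  assumes fin: "finite (set_pmf M)" and X: "finite X" and N: "0 < (N::real)"
    and b: "\<And>i. i \<in> X \<Longrightarrow> measure_pmf.prob M {f. Q i f} \<le> b"
  shows "measure_pmf.prob M {f. N < real (card {i\<in>X. Q i f})} \<le> real (card X) * b / N"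
proof -
  have "measure_pmf.prob M {f. N < real (card {i\<in>X. Q i f})}
    \<le> measure_pmf.expectation M (\<lambda>f. (\<Sum>i\<in>X. indicator {f. Q i f} f) / N)"
  proof (rule prob_le_expectation[OF fin])
    fix f show "0 \<le> (\<Sum>i\<in>X. indicator {f. Q i f} f) / N" using N by (simp add: sum_nonneg)
    assume "N < real (card {i\<in>X. Q i f})"
    moreover have "(\<Sum>i\<in>X. indicator {f. Q i f} f) = real (card {i\<in>X. Q i f})"
      using X by (simp add: indicator_def sum.If_cases Int_def)
    ultimately show "1 \<le> (\<Sum>i\<in>X. indicator {f. Q i f} f) / N" using N by simp
  qed
  also have "\<dots> = (\<Sum>i\<in>X. measure_pmf.prob M {f. Q i f}) / N"
    by (simp add: integrable_measure_pmf_finite[OF fin])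
  also have "\<dots> \<le> (\<Sum>i\<in>X. b) / N" using N b by (intro divide_right_mono sum_mono) auto
  finally show ?thesis by simp
qed

lemma expectation_prod_bernoulli:
  fixes g :: "'j \<Rightarrow> bool \<Rightarrow> real" and pe :: "'e \<Rightarrow> real" and \<phi> :: "'j \<Rightarrow> 'e"
  assumes I: "finite I" and pe: "\<And>e. e \<in> I \<Longrightarrow> 0 \<le> pe e \<and> pe e \<le> 1"
    and J: "finite J" "inj_on \<phi> J" "\<phi> ` J \<subseteq> I"
    and g: "\<And>j b. j \<in> J \<Longrightarrow> 0 \<le> g j b"
  shows "measure_pmf.expectation (bernoulli_product I pe) (\<lambda>f. \<Prod>j\<in>J. g j (f (\<phi> j)))
     = (\<Prod>j\<in>J. g j True * pe (\<phi> j) + g j False * (1 - pe (\<phi> j)))"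
proof -
  define g' where "g' = (\<lambda>e b. if e \<in> \<phi> ` J then g (the_inv_into J \<phi> e) b else 1)"
  have g'\<phi>: "g' (\<phi> j) b = g j b" if "j \<in> J" for j b
    using that J(2) by (simp add: g'_def the_inv_into_f_f)
  have reindex: "(\<Prod>e\<in>I. k e) = (\<Prod>j\<in>J. k (\<phi> j))" if "\<And>e. e \<in> I - \<phi> ` J \<Longrightarrow> k e = 1" for k :: "'e \<Rightarrow> real"
  proof -
    have "(\<Prod>e\<in>I. k e) = (\<Prod>e\<in>\<phi> ` J. k e)"
      by (rule prod.mono_neutral_right) (use I J that in auto)
    then show ?thesis using J(2) by (simp add: prod.reindex)
  qed
  have "(\<Prod>j\<in>J. g j (f (\<phi> j))) = (\<Prod>e\<in>I. g' e (f e))" for f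
    by (subst reindex) (auto simp: g'_def the_inv_into_f_f[OF J(2)] intro!: prod.cong)
  then have "measure_pmf.expectation (bernoulli_product I pe) (\<lambda>f. \<Prod>j\<in>J. g j (f (\<phi> j)))
     = measure_pmf.expectation (bernoulli_product I pe) (\<lambda>f. \<Prod>e\<in>I. g' e (f e))" by simp
  also have "\<dots> = (\<Prod>e\<in>I. measure_pmf.expectation (bernoulli_pmf (pe e)) (g' e))"
  proof (rule expectation_prod_Pi_pmf[OF I])
    fix e show "integrable (measure_pmf (bernoulli_pmf (pe e))) (g' e)"
      by (rule integrable_measure_pmf_finite) (rule finite)
  next
    fix e b assume "e \<in> I"
    show "0 \<le> g' e b" using g J(2) by (auto simp: g'_def the_inv_into_f_f)
  qed
  also have "\<dots> = (\<Prod>e\<in>I. g' e True * pe e + g' e False * (1 - pe e))"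
    by (intro prod.cong refl) (use pe in auto)
  also have "\<dots> = (\<Prod>j\<in>J. g j True * pe (\<phi> j) + g j False * (1 - pe (\<phi> j)))"
    by (subst reindex) (auto simp: g'_def the_inv_into_f_f[OF J(2)] intro!: prod.cong)
  finally show ?thesis .
qed

lemma one_plus_le_exp_mult:
  assumes "0 \<le> (x::real)"
  shows "y * x + 1 * (1 - x) \<le> exp (x * (y - 1))"
  using exp_ge_add_one_self[of "x * (y - 1)"] by (simp add: algebra_simps)

text \<open>
  The weights \<open>c\<close> include the tilt of the exponential moment, so that edges of different kinds
  can be tilted differently in one bound.
\<close>

lemma chernoff_bernoulli:
  fixes c :: "'j \<Rightarrow> real" and pe :: "'e \<Rightarrow> real" and \<phi> :: "'j \<Rightarrow> 'e"
  assumes I: "finite I" and pe: "\<And>e. e \<in> I \<Longrightarrow> 0 \<le> pe e \<and> pe e \<le> 1"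
    and J: "finite J" "inj_on \<phi> J" "\<phi> ` J \<subseteq> I"
  shows "measure_pmf.prob (bernoulli_product I pe) {f. s \<le> (\<Sum>j\<in>J. c j * of_bool (f (\<phi> j)))}
     \<le> exp ((\<Sum>j\<in>J. pe (\<phi> j) * (exp (c j) - 1)) - s)"
proof -
  let ?M = "bernoulli_product I pe"
  define g where "g = (\<lambda>j b. exp (c j * of_bool b))"
  have "measure_pmf.prob ?M {f. s \<le> (\<Sum>j\<in>J. c j * of_bool (f (\<phi> j)))}
     \<le> measure_pmf.expectation ?M (\<lambda>f. exp (-s) * (\<Prod>j\<in>J. g j (f (\<phi> j))))"
  proof (rule prob_le_expectation[OF finite_set_bernoulli_product[OF I]])
    fix f show "0 \<le> exp (-s) * (\<Prod>j\<in>J. g j (f (\<phi> j)))" by (simp add: g_def prod_nonneg)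
    assume "s \<le> (\<Sum>j\<in>J. c j * of_bool (f (\<phi> j)))"
    then have "1 \<le> exp (-s + (\<Sum>j\<in>J. c j * of_bool (f (\<phi> j))))" by simp
    also have "\<dots> = exp (-s) * (\<Prod>j\<in>J. g j (f (\<phi> j)))"
      by (simp only: exp_add exp_sum[OF J(1)] g_def)
    finally show "1 \<le> exp (-s) * (\<Prod>j\<in>J. g j (f (\<phi> j)))" .
  qed
  also have "\<dots> = exp (-s) * (\<Prod>j\<in>J. g j True * pe (\<phi> j) + g j False * (1 - pe (\<phi> j)))"
    using expectation_prod_bernoulli[OF I pe J, where g = g] by (simp add: g_def)
  also have "\<dots> \<le> exp (-s) * (\<Prod>j\<in>J. exp (pe (\<phi> j) * (exp (c j) - 1)))"
  proof (intro mult_left_mono prod_mono conjI)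
    fix j assume "j \<in> J"
    then have p: "0 \<le> pe (\<phi> j)" "pe (\<phi> j) \<le> 1" using pe J(3) by auto
    show "0 \<le> g j True * pe (\<phi> j) + g j False * (1 - pe (\<phi> j))" using p by (simp add: g_def)
    show "g j True * pe (\<phi> j) + g j False * (1 - pe (\<phi> j)) \<le> exp (pe (\<phi> j) * (exp (c j) - 1))"
      using one_plus_le_exp_mult[OF p(1), of "exp (c j)"] by (simp add: g_def)
  qed simp
  also have "\<dots> = exp ((\<Sum>j\<in>J. pe (\<phi> j) * (exp (c j) - 1)) - s)"
    by (simp only: exp_sum[OF J(1), symmetric] exp_add[symmetric]) (simp add: algebra_simps)
  finally show ?thesis .
qed

section \<open>The random signed graph on two communities\<close>

text \<open>
  A fixed sample: \<open>R1\<close> and \<open>R2\<close> are the sampled parts of the two communities, not necessarily of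
  equal size, inside an ambient graph with independent edges indexed by \<open>I\<close>.
\<close>

locale two_communities =
  fixes I :: "nat set set" and pe :: "nat set \<Rightarrow> real" and R1 R2 :: "nat set" and p q :: real
  assumes finite_I: "finite I" and pe01: "\<And>e. e \<in> I \<Longrightarrow> 0 \<le> pe e \<and> pe e \<le> 1"
    and finite_R: "finite R1" "finite R2" and disjoint_R: "R1 \<inter> R2 = {}"
    and pairs_I: "\<And>i j. i \<in> R1 \<union> R2 \<Longrightarrow> j \<in> R1 \<union> R2 \<Longrightarrow> i \<noteq> j \<Longrightarrow> {i, j} \<in> I"
    and pe_mean: "\<And>i j. i \<in> R1 \<union> R2 \<Longrightarrow> j \<in> R1 \<union> R2 \<Longrightarrow> i \<noteq> j \<Longrightarrow> pe {i, j} = mean_adj R1 R2 p q i j"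
    and pq: "0 < q" "q < p" "p \<le> 1"
begin

abbreviation V where "V \<equiv> R1 \<union> R2"
abbreviation m where "m \<equiv> real (card V)"
abbreviation G where "G \<equiv> bernoulli_product I pe"
text \<open>
  Up to a constant, \<open>exp (- R)\<close> bounds the probability that a vertex has a dual variable of the
  wrong sign; \<open>t\<close> is the tilt that achieves this in Chernoff's bound, and \<open>lam\<close> is the penalty
  of the program, chosen so that \<open>lam * t = (p - q) / 2\<close>.
\<close>

definition del where "del = sqrt p - sqrt q"
definition R where "R = m * del\<^sup>2 / 2"
definition t where "t = ln (p / q) / 2"
definition lam where "lam = (p - q) / ln (p / q)"
definition x :: "nat \<Rightarrow> real" where "x = (\<lambda>i. if i \<in> R1 then 1 else -1)"

definition adj :: "(nat set \<Rightarrow> bool) \<Rightarrow> vmat" where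
  "adj f i j = of_bool (i \<noteq> j \<and> f {i, j})"
definition W :: "(nat set \<Rightarrow> bool) \<Rightarrow> vmat" where
  "W f = (\<lambda>i j. adj f i j - mean_adj R1 R2 p q i j)"
abbreviation D :: "(nat set \<Rightarrow> bool) \<Rightarrow> nat \<Rightarrow> real" where
  "D f \<equiv> dual_diag V (adj f) lam x"

lemma finite_R12 [simp]: "finite R1" "finite R2"
  using finite_R by auto

lemma finite_V: "finite V"
  by simp

lemma adj_sym: "adj f i j = adj f j i"
  by (auto simp: adj_def insert_commute)

lemma mean_sym: "mean_adj R1 R2 p q i j = mean_adj R1 R2 p q j i"
  by (auto simp: mean_adj_def)

lemma W_sym: "W f i j = W f j i"
  unfolding W_def using adj_sym[of f i j] mean_sym[of i j] by simp

lemma W_diag [simp]: "W f i i = 0"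
  by (simp add: W_def adj_def mean_adj_def)

lemma mean_bounds: "0 \<le> mean_adj R1 R2 p q i j" "mean_adj R1 R2 p q i j \<le> p"
  using pq by (auto simp: mean_adj_def)

lemma adj_01: "adj f i j = 0 \<or> adj f i j = 1" and adj_bounds: "0 \<le> adj f i j" "adj f i j \<le> 1"
  by (auto simp: adj_def)

lemma abs_W_le: "\<bar>W f i j\<bar> \<le> adj f i j + p" "\<bar>W f i j\<bar> \<le> 1"
  using adj_01[of f i j] mean_bounds[of i j] pq by (auto simp: W_def)

lemma W_square_le: "(W f i j)\<^sup>2 \<le> adj f i j + p\<^sup>2"
proof -
  have "0 \<le> mean_adj R1 R2 p q i j" "mean_adj R1 R2 p q i j \<le> p" by (rule mean_bounds)+
  moreover from this have "(mean_adj R1 R2 p q i j)\<^sup>2 \<le> p\<^sup>2" by (intro power_mono)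
  moreover have "(adj f i j)\<^sup>2 = adj f i j" using adj_01[of f i j] by auto
  moreover have "(W f i j)\<^sup>2 = (adj f i j)\<^sup>2 - 2 * adj f i j * mean_adj R1 R2 p q i j + (mean_adj R1 R2 p q i j)\<^sup>2"
    by (simp add: W_def power2_eq_square algebra_simps)
  moreover have "0 \<le> adj f i j * mean_adj R1 R2 p q i j" using adj_bounds mean_bounds by simp
  ultimately show ?thesis by linarith
qed

lemma del_pos: "0 < del" and del_le: "del \<le> sqrt p" and del_le1: "del \<le> 1"
proof -
  show "0 < del" "del \<le> sqrt p" using pq by (auto simp: del_def)
  moreover have "sqrt p \<le> 1" using pq by simp
  ultimately show "del \<le> 1" by linarith
qed

lemma del_sq_le: "del\<^sup>2 \<le> p"
  using power_mono[OF del_le, of 2] del_pos pq by simp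

lemma R_le: "2 * R \<le> m * p" and R_nonneg: "0 \<le> R" and R_le_m: "2 * R \<le> m"
proof -
  show "2 * R \<le> m * p" using del_sq_le by (simp add: R_def mult_left_mono)
  also have "\<dots> \<le> m * 1" using pq by (intro mult_left_mono) auto
  finally show "2 * R \<le> m" by simp
qed (simp add: R_def)

lemma t_pos: "0 < t" and exp_t: "exp t = sqrt p / sqrt q" and exp_minus_t: "exp (- t) = sqrt q / sqrt p"
  and lam_t: "lam * t = (p - q) / 2" and lam_pos: "0 < lam"
proof -
  have l: "0 < ln (p / q)" using pq by (simp add: ln_gt_zero)
  then show "0 < t" by (simp add: t_def)
  show "0 < lam" using l pq by (simp add: lam_def)
  show "lam * t = (p - q) / 2" using l by (simp add: lam_def t_def)
  have "t = ln (sqrt (p / q))" using pq by (simp add: t_def ln_sqrt)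
  then have "exp t = sqrt (p / q)" using pq by simp
  then show "exp t = sqrt p / sqrt q" by (simp add: real_sqrt_divide)
  then show "exp (- t) = sqrt q / sqrt p" by (simp add: exp_minus)
qed

text \<open>Tilting by \<open>t\<close> in opposite directions brings both kinds of edges to their geometric mean.\<close>

lemma p_exp_minus_t: "p * exp (- t) = sqrt (p * q)" and q_exp_t: "q * exp t = sqrt (p * q)"
  and del_square: "del\<^sup>2 = p + q - 2 * sqrt (p * q)"
proof -
  have "sqrt p * sqrt p = p" "sqrt q * sqrt q = q" using pq by auto
  moreover have "sqrt p > 0" "sqrt q > 0" using pq by auto
  ultimately show "p * exp (- t) = sqrt (p * q)" "q * exp t = sqrt (p * q)" "del\<^sup>2 = p + q - 2 * sqrt (p * q)"
    unfolding exp_t exp_minus_t del_def by (auto simp: real_sqrt_mult power2_eq_square field_simps)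
qed

lemma chernoff_star:
  assumes i: "i \<in> V" and T: "T \<subseteq> V - {i}"
  shows "measure_pmf.prob G {f. s \<le> (\<Sum>j\<in>T. c j * adj f i j)}
     \<le> exp ((\<Sum>j\<in>T. mean_adj R1 R2 p q i j * (exp (c j) - 1)) - s)"
proof -
  have fT: "finite T" using T finite_subset[of T V] by auto
  have inj: "inj_on (\<lambda>j. {i, j}) T" by (auto simp: inj_on_def doubleton_eq_iff)
  have sub: "(\<lambda>j. {i, j}) ` T \<subseteq> I" using i T pairs_I by auto
  have "(\<Sum>j\<in>T. c j * adj f i j) = (\<Sum>j\<in>T. c j * of_bool (f {i, j}))" for f
    by (intro sum.cong refl) (use T in \<open>auto simp: adj_def\<close>)
  moreover have "(\<Sum>j\<in>T. mean_adj R1 R2 p q i j * (exp (c j) - 1)) = (\<Sum>j\<in>T. pe {i, j} * (exp (c j) - 1))"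
  proof (intro sum.cong refl)
    fix j assume "j \<in> T"
    then have "pe {i, j} = mean_adj R1 R2 p q i j" using i T by (intro pe_mean) auto
    then show "mean_adj R1 R2 p q i j * (exp (c j) - 1) = pe {i, j} * (exp (c j) - 1)" by simp
  qed
  ultimately show ?thesis
    using chernoff_bernoulli[OF finite_I pe01 fT inj sub, where s = s and c = c] by simp
qed

definition upper :: "(nat \<times> nat) set" where
  "upper = {(i, j). i \<in> V \<and> j \<in> V \<and> i < j}"

lemma finite_upper: "finite upper"
  by (rule finite_subset[of _ "V \<times> V"]) (auto simp: upper_def)

lemma chernoff_upper:
  assumes T: "T \<subseteq> upper"
  shows "measure_pmf.prob G {f. s \<le> (\<Sum>(i,j)\<in>T. c i j * adj f i j)}
     \<le> exp ((\<Sum>(i,j)\<in>T. mean_adj R1 R2 p q i j * (exp (c i j) - 1)) - s)"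
proof -
  have fT: "finite T" using finite_subset[OF T finite_upper] .
  have inj: "inj_on (\<lambda>(i, j). {i, j}) T"
  proof (rule inj_onI)
    fix y z assume "y \<in> T" "z \<in> T" and eq: "(case y of (i, j) \<Rightarrow> {i, j}) = (case z of (i, j) \<Rightarrow> {i, j})"
    then have "fst y < snd y" "fst z < snd z" using T by (auto simp: upper_def)
    with eq show "y = z" by (cases y; cases z) (auto simp: doubleton_eq_iff)
  qed
  have sub: "(\<lambda>(i, j). {i, j}) ` T \<subseteq> I" using T pairs_I by (auto simp: upper_def)
  have "(\<Sum>(i,j)\<in>T. c i j * adj f i j) = (\<Sum>z\<in>T. case_prod c z * of_bool (f (case z of (i, j) \<Rightarrow> {i, j})))" for f
    by (intro sum.cong refl) (use T in \<open>auto simp: adj_def upper_def\<close>)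
  moreover have "(\<Sum>(i,j)\<in>T. mean_adj R1 R2 p q i j * (exp (c i j) - 1))
     = (\<Sum>z\<in>T. pe (case z of (i, j) \<Rightarrow> {i, j}) * (exp (case_prod c z) - 1))"
  proof (intro sum.cong refl)
    fix z assume "z \<in> T"
    then obtain i j where z: "z = (i, j)" and ij: "i \<in> V" "j \<in> V" "i \<noteq> j"
      using T unfolding upper_def by (cases z) auto
    show "(case z of (i, j) \<Rightarrow> mean_adj R1 R2 p q i j * (exp (c i j) - 1))
       = pe (case z of (i, j) \<Rightarrow> {i, j}) * (exp (case_prod c z) - 1)"
      using pe_mean[OF ij] by (simp add: z)
  qed
  ultimately show ?thesis
    using chernoff_bernoulli[OF finite_I pe01 fT inj sub, where s = s and c = "case_prod c"] by simp
qed

lemma sum_upper: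
  fixes F :: "nat \<Rightarrow> nat \<Rightarrow> real"
  assumes "\<And>i j. F i j = F j i" "\<And>i. F i i = 0"
  shows "(\<Sum>i\<in>V. \<Sum>j\<in>V. F i j) = 2 * (\<Sum>(i,j)\<in>upper. F i j)"
proof -
  define lower where "lower = {(i, j). i \<in> V \<and> j \<in> V \<and> j < i}"
  define dg where "dg = (\<lambda>i. (i, i)) ` V"
  have V2: "V \<times> V = (upper \<union> lower) \<union> dg"
  proof (intro equalityI subsetI)
    fix z assume "z \<in> V \<times> V"
    then obtain i j where z: "z = (i, j)" "i \<in> V" "j \<in> V" by (cases z) blast
    then show "z \<in> (upper \<union> lower) \<union> dg"
      by (cases i j rule: linorder_cases) (auto simp only: upper_def lower_def dg_def)
  qed (auto simp: upper_def lower_def dg_def)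
  have fin: "finite upper" "finite lower" "finite dg"
    using finite_upper by (auto simp: lower_def dg_def intro: finite_subset[of _ "V \<times> V"])
  have disj: "upper \<inter> lower = {}" "(upper \<union> lower) \<inter> dg = {}"
    by (auto simp: upper_def lower_def dg_def)
  have low: "lower = (\<lambda>(i, j). (j, i)) ` upper"
    by (auto simp: upper_def lower_def image_def)
  have "(\<Sum>i\<in>V. \<Sum>j\<in>V. F i j) = (\<Sum>(i,j)\<in>V \<times> V. F i j)" by (rule sum.cartesian_product)
  also have "\<dots> = (\<Sum>(i,j)\<in>upper. F i j) + (\<Sum>(i,j)\<in>lower. F i j) + (\<Sum>(i,j)\<in>dg. F i j)"
    unfolding V2 using fin disj by (simp add: sum.union_disjoint)
  also have "(\<Sum>(i,j)\<in>dg. F i j) = 0" by (rule sum.neutral) (auto simp: assms dg_def)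
  also have "(\<Sum>(i,j)\<in>lower. F i j) = (\<Sum>(i,j)\<in>upper. F i j)"
    unfolding low by (subst sum.reindex) (auto simp: inj_on_def assms(1) intro!: sum.cong)
  finally show ?thesis by simp
qed

end

section \<open>Rounding a quadratic form to integer vectors\<close>

lemma quadratic_form_coordinate:
  fixes W :: "nat \<Rightarrow> nat \<Rightarrow> real"
  assumes fin: "finite V" and a: "a \<in> V" and sym: "\<And>i j. W i j = W j i" and dg: "\<And>i. W i i = 0"
  shows "(\<Sum>i\<in>V. \<Sum>j\<in>V. W i j * (z(a := s)) i * (z(a := s)) j)
    = (\<Sum>i\<in>V - {a}. \<Sum>j\<in>V - {a}. W i j * z i * z j) + 2 * s * (\<Sum>j\<in>V - {a}. W a j * z j)"
proof -
  define U where "U = V - {a}"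
  have V: "V = insert a U" "a \<notin> U" "finite U" using a fin by (auto simp: U_def)
  let ?z = "z(a := s)"
  have e: "?z i = z i" if "i \<in> U" for i using that V by auto
  have "(\<Sum>j\<in>U. W a j * ?z a * ?z j) = s * (\<Sum>j\<in>U. W a j * z j)"
    unfolding sum_distrib_left by (intro sum.cong refl) (simp add: e del: fun_upd_apply, simp)
  moreover have "(\<Sum>i\<in>U. W i a * ?z i * ?z a) = s * (\<Sum>j\<in>U. W a j * z j)"
    unfolding sum_distrib_left by (intro sum.cong refl) (simp add: e sym[of _ a] del: fun_upd_apply, simp)
  moreover have "(\<Sum>i\<in>U. \<Sum>j\<in>U. W i j * ?z i * ?z j) = (\<Sum>i\<in>U. \<Sum>j\<in>U. W i j * z i * z j)"
    by (intro sum.cong refl) (simp add: e del: fun_upd_apply)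
  moreover have "(\<Sum>i\<in>V. \<Sum>j\<in>V. W i j * ?z i * ?z j) = W a a * ?z a * ?z a
     + (\<Sum>j\<in>U. W a j * ?z a * ?z j) + ((\<Sum>i\<in>U. W i a * ?z i * ?z a) + (\<Sum>i\<in>U. \<Sum>j\<in>U. W i j * ?z i * ?z j))"
    unfolding V(1) by (simp only: sum.insert[OF V(3) V(2)] sum.distrib)
  ultimately show ?thesis unfolding U_def[symmetric] dg by simp
qed

text \<open>
  With a vanishing diagonal the form is affine in each coordinate, so every coordinate can be
  rounded up or down, whichever does not decrease the form.
\<close>

lemma round_quadratic_form:
  fixes W :: "nat \<Rightarrow> nat \<Rightarrow> real"
  assumes fin: "finite V" and sym: "\<And>i j. W i j = W j i" and dg: "\<And>i. W i i = 0"
    and T: "finite T" "T \<subseteq> V"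
  shows "\<exists>y. (\<forall>i\<in>T. y i \<in> \<int> \<and> \<bar>y i - z i\<bar> \<le> 1) \<and> (\<forall>i. i \<notin> T \<longrightarrow> y i = z i) \<and>
     (\<Sum>i\<in>V. \<Sum>j\<in>V. W i j * z i * z j) \<le> (\<Sum>i\<in>V. \<Sum>j\<in>V. W i j * y i * y j)"
  using T
proof (induction T rule: finite_induct)
  case empty
  then show ?case by auto
next
  case (insert a T)
  then obtain y where y: "\<forall>i\<in>T. y i \<in> \<int> \<and> \<bar>y i - z i\<bar> \<le> 1" "\<forall>i. i \<notin> T \<longrightarrow> y i = z i"
    and le: "(\<Sum>i\<in>V. \<Sum>j\<in>V. W i j * z i * z j) \<le> (\<Sum>i\<in>V. \<Sum>j\<in>V. W i j * y i * y j)" by auto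
  have a: "a \<in> V" using insert by auto
  define g where "g = (\<Sum>j\<in>V - {a}. W a j * y j)"
  define s :: real where "s = (if g \<ge> 0 then \<lceil>y a\<rceil> else \<lfloor>y a\<rfloor>)"
  have ya: "y a = z a" using y insert.hyps by auto
  have s: "s \<in> \<int>" "\<bar>s - y a\<bar> \<le> 1" "g * y a \<le> g * s"
  proof -
    show "s \<in> \<int>" by (simp add: s_def)
    show "\<bar>s - y a\<bar> \<le> 1" unfolding s_def by (auto simp: abs_le_iff) linarith+
    show "g * y a \<le> g * s"
    proof (cases "g \<ge> 0")
      case True
      then show ?thesis unfolding s_def by (simp add: mult_left_mono)
    next
      case False
      then show ?thesis unfolding s_def by (simp add: mult_left_mono_neg)
    qed
  qed
  have "(\<Sum>i\<in>V. \<Sum>j\<in>V. W i j * y i * y j) \<le> (\<Sum>i\<in>V. \<Sum>j\<in>V. W i j * (y(a := s)) i * (y(a := s)) j)"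
  proof -
    have "(\<Sum>i\<in>V. \<Sum>j\<in>V. W i j * y i * y j) = (\<Sum>i\<in>V - {a}. \<Sum>j\<in>V - {a}. W i j * y i * y j) + 2 * y a * g"
      using quadratic_form_coordinate[where W = W, OF fin a sym dg, of y "y a"] unfolding g_def by simp
    then show ?thesis
      using quadratic_form_coordinate[where W = W, OF fin a sym dg, of y s] s(3) unfolding g_def
      by (simp add: mult.commute)
  qed
  with le have "(\<Sum>i\<in>V. \<Sum>j\<in>V. W i j * z i * z j) \<le> (\<Sum>i\<in>V. \<Sum>j\<in>V. W i j * (y(a := s)) i * (y(a := s)) j)"
    by linarith
  moreover have "\<forall>i\<in>insert a T. (y(a := s)) i \<in> \<int> \<and> \<bar>(y(a := s)) i - z i\<bar> \<le> 1"
    using y s ya by auto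
  moreover have "\<forall>i. i \<notin> insert a T \<longrightarrow> (y(a := s)) i = z i" using y by auto
  ultimately show ?case by blast
qed

text \<open>
  The rounded vectors. Membership in \<open>extensional V\<close> fixes the irrelevant values outside \<open>V\<close> and
  thereby makes this set finite.
\<close>

definition int_vectors :: "nat set \<Rightarrow> (nat \<Rightarrow> int) set" where
  "int_vectors V = {k \<in> extensional V. (\<Sum>i\<in>V. (real_of_int (k i))\<^sup>2) \<le> 4 * real (card V)}"

lemma round_to_int_vectors:
  fixes W :: "nat \<Rightarrow> nat \<Rightarrow> real"
  assumes fin: "finite V" and sym: "\<And>i j. W i j = W j i" and dg: "\<And>i. W i i = 0"
    and z: "(\<Sum>i\<in>V. (z i)\<^sup>2) \<le> real (card V)"
  shows "\<exists>k\<in>int_vectors V. (\<Sum>i\<in>V. \<Sum>j\<in>V. W i j * z i * z j)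
      \<le> (\<Sum>i\<in>V. \<Sum>j\<in>V. W i j * real_of_int (k i) * real_of_int (k j))"
proof -
  obtain y where y: "\<And>i. i \<in> V \<Longrightarrow> y i \<in> \<int>" "\<And>i. i \<in> V \<Longrightarrow> \<bar>y i - z i\<bar> \<le> 1"
    and le: "(\<Sum>i\<in>V. \<Sum>j\<in>V. W i j * z i * z j) \<le> (\<Sum>i\<in>V. \<Sum>j\<in>V. W i j * y i * y j)"
    using round_quadratic_form[where W = W and z = z, OF fin sym dg fin subset_refl] by blast
  define k where "k = restrict (\<lambda>i. \<lfloor>y i\<rfloor>) V"
  have k: "real_of_int (k i) = y i" if "i \<in> V" for i
    using y(1)[OF that] that by (auto simp: k_def elim: Ints_cases)
  have "(\<Sum>i\<in>V. (real_of_int (k i))\<^sup>2) \<le> (\<Sum>i\<in>V. 2 * (z i)\<^sup>2 + 2)"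
  proof (rule sum_mono)
    fix i assume i: "i \<in> V"
    have "(y i)\<^sup>2 \<le> 2 * (z i)\<^sup>2 + 2 * (y i - z i)\<^sup>2"
      using zero_le_power2[of "2 * z i - y i"] by (simp add: power2_eq_square algebra_simps)
    moreover have "(y i - z i)\<^sup>2 \<le> 1" using y(2)[OF i] by (simp add: abs_square_le_1)
    ultimately show "(real_of_int (k i))\<^sup>2 \<le> 2 * (z i)\<^sup>2 + 2" by (simp add: k[OF i])
  qed
  also have "\<dots> \<le> 4 * real (card V)" using z by (simp add: sum.distrib sum_distrib_left[symmetric])
  finally have "k \<in> int_vectors V" unfolding int_vectors_def by (auto simp: k_def)
  moreover have "(\<Sum>i\<in>V. \<Sum>j\<in>V. W i j * y i * y j) = (\<Sum>i\<in>V. \<Sum>j\<in>V. W i j * real_of_int (k i) * real_of_int (k j))"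
    by (intro sum.cong refl) (simp add: k)
  ultimately show ?thesis using le by auto
qed

lemma sum_exp_neg_square_le:
  "(\<Sum>c\<in>{- int N..int N}. exp (- (real_of_int c)\<^sup>2)) \<le> exp 2"
proof -
  have half: "exp (- (real_of_int c)\<^sup>2) \<le> (1/2) ^ nat \<bar>c\<bar>" for c :: int
  proof -
    have "\<bar>c\<bar> \<le> c\<^sup>2" by (metis abs_le_square_iff abs_idempotent abs_power2 linorder_le_cases mult.right_neutral
        mult_left_mono abs_ge_zero power2_eq_square power2_abs int_one_le_iff_zero_less linorder_not_le order_antisym_conv order.strict_iff_order zero_le_square)
    then have "real_of_int \<bar>c\<bar> \<le> real_of_int (c\<^sup>2)" by (rule of_int_le_iff[THEN iffD2])
    then have "exp (- (real_of_int c)\<^sup>2) \<le> exp (- real (nat \<bar>c\<bar>))" by simp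
    also have "\<dots> = (exp (-1)) ^ nat \<bar>c\<bar>" by (simp add: exp_of_nat_mult[symmetric])
    also have "\<dots> \<le> (1/2) ^ nat \<bar>c\<bar>"
    proof (rule power_mono)
      have "2 \<le> exp (1::real)" using exp_ge_add_one_self[of 1] by simp
      then show "exp (-1) \<le> (1/2 :: real)" by (simp add: exp_minus field_simps)
    qed simp
    finally show ?thesis .
  qed
  have geo: "(\<Sum>c\<in>{- int N..int N}. (1/2 :: real) ^ nat \<bar>c\<bar>) = 3 - 2 * (1/2) ^ N" for N
  proof (induction N)
    case (Suc N)
    have "{- int (Suc N)..int (Suc N)} = insert (- int (Suc N)) (insert (int (Suc N)) {- int N..int N})"
      by auto
    then show ?case using Suc by (simp add: nat_add_distrib)
  qed simp
  have "(\<Sum>c\<in>{- int N..int N}. exp (- (real_of_int c)\<^sup>2)) \<le> 3 - 2 * (1/2) ^ N"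
    unfolding geo[symmetric] by (rule sum_mono) (rule half)
  also have "\<dots> \<le> 1 + 2" by simp
  also have "\<dots> \<le> exp (2::real)" by (rule exp_ge_add_one_self)
  finally show ?thesis .
qed

text \<open>
  An exponential moment bound for counting: the weight \<open>exp (4 * card V - (\<Sum>i\<in>V. k i ^ 2))\<close> is
  at least one on the vectors to be counted, and its sum over a box factorises over the
  coordinates.
\<close>

lemma card_int_vectors:
  assumes fin: "finite V"
  shows "finite (int_vectors V)" and "real (card (int_vectors V)) \<le> exp (6 * real (card V))"
proof -
  define N where "N = 2 * card V"
  let ?P = "PiE V (\<lambda>_. {- int N..int N})"
  have sub: "int_vectors V \<subseteq> ?P"
  proof
    fix k assume k: "k \<in> int_vectors V"
    have "k i \<in> {- int N..int N}" if i: "i \<in> V" for i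
    proof -
      have c1: "1 \<le> card V" using i fin by (auto simp: Suc_le_eq card_gt_0_iff)
      have "(real_of_int (k i))\<^sup>2 \<le> (\<Sum>i\<in>V. (real_of_int (k i))\<^sup>2)"
        using i fin by (intro member_le_sum) auto
      also have "\<dots> \<le> 4 * real (card V)" using k by (simp add: int_vectors_def)
      also have "\<dots> \<le> (real N)\<^sup>2" using c1 by (simp add: N_def power2_eq_square)
      finally have "\<bar>real_of_int (k i)\<bar> \<le> real N" by (simp add: abs_le_square_iff[symmetric])
      then show ?thesis by auto
    qed
    then show "k \<in> ?P" using k by (auto simp: int_vectors_def PiE_iff)
  qed
  have finP: "finite ?P" using fin by (intro finite_PiE) auto
  show "finite (int_vectors V)" using sub finP by (rule finite_subset)
  have "real (card (int_vectors V)) = (\<Sum>k\<in>int_vectors V. 1)" by simp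
  also have "\<dots> \<le> (\<Sum>k\<in>int_vectors V. exp (4 * real (card V)) * (\<Prod>i\<in>V. exp (- (real_of_int (k i))\<^sup>2)))"
  proof (rule sum_mono)
    fix k assume "k \<in> int_vectors V"
    then have "1 \<le> exp (4 * real (card V) + (\<Sum>i\<in>V. - (real_of_int (k i))\<^sup>2))"
      by (simp add: int_vectors_def sum_negf)
    also have "\<dots> = exp (4 * real (card V)) * (\<Prod>i\<in>V. exp (- (real_of_int (k i))\<^sup>2))"
      by (simp only: exp_add exp_sum[OF fin])
    finally show "1 \<le> exp (4 * real (card V)) * (\<Prod>i\<in>V. exp (- (real_of_int (k i))\<^sup>2))" .
  qed
  also have "\<dots> \<le> (\<Sum>k\<in>?P. exp (4 * real (card V)) * (\<Prod>i\<in>V. exp (- (real_of_int (k i))\<^sup>2)))"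
    by (rule sum_mono2[OF finP sub]) (simp add: prod_nonneg)
  also have "\<dots> = exp (4 * real (card V)) * (\<Prod>i\<in>V. \<Sum>c\<in>{- int N..int N}. exp (- (real_of_int c)\<^sup>2))"
    unfolding sum_distrib_left[symmetric] by (subst prod_sum_PiE[OF fin]) auto
  also have "\<dots> \<le> exp (4 * real (card V)) * (\<Prod>i\<in>V. exp 2)"
    by (intro mult_left_mono prod_mono conjI sum_exp_neg_square_le sum_nonneg) auto
  also have "\<dots> = exp (6 * real (card V))"
    by (simp add: exp_of_nat_mult[symmetric] exp_add[symmetric])
  finally show "real (card (int_vectors V)) \<le> exp (6 * real (card V))" .
qed

section \<open>Heavy pairs\<close>

lemma sum_powers_of_two_le:
  assumes F: "finite F" "\<And>a. a \<in> F \<Longrightarrow> (2::real) ^ a \<le> X" and X: "0 \<le> X"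
  shows "(\<Sum>a\<in>F. (2::real) ^ a) \<le> 2 * X"
proof (cases "F = {}")
  case False
  have "(\<Sum>a\<in>F. (2::real) ^ a) \<le> (\<Sum>a<Suc (Max F). 2 ^ a)"
    using F by (intro sum_mono2) (auto simp: less_Suc_eq_le)
  also have "\<dots> = 2 * 2 ^ Max F - 1"
    using geometric_sum[of "2::real" "Suc (Max F)"] by simp
  also have "\<dots> \<le> 2 * X" using F(2)[OF Max_in[OF F(1) False]] by linarith
  finally show ?thesis .
qed (use X in simp)

text \<open>
  Vertices are grouped by the binary logarithm of \<open>\<bar>k i\<bar>\<close>, and the number of edges between two
  groups is bounded by \<open>disc\<close>. In the \<open>c1\<close> part one more factor of size \<open>\<bar>k i * k j\<bar> / T\<close> may be
  inserted, which turns it into a product of two square sums. In the \<open>c2\<close> part only levels of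
  ratio at most about \<open>\<rho>\<close> meet, so one of the two sums over levels is geometric and the other is
  a single square sum.
\<close>

lemma heavy_level_pairs_bound:
  fixes A :: "nat \<Rightarrow> nat \<Rightarrow> real" and k :: "nat \<Rightarrow> int"
  assumes fin: "finite V" and A0: "\<And>i j. 0 \<le> A i j"
    and disc: "\<And>S S'. S \<subseteq> V \<Longrightarrow> S' \<subseteq> V \<Longrightarrow> (\<Sum>i\<in>S. \<Sum>j\<in>S'. A i j)
       \<le> c1 * (real (card S) * real (card S')) + c2 * max (real (card S)) (real (card S'))"
    and K: "(\<Sum>i\<in>V. (real_of_int (k i))\<^sup>2) \<le> Kb"
    and pos: "0 < T" "1 \<le> \<rho>" "0 \<le> c1" "0 \<le> c2"
  defines "P \<equiv> \<lambda>i j. \<bar>k j\<bar> \<le> \<bar>k i\<bar> \<and> real_of_int \<bar>k i\<bar> < \<rho> * real_of_int \<bar>k j\<bar> \<and> T < real_of_int \<bar>k i * k j\<bar>"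
  shows "(\<Sum>i\<in>V. \<Sum>j\<in>V. if P i j then A i j * real_of_int \<bar>k i * k j\<bar> else 0)
     \<le> 16 * c1 * Kb\<^sup>2 / T + 24 * \<rho> * c2 * Kb"
proof -
  define V0 where "V0 = {i\<in>V. k i \<noteq> 0}"
  define L where "L = (\<lambda>i. floor_log (nat \<bar>k i\<bar>))"
  define Lv where "Lv = L ` V0"
  define S where "S = (\<lambda>a. {i\<in>V0. L i = a})"
  define s where "s = (\<lambda>a. real (card (S a)))"
  have fV0: "finite V0" and fLv: "finite Lv" and SV: "S a \<subseteq> V" for a
    using fin by (auto simp: V0_def Lv_def S_def)
  have s0: "0 \<le> s a" for a by (simp add: s_def)
  have lev: "2 ^ L i \<le> real_of_int \<bar>k i\<bar>" "real_of_int \<bar>k i\<bar> < 2 * 2 ^ L i" if "k i \<noteq> 0" for i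
  proof -
    have "0 < nat \<bar>k i\<bar>" using that by simp
    from floor_log_exp2_le[OF this] floor_log_exp2_gt[of "nat \<bar>k i\<bar>"]
    have "2 ^ L i \<le> nat \<bar>k i\<bar>" "nat \<bar>k i\<bar> < 2 * 2 ^ L i" by (simp_all add: L_def)
    then have "real (2 ^ L i) \<le> real (nat \<bar>k i\<bar>)" "real (nat \<bar>k i\<bar>) < real (2 * 2 ^ L i)"
      by (simp_all only: of_nat_le_iff of_nat_less_iff)
    then show "2 ^ L i \<le> real_of_int \<bar>k i\<bar>" "real_of_int \<bar>k i\<bar> < 2 * 2 ^ L i" by simp_all
  qed
  define F where "F = (\<lambda>i j. if P i j then A i j * real_of_int \<bar>k i * k j\<bar> else 0)"
  have Fz: "F i j = 0" if "k i = 0 \<or> k j = 0" for i j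
    using that pos(1) by (auto simp: F_def P_def)
  have grp: "(\<Sum>i\<in>V0. h i) = (\<Sum>a\<in>Lv. \<Sum>i\<in>S a. h i)" for h :: "nat \<Rightarrow> real"
    unfolding S_def by (rule sum.group[OF fV0 fLv, symmetric]) (simp add: Lv_def)
  have mass: "(\<Sum>a\<in>Lv. s a * 4 ^ a) \<le> Kb"
  proof -
    have "(\<Sum>a\<in>Lv. s a * 4 ^ a) = (\<Sum>a\<in>Lv. \<Sum>i\<in>S a. 4 ^ L i)"
      by (intro sum.cong refl) (simp add: s_def S_def)
    also have "\<dots> = (\<Sum>i\<in>V0. 4 ^ L i)" by (rule grp[symmetric])
    also have "\<dots> \<le> (\<Sum>i\<in>V0. (real_of_int (k i))\<^sup>2)"
    proof (rule sum_mono)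
      fix i assume "i \<in> V0"
      then have "(2 ^ L i)\<^sup>2 \<le> (real_of_int \<bar>k i\<bar>)\<^sup>2" using lev by (intro power_mono) (auto simp: V0_def)
      moreover have "(2 ^ L i)\<^sup>2 = (4::real) ^ L i"
        by (metis mult.commute numeral_Bit0_eq_double power2_eq_square power_mult power_mult_distrib mult_2 numeral_Bit0)
      ultimately show "4 ^ L i \<le> (real_of_int (k i))\<^sup>2" by simp
    qed
    also have "\<dots> \<le> (\<Sum>i\<in>V. (real_of_int (k i))\<^sup>2)"
      by (rule sum_mono2) (use fin in \<open>auto simp: V0_def\<close>)
    finally show ?thesis using K by linarith
  qed
  have mass0: "0 \<le> (\<Sum>a\<in>Lv. s a * 4 ^ a)" by (intro sum_nonneg) (simp add: s0)
  (* \<open>t1\<close> bounds the \<open>c1\<close> part of a pair of levels; \<open>t2\<close> and \<open>t3\<close> bound the \<open>c2\<close> part according to which of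
     the two groups is the larger one. *)
  define t1 where "t1 = (\<lambda>a b. 16 * c1 / T * ((s a * 4 ^ a) * (s b * 4 ^ b)))"
  define t2 where "t2 = (\<lambda>a b. if b \<le> a then 4 * c2 * (s a * 2 ^ a) * 2 ^ b else 0)"
  define t3 where "t3 = (\<lambda>a b. if 2 ^ a \<le> 2 * \<rho> * 2 ^ b then 4 * c2 * (s b * 2 ^ b) * 2 ^ a else 0)"
  have tpos: "0 \<le> t1 a b" "0 \<le> t2 a b" "0 \<le> t3 a b" for a b
    using pos s0 by (auto simp: t1_def t2_def t3_def)
  have cell: "(\<Sum>i\<in>S a. \<Sum>j\<in>S b. F i j) \<le> t1 a b + t2 a b + t3 a b" for a b
  proof (cases "b \<le> a \<and> 2 ^ a \<le> 2 * \<rho> * 2 ^ b \<and> T < 4 * (2 ^ a * 2 ^ b)")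
    case True
    have "(\<Sum>i\<in>S a. \<Sum>j\<in>S b. F i j) \<le> (\<Sum>i\<in>S a. \<Sum>j\<in>S b. 4 * (2 ^ a * 2 ^ b) * A i j)"
    proof (intro sum_mono)
      fix i j assume "i \<in> S a" "j \<in> S b"
      then have i: "k i \<noteq> 0" "L i = a" and j: "k j \<noteq> 0" "L j = b" by (auto simp: S_def V0_def)
      have "real_of_int \<bar>k i * k j\<bar> = real_of_int \<bar>k i\<bar> * real_of_int \<bar>k j\<bar>" by (simp add: abs_mult)
      also have "\<dots> \<le> (2 * 2 ^ a) * (2 * 2 ^ b)" using lev(2)[OF i(1)] lev(2)[OF j(1)] i j
        by (intro mult_mono) auto
      finally have "A i j * real_of_int \<bar>k i * k j\<bar> \<le> A i j * (4 * (2 ^ a * 2 ^ b))"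
        using A0 by (intro mult_left_mono) auto
      then show "F i j \<le> 4 * (2 ^ a * 2 ^ b) * A i j"
        using A0[of i j] by (auto simp: F_def mult.commute)
    qed
    also have "\<dots> = 4 * (2 ^ a * 2 ^ b) * (\<Sum>i\<in>S a. \<Sum>j\<in>S b. A i j)" by (simp add: sum_distrib_left)
    also have "\<dots> \<le> 4 * (2 ^ a * 2 ^ b) * (c1 * (s a * s b) + c2 * (s a + s b))"
    proof (rule mult_left_mono)
      have "c2 * max (s a) (s b) \<le> c2 * (s a + s b)" using pos s0 by (intro mult_left_mono) auto
      then show "(\<Sum>i\<in>S a. \<Sum>j\<in>S b. A i j) \<le> c1 * (s a * s b) + c2 * (s a + s b)"
        using disc[OF SV[of a] SV[of b]] by (simp add: s_def)
    qed simp
    also have "\<dots> = 4 * (2 ^ a * 2 ^ b) * (c1 * (s a * s b)) + t2 a b + t3 a b"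
      using True by (simp add: t2_def t3_def algebra_simps)
    also have "4 * (2 ^ a * 2 ^ b) * (c1 * (s a * s b)) \<le> t1 a b"
    proof -
      have four: "(4::real) ^ a = 2 ^ a * 2 ^ a" for a by (simp add: power_mult_distrib[symmetric])
      have "(4 * (2 ^ a * 2 ^ b)) * T * (c1 * (s a * s b)) \<le> (4 * (2 ^ a * 2 ^ b)) * (4 * (2 ^ a * 2 ^ b)) * (c1 * (s a * s b))"
        using True pos s0 by (intro mult_right_mono mult_left_mono) auto
      then have "4 * (2 ^ a * 2 ^ b) * (c1 * (s a * s b)) \<le> (4 * (2 ^ a * 2 ^ b)) * (4 * (2 ^ a * 2 ^ b)) * (c1 * (s a * s b)) / T"
        using pos by (simp add: field_simps)
      also have "\<dots> = t1 a b" unfolding t1_def four by simp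
      finally show ?thesis .
    qed
    finally show ?thesis by simp
  next
    case False
    have "F i j = 0" if "i \<in> S a" "j \<in> S b" for i j
    proof (rule ccontr)
      assume "F i j \<noteq> 0"
      then have P: "P i j" unfolding F_def by presburger
      from that have i: "k i \<noteq> 0" "L i = a" and j: "k j \<noteq> 0" "L j = b" by (auto simp: S_def V0_def)
      have "b \<le> a" using P i j unfolding L_def P_def
        by (metis floor_log_le_iff nat_mono)
      moreover have "2 ^ a \<le> 2 * \<rho> * 2 ^ b"
      proof -
        have "2 ^ a \<le> \<rho> * real_of_int \<bar>k j\<bar>" using lev(1)[OF i(1)] i P by (auto simp: P_def)
        also have "\<dots> \<le> \<rho> * (2 * 2 ^ b)" using lev(2)[OF j(1)] j pos by (intro mult_left_mono) auto
        finally show ?thesis by simp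
      qed
      moreover have "T < 4 * (2 ^ a * 2 ^ b)"
      proof -
        have "T < real_of_int \<bar>k i\<bar> * real_of_int \<bar>k j\<bar>" using P by (simp add: P_def abs_mult)
        also have "\<dots> \<le> (2 * 2 ^ a) * (2 * 2 ^ b)" using lev(2)[OF i(1)] lev(2)[OF j(1)] i j
          by (intro mult_mono) auto
        finally show ?thesis by simp
      qed
      ultimately show False using False by blast
    qed
    then have "(\<Sum>i\<in>S a. \<Sum>j\<in>S b. F i j) = 0" by (intro sum.neutral ballI)
    then show ?thesis using tpos[of a b] by linarith
  qed
  have "(\<Sum>i\<in>V. \<Sum>j\<in>V. F i j) = (\<Sum>i\<in>V0. \<Sum>j\<in>V0. F i j)"
  proof -
    have "(\<Sum>i\<in>V. \<Sum>j\<in>V. F i j) = (\<Sum>i\<in>V. \<Sum>j\<in>V0. F i j)"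
      by (intro sum.cong refl sum.mono_neutral_right) (use fin Fz in \<open>auto simp: V0_def\<close>)
    also have "\<dots> = (\<Sum>i\<in>V0. \<Sum>j\<in>V0. F i j)"
      by (intro sum.mono_neutral_right) (use fin Fz in \<open>auto simp: V0_def\<close>)
    finally show ?thesis .
  qed
  also have "\<dots> = (\<Sum>a\<in>Lv. \<Sum>b\<in>Lv. \<Sum>i\<in>S a. \<Sum>j\<in>S b. F i j)"
    unfolding grp by (rule sum.cong[OF refl], rule sum.swap)
  also have "\<dots> \<le> (\<Sum>a\<in>Lv. \<Sum>b\<in>Lv. t1 a b + t2 a b + t3 a b)"
    by (intro sum_mono cell)
  also have "\<dots> = (\<Sum>a\<in>Lv. \<Sum>b\<in>Lv. t1 a b) + (\<Sum>a\<in>Lv. \<Sum>b\<in>Lv. t2 a b) + (\<Sum>b\<in>Lv. \<Sum>a\<in>Lv. t3 a b)"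
    by (simp only: sum.distrib) (simp only: sum.swap[of t3])
  also have "(\<Sum>a\<in>Lv. \<Sum>b\<in>Lv. t1 a b) \<le> 16 * c1 * Kb\<^sup>2 / T"
  proof -
    have "(\<Sum>a\<in>Lv. \<Sum>b\<in>Lv. t1 a b) = 16 * c1 / T * ((\<Sum>a\<in>Lv. s a * 4 ^ a) * (\<Sum>b\<in>Lv. s b * 4 ^ b))"
      unfolding t1_def sum_product by (simp only: sum_distrib_left)
    also have "\<dots> \<le> 16 * c1 / T * (Kb * Kb)"
      using mass mass0 pos by (intro mult_left_mono mult_mono) auto
    finally show ?thesis by (simp add: power2_eq_square)
  qed
  also have "(\<Sum>a\<in>Lv. \<Sum>b\<in>Lv. t2 a b) \<le> 8 * c2 * Kb"
  proof -
    have "(\<Sum>b\<in>Lv. t2 a b) \<le> 8 * c2 * (s a * 4 ^ a)" for a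
    proof -
      have "(\<Sum>b\<in>Lv. t2 a b) = 4 * c2 * (s a * 2 ^ a) * (\<Sum>b\<in>{b\<in>Lv. b \<le> a}. 2 ^ b)"
        unfolding t2_def sum.inter_filter[OF fLv] sum_distrib_left by (intro sum.cong) auto
      also have "\<dots> \<le> 4 * c2 * (s a * 2 ^ a) * (2 * 2 ^ a)"
        using fLv pos s0 by (intro mult_left_mono sum_powers_of_two_le) auto
      also have "\<dots> = 8 * c2 * (s a * 4 ^ a)" by (simp add: power_mult_distrib[symmetric])
      finally show ?thesis .
    qed
    then have "(\<Sum>a\<in>Lv. \<Sum>b\<in>Lv. t2 a b) \<le> (\<Sum>a\<in>Lv. 8 * c2 * (s a * 4 ^ a))" by (intro sum_mono)
    also have "\<dots> = 8 * c2 * (\<Sum>a\<in>Lv. s a * 4 ^ a)" by (simp add: sum_distrib_left)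
    also have "\<dots> \<le> 8 * c2 * Kb" using mass pos by (intro mult_left_mono) auto
    finally show ?thesis .
  qed
  also have "(\<Sum>b\<in>Lv. \<Sum>a\<in>Lv. t3 a b) \<le> 16 * \<rho> * c2 * Kb"
  proof -
    have "(\<Sum>a\<in>Lv. t3 a b) \<le> 16 * \<rho> * c2 * (s b * 4 ^ b)" for b
    proof -
      have "(\<Sum>a\<in>Lv. t3 a b) = 4 * c2 * (s b * 2 ^ b) * (\<Sum>a\<in>{a\<in>Lv. 2 ^ a \<le> 2 * \<rho> * 2 ^ b}. 2 ^ a)"
        unfolding t3_def sum.inter_filter[OF fLv] sum_distrib_left by (intro sum.cong) auto
      also have "\<dots> \<le> 4 * c2 * (s b * 2 ^ b) * (2 * (2 * \<rho> * 2 ^ b))"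
        using fLv pos s0 by (intro mult_left_mono sum_powers_of_two_le) auto
      also have "\<dots> = 16 * \<rho> * c2 * (s b * 4 ^ b)" by (simp add: power_mult_distrib[symmetric])
      finally show ?thesis .
    qed
    then have "(\<Sum>b\<in>Lv. \<Sum>a\<in>Lv. t3 a b) \<le> (\<Sum>b\<in>Lv. 16 * \<rho> * c2 * (s b * 4 ^ b))" by (intro sum_mono)
    also have "\<dots> = 16 * \<rho> * c2 * (\<Sum>a\<in>Lv. s a * 4 ^ a)" by (simp add: sum_distrib_left)
    also have "\<dots> \<le> 16 * \<rho> * c2 * Kb" using mass pos by (intro mult_left_mono) auto
    finally show ?thesis .
  qed
  finally have fin1: "(\<Sum>i\<in>V. \<Sum>j\<in>V. F i j) \<le> 16 * c1 * Kb\<^sup>2 / T + 8 * c2 * Kb + 16 * \<rho> * c2 * Kb" by simp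
  have Kb0: "0 \<le> Kb" using mass mass0 by linarith
  have "c2 * Kb \<le> \<rho> * (c2 * Kb)" using mult_right_mono[OF pos(2), of "c2 * Kb"] pos Kb0 by simp
  then show ?thesis using fin1 unfolding F_def by (simp add: algebra_simps)
qed

text \<open>
  Where \<open>\<bar>k i\<bar>\<close> exceeds \<open>\<rho> * \<bar>k j\<bar>\<close>, the product \<open>\<bar>k i * k j\<bar>\<close> is at most \<open>k i ^ 2 / \<rho>\<close> and the
  degree bound suffices; the other pairs are those of the previous lemma. Symmetry of \<open>A\<close>
  accounts for the two orders of \<open>i\<close> and \<open>j\<close> and for the factor two.
\<close>

lemma heavy_pairs_bound:
  fixes A :: "nat \<Rightarrow> nat \<Rightarrow> real" and k :: "nat \<Rightarrow> int"
  assumes fin: "finite V" and A0: "\<And>i j. 0 \<le> A i j" and symA: "\<And>i j. A i j = A j i"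
    and deg: "\<And>i. i \<in> V \<Longrightarrow> (\<Sum>j\<in>V. A i j) \<le> d"
    and disc: "\<And>S S'. S \<subseteq> V \<Longrightarrow> S' \<subseteq> V \<Longrightarrow> (\<Sum>i\<in>S. \<Sum>j\<in>S'. A i j)
       \<le> c1 * (real (card S) * real (card S')) + c2 * max (real (card S)) (real (card S'))"
    and K: "(\<Sum>i\<in>V. (real_of_int (k i))\<^sup>2) \<le> Kb"
    and pos: "0 < T" "1 \<le> \<rho>" "0 \<le> c1" "0 \<le> c2" "0 \<le> d"
  shows "(\<Sum>i\<in>V. \<Sum>j\<in>V. if T < real_of_int \<bar>k i * k j\<bar> then A i j * real_of_int \<bar>k i * k j\<bar> else 0)
     \<le> 2 * d * Kb / \<rho> + 32 * c1 * Kb\<^sup>2 / T + 48 * \<rho> * c2 * Kb"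
proof -
  define P where "P = (\<lambda>i j. \<bar>k j\<bar> \<le> \<bar>k i\<bar> \<and> real_of_int \<bar>k i\<bar> < \<rho> * real_of_int \<bar>k j\<bar> \<and> T < real_of_int \<bar>k i * k j\<bar>)"
  define X where "X = (\<lambda>i j. if P i j then A i j * real_of_int \<bar>k i * k j\<bar> else 0)"
  define Y where "Y = (\<lambda>i j. (real_of_int (k i))\<^sup>2 / \<rho> * A i j)"
  have Y0: "0 \<le> Y i j" for i j using pos A0 by (simp add: Y_def)
  have X0: "0 \<le> X i j" for i j using A0 by (simp add: X_def)
  have half: "A i j * real_of_int \<bar>k i * k j\<bar> \<le> X i j + Y i j"
    if "T < real_of_int \<bar>k i * k j\<bar>" "\<bar>k j\<bar> \<le> \<bar>k i\<bar>" for i j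
  proof (cases "P i j")
    case True
    then show ?thesis using Y0[of i j] by (simp add: X_def)
  next
    case False
    then have "\<rho> * real_of_int \<bar>k j\<bar> \<le> real_of_int \<bar>k i\<bar>" using that by (auto simp: P_def)
    then have "real_of_int \<bar>k j\<bar> \<le> real_of_int \<bar>k i\<bar> / \<rho>" using pos by (simp add: field_simps)
    then have "real_of_int \<bar>k i\<bar> * real_of_int \<bar>k j\<bar> \<le> real_of_int \<bar>k i\<bar> * (real_of_int \<bar>k i\<bar> / \<rho>)"
      by (intro mult_left_mono) auto
    then have "real_of_int \<bar>k i * k j\<bar> \<le> (real_of_int (k i))\<^sup>2 / \<rho>"
      by (simp add: abs_mult power2_eq_square)
    then have "A i j * real_of_int \<bar>k i * k j\<bar> \<le> A i j * ((real_of_int (k i))\<^sup>2 / \<rho>)"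
      using A0 by (intro mult_left_mono)
    then show ?thesis using X0[of i j] by (simp add: Y_def mult.commute)
  qed
  have "(\<Sum>i\<in>V. \<Sum>j\<in>V. if T < real_of_int \<bar>k i * k j\<bar> then A i j * real_of_int \<bar>k i * k j\<bar> else 0)
     \<le> (\<Sum>i\<in>V. \<Sum>j\<in>V. (X i j + Y i j) + (X j i + Y j i))"
  proof (intro sum_mono)
    fix i j
    show "(if T < real_of_int \<bar>k i * k j\<bar> then A i j * real_of_int \<bar>k i * k j\<bar> else 0) \<le> (X i j + Y i j) + (X j i + Y j i)"
    proof (cases "T < real_of_int \<bar>k i * k j\<bar>")
      case True
      show ?thesis
      proof (cases "\<bar>k j\<bar> \<le> \<bar>k i\<bar>")
        case False
        have "A j i * real_of_int \<bar>k j * k i\<bar> \<le> X j i + Y j i"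
          using True False by (intro half) (auto simp: mult.commute)
        then show ?thesis using True X0[of i j] Y0[of i j] by (simp add: symA[of i j] mult.commute)
      qed (use True half[of i j] X0[of j i] Y0[of j i] in auto)
    next
      case False
      then show ?thesis using X0[of i j] Y0[of i j] X0[of j i] Y0[of j i] by simp
    qed
  qed
  also have "\<dots> = 2 * (\<Sum>i\<in>V. \<Sum>j\<in>V. X i j) + 2 * (\<Sum>i\<in>V. \<Sum>j\<in>V. Y i j)"
  proof -
    have "(\<Sum>i\<in>V. \<Sum>j\<in>V. X j i) = (\<Sum>i\<in>V. \<Sum>j\<in>V. X i j)" "(\<Sum>i\<in>V. \<Sum>j\<in>V. Y j i) = (\<Sum>i\<in>V. \<Sum>j\<in>V. Y i j)"
      by (rule sum.swap)+
    then show ?thesis by (simp only: sum.distrib)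
  qed
  also have "(\<Sum>i\<in>V. \<Sum>j\<in>V. X i j) \<le> 16 * c1 * Kb\<^sup>2 / T + 24 * \<rho> * c2 * Kb"
    unfolding X_def P_def by (rule heavy_level_pairs_bound[OF fin A0 disc K pos(1-4)])
  also have "(\<Sum>i\<in>V. \<Sum>j\<in>V. Y i j) \<le> d * Kb / \<rho>"
  proof -
    have "(\<Sum>i\<in>V. \<Sum>j\<in>V. Y i j) = (\<Sum>i\<in>V. (real_of_int (k i))\<^sup>2 / \<rho> * (\<Sum>j\<in>V. A i j))"
      unfolding Y_def by (simp add: sum_distrib_left)
    also have "\<dots> \<le> (\<Sum>i\<in>V. (real_of_int (k i))\<^sup>2 / \<rho> * d)"
      using pos by (intro sum_mono mult_left_mono deg) auto
    also have "\<dots> = (\<Sum>i\<in>V. (real_of_int (k i))\<^sup>2) * (d / \<rho>)"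
      unfolding sum_distrib_right by (intro sum.cong refl) simp
    also have "\<dots> \<le> Kb * (d / \<rho>)" using K pos by (intro mult_right_mono) auto
    finally show ?thesis by (simp add: mult.commute)
  qed
  finally show ?thesis by (simp add: algebra_simps)
qed

section \<open>The operator norm of the centred adjacency matrix\<close>

lemma sum_Pow_power:
  fixes x :: real
  assumes "finite V"
  shows "(\<Sum>S\<in>Pow V. x ^ card S) = (1 + x) ^ card V"
  using assms
proof (induction V rule: finite_induct)
  case (insert a V)
  have disj: "Pow V \<inter> insert a ` Pow V = {}" using insert.hyps by auto
  have inj: "inj_on (insert a) (Pow V)"
    using insert.hyps by (auto simp: inj_on_def)
  have "(\<Sum>S\<in>insert a ` Pow V. x ^ card S) = (\<Sum>S\<in>Pow V. x * x ^ card S)"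
    unfolding sum.reindex[OF inj] o_def
  proof (intro sum.cong refl)
    fix S assume "S \<in> Pow V"
    then have "finite S" "a \<notin> S" using insert.hyps finite_subset by auto
    then show "x ^ card (insert a S) = x * x ^ card S" by simp
  qed
  then have "(\<Sum>S\<in>Pow (insert a V). x ^ card S) = (\<Sum>S\<in>Pow V. x ^ card S) + x * (\<Sum>S\<in>Pow V. x ^ card S)"
    unfolding Pow_insert using insert.hyps disj by (simp add: sum.union_disjoint sum_distrib_left)
  then show ?case using insert by (simp add: algebra_simps)
qed simp

lemma exp_minus_linear_le:
  fixes x :: real
  assumes "\<bar>x\<bar> \<le> 1"
  shows "exp x - 1 - x \<le> x\<^sup>2"
proof (cases "0 \<le> x")
  case True
  then show ?thesis using exp_bound[of x] assms by simp
next
  case False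
  define y where "y = - x"
  have y: "0 < y" "y \<le> 1" using False assms by (auto simp: y_def)
  have "1 \<le> (1 + y) * (1 - y + y\<^sup>2)" using y by (simp add: power2_eq_square algebra_simps)
  also have "\<dots> \<le> exp y * (1 - y + y\<^sup>2)"
  proof (rule mult_right_mono)
    show "0 \<le> 1 - y + y\<^sup>2" using y by simp
  qed (rule exp_ge_add_one_self)
  finally have "exp (- y) * 1 \<le> exp (- y) * (exp y * (1 - y + y\<^sup>2))" by (intro mult_left_mono) auto
  then have "exp (- y) \<le> 1 - y + y\<^sup>2" by (simp add: exp_minus field_simps)
  then show ?thesis by (simp add: y_def)
qed

context two_communities
begin

definition pairs_between :: "nat set \<Rightarrow> nat set \<Rightarrow> (nat \<times> nat) set" where
  "pairs_between S S' = {(i, j) \<in> upper. i \<in> S \<and> j \<in> S' \<or> j \<in> S \<and> i \<in> S'}"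

lemma card_pairs_between:
  assumes "S \<subseteq> V" "S' \<subseteq> V"
  shows "real (card (pairs_between S S')) \<le> 2 * (real (card S) * real (card S'))"
proof -
  have fin: "finite S" "finite S'" using assms finite_V finite_subset by blast+
  have "pairs_between S S' \<subseteq> S \<times> S' \<union> S' \<times> S" by (auto simp: pairs_between_def)
  then have "card (pairs_between S S') \<le> card (S \<times> S' \<union> S' \<times> S)"
    using fin by (intro card_mono) auto
  also have "\<dots> \<le> card (S \<times> S') + card (S' \<times> S)" by (rule card_Un_le)
  also have "\<dots> = 2 * (card S * card S')" by (simp add: card_cartesian_product)
  finally have "real (card (pairs_between S S')) \<le> real (2 * (card S * card S'))" by (simp only: of_nat_le_iff)
  then show ?thesis by simp
qed

lemma sum_adj_le_pairs_between:
  assumes "S \<subseteq> V" "S' \<subseteq> V"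
  shows "(\<Sum>i\<in>S. \<Sum>j\<in>S'. adj f i j) \<le> 2 * (\<Sum>(i,j)\<in>pairs_between S S'. adj f i j)"
proof -
  define F where "F = (\<lambda>i j. if i \<in> S \<and> j \<in> S' \<or> j \<in> S \<and> i \<in> S' then adj f i j else 0)"
  have F0: "0 \<le> F i j" for i j by (simp add: F_def adj_bounds)
  have "(\<Sum>i\<in>S. \<Sum>j\<in>S'. adj f i j) = (\<Sum>i\<in>S. \<Sum>j\<in>S'. F i j)"
    by (intro sum.cong refl) (auto simp: F_def)
  also have "\<dots> \<le> (\<Sum>i\<in>S. \<Sum>j\<in>V. F i j)"
    using assms F0 by (intro sum_mono sum_mono2) auto
  also have "\<dots> \<le> (\<Sum>i\<in>V. \<Sum>j\<in>V. F i j)"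
    using assms F0 by (intro sum_mono2 sum_nonneg) auto
  also have "\<dots> = 2 * (\<Sum>(i,j)\<in>upper. F i j)"
  proof (rule sum_upper)
    fix i j show "F i j = F j i" by (auto simp: F_def adj_sym[of f i j])
  qed (auto simp: F_def adj_def)
  also have "(\<Sum>(i,j)\<in>upper. F i j) = (\<Sum>(i,j)\<in>pairs_between S S'. F i j)"
    by (rule sum.mono_neutral_right) (auto simp: finite_upper pairs_between_def F_def split: if_splits)
  also have "\<dots> = (\<Sum>(i,j)\<in>pairs_between S S'. adj f i j)"
    by (intro sum.cong refl) (auto simp: F_def pairs_between_def)
  finally show ?thesis .
qed

text \<open>
  The number of edges between \<open>S\<close> and \<open>S'\<close> is bounded by a multiple of its mean plus a multiple
  of \<open>R * max (card S) (card S')\<close>. A large \<open>\<theta>\<close> makes the second multiple small at the expense of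
  the first.
\<close>

definition discrepancy :: "real \<Rightarrow> (nat set \<Rightarrow> bool) \<Rightarrow> nat set \<Rightarrow> nat set \<Rightarrow> bool" where
  "discrepancy \<theta> f S S' \<longleftrightarrow> (\<Sum>i\<in>S. \<Sum>j\<in>S'. adj f i j)
     \<le> 4 * exp \<theta> * p * (real (card S) * real (card S')) + 16 / \<theta> * R * max (real (card S)) (real (card S'))"

text \<open>
  With the tilt \<open>\<theta>\<close> the mean is paid for by the first term of the discrepancy bound; the second
  one yields a probability small enough for a union bound over all pairs of sets.
\<close>

lemma prob_dense_pair:
  assumes S: "S \<subseteq> V" "S' \<subseteq> V" and \<theta>: "1 \<le> \<theta>"
  shows "measure_pmf.prob G {f. \<not> discrepancy \<theta> f S S'} \<le> exp (- 4 * R) ^ card S * exp (- 4 * R) ^ card S'"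
proof -
  let ?s = "real (card S)" and ?s' = "real (card S')"
  let ?T = "pairs_between S S'"
  define X where "X = 4 * exp \<theta> * p * (?s * ?s') + 16 / \<theta> * R * max ?s ?s'"
  have "measure_pmf.prob G {f. \<not> discrepancy \<theta> f S S'}
     \<le> measure_pmf.prob G {f. \<theta> * X / 2 \<le> (\<Sum>(i,j)\<in>?T. \<theta> * adj f i j)}"
  proof (rule prob_mono)
    fix f assume "\<not> discrepancy \<theta> f S S'"
    then have "X \<le> 2 * (\<Sum>(i,j)\<in>?T. adj f i j)"
      using sum_adj_le_pairs_between[OF S, of f] by (simp add: discrepancy_def X_def)
    then have "\<theta> * X \<le> \<theta> * (2 * (\<Sum>(i,j)\<in>?T. adj f i j))" using \<theta> by (intro mult_left_mono) auto
    also have "\<dots> = 2 * (\<Sum>(i,j)\<in>?T. \<theta> * adj f i j)" by (simp add: sum_distrib_left split_def mult_ac)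
    finally show "\<theta> * X / 2 \<le> (\<Sum>(i,j)\<in>?T. \<theta> * adj f i j)" by simp
  qed
  also have "\<dots> \<le> exp ((\<Sum>(i,j)\<in>?T. mean_adj R1 R2 p q i j * (exp \<theta> - 1)) - \<theta> * X / 2)"
    by (rule chernoff_upper[where c = "\<lambda>_ _. \<theta>"]) (auto simp: pairs_between_def)
  also have "\<dots> \<le> exp (- 4 * R * (?s + ?s'))"
  proof (subst exp_le_cancel_iff)
    have e0: "0 \<le> exp \<theta> - 1" using \<theta> by simp
    have "(\<Sum>(i,j)\<in>?T. mean_adj R1 R2 p q i j * (exp \<theta> - 1)) \<le> (\<Sum>z\<in>?T. p * (exp \<theta> - 1))"
      using \<theta> by (intro sum_mono) (auto simp: mean_bounds intro!: mult_right_mono)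
    also have "\<dots> = real (card ?T) * (p * (exp \<theta> - 1))" by simp
    also have "\<dots> \<le> (2 * (?s * ?s')) * (p * exp \<theta>)"
      using card_pairs_between[OF S] pq \<theta> by (intro mult_mono) auto
    also have "\<dots> \<le> \<theta> * (2 * (?s * ?s') * (p * exp \<theta>))"
      using mult_right_mono[OF \<theta>, of "2 * (?s * ?s') * (p * exp \<theta>)"] pq by simp
    finally have a: "(\<Sum>(i,j)\<in>?T. mean_adj R1 R2 p q i j * (exp \<theta> - 1)) \<le> \<theta> * (2 * (?s * ?s') * (p * exp \<theta>))" .
    have b: "\<theta> * X / 2 = \<theta> * (2 * (?s * ?s') * (p * exp \<theta>)) + 8 * R * max ?s ?s'"
      using \<theta> by (simp add: X_def field_simps)
    have "4 * R * (?s + ?s') \<le> 4 * R * (2 * max ?s ?s')" using R_nonneg by (intro mult_left_mono) auto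
    then show "(\<Sum>(i,j)\<in>?T. mean_adj R1 R2 p q i j * (exp \<theta> - 1)) - \<theta> * X / 2 \<le> - 4 * R * (?s + ?s')"
      using a b by linarith
  qed
  also have "\<dots> = exp (- 4 * R) ^ card S * exp (- 4 * R) ^ card S'"
    by (simp add: exp_of_nat_mult[symmetric] exp_add[symmetric] algebra_simps)
  finally show ?thesis .
qed

lemma m_exp_le:
  assumes "ln m \<le> R" "1 \<le> R"
  shows "m * exp (- c * R) \<le> exp (- (c - 1) * R)"
proof -
  have "0 < m" using R_le_m assms by linarith
  then have "m = exp (ln m)" by simp
  also have "\<dots> \<le> exp R" using assms by simp
  finally have "m * exp (- c * R) \<le> exp R * exp (- c * R)" by (intro mult_right_mono) auto
  also have "\<dots> = exp (- (c - 1) * R)" by (simp add: exp_add[symmetric] algebra_simps)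
  finally show ?thesis .
qed

text \<open>
  As \<open>m \<le> exp R\<close>, the sum of \<open>exp (- 4 * R) ^ card S\<close> over all nonempty \<open>S \<subseteq> V\<close>, which is
  \<open>(1 + exp (- 4 * R)) ^ card V - 1\<close>, is of order \<open>m * exp (- 4 * R)\<close>.
\<close>

lemma prob_discrepancy:
  assumes lnm: "ln m \<le> R" and R: "1 \<le> R" and \<theta>: "1 \<le> \<theta>"
  shows "measure_pmf.prob G {f. \<exists>S\<in>Pow V. \<exists>S'\<in>Pow V. \<not> discrepancy \<theta> f S S'} \<le> 4 * exp (- 6 * R)"
proof -
  let ?N = "Pow V - {{}}"
  define y where "y = exp (- 4 * R)"
  have triv: "discrepancy \<theta> f S S'" if "S = {} \<or> S' = {}" for f S S'
    using that pq \<theta> R_nonneg by (auto simp: discrepancy_def)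
  have "measure_pmf.prob G {f. \<exists>S\<in>Pow V. \<exists>S'\<in>Pow V. \<not> discrepancy \<theta> f S S'}
     \<le> measure_pmf.prob G {f. \<exists>z\<in>?N \<times> ?N. \<not> discrepancy \<theta> f (fst z) (snd z)}"
  proof (rule prob_mono)
    fix f assume "\<exists>S\<in>Pow V. \<exists>S'\<in>Pow V. \<not> discrepancy \<theta> f S S'"
    then obtain S S' where "S \<in> Pow V" "S' \<in> Pow V" "\<not> discrepancy \<theta> f S S'" by blast
    with triv[of S S' f] have "(S, S') \<in> ?N \<times> ?N" "\<not> discrepancy \<theta> f (fst (S, S')) (snd (S, S'))" by auto
    then show "\<exists>z\<in>?N \<times> ?N. \<not> discrepancy \<theta> f (fst z) (snd z)" by (rule bexI[rotated])
  qed
  also have "\<dots> \<le> (\<Sum>z\<in>?N \<times> ?N. y ^ card (fst z) * y ^ card (snd z))"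
  proof (rule prob_bex_le)
    fix z assume "z \<in> ?N \<times> ?N"
    then have "fst z \<subseteq> V" "snd z \<subseteq> V" by auto
    then show "measure_pmf.prob G {f. \<not> discrepancy \<theta> f (fst z) (snd z)} \<le> y ^ card (fst z) * y ^ card (snd z)"
      unfolding y_def using \<theta> by (rule prob_dense_pair)
  qed simp
  also have "\<dots> = (\<Sum>S\<in>?N. y ^ card S) * (\<Sum>S\<in>?N. y ^ card S)"
    unfolding sum_product by (simp add: sum.cartesian_product split_def)
  also have "\<dots> \<le> (2 * exp (- 3 * R)) * (2 * exp (- 3 * R))"
  proof -
    have "(\<Sum>S\<in>?N. y ^ card S) = (1 + y) ^ card V - 1"
      by (simp add: sum_diff1 sum_Pow_power)
    also have "(1 + y) ^ card V \<le> exp y ^ card V"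
      by (intro power_mono) (auto simp: y_def)
    also have "\<dots> = exp (m * y)" by (simp add: exp_of_nat_mult)
    also have "exp (m * y) - 1 \<le> 2 * (m * y)"
    proof -
      have my: "0 \<le> m * y" "m * y \<le> 1"
        using m_exp_le[OF lnm R, of 4] R by (auto simp: y_def intro: order_trans)
      then have "exp (m * y) \<le> 1 + m * y + (m * y)\<^sup>2" using exp_bound by blast
      moreover have "(m * y)\<^sup>2 \<le> m * y" using my by (simp add: power2_eq_square mult_left_le)
      ultimately show ?thesis by linarith
    qed
    also have "m * y \<le> exp (- 3 * R)" using m_exp_le[OF lnm R, of 4] by (simp add: y_def)
    finally have "(\<Sum>S\<in>?N. y ^ card S) \<le> 2 * exp (- 3 * R)" by simp
    then show ?thesis by (intro mult_mono) (auto intro!: sum_nonneg simp: y_def)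
  qed
  also have "\<dots> = 4 * exp (- 6 * R)" by (simp add: exp_add[symmetric])
  finally show ?thesis .
qed

lemma prob_degree:
  assumes lnm: "ln m \<le> R" and R: "1 \<le> R"
  shows "measure_pmf.prob G {f. \<exists>i\<in>V. 8 * m * p < (\<Sum>j\<in>V. adj f i j)} \<le> exp (- 11 * R)"
proof -
  have "measure_pmf.prob G {f. \<exists>i\<in>V. 8 * m * p < (\<Sum>j\<in>V. adj f i j)} \<le> (\<Sum>i\<in>V. exp (- 12 * R))"
  proof (rule prob_bex_le[OF finite_V])
    fix i assume i: "i \<in> V"
    have "measure_pmf.prob G {f. 8 * m * p < (\<Sum>j\<in>V. adj f i j)}
      \<le> measure_pmf.prob G {f. 8 * m * p \<le> (\<Sum>j\<in>V - {i}. 1 * adj f i j)}"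
    proof (rule prob_mono)
      fix f assume "8 * m * p < (\<Sum>j\<in>V. adj f i j)"
      moreover have "(\<Sum>j\<in>V. adj f i j) = (\<Sum>j\<in>V - {i}. adj f i j)"
        by (rule sum.mono_neutral_right) (auto simp: adj_def)
      ultimately show "8 * m * p \<le> (\<Sum>j\<in>V - {i}. 1 * adj f i j)" by simp
    qed
    also have "\<dots> \<le> exp ((\<Sum>j\<in>V - {i}. mean_adj R1 R2 p q i j * (exp 1 - 1)) - 8 * m * p)"
      by (rule chernoff_star[OF i subset_refl])
    also have "\<dots> \<le> exp (- 12 * R)"
    proof (subst exp_le_cancel_iff)
      have e: "exp 1 - 1 \<le> (2::real)" using exp_le by simp
      have "(\<Sum>j\<in>V - {i}. mean_adj R1 R2 p q i j * (exp 1 - 1)) \<le> (\<Sum>j\<in>V - {i}. p * 2)"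
        using e by (intro sum_mono mult_mono mean_bounds) (use pq in auto)
      also have "\<dots> \<le> m * (p * 2)"
        using pq by (auto intro!: mult_right_mono card_mono)
      finally show "(\<Sum>j\<in>V - {i}. mean_adj R1 R2 p q i j * (exp 1 - 1)) - 8 * m * p \<le> - 12 * R"
        using R_le by simp
    qed
    finally show "measure_pmf.prob G {f. 8 * m * p < (\<Sum>j\<in>V. adj f i j)} \<le> exp (- 12 * R)" .
  qed
  also have "\<dots> = m * exp (- 12 * R)" by simp
  also have "\<dots> \<le> exp (- 11 * R)" using m_exp_le[OF lnm R, of 12] by simp
  finally show ?thesis .
qed

text \<open>
  The tilt \<open>200 / s\<close> is the largest one for which all coefficients are at most one, so that the
  second-order bound \<open>exp c - 1 - c \<le> c\<^sup>2\<close> applies. The resulting exponent has to beat the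
  number \<open>exp (6 * m)\<close> of rounded vectors.
\<close>

lemma prob_light_pairs:
  fixes k :: "nat \<Rightarrow> int" and \<sigma> :: real
  assumes k: "k \<in> int_vectors V" and \<sigma>: "\<bar>\<sigma>\<bar> = 1" and s: "0 < s" "320000 * m * p \<le> s\<^sup>2" and m: "0 < m"
  defines "L \<equiv> {(i, j) \<in> upper. real_of_int \<bar>k i * k j\<bar> \<le> s / 200}"
  shows "measure_pmf.prob G {f. m * s / 8 < \<sigma> * (\<Sum>(i,j)\<in>L. W f i j * real_of_int (k i * k j))} \<le> exp (- 23 * m)"
proof -
  define \<theta> where "\<theta> = 200 / s"
  have \<theta>: "0 < \<theta>" using s by (simp add: \<theta>_def)
  define c where "c = (\<lambda>i j. \<theta> * \<sigma> * real_of_int (k i * k j))"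
  have L: "L \<subseteq> upper" by (auto simp: L_def)
  have fL: "finite L" using finite_subset[OF L finite_upper] .
  define mu where "mu = (\<Sum>(i,j)\<in>L. mean_adj R1 R2 p q i j * c i j)"
  have "measure_pmf.prob G {f. m * s / 8 < \<sigma> * (\<Sum>(i,j)\<in>L. W f i j * real_of_int (k i * k j))}
    \<le> measure_pmf.prob G {f. \<theta> * (m * s / 8) + mu \<le> (\<Sum>(i,j)\<in>L. c i j * adj f i j)}"
  proof (rule prob_mono)
    fix f assume "m * s / 8 < \<sigma> * (\<Sum>(i,j)\<in>L. W f i j * real_of_int (k i * k j))"
    then have "\<theta> * (m * s / 8) \<le> \<theta> * (\<sigma> * (\<Sum>(i,j)\<in>L. W f i j * real_of_int (k i * k j)))"
      using \<theta> by (intro mult_left_mono) auto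
    also have "\<dots> = (\<Sum>(i,j)\<in>L. c i j * adj f i j) - mu"
      unfolding mu_def sum_distrib_left sum_subtractf[symmetric]
      by (intro sum.cong refl) (auto simp: c_def W_def algebra_simps)
    finally show "\<theta> * (m * s / 8) + mu \<le> (\<Sum>(i,j)\<in>L. c i j * adj f i j)" by simp
  qed
  also have "\<dots> \<le> exp ((\<Sum>(i,j)\<in>L. mean_adj R1 R2 p q i j * (exp (c i j) - 1)) - (\<theta> * (m * s / 8) + mu))"
    by (rule chernoff_upper[OF L])
  also have "\<dots> \<le> exp (- 23 * m)"
  proof (subst exp_le_cancel_iff)
    have "(\<Sum>(i,j)\<in>L. mean_adj R1 R2 p q i j * (exp (c i j) - 1)) - mu
       = (\<Sum>(i,j)\<in>L. mean_adj R1 R2 p q i j * (exp (c i j) - 1 - c i j))"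
      unfolding mu_def sum_subtractf[symmetric] by (intro sum.cong refl) (auto simp: algebra_simps)
    also have "\<dots> \<le> (\<Sum>(i,j)\<in>L. p * (c i j)\<^sup>2)"
    proof (rule sum_mono)
      fix z assume z: "z \<in> L"
      obtain i j where ij: "z = (i, j)" by (cases z)
      have "\<bar>c i j\<bar> = \<theta> * real_of_int \<bar>k i * k j\<bar>" using \<sigma> \<theta> by (simp add: c_def abs_mult)
      also have "\<dots> \<le> \<theta> * (s / 200)" using z \<theta> by (intro mult_left_mono) (auto simp: L_def ij)
      also have "\<dots> = 1" using s by (simp add: \<theta>_def)
      finally have "exp (c i j) - 1 - c i j \<le> (c i j)\<^sup>2" by (rule exp_minus_linear_le)
      moreover have "0 \<le> exp (c i j) - 1 - c i j" using exp_ge_add_one_self[of "c i j"] by linarith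
      ultimately show "(case z of (i, j) \<Rightarrow> mean_adj R1 R2 p q i j * (exp (c i j) - 1 - c i j)) \<le> (case z of (i, j) \<Rightarrow> p * (c i j)\<^sup>2)"
        unfolding ij using mean_bounds pq by (auto intro!: mult_mono)
    qed
    also have "\<dots> \<le> (\<Sum>(i,j)\<in>upper. p * (c i j)\<^sup>2)"
      by (rule sum_mono2[OF finite_upper L]) (use pq in auto)
    also have "\<dots> \<le> p * (\<theta>\<^sup>2 * (16 * m\<^sup>2))"
    proof -
      have "(\<Sum>(i,j)\<in>upper. p * (c i j)\<^sup>2) \<le> (\<Sum>z\<in>V \<times> V. case z of (i, j) \<Rightarrow> p * (c i j)\<^sup>2)"
        by (rule sum_mono2) (use pq in \<open>auto simp: upper_def\<close>)
      also have "\<dots> = (\<Sum>i\<in>V. \<Sum>j\<in>V. p * (c i j)\<^sup>2)" by (simp add: sum.cartesian_product)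
      also have "\<dots> = p * (\<theta>\<^sup>2 * ((\<Sum>i\<in>V. (real_of_int (k i))\<^sup>2) * (\<Sum>j\<in>V. (real_of_int (k j))\<^sup>2)))"
      proof -
        have s2: "\<sigma>\<^sup>2 = 1" using \<sigma> by (metis power2_abs power_one)
        have "(\<Sum>i\<in>V. (real_of_int (k i))\<^sup>2) * (\<Sum>j\<in>V. (real_of_int (k j))\<^sup>2)
          = (\<Sum>i\<in>V. \<Sum>j\<in>V. (real_of_int (k i))\<^sup>2 * (real_of_int (k j))\<^sup>2)" by (rule sum_product)
        then show ?thesis
          by (simp only: sum_distrib_left) (intro sum.cong refl, simp add: c_def power_mult_distrib s2)
      qed
      also have "\<dots> \<le> p * (\<theta>\<^sup>2 * ((4 * m) * (4 * m)))"
        using k pq by (intro mult_left_mono mult_mono) (auto simp: int_vectors_def sum_nonneg)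
      finally show ?thesis by (simp add: power2_eq_square)
    qed
    also have "\<dots> = 640000 * m * p / s\<^sup>2 * m"
      by (simp add: \<theta>_def power2_eq_square)
    also have "\<dots> \<le> 2 * m"
    proof (intro mult_right_mono)
      show "640000 * m * p / s\<^sup>2 \<le> 2" using s by (simp add: divide_le_eq mult_ac)
    qed (use m in auto)
    finally have "(\<Sum>(i,j)\<in>L. mean_adj R1 R2 p q i j * (exp (c i j) - 1)) - mu \<le> 2 * m" .
    moreover have "\<theta> * (m * s / 8) = 25 * m" using s by (simp add: \<theta>_def)
    ultimately show "(\<Sum>(i,j)\<in>L. mean_adj R1 R2 p q i j * (exp (c i j) - 1)) - (\<theta> * (m * s / 8) + mu) \<le> - 23 * m"
      using m by linarith
  qed
  finally show ?thesis .
qed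

text \<open>
  The parameters balance the three terms of the deterministic estimate: the ratio
  \<open>\<rho> = 512 * m * p / s\<close> makes the degree term equal to \<open>m * s / 8\<close>, and then \<open>\<theta> = 6400000 / e2\<close>
  makes the \<open>R\<close> part of the discrepancy small compared with \<open>m * s\<close>. The size of \<open>R\<close> has to pay
  for the factor \<open>exp \<theta>\<close> in its other part.
\<close>

lemma heavy_pairs_small:
  fixes k :: "nat \<Rightarrow> int"
  assumes lnm: "ln m \<le> R" and R: "1 \<le> R" and e2: "0 < e2" "e2 \<le> 1"
    and big: "4000000 * exp (6400000 / e2) \<le> e2 * R"
    and k: "k \<in> int_vectors V"
    and deg: "\<And>i. i \<in> V \<Longrightarrow> (\<Sum>j\<in>V. adj f i j) \<le> 8 * m * p"
    and disc: "\<And>S S'. S \<subseteq> V \<Longrightarrow> S' \<subseteq> V \<Longrightarrow> discrepancy (6400000 / e2) f S S'"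
  defines "s \<equiv> sqrt (e2 * m * p * R)"
  shows "(\<Sum>i\<in>V. \<Sum>j\<in>V. if s / 200 < real_of_int \<bar>k i * k j\<bar> then \<bar>W f i j\<bar> * real_of_int \<bar>k i * k j\<bar> else 0)
     \<le> 5 / 8 * (m * s)"
proof -
  define \<theta> where "\<theta> = 6400000 / e2"
  define T where "T = s / 200"
  define \<rho> where "\<rho> = 512 * m * p / s"
  have m: "0 < m" using R_le_m R by linarith
  have mp: "0 < m * p" using m pq by simp
  have \<theta>: "1 \<le> \<theta>" "0 < \<theta>" using e2 by (auto simp: \<theta>_def field_simps)
  have Z: "0 < e2 * m * p * R" using m pq e2 R by simp
  have s: "0 < s" and s2: "s\<^sup>2 = e2 * m * p * R" "s * s = e2 * m * p * R" using Z by (auto simp: s_def power2_eq_square[symmetric])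
  have T: "0 < T" using s by (simp add: T_def)
  have eth: "1 \<le> exp \<theta>" using \<theta> by simp
  have big1: "4000000 * exp \<theta> * (m * p) \<le> s\<^sup>2"
    using mult_right_mono[OF big, of "m * p"] mp unfolding s2 \<theta>_def by (simp add: mult_ac)
  have big2: "4000000 * (m * p) \<le> s\<^sup>2"
    using big1 mult_right_mono[OF eth, of "4000000 * (m * p)"] mp by (simp add: mult_ac)
  have \<rho>: "1 \<le> \<rho>"
  proof -
    have "s\<^sup>2 \<le> 1 * m * p * R" unfolding s2 using e2 m pq R by (intro mult_right_mono) auto
    also have "\<dots> = (m * p) * R" by simp
    also have "\<dots> \<le> (m * p) * (m * p)" using R_le R mp by (intro mult_left_mono) linarith+
    also have "\<dots> \<le> (512 * (m * p)) * (512 * (m * p))" by (rule mult_mono) (use mp in linarith)+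
    also have "\<dots> = (512 * m * p)\<^sup>2" by (simp add: power2_eq_square)
    finally have "s \<le> 512 * m * p" by (rule power2_le_imp_le) (use pq in simp)
    then show ?thesis using s by (simp add: \<rho>_def)
  qed
  have Kb: "(\<Sum>i\<in>V. (real_of_int (k i))\<^sup>2) \<le> 4 * m" using k by (simp add: int_vectors_def)
  have A: "(\<Sum>i\<in>V. \<Sum>j\<in>V. if T < real_of_int \<bar>k i * k j\<bar> then adj f i j * real_of_int \<bar>k i * k j\<bar> else 0)
     \<le> 2 * (8 * m * p) * (4 * m) / \<rho> + 32 * (4 * exp \<theta> * p) * (4 * m)\<^sup>2 / T + 48 * \<rho> * (16 / \<theta> * R) * (4 * m)"
    using T \<rho> R \<theta> mp pq deg disc Kb
    by (intro heavy_pairs_bound adj_sym adj_bounds) (auto simp: discrepancy_def \<theta>_def)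
  have a1: "2 * (8 * m * p) * (4 * m) / \<rho> = m * s / 8"
    using s m pq by (simp add: \<rho>_def field_simps)
  have a2: "32 * (4 * exp \<theta> * p) * (4 * m)\<^sup>2 / T \<le> m * s / 8"
  proof -
    have "32 * (4 * exp \<theta> * p) * (4 * m)\<^sup>2 / T = (409600 * exp \<theta> * (m * p)) * m / s"
      by (simp add: T_def power2_eq_square)
    also have "\<dots> \<le> (s\<^sup>2 / 8) * m / s"
    proof (intro divide_right_mono mult_right_mono)
      have "0 \<le> exp \<theta> * (m * p)" using mp by simp
      then show "409600 * exp \<theta> * (m * p) \<le> s\<^sup>2 / 8" using big1 by linarith
    qed (use m s in auto)
    also have "\<dots> = m * s / 8" using s by (simp add: power2_eq_square)
    finally show ?thesis .
  qed
  have a3: "48 * \<rho> * (16 / \<theta> * R) * (4 * m) \<le> m * s / 4"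
  proof -
    have "48 * \<rho> * (16 / \<theta> * R) * (4 * m) = (98304 / 400000) * (e2 * m * p * R) * m / s"
      by (simp add: \<rho>_def \<theta>_def)
    also have "\<dots> = (98304 / 400000) * (m * s)" using s unfolding s2(2)[symmetric] by simp
    also have "\<dots> \<le> (1 / 4) * (m * s)" using m s by (intro mult_right_mono) auto
    finally show ?thesis by simp
  qed
  have B: "(\<Sum>i\<in>V. \<Sum>j\<in>V. if T < real_of_int \<bar>k i * k j\<bar> then p * real_of_int \<bar>k i * k j\<bar> else 0) \<le> m * s / 8"
  proof -
    have "(\<Sum>i\<in>V. \<Sum>j\<in>V. if T < real_of_int \<bar>k i * k j\<bar> then p * real_of_int \<bar>k i * k j\<bar> else 0)
      \<le> (\<Sum>i\<in>V. \<Sum>j\<in>V. p / T * ((real_of_int (k i))\<^sup>2 * (real_of_int (k j))\<^sup>2))"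
    proof (intro sum_mono)
      fix i j
      define y where "y = real_of_int \<bar>k i * k j\<bar>"
      have y2: "(real_of_int (k i))\<^sup>2 * (real_of_int (k j))\<^sup>2 = y * y"
        unfolding y_def of_int_abs abs_mult_self_eq by (simp add: power2_eq_square)
      have "p * y \<le> p / T * (y * y)" if "T < y"
      proof -
        have "p * (T * y) \<le> p * (y * y)" using that pq T by (intro mult_left_mono mult_right_mono) auto
        then show ?thesis using T by (simp add: field_simps)
      qed
      then show "(if T < real_of_int \<bar>k i * k j\<bar> then p * real_of_int \<bar>k i * k j\<bar> else 0)
        \<le> p / T * ((real_of_int (k i))\<^sup>2 * (real_of_int (k j))\<^sup>2)"
        unfolding y2 y_def[symmetric] using pq T by simp
    qed
    also have "\<dots> = p / T * ((\<Sum>i\<in>V. (real_of_int (k i))\<^sup>2) * (\<Sum>j\<in>V. (real_of_int (k j))\<^sup>2))"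
      unfolding sum_product by (simp only: sum_distrib_left)
    also have "\<dots> \<le> p / T * ((4 * m) * (4 * m))"
      using Kb pq T by (intro mult_left_mono mult_mono) (auto intro: sum_nonneg)
    also have "\<dots> = (3200 * (m * p)) * m / s" by (simp add: T_def)
    also have "\<dots> \<le> (s\<^sup>2 / 8) * m / s"
      using big2 m s mp by (intro divide_right_mono mult_right_mono) auto
    also have "\<dots> = m * s / 8" using s by (simp add: power2_eq_square)
    finally show ?thesis .
  qed
  have "(\<Sum>i\<in>V. \<Sum>j\<in>V. if s / 200 < real_of_int \<bar>k i * k j\<bar> then \<bar>W f i j\<bar> * real_of_int \<bar>k i * k j\<bar> else 0)
    \<le> (\<Sum>i\<in>V. \<Sum>j\<in>V. (if T < real_of_int \<bar>k i * k j\<bar> then adj f i j * real_of_int \<bar>k i * k j\<bar> else 0)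
       + (if T < real_of_int \<bar>k i * k j\<bar> then p * real_of_int \<bar>k i * k j\<bar> else 0))"
  proof (intro sum_mono)
    fix i j
    have "\<bar>W f i j\<bar> * real_of_int \<bar>k i * k j\<bar> \<le> (adj f i j + p) * real_of_int \<bar>k i * k j\<bar>"
      by (intro mult_right_mono abs_W_le) auto
    then show "(if s / 200 < real_of_int \<bar>k i * k j\<bar> then \<bar>W f i j\<bar> * real_of_int \<bar>k i * k j\<bar> else 0)
     \<le> (if T < real_of_int \<bar>k i * k j\<bar> then adj f i j * real_of_int \<bar>k i * k j\<bar> else 0)
       + (if T < real_of_int \<bar>k i * k j\<bar> then p * real_of_int \<bar>k i * k j\<bar> else 0)"
      by (simp add: T_def distrib_right)
  qed
  also have "\<dots> \<le> (m * s / 8 + m * s / 8 + m * s / 4) + m * s / 8"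
    unfolding sum.distrib using a1 a2 a3
    by (intro add_mono B order_trans[OF A]) auto
  also have "\<dots> = 5 / 8 * (m * s)" by simp
  finally show ?thesis .
qed

text \<open>
  The argument of Friedman, Kahn and Szemeredi. A direction that violates the bound, scaled to
  square norm \<open>m\<close>, is rounded to an integer vector \<open>k\<close>. Pairs with small \<open>\<bar>k i * k j\<bar>\<close> are
  handled by a union bound over all \<open>k\<close>, the others by degrees and discrepancy. The factor \<open>e2\<close>
  can be any positive constant once \<open>R\<close> is large; this is needed because the norm has to be a
  small fraction of the typical dual variable, which is of order \<open>m * del * sqrt p\<close>.
\<close>

lemma prob_norm:
  assumes lnm: "ln m \<le> R" and R: "1 \<le> R" and e2: "0 < e2" "e2 \<le> 1"
    and big: "4000000 * exp (6400000 / e2) \<le> e2 * R"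
  shows "measure_pmf.prob G {f. \<exists>u. sqrt (e2 * m * p * R) * (\<Sum>i\<in>V. (u i)\<^sup>2)
       < \<bar>\<Sum>i\<in>V. \<Sum>j\<in>V. W f i j * u i * u j\<bar>} \<le> 7 * exp (- R)"
proof -
  define s where "s = sqrt (e2 * m * p * R)"
  define \<theta> where "\<theta> = 6400000 / e2"
  have m: "0 < m" using R_le_m R by linarith
  have mp: "0 < m * p" using m pq by simp
  have \<theta>: "1 \<le> \<theta>" "0 < \<theta>" using e2 by (auto simp: \<theta>_def field_simps)
  have Z: "0 < e2 * m * p * R" using m pq e2 R by simp
  have s: "0 < s" and s2: "s\<^sup>2 = e2 * m * p * R" using Z by (auto simp: s_def)
  have eth: "1 \<le> exp \<theta>" using \<theta> by simp
  have "4000000 * exp \<theta> * (m * p) \<le> s\<^sup>2"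
    using mult_right_mono[OF big, of "m * p"] mp unfolding s2 \<theta>_def by (simp add: mult_ac)
  moreover have "4000000 * (m * p) \<le> 4000000 * exp \<theta> * (m * p)"
    using mult_right_mono[OF eth, of "4000000 * (m * p)"] mp by (simp add: mult_ac)
  ultimately have big2: "320000 * m * p \<le> s\<^sup>2" using mp by linarith
  define L where "L = (\<lambda>k :: nat \<Rightarrow> int. {(i, j) \<in> upper. real_of_int \<bar>k i * k j\<bar> \<le> s / 200})"
  define light where "light = (\<lambda>f z. m * s / 8 < snd z * (\<Sum>(i,j)\<in>L (fst z). W f i j * real_of_int (fst z i * fst z j)))"
  let ?Z = "int_vectors V \<times> {1, -1 :: real}"
  have "measure_pmf.prob G {f. \<exists>u. s * (\<Sum>i\<in>V. (u i)\<^sup>2) < \<bar>\<Sum>i\<in>V. \<Sum>j\<in>V. W f i j * u i * u j\<bar>}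
    \<le> measure_pmf.prob G {f. (\<exists>i\<in>V. 8 * m * p < (\<Sum>j\<in>V. adj f i j)) \<or>
        ((\<exists>S\<in>Pow V. \<exists>S'\<in>Pow V. \<not> discrepancy \<theta> f S S') \<or> (\<exists>z\<in>?Z. light f z))}"
  proof (rule prob_mono, rule ccontr)
    fix f assume "\<exists>u. s * (\<Sum>i\<in>V. (u i)\<^sup>2) < \<bar>\<Sum>i\<in>V. \<Sum>j\<in>V. W f i j * u i * u j\<bar>"
    then obtain u where u: "s * (\<Sum>i\<in>V. (u i)\<^sup>2) < \<bar>\<Sum>i\<in>V. \<Sum>j\<in>V. W f i j * u i * u j\<bar>" by blast
    assume no: "\<not> ((\<exists>i\<in>V. 8 * m * p < (\<Sum>j\<in>V. adj f i j)) \<or>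
        ((\<exists>S\<in>Pow V. \<exists>S'\<in>Pow V. \<not> discrepancy \<theta> f S S') \<or> (\<exists>z\<in>?Z. light f z)))"
    then have deg: "\<And>i. i \<in> V \<Longrightarrow> (\<Sum>j\<in>V. adj f i j) \<le> 8 * m * p"
      and disc: "\<And>S S'. S \<subseteq> V \<Longrightarrow> S' \<subseteq> V \<Longrightarrow> discrepancy \<theta> f S S'"
      and lt: "\<And>z. z \<in> ?Z \<Longrightarrow> \<not> light f z" by (auto simp: not_less)
    define Su where "Su = (\<Sum>i\<in>V. (u i)\<^sup>2)"
    define Q where "Q = (\<Sum>i\<in>V. \<Sum>j\<in>V. W f i j * u i * u j)"
    define \<sigma> :: real where "\<sigma> = (if 0 \<le> Q then 1 else -1)"
    have Q: "\<sigma> * Q = \<bar>Q\<bar>" by (simp add: \<sigma>_def)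
    have Su: "0 < Su"
    proof (rule ccontr)
      assume "\<not> 0 < Su"
      moreover have "0 \<le> Su" by (simp add: Su_def sum_nonneg)
      ultimately have Su0: "Su = 0" by simp
      then have "u i = 0" if "i \<in> V" for i
        using that finite_V unfolding Su_def by (simp add: sum_nonneg_eq_0_iff)
      then have "Q = 0" unfolding Q_def by simp
      then show False using u Su0 by (simp add: Su_def[symmetric] Q_def[symmetric])
    qed
    define c where "c = sqrt (m / Su)"
    have c2: "c\<^sup>2 = m / Su" using Su m by (simp add: c_def)
    have "(\<Sum>i\<in>V. (c * u i)\<^sup>2) = c\<^sup>2 * Su"
      unfolding Su_def sum_distrib_left by (simp add: power_mult_distrib)
    then have z: "(\<Sum>i\<in>V. (c * u i)\<^sup>2) = m" using Su by (simp add: c2)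
    obtain k where k: "k \<in> int_vectors V"
      and kle: "(\<Sum>i\<in>V. \<Sum>j\<in>V. (\<sigma> * W f i j) * (c * u i) * (c * u j))
         \<le> (\<Sum>i\<in>V. \<Sum>j\<in>V. (\<sigma> * W f i j) * real_of_int (k i) * real_of_int (k j))"
      using round_to_int_vectors[OF finite_V, of "\<lambda>i j. \<sigma> * W f i j" "\<lambda>i. c * u i"] z W_sym[of f] by auto
    have "(\<Sum>i\<in>V. \<Sum>j\<in>V. (\<sigma> * W f i j) * (c * u i) * (c * u j)) = c\<^sup>2 * (\<sigma> * Q)"
      unfolding Q_def sum_distrib_left by (intro sum.cong refl) (simp add: power2_eq_square)
    also have "\<dots> = m / Su * \<bar>Q\<bar>" by (simp add: c2 Q)
    also have "\<dots> > m / Su * (s * Su)"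
      using u Su m by (intro mult_strict_left_mono) (auto simp: Su_def Q_def)
    finally have lower: "m * s < (\<Sum>i\<in>V. \<Sum>j\<in>V. (\<sigma> * W f i j) * real_of_int (k i) * real_of_int (k j))"
      using kle Su by simp
    define F where "F = (\<lambda>i j. if s / 200 < real_of_int \<bar>k i * k j\<bar> then \<bar>W f i j\<bar> * real_of_int \<bar>k i * k j\<bar> else 0)"
    have "(\<Sum>i\<in>V. \<Sum>j\<in>V. (\<sigma> * W f i j) * real_of_int (k i) * real_of_int (k j))
      = 2 * (\<Sum>(i,j)\<in>upper. (\<sigma> * W f i j) * real_of_int (k i) * real_of_int (k j))"
      by (rule sum_upper) (auto simp: W_sym)
    also have "(\<Sum>(i,j)\<in>upper. (\<sigma> * W f i j) * real_of_int (k i) * real_of_int (k j))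
      = (\<Sum>(i,j)\<in>upper - L k. (\<sigma> * W f i j) * real_of_int (k i) * real_of_int (k j))
        + (\<Sum>(i,j)\<in>L k. (\<sigma> * W f i j) * real_of_int (k i) * real_of_int (k j))"
      by (rule sum.subset_diff) (auto simp: L_def finite_upper)
    also have "(\<Sum>(i,j)\<in>L k. (\<sigma> * W f i j) * real_of_int (k i) * real_of_int (k j))
      = \<sigma> * (\<Sum>(i,j)\<in>L k. W f i j * real_of_int (k i * k j))"
      unfolding sum_distrib_left by (intro sum.cong refl) auto
    also have "\<dots> \<le> m * s / 8"
      using lt[of "(k, \<sigma>)"] k by (auto simp: light_def \<sigma>_def)
    also have "(\<Sum>(i,j)\<in>upper - L k. (\<sigma> * W f i j) * real_of_int (k i) * real_of_int (k j)) \<le> (\<Sum>(i,j)\<in>upper. F i j)"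
    proof -
      have "(\<Sum>(i,j)\<in>upper - L k. (\<sigma> * W f i j) * real_of_int (k i) * real_of_int (k j)) \<le> (\<Sum>(i,j)\<in>upper - L k. F i j)"
      proof (rule sum_mono)
        fix z assume z: "z \<in> upper - L k"
        obtain i j where ij: "z = (i, j)" by (cases z)
        have "(\<sigma> * W f i j) * real_of_int (k i) * real_of_int (k j) \<le> \<bar>(\<sigma> * W f i j) * real_of_int (k i) * real_of_int (k j)\<bar>"
          by (rule abs_ge_self)
        also have "\<dots> = \<bar>W f i j\<bar> * real_of_int \<bar>k i * k j\<bar>" by (simp add: abs_mult \<sigma>_def)
        also have "\<dots> = F i j" using z by (auto simp: F_def ij L_def not_le)
        finally show "(case z of (i, j) \<Rightarrow> (\<sigma> * W f i j) * real_of_int (k i) * real_of_int (k j)) \<le> (case z of (i, j) \<Rightarrow> F i j)"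
          by (simp add: ij)
      qed
      also have "\<dots> \<le> (\<Sum>(i,j)\<in>upper. F i j)"
        by (rule sum_mono2) (auto simp: finite_upper F_def)
      finally show ?thesis .
    qed
    also have "2 * ((\<Sum>(i,j)\<in>upper. F i j) + m * s / 8) = (\<Sum>i\<in>V. \<Sum>j\<in>V. F i j) + m * s / 4"
      by (subst sum_upper) (auto simp: F_def W_sym mult.commute)
    also have "(\<Sum>i\<in>V. \<Sum>j\<in>V. F i j) \<le> 5 / 8 * (m * s)"
      unfolding F_def s_def by (rule heavy_pairs_small[OF lnm R e2 big k deg disc[unfolded \<theta>_def]])
    finally have "(\<Sum>i\<in>V. \<Sum>j\<in>V. (\<sigma> * W f i j) * real_of_int (k i) * real_of_int (k j))
      \<le> 5 / 8 * (m * s) + m * s / 4" by simp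
    moreover have "0 < m * s" using m s by simp
    ultimately show False using lower by linarith
  qed
  also have "\<dots> \<le> exp (- 11 * R) + (4 * exp (- 6 * R) + 2 * exp (- R))"
  proof (rule order_trans[OF prob_disj_le add_mono[OF prob_degree[OF lnm R] order_trans[OF prob_disj_le add_mono[OF prob_discrepancy[OF lnm R \<theta>(1)]]]]])
    have "measure_pmf.prob G {f. \<exists>z\<in>?Z. light f z} \<le> (\<Sum>z\<in>?Z. exp (- 23 * m))"
    proof (rule prob_bex_le)
      show "finite ?Z" using card_int_vectors[OF finite_V] by simp
      fix z assume z: "z \<in> ?Z"
      then have "fst z \<in> int_vectors V" "\<bar>snd z\<bar> = 1" by auto
      then show "measure_pmf.prob G {f. light f z} \<le> exp (- 23 * m)"
        unfolding light_def L_def by (rule prob_light_pairs[OF _ _ s big2 m])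
    qed
    also have "\<dots> = 2 * (real (card (int_vectors V)) * exp (- 23 * m))"
      by (simp add: card_cartesian_product)
    also have "\<dots> \<le> 2 * (exp (6 * m) * exp (- 23 * m))"
      using card_int_vectors[OF finite_V] by (intro mult_left_mono mult_right_mono) auto
    also have "\<dots> \<le> 2 * exp (- R)"
      using R_le_m R_nonneg m by (simp add: exp_add[symmetric])
    finally show "measure_pmf.prob G {f. \<exists>z\<in>?Z. light f z} \<le> 2 * exp (- R)" .
  qed
  also have "\<dots> \<le> 7 * exp (- R)"
  proof -
    have "exp (- 11 * R) \<le> exp (- R)" "exp (- 6 * R) \<le> exp (- R)" using R by auto
    then show ?thesis by linarith
  qed
  finally show ?thesis unfolding s_def .
qed

end

section \<open>Tail bounds for the dual certificate\<close>

lemma mult_exp_minus_half_le: "t * exp (- t / 2) \<le> (1::real)"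
proof -
  have "1 + t / 2 \<le> exp (t / 2)" by (rule exp_ge_add_one_self)
  moreover have "exp (t / 2) \<ge> t"
  proof (cases "t \<le> 2")
    case False
    have "(1 + t / 4) \<le> exp (t / 4)" using exp_ge_add_one_self[of "t / 4"] by simp
    then have "(1 + t / 4)\<^sup>2 \<le> (exp (t / 4))\<^sup>2" using False by (intro power_mono) auto
    moreover have "(exp (t / 4))\<^sup>2 = exp (t / 2)" by (simp add: power2_eq_square exp_add[symmetric])
    moreover have "t \<le> (1 + t / 4)\<^sup>2" using zero_le_power2[of "1 - t / 4"] by (simp add: power2_eq_square algebra_simps)
    ultimately show ?thesis by linarith
  qed (use calculation in linarith)
  ultimately show ?thesis by (simp add: exp_minus field_simps)
qed

context two_communities
begin

text \<open>\<open>ns i\<close> and \<open>no i\<close> are the numbers of vertices in the same and in the other community.\<close>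

definition own where "own i = (if i \<in> R1 then R1 else R2)"
definition other where "other i = (if i \<in> R1 then R2 else R1)"
abbreviation ns where "ns i \<equiv> real (card (own i))"
abbreviation no where "no i \<equiv> real (card (other i))"

lemma m_split: "m = real (card R1) + real (card R2)"
  using disjoint_R by (simp add: card_Un_disjoint)

lemma own_Un_other: "own i \<union> other i = V" and own_Int_other: "own i \<inter> other i = {}"
  and finite_own [simp]: "finite (own i)" and finite_other [simp]: "finite (other i)"
  using disjoint_R by (auto simp: own_def other_def)

lemma self_own: "i \<in> V \<Longrightarrow> i \<in> own i"
  by (auto simp: own_def)

lemma ns_no: "ns i + no i = m"
  using m_split by (auto simp: own_def other_def)

lemma imbalance: "\<bar>ns i - no i\<bar> = \<bar>real (card R1) - real (card R2)\<bar>"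
  by (simp add: own_def other_def abs_minus_commute)

lemma x_mult: "i \<in> V \<Longrightarrow> j \<in> V \<Longrightarrow> x i * x j = (if j \<in> own i then 1 else -1)"
  using disjoint_R by (auto simp: x_def own_def)

lemma x_sq [simp]: "x i * x i = 1"
  by (simp add: x_def)

lemma mean_eq: "i \<in> V \<Longrightarrow> j \<in> V \<Longrightarrow> i \<noteq> j \<Longrightarrow> mean_adj R1 R2 p q i j = (if j \<in> own i then p else q)"
  using disjoint_R by (auto simp: mean_adj_def own_def)

lemma sum_own_other:
  fixes h :: "nat \<Rightarrow> real"
  shows "(\<Sum>j\<in>V. h j) = (\<Sum>j\<in>own i. h j) + (\<Sum>j\<in>other i. h j)"
  unfolding own_Un_other[of i, symmetric] by (rule sum.union_disjoint) (auto simp: own_Int_other)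

lemma sum_own_other_const:
  shows "(\<Sum>j\<in>V. if j \<in> own i then a else b) = ns i * a + no i * (b::real)"
proof -
  have "(\<Sum>j\<in>other i. if j \<in> own i then a else b) = (\<Sum>j\<in>other i. b)"
    using own_Int_other[of i] by (intro sum.cong refl) auto
  moreover have "(\<Sum>j\<in>own i. if j \<in> own i then a else b) = (\<Sum>j\<in>own i. a)"
    by (intro sum.cong refl) auto
  ultimately show ?thesis unfolding sum_own_other[of _ i] by (simp only: sum_constant)
qed

lemma D_eq:
  assumes i: "i \<in> V"
  shows "D f i = (\<Sum>j\<in>V - {i}. x i * x j * adj f i j) - lam * (ns i - no i)"
proof -
  have "D f i = (\<Sum>j\<in>V. x i * x j * adj f i j) - lam * (\<Sum>j\<in>V. x i * x j)"
    unfolding dual_diag_def sum_distrib_left sum_subtractf[symmetric]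
    by (intro sum.cong refl) (simp add: algebra_simps)
  also have "(\<Sum>j\<in>V. x i * x j) = (\<Sum>j\<in>V. if j \<in> own i then 1 else -1)"
    using x_mult i by (intro sum.cong refl) auto
  also have "\<dots> = ns i - no i" unfolding sum_own_other_const by simp
  also have "(\<Sum>j\<in>V. x i * x j * adj f i j) = (\<Sum>j\<in>V - {i}. x i * x j * adj f i j)"
    by (rule sum.mono_neutral_right) (auto simp: adj_def)
  finally show ?thesis .
qed

lemma star_moment_le:
  assumes i: "i \<in> V" and X: "i \<in> X" "finite X" and a: "0 \<le> a" and b: "0 \<le> b"
  shows "(\<Sum>j\<in>V - X. mean_adj R1 R2 p q i j * (exp (if j \<in> own i then - a else b) - 1))
    \<le> ns i * (p * (exp (- a) - 1)) + no i * (q * (exp b - 1)) + real (card X)"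
proof -
  define h where "h = (\<lambda>j. if j \<in> own i then p * (exp (- a) - 1) else q * (exp b - 1))"
  have hl: "- 1 \<le> h j" for j
  proof -
    have "p * (1 - exp (- a)) \<le> 1 * 1" using pq a by (intro mult_mono) auto
    moreover have "0 \<le> q * (exp b - 1)" using pq b by simp
    ultimately show ?thesis by (auto simp: h_def algebra_simps)
  qed
  have "(\<Sum>j\<in>V - X. mean_adj R1 R2 p q i j * (exp (if j \<in> own i then - a else b) - 1)) = (\<Sum>j\<in>V - X. h j)"
  proof (intro sum.cong refl)
    fix j assume "j \<in> V - X"
    then have "j \<in> V" "i \<noteq> j" using X by auto
    then show "mean_adj R1 R2 p q i j * (exp (if j \<in> own i then - a else b) - 1) = h j"
      using mean_eq[OF i] by (simp add: h_def)
  qed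
  also have "\<dots> = (\<Sum>j\<in>V. h j) - (\<Sum>j\<in>V \<inter> X. h j)"
  proof -
    have "(\<Sum>j\<in>V. h j) = (\<Sum>j\<in>V - (V \<inter> X). h j) + (\<Sum>j\<in>V \<inter> X. h j)"
      by (rule sum.subset_diff) auto
    then show ?thesis by (simp add: Diff_Int)
  qed
  finally have eq: "(\<Sum>j\<in>V - X. mean_adj R1 R2 p q i j * (exp (if j \<in> own i then - a else b) - 1))
     = (\<Sum>j\<in>V. h j) - (\<Sum>j\<in>V \<inter> X. h j)" .
  have "(\<Sum>j\<in>V \<inter> X. h j) \<ge> (\<Sum>j\<in>V \<inter> X. -1)" by (intro sum_mono hl)
  then have "(\<Sum>j\<in>V \<inter> X. h j) \<ge> - real (card X)"
    using card_mono[of X "V \<inter> X"] X by simp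
  then show ?thesis unfolding eq unfolding h_def sum_own_other_const by linarith
qed

text \<open>The exponent in Chernoff's bound for \<open>D f i \<le> \<tau>\<close> with tilt \<open>\<sigma>\<close>.\<close>

definition crude_exponent :: "nat \<Rightarrow> real \<Rightarrow> real \<Rightarrow> real" where
  "crude_exponent i \<sigma> \<tau> = ns i * (p * (exp (- \<sigma>) - 1)) + no i * (q * (exp \<sigma> - 1)) + \<sigma> * (\<tau> + lam * (ns i - no i))"

text \<open>The additive constant in the exponent pays for the missing edge from \<open>i\<close> to itself.\<close>

lemma prob_D_le:
  assumes i: "i \<in> V" and \<sigma>: "0 \<le> \<sigma>"
  shows "measure_pmf.prob G {f. D f i \<le> \<tau>} \<le> exp (1 + crude_exponent i \<sigma> \<tau>)"
proof -
  define c where "c = (\<lambda>j. if j \<in> own i then - \<sigma> else \<sigma>)"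
  have "measure_pmf.prob G {f. D f i \<le> \<tau>}
    \<le> measure_pmf.prob G {f. - \<sigma> * (\<tau> + lam * (ns i - no i)) \<le> (\<Sum>j\<in>V - {i}. c j * adj f i j)}"
  proof (rule prob_mono)
    fix f assume "D f i \<le> \<tau>"
    then have "(\<Sum>j\<in>V - {i}. x i * x j * adj f i j) \<le> \<tau> + lam * (ns i - no i)" using D_eq[OF i, of f] by linarith
    then have "\<sigma> * (\<Sum>j\<in>V - {i}. x i * x j * adj f i j) \<le> \<sigma> * (\<tau> + lam * (ns i - no i))"
      using \<sigma> by (intro mult_left_mono)
    moreover have "(\<Sum>j\<in>V - {i}. c j * adj f i j) = - (\<sigma> * (\<Sum>j\<in>V - {i}. x i * x j * adj f i j))"
      unfolding sum_distrib_left sum_negf[symmetric]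
      by (intro sum.cong refl) (use x_mult[OF i] in \<open>auto simp: c_def\<close>)
    ultimately show "- \<sigma> * (\<tau> + lam * (ns i - no i)) \<le> (\<Sum>j\<in>V - {i}. c j * adj f i j)" by linarith
  qed
  also have "\<dots> \<le> exp ((\<Sum>j\<in>V - {i}. mean_adj R1 R2 p q i j * (exp (c j) - 1)) - (- \<sigma> * (\<tau> + lam * (ns i - no i))))"
    by (rule chernoff_star[OF i subset_refl])
  also have "\<dots> \<le> exp (1 + crude_exponent i \<sigma> \<tau>)"
    using star_moment_le[OF i, of "{i}" \<sigma> \<sigma>] \<sigma> by (simp add: c_def crude_exponent_def)
  finally show ?thesis .
qed

text \<open>
  This identity is the reason for the value of \<open>lam\<close>: at the optimal tilt the penalty cancels
  any imbalance between the two communities, and only the total size \<open>m\<close> enters.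
\<close>

lemma crude_exponent_t: "crude_exponent i t \<tau> = - R + t * \<tau>"
proof -
  have a: "p * (exp (- t) - 1) = sqrt (p * q) - p" "q * (exp t - 1) = sqrt (p * q) - q"
    using p_exp_minus_t q_exp_t by (simp_all add: algebra_simps)
  have "crude_exponent i t \<tau> = ns i * (sqrt (p * q) - p) + no i * (sqrt (p * q) - q) + (t * \<tau> + lam * t * (ns i - no i))"
    unfolding crude_exponent_def a by (simp add: algebra_simps)
  also have "\<dots> = - ((ns i + no i) * (p + q - 2 * sqrt (p * q)) / 2) + t * \<tau>"
    unfolding lam_t by (simp add: field_simps)
  also have "\<dots> = - R + t * \<tau>" unfolding ns_no R_def del_square by simp
  finally show ?thesis .
qed

lemma prob_D_le_sharp:
  assumes "i \<in> V"
  shows "measure_pmf.prob G {f. D f i \<le> \<tau>} \<le> exp (1 - R + t * \<tau>)"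
  using prob_D_le[OF assms, of t \<tau>] t_pos unfolding crude_exponent_t by (simp add: algebra_simps)

lemma t_mult_le: "t * sqrt q \<le> del"
proof -
  have q: "0 < sqrt q" using pq by simp
  have "1 + t \<le> exp t" by (rule exp_ge_add_one_self)
  then have "t \<le> sqrt p / sqrt q - 1" unfolding exp_t by linarith
  also have "\<dots> = del / sqrt q" using q by (simp add: del_def diff_divide_distrib)
  finally show "t * sqrt q \<le> del" using q by (simp add: field_simps)
qed

text \<open>
  A slack of a small fraction of the typical size \<open>m * del * sqrt p\<close> costs only a small fraction
  of the exponent. If \<open>p / q\<close> is bounded, the optimal tilt \<open>t\<close> shows this. If it is large, \<open>t\<close>
  would multiply the slack by too much, but then the bounded tilt \<open>ln (8 / \<eta>)\<close> is almost
  optimal.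
\<close>

lemma crude_exponent_small:
  assumes \<eta>: "0 < \<eta>" "\<eta> \<le> 1" and i: "i \<in> V"
    and bal: "\<bar>real (card R1) - real (card R2)\<bar> \<le> \<eta> / 4 * m"
  shows "\<exists>\<sigma>. 0 \<le> \<sigma> \<and> \<sigma> \<le> ln (8 / \<eta>) \<and>
    crude_exponent i \<sigma> (\<eta>\<^sup>2 / 64 * m * del * sqrt p) \<le> - (1 - \<eta>) * R"
proof -
  define T where "T = ln (8 / \<eta>)"
  define Th where "Th = \<eta>\<^sup>2 / 64 * m * del * sqrt p"
  have T: "exp T = 8 / \<eta>" "exp (- T) = \<eta> / 8" "T \<le> 8 / \<eta>"
    using \<eta> ln_le_minus_one[of "8 / \<eta>"] by (auto simp: T_def exp_minus)
  have T0: "0 < T" using \<eta> by (simp add: T_def)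
  have sp: "sqrt p * sqrt p = p" using pq by simp
  have R': "m * del * del = 2 * R" by (simp add: R_def power2_eq_square)
  show ?thesis
  proof (cases "t \<le> T")
    case True
    have "sqrt p = exp t * sqrt q" using pq by (simp add: exp_t)
    also have "\<dots> \<le> exp T * sqrt q" using True pq by (intro mult_right_mono) auto
    finally have "t * sqrt p \<le> t * (8 / \<eta> * sqrt q)" using t_pos T by (intro mult_left_mono) auto
    also have "\<dots> = 8 / \<eta> * (t * sqrt q)" by simp
    also have "\<dots> \<le> 8 / \<eta> * del" using \<eta> t_mult_le by (intro mult_left_mono) auto
    finally have a: "t * sqrt p \<le> 8 / \<eta> * del" .
    have "t * Th = \<eta>\<^sup>2 / 64 * m * del * (t * sqrt p)" by (simp add: Th_def)
    also have "\<dots> \<le> \<eta>\<^sup>2 / 64 * m * del * (8 / \<eta> * del)"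
      using a del_pos by (intro mult_left_mono) auto
    also have "\<dots> = \<eta> / 8 * (m * del * del)" using \<eta> by (simp add: power2_eq_square)
    also have "\<dots> \<le> \<eta> * R" unfolding R' using \<eta> R_nonneg by simp
    finally have "crude_exponent i t Th \<le> - (1 - \<eta>) * R"
      unfolding crude_exponent_t by (simp add: algebra_simps)
    then show ?thesis using True t_pos unfolding Th_def T_def by (intro exI[of _ t]) auto
  next
    case False
    have mp: "0 \<le> m * p" using pq by simp
    have "q * exp T \<le> q * (exp t * exp (T - t))" by (simp add: exp_add[symmetric])
    also have "\<dots> = p * (exp (- t) * exp (T - t))" using q_exp_t p_exp_minus_t by (simp add: mult.assoc[symmetric])
    also have "\<dots> \<le> p * exp (- T)" using False pq by (intro mult_left_mono) (auto simp: exp_add[symmetric])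
    finally have qT: "q * exp T \<le> p * (\<eta> / 8)" using T by simp
    have lamT: "T * lam \<le> p / 2"
    proof -
      have "T * lam \<le> t * lam" using False lam_pos by (intro mult_right_mono) auto
      also have "\<dots> = (p - q) / 2" using lam_t by (simp add: mult.commute)
      also have "\<dots> \<le> p / 2" using pq by simp
      finally show ?thesis .
    qed
    have im: "\<bar>ns i - no i\<bar> \<le> \<eta> / 4 * m" using bal unfolding imbalance .
    have ns: "m / 2 - \<eta> / 8 * m \<le> ns i" using im ns_no[of i] by linarith
    have e1: "ns i * (p * (exp (- T) - 1)) \<le> - (m * p / 2) + \<eta> / 8 * (m * p) + ns i * p * (\<eta> / 8)"
    proof -
      have "(m / 2 - \<eta> / 8 * m) * p \<le> ns i * p" using ns pq by (intro mult_right_mono) auto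
      moreover have "ns i * (p * (exp (- T) - 1)) = ns i * p * (\<eta> / 8) - ns i * p"
        unfolding T by (simp add: algebra_simps)
      moreover have "(m / 2 - \<eta> / 8 * m) * p = m * p / 2 - \<eta> / 8 * (m * p)" by (simp add: algebra_simps)
      ultimately show ?thesis by linarith
    qed
    have e2: "no i * (q * (exp T - 1)) \<le> no i * p * (\<eta> / 8)"
    proof -
      have "q * (exp T - 1) \<le> p * (\<eta> / 8)" using qT pq by (simp add: algebra_simps)
      then have "no i * (q * (exp T - 1)) \<le> no i * (p * (\<eta> / 8))" by (intro mult_left_mono) auto
      then show ?thesis by (simp only: mult.assoc)
    qed
    have e3: "T * Th \<le> \<eta> / 8 * (m * p)"
    proof -
      have "T * Th = T * (\<eta>\<^sup>2 / 64) * m * (del * sqrt p)" by (simp add: Th_def)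
      also have "\<dots> \<le> 8 / \<eta> * (\<eta>\<^sup>2 / 64) * m * (sqrt p * sqrt p)"
        using T T0 \<eta> del_le del_pos pq by (intro mult_mono) auto
      also have "\<dots> = \<eta> / 8 * (m * p)" unfolding sp using \<eta> by (simp add: power2_eq_square)
      finally show ?thesis .
    qed
    have e4: "T * (lam * (ns i - no i)) \<le> \<eta> / 8 * (m * p)"
    proof -
      have "T * (lam * (ns i - no i)) = (T * lam) * (ns i - no i)" by simp
      also have "\<dots> \<le> (T * lam) * (\<eta> / 4 * m)"
        by (rule mult_left_mono[OF abs_le_D1[OF im]]) (use T0 lam_pos in simp)
      also have "\<dots> \<le> (p / 2) * (\<eta> / 4 * m)" using lamT \<eta> by (intro mult_right_mono) auto
      finally show ?thesis by (simp add: mult_ac)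
    qed
    have e5: "ns i * p * (\<eta> / 8) + no i * p * (\<eta> / 8) = \<eta> / 8 * (m * p)"
      unfolding ns_no[of i, symmetric] by (simp only: algebra_simps)
    have "crude_exponent i T Th \<le> - (m * p / 2) + 4 * (\<eta> / 8 * (m * p))"
      using e1 e2 e3 e4 e5 unfolding crude_exponent_def distrib_left by linarith
    also have "\<dots> = - ((1 - \<eta>) * (m * p / 2))" by (simp add: field_simps)
    also have "\<dots> \<le> - ((1 - \<eta>) * R)"
      unfolding neg_le_iff_le using \<eta> R_le by (intro mult_left_mono) auto
    also have "\<dots> = - (1 - \<eta>) * R" by (simp add: algebra_simps)
    finally show ?thesis using T0 unfolding Th_def T_def by (intro exI[of _ T]) (auto simp: T_def)
  qed
qed

end

context two_communities
begin

section \<open>The cut between the communities\<close>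

lemma chernoff_cross:
  "measure_pmf.prob G {f. s \<le> c * (\<Sum>i\<in>R1. \<Sum>j\<in>R2. adj f i j)}
     \<le> exp (real (card R1) * real (card R2) * (q * (exp c - 1)) - s)"
proof -
  let ?\<phi> = "\<lambda>z :: nat \<times> nat. {fst z, snd z}"
  have ne: "i \<noteq> j" if "i \<in> R1" "j \<in> R2" for i j using that disjoint_R by auto
  have inj: "inj_on ?\<phi> (R1 \<times> R2)"
    using ne by (auto simp: inj_on_def doubleton_eq_iff)
  have sub: "?\<phi> ` (R1 \<times> R2) \<subseteq> I" using pairs_I ne by auto
  have eq1: "c * (\<Sum>i\<in>R1. \<Sum>j\<in>R2. adj f i j) = (\<Sum>z\<in>R1 \<times> R2. c * of_bool (f (?\<phi> z)))" for f
    unfolding sum_distrib_left sum.cartesian_product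
    by (intro sum.cong refl) (use ne in \<open>auto simp: adj_def\<close>)
  have eq2: "(\<Sum>z\<in>R1 \<times> R2. pe (?\<phi> z) * (exp c - 1)) = (\<Sum>z\<in>R1 \<times> R2. q * (exp c - 1))"
  proof (intro sum.cong refl)
    fix z assume z: "z \<in> R1 \<times> R2"
    then have "pe (?\<phi> z) = mean_adj R1 R2 p q (fst z) (snd z)" using ne by (intro pe_mean) auto
    also have "\<dots> = q" using z disjoint_R by (auto simp: mean_adj_def)
    finally show "pe (?\<phi> z) * (exp c - 1) = q * (exp c - 1)" by simp
  qed
  have fin: "finite (R1 \<times> R2)" by simp
  have "measure_pmf.prob G {f. s \<le> (\<Sum>z\<in>R1 \<times> R2. c * of_bool (f (?\<phi> z)))}
    \<le> exp ((\<Sum>z\<in>R1 \<times> R2. pe (?\<phi> z) * (exp c - 1)) - s)"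
    by (rule chernoff_bernoulli[OF finite_I pe01 fin inj sub])
  then show ?thesis
    unfolding eq1 eq2 by (simp only: sum_constant card_cartesian_product of_nat_mult)
qed

definition k1 :: real where
  "k1 = del\<^sup>2 / (4 * t) * (real (card R1) * real (card R2))"

text \<open>
  At the tilt \<open>t\<close> the exponent is \<open>del\<^sup>2 / 2\<close> per pair of vertices; asking for a sum of at least
  \<open>k1\<close> uses up half of it.
\<close>

lemma prob_cut:
  "measure_pmf.prob G {f. (\<Sum>i\<in>R1. \<Sum>j\<in>R2. lam - adj f i j) < k1}
     \<le> exp (- (real (card R1) * real (card R2) * del\<^sup>2 / 4))"
proof -
  let ?M = "real (card R1) * real (card R2)"
  define X where "X = lam * ?M - k1"
  have "measure_pmf.prob G {f. (\<Sum>i\<in>R1. \<Sum>j\<in>R2. lam - adj f i j) < k1}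
     \<le> measure_pmf.prob G {f. t * X \<le> t * (\<Sum>i\<in>R1. \<Sum>j\<in>R2. adj f i j)}"
  proof (rule prob_mono)
    fix f assume "(\<Sum>i\<in>R1. \<Sum>j\<in>R2. lam - adj f i j) < k1"
    then have "X \<le> (\<Sum>i\<in>R1. \<Sum>j\<in>R2. adj f i j)" by (simp add: X_def sum_subtractf mult_ac)
    then show "t * X \<le> t * (\<Sum>i\<in>R1. \<Sum>j\<in>R2. adj f i j)" using t_pos by (intro mult_left_mono) auto
  qed
  also have "\<dots> \<le> exp (?M * (q * (exp t - 1)) - t * X)" by (rule chernoff_cross)
  also have "?M * (q * (exp t - 1)) - t * X = - (?M * del\<^sup>2 / 4)"
  proof -
    have "t * X = (lam * t) * ?M - del\<^sup>2 / 4 * ?M"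
      using t_pos by (simp add: X_def k1_def field_simps)
    moreover have "q * (exp t - 1) = sqrt (p * q) - q" using q_exp_t by (simp add: algebra_simps)
    ultimately have "?M * (q * (exp t - 1)) - t * X = ?M * (sqrt (p * q) - q - (p - q) / 2 + del\<^sup>2 / 4)"
      unfolding lam_t by (simp add: algebra_simps)
    also have "sqrt (p * q) - q - (p - q) / 2 + del\<^sup>2 / 4 = - (del\<^sup>2 / 4)" by (simp add: del_square field_simps)
    finally show ?thesis by simp
  qed
  finally show ?thesis .
qed

text \<open>
  A first moment bound, read off from the exponential moment with \<open>exp c\<close> the reciprocal of the
  mean.
\<close>

lemma prob_cross_edge:
  "measure_pmf.prob G {f. \<exists>i\<in>R1. \<exists>j\<in>R2. adj f i j \<noteq> 0} \<le> 3 * (q * (real (card R1) * real (card R2)))"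
proof (cases "R1 = {} \<or> R2 = {}")
  case True
  then have "{f. \<exists>i\<in>R1. \<exists>j\<in>R2. adj f i j \<noteq> 0} = {}" by auto
  then show ?thesis using True by auto
next
  case False
  let ?M = "real (card R1) * real (card R2)"
  have M: "0 < q * ?M" using False pq by (simp add: card_gt_0_iff)
  have "measure_pmf.prob G {f. \<exists>i\<in>R1. \<exists>j\<in>R2. adj f i j \<noteq> 0} \<le> exp 1 * (q * ?M)"
  proof (cases "q * ?M \<le> 1")
    case True
    (* The tilt at which the mean of the tilted sum is one. *)
    define c where "c = - ln (q * ?M)"
    have c: "0 \<le> c" "exp c = 1 / (q * ?M)" using True M by (auto simp: c_def exp_minus field_simps)
    have "measure_pmf.prob G {f. \<exists>i\<in>R1. \<exists>j\<in>R2. adj f i j \<noteq> 0}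
      \<le> measure_pmf.prob G {f. c \<le> c * (\<Sum>i\<in>R1. \<Sum>j\<in>R2. adj f i j)}"
    proof (rule prob_mono)
      fix f assume "\<exists>i\<in>R1. \<exists>j\<in>R2. adj f i j \<noteq> 0"
      then obtain i j where ij: "i \<in> R1" "j \<in> R2" "adj f i j = 1" using adj_01[of f] by metis
      have "1 \<le> (\<Sum>j\<in>R2. adj f i j)"
        using member_le_sum[of j R2 "adj f i"] ij adj_bounds by simp
      also have "\<dots> \<le> (\<Sum>i\<in>R1. \<Sum>j\<in>R2. adj f i j)"
        using ij adj_bounds by (intro member_le_sum[of i R1 "\<lambda>i. \<Sum>j\<in>R2. adj f i j"]) (auto intro: sum_nonneg)
      finally have "c * 1 \<le> c * (\<Sum>i\<in>R1. \<Sum>j\<in>R2. adj f i j)" using c by (intro mult_left_mono)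
      then show "c \<le> c * (\<Sum>i\<in>R1. \<Sum>j\<in>R2. adj f i j)" by simp
    qed
    also have "\<dots> \<le> exp (?M * (q * (exp c - 1)) - c)" by (rule chernoff_cross)
    also have "\<dots> \<le> exp (1 - c)"
    proof -
      have "?M * (q * (exp c - 1)) = (q * ?M) * exp c - q * ?M" by (simp add: algebra_simps)
      also have "\<dots> \<le> 1" using M unfolding c(2) by simp
      finally show ?thesis by simp
    qed
    also have "\<dots> = exp 1 * (q * ?M)" using c M by (simp add: exp_diff)
    finally show ?thesis .
  next
    case False
    have "1 * 1 \<le> exp 1 * (q * ?M)" using False by (intro mult_mono) auto
    then show ?thesis using measure_pmf.prob_le_1[of G "{f. \<exists>i\<in>R1. \<exists>j\<in>R2. adj f i j \<noteq> 0}"] by linarith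
  qed
  also have "\<dots> \<le> 3 * (q * ?M)" using exp_le M by (intro mult_right_mono) auto
  finally show ?thesis .
qed

text \<open>
  If \<open>q\<close> is negligible compared with \<open>p\<close>, the tilt may be as large as \<open>3 / e\<close> before the moment
  of the edges to the other community reaches \<open>m * p\<close>.
\<close>

lemma prob_other_degree:
  assumes lnm: "ln m \<le> R" and R: "1 \<le> R" and e: "0 < e" and K: "q * exp (3 / e) \<le> p"
  shows "measure_pmf.prob G {f. \<exists>i\<in>V. e * m * p < (\<Sum>j\<in>other i. adj f i j)} \<le> exp (- 3 * R)"
proof -
  have "measure_pmf.prob G {f. \<exists>i\<in>V. e * m * p < (\<Sum>j\<in>other i. adj f i j)} \<le> (\<Sum>i\<in>V. exp (- 4 * R))"
  proof (rule prob_bex_le[OF finite_V])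
    fix i assume i: "i \<in> V"
    define c where "c = 3 / e"
    have c: "0 < c" using e by (simp add: c_def)
    have sub: "other i \<subseteq> V - {i}"
      using own_Un_other[of i] own_Int_other[of i] self_own[OF i] by auto
    have "measure_pmf.prob G {f. e * m * p < (\<Sum>j\<in>other i. adj f i j)}
      \<le> measure_pmf.prob G {f. c * (e * m * p) \<le> (\<Sum>j\<in>other i. c * adj f i j)}"
      by (rule prob_mono) (use c in \<open>simp add: sum_distrib_left[symmetric]\<close>)
    also have "\<dots> \<le> exp ((\<Sum>j\<in>other i. mean_adj R1 R2 p q i j * (exp c - 1)) - c * (e * m * p))"
      by (rule chernoff_star[OF i sub])
    also have "\<dots> \<le> exp (- 4 * R)"
    proof (subst exp_le_cancel_iff)
      have "(\<Sum>j\<in>other i. mean_adj R1 R2 p q i j * (exp c - 1)) = (\<Sum>j\<in>other i. q * (exp c - 1))"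
      proof (intro sum.cong refl)
        fix j assume j: "j \<in> other i"
        then have "j \<in> V" "i \<noteq> j" "j \<notin> own i" using sub own_Int_other[of i] by auto
        then show "mean_adj R1 R2 p q i j * (exp c - 1) = q * (exp c - 1)" using mean_eq[OF i] by simp
      qed
      also have "\<dots> = no i * (q * exp c - q)" by (simp add: algebra_simps)
      also have "\<dots> \<le> m * p"
        using ns_no[of i] K pq unfolding c_def by (intro mult_mono) (auto simp: e less_imp_le)
      finally have "(\<Sum>j\<in>other i. mean_adj R1 R2 p q i j * (exp c - 1)) \<le> m * p" .
      moreover have "c * (e * m * p) = 3 * (m * p)" using e by (simp add: c_def)
      ultimately show "(\<Sum>j\<in>other i. mean_adj R1 R2 p q i j * (exp c - 1)) - c * (e * m * p) \<le> - 4 * R"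
        using R_le by linarith
    qed
    finally show "measure_pmf.prob G {f. e * m * p < (\<Sum>j\<in>other i. adj f i j)} \<le> exp (- 4 * R)" .
  qed
  also have "\<dots> = m * exp (- 4 * R)" by simp
  also have "\<dots> \<le> exp (- 3 * R)" using m_exp_le[OF lnm R, of 4] by simp
  finally show ?thesis .
qed

section \<open>Dual variables relative to the degree\<close>

text \<open>
  For unbounded \<open>p / q\<close> the tilt \<open>t\<close> is unbounded, so an additive slack in \<open>D f i\<close> would be too
  expensive. A slack proportional to the degree of \<open>i\<close> merely changes the weights of the edges
  from \<open>\<plusminus>\<sigma>\<close> to \<open>\<sigma> * (a \<plusminus> 1)\<close>, and truncating the tilt at \<open>T\<close> costs no more than
  \<open>m * p * exp (- T / 2)\<close>. Dividing by \<open>1 + a\<close> keeps the weight of the edges to the other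
  community at most \<open>t\<close>, where their moment is at most the geometric mean.
\<close>

lemma prob_D_relative:
  assumes i: "i \<in> V" and a: "0 \<le> a" "a \<le> 1 / 4" and b: "0 \<le> b" and T: "0 < T"
    and bal: "\<bar>real (card R1) - real (card R2)\<bar> \<le> \<Delta>" and lamp: "lam \<le> p"
  shows "measure_pmf.prob G {f. D f i \<le> a * (\<Sum>j\<in>V. adj f i j) + b}
     \<le> exp (- R + 1 + p * \<Delta> + T * (b + p * \<Delta>) + 2 * a * m * p + m * p * exp (- T / 2))"
proof -
  (* \<open>T'\<close> is the tilt of the edges to the other community, \<open>T' * (1 - 2 * a)\<close> a lower bound for that of the
     edges to the own one. *)
  define T' where "T' = min t T"
  define \<sigma> where "\<sigma> = T' / (1 + a)"
  have T': "0 < T'" "T' \<le> t" "T' \<le> T" using T t_pos by (auto simp: T'_def)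
  have \<sigma>: "0 \<le> \<sigma>" "\<sigma> \<le> T" "\<sigma> * (1 + a) = T'"
  proof -
    show "0 \<le> \<sigma>" "\<sigma> * (1 + a) = T'" using T' a by (auto simp: \<sigma>_def)
    have "\<sigma> \<le> T' / 1" unfolding \<sigma>_def using T' a by (intro divide_left_mono) auto
    then show "\<sigma> \<le> T" using T' by linarith
  qed
  have im: "\<bar>ns i - no i\<bar> \<le> \<Delta>" using bal unfolding imbalance .
  have \<Delta>: "0 \<le> \<Delta>" using bal by linarith
  define \<tau> where "\<tau> = b + p * \<Delta>"
  have \<tau>0: "0 \<le> \<tau>" using b pq \<Delta> by (simp add: \<tau>_def)
  define c where "c = (\<lambda>j. if j \<in> own i then - (\<sigma> * (1 - a)) else \<sigma> * (1 + a))"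
  have "measure_pmf.prob G {f. D f i \<le> a * (\<Sum>j\<in>V. adj f i j) + b}
    \<le> measure_pmf.prob G {f. - (\<sigma> * \<tau>) \<le> (\<Sum>j\<in>V - {i}. c j * adj f i j)}"
  proof (rule prob_mono)
    fix f assume D: "D f i \<le> a * (\<Sum>j\<in>V. adj f i j) + b"
    have eqd: "(\<Sum>j\<in>V. adj f i j) = (\<Sum>j\<in>V - {i}. adj f i j)"
      by (rule sum.mono_neutral_right) (auto simp: adj_def)
    have "(\<Sum>j\<in>V - {i}. x i * x j * adj f i j) - a * (\<Sum>j\<in>V - {i}. adj f i j)
       = (\<Sum>j\<in>V - {i}. (x i * x j - a) * adj f i j)"
      by (simp add: sum_distrib_left sum_subtractf[symmetric] algebra_simps)
    moreover have "lam * (ns i - no i) \<le> p * \<Delta>"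
    proof -
      have "lam * (ns i - no i) \<le> lam * \<Delta>" using im lam_pos by (intro mult_left_mono) linarith+
      also have "\<dots> \<le> p * \<Delta>" using lamp \<Delta> by (intro mult_right_mono)
      finally show ?thesis .
    qed
    ultimately have "(\<Sum>j\<in>V - {i}. (x i * x j - a) * adj f i j) \<le> \<tau>"
      using D[unfolded eqd] D_eq[OF i, of f] unfolding \<tau>_def by linarith
    then have "\<sigma> * (\<Sum>j\<in>V - {i}. (x i * x j - a) * adj f i j) \<le> \<sigma> * \<tau>" using \<sigma> by (intro mult_left_mono)
    moreover have "(\<Sum>j\<in>V - {i}. c j * adj f i j) = - (\<sigma> * (\<Sum>j\<in>V - {i}. (x i * x j - a) * adj f i j))"
      unfolding sum_distrib_left sum_negf[symmetric]
    proof (intro sum.cong refl)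
      fix j assume "j \<in> V - {i}"
      then have "x i * x j = (if j \<in> own i then 1 else -1)" using x_mult[OF i] by auto
      then show "c j * adj f i j = - (\<sigma> * ((x i * x j - a) * adj f i j))"
        unfolding c_def by (simp add: algebra_simps)
    qed
    ultimately show "- (\<sigma> * \<tau>) \<le> (\<Sum>j\<in>V - {i}. c j * adj f i j)" by linarith
  qed
  also have "\<dots> \<le> exp ((\<Sum>j\<in>V - {i}. mean_adj R1 R2 p q i j * (exp (c j) - 1)) - (- (\<sigma> * \<tau>)))"
    by (rule chernoff_star[OF i subset_refl])
  also have "\<dots> \<le> exp (ns i * (p * (exp (- (\<sigma> * (1 - a))) - 1)) + no i * (q * (exp (\<sigma> * (1 + a)) - 1)) + 1 + \<sigma> * \<tau>)"
    using star_moment_le[OF i, of "{i}" "\<sigma> * (1 - a)" "\<sigma> * (1 + a)"] \<sigma> a T' by (simp add: c_def)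
  also have "\<dots> \<le> exp (- R + 1 + p * \<Delta> + T * (b + p * \<Delta>) + 2 * a * m * p + m * p * exp (- T / 2))"
  proof (subst exp_le_cancel_iff)
    have i1: "q * exp (\<sigma> * (1 + a)) \<le> sqrt (p * q)"
    proof -
      have "q * exp T' \<le> q * exp t" using T' pq by (intro mult_left_mono) auto
      then show ?thesis unfolding \<sigma> q_exp_t .
    qed
    have s1: "T' * (1 - 2 * a) \<le> \<sigma> * (1 - a)"
    proof -
      have "(1 - 2 * a) * (1 + a) \<le> 1 - a" using a by (simp add: algebra_simps)
      then have "\<sigma> * ((1 - 2 * a) * (1 + a)) \<le> \<sigma> * (1 - a)" using \<sigma> by (intro mult_left_mono)
      moreover have "\<sigma> * ((1 - 2 * a) * (1 + a)) = T' * (1 - 2 * a)" unfolding \<sigma>(3)[symmetric] by (simp add: mult_ac)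
      ultimately show ?thesis by linarith
    qed
    have i2: "exp (- (\<sigma> * (1 - a))) \<le> exp (- t) + 2 * a + exp (- T / 2)"
    proof (cases "t \<le> T")
      case True
      then have "T' = t" by (simp add: T'_def)
      then have "exp (- (\<sigma> * (1 - a))) \<le> exp (- t + 2 * a * t)" using s1 by (simp add: algebra_simps)
      also have "\<dots> = exp (- t) + exp (- t + 2 * a * t) * (1 - exp (- (2 * a * t)))"
        by (simp add: algebra_simps exp_add[symmetric])
      also have "\<dots> \<le> exp (- t) + exp (- t + 2 * a * t) * (2 * a * t)"
        using exp_ge_add_one_self[of "- (2 * a * t)"] by (intro add_left_mono mult_left_mono) auto
      also have "exp (- t + 2 * a * t) * (2 * a * t) \<le> exp (- t / 2) * (2 * a * t)"
      proof (rule mult_right_mono)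
        have "2 * a * t \<le> 2 * (1 / 4) * t" using a t_pos by (intro mult_right_mono) auto
        then show "exp (- t + 2 * a * t) \<le> exp (- t / 2)" by simp
      qed (use a t_pos in auto)
      also have "\<dots> = 2 * a * (t * exp (- t / 2))" by simp
      also have "\<dots> \<le> 2 * a * 1" using a mult_exp_minus_half_le by (intro mult_left_mono) auto
      finally show ?thesis by (simp add: add_increasing2)
    next
      case False
      then have "T' = T" by (simp add: T'_def)
      moreover have "T * (1 / 2) \<le> T * (1 - 2 * a)" using a T by (intro mult_left_mono) auto
      ultimately have "exp (- (\<sigma> * (1 - a))) \<le> exp (- T / 2)" using s1 by simp
      moreover have "0 \<le> exp (- t) + 2 * a" using a by simp
      ultimately show ?thesis by linarith
    qed
    have i3: "p * exp (- (\<sigma> * (1 - a))) \<le> sqrt (p * q) + 2 * a * p + p * exp (- T / 2)"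
      using mult_left_mono[OF i2, of p] p_exp_minus_t pq by (simp add: distrib_left mult_ac)
    have pos: "0 \<le> 2 * a * p + p * exp (- T / 2)" using a pq by simp
    have j1: "ns i * (p * exp (- (\<sigma> * (1 - a)))) \<le> ns i * sqrt (p * q) + m * (2 * a * p + p * exp (- T / 2))"
    proof -
      have "ns i * (p * exp (- (\<sigma> * (1 - a)))) \<le> ns i * (sqrt (p * q) + (2 * a * p + p * exp (- T / 2)))"
        using i3 by (intro mult_left_mono) auto
      moreover have "ns i * (2 * a * p + p * exp (- T / 2)) \<le> m * (2 * a * p + p * exp (- T / 2))"
        using ns_no[of i] pos by (intro mult_right_mono) auto
      ultimately show ?thesis by (simp only: distrib_left)
    qed
    have j2: "no i * (q * exp (\<sigma> * (1 + a))) \<le> no i * sqrt (p * q)" using i1 by (intro mult_left_mono) auto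
    have j3: "ns i * p + no i * q \<ge> m * (p + q) / 2 - p * \<Delta>"
    proof -
      have h: "no i - ns i \<le> \<Delta>" "(p - q) / 2 \<le> p" "0 \<le> (p - q) / 2" using im pq by (linarith, simp_all)
      have "(no i - ns i) * ((p - q) / 2) \<le> \<Delta> * p" by (rule mult_mono[OF h(1,2) \<Delta> h(3)])
      moreover have "ns i * p + no i * q = (ns i + no i) * (p + q) / 2 - (no i - ns i) * ((p - q) / 2)"
        by (simp add: field_simps)
      ultimately show ?thesis unfolding ns_no by (simp add: mult.commute)
    qed
    have j4: "\<sigma> * \<tau> \<le> T * \<tau>" using \<sigma> \<tau>0 by (intro mult_right_mono)
    have j5: "m * (p + q) / 2 - m * sqrt (p * q) = R" unfolding R_def del_square by (simp add: algebra_simps)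
    have j6: "ns i * sqrt (p * q) + no i * sqrt (p * q) = m * sqrt (p * q)"
      unfolding ns_no[of i, symmetric] by (simp only: distrib_right)
    have e1: "ns i * (p * (exp (- (\<sigma> * (1 - a))) - 1)) = ns i * (p * exp (- (\<sigma> * (1 - a)))) - ns i * p"
      "no i * (q * (exp (\<sigma> * (1 + a)) - 1)) = no i * (q * exp (\<sigma> * (1 + a))) - no i * q"
      by (simp_all only: right_diff_distrib mult_1_right)
    have e2: "m * (2 * a * p + p * exp (- T / 2)) = 2 * a * m * p + m * p * exp (- T / 2)" by (simp add: algebra_simps)
    show "ns i * (p * (exp (- (\<sigma> * (1 - a))) - 1)) + no i * (q * (exp (\<sigma> * (1 + a)) - 1)) + 1 + \<sigma> * \<tau>
      \<le> - R + 1 + p * \<Delta> + T * (b + p * \<Delta>) + 2 * a * m * p + m * p * exp (- T / 2)"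
      using j1 j2 j3 j4 j5 j6 unfolding e1 e2 \<tau>_def by linarith
  qed
  finally show ?thesis .
qed

end

context two_communities
begin

section \<open>Pairs of exceptional vertices\<close>

text \<open>
  The edges in \<open>P\<close> will be those that put \<open>i\<close> and \<open>k\<close> at distance one or two, with \<open>X\<close> their end
  points. Once the at most three vertices of \<open>X\<close> are removed, the stars of \<open>i\<close> and \<open>k\<close> and the
  edges in \<open>P\<close> are disjoint, and the product of exponential moments factorises; removing \<open>X\<close>
  changes each dual variable by at most two.
\<close>

lemma prob_two_bad:
  assumes ik: "i \<in> X" "k \<in> X" "i \<noteq> k" and X: "X \<subseteq> V" "card X \<le> 3"
    and P: "P \<subseteq> {e. \<exists>a\<in>X. \<exists>b\<in>X. a \<noteq> b \<and> e = {a, b}}" and fP: "finite P"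
    and si: "0 \<le> si" "si \<le> T" and sk: "0 \<le> sk" "sk \<le> T"
  shows "measure_pmf.prob G {f. (\<forall>e\<in>P. f e) \<and> D f i \<le> \<tau> \<and> D f k \<le> \<tau>}
    \<le> p ^ card P * exp (6 + 4 * T + crude_exponent i si \<tau> + crude_exponent k sk \<tau>)"
proof -
  have Pe: "\<exists>a\<in>X. \<exists>b\<in>X. a \<noteq> b \<and> e = {a, b}" if "e \<in> P" for e
    using subsetD[OF P that] by simp
  have fX: "finite X" by (rule finite_subset[OF X(1) finite_V])
  have iV: "i \<in> V" and kV: "k \<in> V" using ik X by auto
  define star where "star = (\<lambda>a. (\<lambda>j. {a, j}) ` (V - X))"
  define J where "J = P \<union> (star i \<union> star k)"
  define w where "w = (\<lambda>e. (if e \<in> star i then - si else - sk) * (\<Prod>v\<in>e. x v))"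
  (* One factor per edge: the indicator of presence on \<open>P\<close>, an exponential tilt on the two stars. *)
  define g where "g = (\<lambda>e b. if e \<in> P then of_bool b else exp (w e * of_bool b))"
  have disj1: "P \<inter> (star i \<union> star k) = {}"
  proof -
    have "e \<notin> star i \<union> star k" if e: "e \<in> P" for e
    proof -
      from Pe[OF e] obtain a b where ab: "a \<in> X" "b \<in> X" "e = {a, b}" by (elim bexE conjE)
      have "{a, b} \<noteq> {c, j}" if "j \<notin> X" for c j using that ab by (metis insertCI insertE singletonD)
      then show ?thesis unfolding ab(3) star_def by auto
    qed
    then show ?thesis by auto
  qed
  have disj2: "star i \<inter> star k = {}"
    using ik by (auto simp: star_def doubleton_eq_iff)
  have inj: "inj_on (\<lambda>j. {a, j}) (V - X)" for a by (auto simp: inj_on_def doubleton_eq_iff)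
  have fin: "finite J" "finite (star i)" "finite (star k)" using fP by (auto simp: J_def star_def)
  have PI: "e \<in> I" "pe e \<le> p" "0 \<le> pe e" if e: "e \<in> P" for e
  proof -
    from Pe[OF e] obtain a b where ab: "a \<in> X" "b \<in> X" "a \<noteq> b" "e = {a, b}" by (elim bexE conjE)
    then have abV: "a \<in> V" "b \<in> V" using X(1) by blast+
    show "e \<in> I" using pairs_I[OF abV ab(3)] by (simp add: ab(4))
    then show "0 \<le> pe e" using pe01 by auto
    show "pe e \<le> p" unfolding ab(4) pe_mean[OF abV ab(3)] by (rule mean_bounds)
  qed
  have starI: "star a \<subseteq> I" if a: "a \<in> X" for a
  proof
    fix e assume "e \<in> star a"
    then obtain j where j: "e = {a, j}" "j \<in> V - X" by (auto simp only: star_def)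
    have "a \<in> V" "j \<in> V" "a \<noteq> j" using a j X(1) by blast+
    then show "e \<in> I" unfolding j(1) by (rule pairs_I)
  qed
  have JI: "J \<subseteq> I" using PI(1) starI[OF ik(1)] starI[OF ik(2)] unfolding J_def by blast
  have wi: "w {i, j} = - si * (x i * x j)" if "j \<in> V - X" for j
  proof -
    have "i \<noteq> j" "{i, j} \<in> star i" using that ik by (auto simp: star_def)
    then show ?thesis by (simp add: w_def)
  qed
  have wk: "w {k, j} = - sk * (x k * x j)" if "j \<in> V - X" for j
  proof -
    have "{k, j} \<notin> star i" using that disj2 by (auto simp: star_def)
    moreover have "k \<noteq> j" using that ik by auto
    ultimately show ?thesis by (simp add: w_def)
  qed
  have lowD: "(\<Sum>j\<in>V - X. x a * x j * adj f a j) \<le> \<tau> + 2 + lam * (ns a - no a)"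
    if a: "a \<in> X" and D: "D f a \<le> \<tau>" for f a
  proof -
    have aV: "a \<in> V" using a X by auto
    have un: "V - {a} = (V - X) \<union> (X - {a})" using a X by auto
    have "(\<Sum>j\<in>V - {a}. x a * x j * adj f a j) = (\<Sum>j\<in>V - X. x a * x j * adj f a j) + (\<Sum>j\<in>X - {a}. x a * x j * adj f a j)"
      unfolding un by (rule sum.union_disjoint) (use fX in auto)
    moreover have "(\<Sum>j\<in>X - {a}. x a * x j * adj f a j) \<ge> (\<Sum>j\<in>X - {a}. - 1)"
    proof (rule sum_mono)
      fix j show "- 1 \<le> x a * x j * adj f a j" using adj_01[of f a j] by (auto simp: x_def)
    qed
    moreover have "card (X - {a}) \<le> 2" using a X fX by (simp add: card_Diff_singleton)
    then have "(\<Sum>j\<in>X - {a}. - 1) \<ge> (- 2 :: real)" by simp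
    ultimately show ?thesis using D D_eq[OF aV, of f] by linarith
  qed
  define K where "K = exp (si * (\<tau> + 2 + lam * (ns i - no i)) + sk * (\<tau> + 2 + lam * (ns k - no k)))"
  have prodg: "(\<Prod>e\<in>J. g e (f e)) = (\<Prod>e\<in>P. of_bool (f e)) *
      exp (- si * (\<Sum>j\<in>V - X. x i * x j * adj f i j) - sk * (\<Sum>j\<in>V - X. x k * x j * adj f k j))" for f
  proof -
    have sg: "(\<Prod>e\<in>star a. g e (f e)) = exp (- s * (\<Sum>j\<in>V - X. x a * x j * adj f a j))"
      if a: "a \<in> X" "star a \<inter> P = {}" and w: "\<And>j. j \<in> V - X \<Longrightarrow> w {a, j} = - s * (x a * x j)" for a s
    proof -
      have "(\<Prod>e\<in>star a. g e (f e)) = (\<Prod>j\<in>V - X. g {a, j} (f {a, j}))"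
        unfolding star_def by (rule prod.reindex[OF inj, unfolded o_def])
      also have "\<dots> = (\<Prod>j\<in>V - X. exp (- s * (x a * x j * adj f a j)))"
      proof (intro prod.cong refl)
        fix j assume j: "j \<in> V - X"
        then have "{a, j} \<notin> P" "a \<noteq> j" using a by (auto simp: star_def)
        then show "g {a, j} (f {a, j}) = exp (- s * (x a * x j * adj f a j))"
          by (simp add: g_def w[OF j] adj_def)
      qed
      also have "\<dots> = exp (- s * (\<Sum>j\<in>V - X. x a * x j * adj f a j))"
        by (simp add: exp_sum[symmetric] sum_distrib_left)
      finally show ?thesis .
    qed
    have "(\<Prod>e\<in>J. g e (f e)) = (\<Prod>e\<in>P. g e (f e)) * ((\<Prod>e\<in>star i. g e (f e)) * (\<Prod>e\<in>star k. g e (f e)))"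
      unfolding J_def using fP fin disj1 disj2 by (subst prod.union_disjoint) (auto simp: prod.union_disjoint)
    moreover have "(\<Prod>e\<in>P. g e (f e)) = (\<Prod>e\<in>P. of_bool (f e))" by (intro prod.cong refl) (simp add: g_def)
    moreover have "(\<Prod>e\<in>star i. g e (f e)) = exp (- si * (\<Sum>j\<in>V - X. x i * x j * adj f i j))"
      by (rule sg) (use ik disj1 wi in auto)
    moreover have "(\<Prod>e\<in>star k. g e (f e)) = exp (- sk * (\<Sum>j\<in>V - X. x k * x j * adj f k j))"
      by (rule sg) (use ik disj1 wk in auto)
    ultimately show ?thesis by (simp add: exp_add[symmetric])
  qed
  have "measure_pmf.prob G {f. (\<forall>e\<in>P. f e) \<and> D f i \<le> \<tau> \<and> D f k \<le> \<tau>}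
    \<le> measure_pmf.expectation G (\<lambda>f. K * (\<Prod>e\<in>J. g e (f e)))"
  proof (rule prob_le_expectation[OF finite_set_bernoulli_product[OF finite_I]])
    fix f show "0 \<le> K * (\<Prod>e\<in>J. g e (f e))" by (simp add: K_def prodg prod_nonneg)
    assume f: "(\<forall>e\<in>P. f e) \<and> D f i \<le> \<tau> \<and> D f k \<le> \<tau>"
    have "si * (\<Sum>j\<in>V - X. x i * x j * adj f i j) \<le> si * (\<tau> + 2 + lam * (ns i - no i))"
      using lowD[OF ik(1)] f si by (intro mult_left_mono) auto
    moreover have "sk * (\<Sum>j\<in>V - X. x k * x j * adj f k j) \<le> sk * (\<tau> + 2 + lam * (ns k - no k))"
      using lowD[OF ik(2)] f sk by (intro mult_left_mono) auto
    ultimately have "1 \<le> exp ((si * (\<tau> + 2 + lam * (ns i - no i)) + sk * (\<tau> + 2 + lam * (ns k - no k)))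
       + (- si * (\<Sum>j\<in>V - X. x i * x j * adj f i j) - sk * (\<Sum>j\<in>V - X. x k * x j * adj f k j)))"
      unfolding one_le_exp_iff by linarith
    also have "\<dots> = K * (\<Prod>e\<in>J. g e (f e))"
      unfolding prodg exp_add K_def using f by simp
    finally show "1 \<le> K * (\<Prod>e\<in>J. g e (f e))" .
  qed
  also have "\<dots> = K * (\<Prod>e\<in>J. g e True * pe e + g e False * (1 - pe e))"
    using expectation_prod_bernoulli[OF finite_I pe01 fin(1), where \<phi> = "\<lambda>e. e" and g = g] JI
    by (simp add: g_def)
  also have "(\<Prod>e\<in>J. g e True * pe e + g e False * (1 - pe e))
     \<le> p ^ card P * exp (ns i * (p * (exp (- si) - 1)) + no i * (q * (exp si - 1)) + 3
        + (ns k * (p * (exp (- sk) - 1)) + no k * (q * (exp sk - 1)) + 3))"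
  proof -
    let ?h = "\<lambda>e. g e True * pe e + g e False * (1 - pe e)"
    have hP: "(\<Prod>e\<in>P. ?h e) \<le> p ^ card P"
    proof -
      have "(\<Prod>e\<in>P. ?h e) \<le> (\<Prod>e\<in>P. p)" using PI by (intro prod_mono) (auto simp: g_def)
      then show ?thesis by simp
    qed
    have hS: "(\<Prod>e\<in>star a. ?h e) \<le> exp (ns a * (p * (exp (- s) - 1)) + no a * (q * (exp s - 1)) + 3)"
      if a: "a \<in> X" "star a \<inter> P = {}" and w: "\<And>j. j \<in> V - X \<Longrightarrow> w {a, j} = - s * (x a * x j)" and s: "0 \<le> s" for a s
    proof -
      have aV: "a \<in> V" using a X by auto
      have "(\<Prod>e\<in>star a. ?h e) = (\<Prod>j\<in>V - X. ?h {a, j})"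
        unfolding star_def by (rule prod.reindex[OF inj, unfolded o_def])
      also have "\<dots> \<le> (\<Prod>j\<in>V - X. exp (mean_adj R1 R2 p q a j * (exp (if j \<in> own a then - s else s) - 1)))"
      proof (intro prod_mono conjI)
        fix j assume j: "j \<in> V - X"
        then have ne: "{a, j} \<notin> P" "a \<noteq> j" "j \<in> V" using a by (auto simp: star_def)
        have pe: "pe {a, j} = mean_adj R1 R2 p q a j" using ne aV by (intro pe_mean) auto
        have c: "w {a, j} = (if j \<in> own a then - s else s)" unfolding w[OF j] x_mult[OF aV ne(3)] by simp
        have p0: "0 \<le> pe {a, j}" "pe {a, j} \<le> 1" using mean_bounds[of a j] pq unfolding pe by auto
        show "0 \<le> ?h {a, j}" using p0 ne by (simp add: g_def)
        show "?h {a, j} \<le> exp (mean_adj R1 R2 p q a j * (exp (if j \<in> own a then - s else s) - 1))"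
          using one_plus_le_exp_mult[OF p0(1), of "exp (w {a, j})"] ne unfolding c pe by (simp add: g_def c pe)
      qed
      also have "\<dots> = exp (\<Sum>j\<in>V - X. mean_adj R1 R2 p q a j * (exp (if j \<in> own a then - s else s) - 1))"
        by (simp add: exp_sum)
      also have "\<dots> \<le> exp (ns a * (p * (exp (- s) - 1)) + no a * (q * (exp s - 1)) + 3)"
        using star_moment_le[OF aV a(1) fX s s] X by simp
      finally show ?thesis .
    qed
    have h0: "0 \<le> ?h e" if "e \<in> J" for e
      using that JI pe01[of e] by (auto simp: g_def)
    have "(\<Prod>e\<in>J. ?h e) = (\<Prod>e\<in>P. ?h e) * ((\<Prod>e\<in>star i. ?h e) * (\<Prod>e\<in>star k. ?h e))"
      unfolding J_def using fP fin disj1 disj2 by (subst prod.union_disjoint) (auto simp: prod.union_disjoint)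
    also have "\<dots> \<le> p ^ card P * (exp (ns i * (p * (exp (- si) - 1)) + no i * (q * (exp si - 1)) + 3)
        * exp (ns k * (p * (exp (- sk) - 1)) + no k * (q * (exp sk - 1)) + 3))"
    proof (intro mult_mono hP)
      show "(\<Prod>e\<in>star i. ?h e) \<le> exp (ns i * (p * (exp (- si) - 1)) + no i * (q * (exp si - 1)) + 3)"
        by (rule hS) (use ik disj1 wi si in auto)
      show "(\<Prod>e\<in>star k. ?h e) \<le> exp (ns k * (p * (exp (- sk) - 1)) + no k * (q * (exp sk - 1)) + 3)"
        by (rule hS) (use ik disj1 wk sk in auto)
    qed (use pq h0 in \<open>auto intro!: prod_nonneg mult_nonneg_nonneg simp: J_def\<close>)
    finally show ?thesis by (simp add: exp_add[symmetric])
  qed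
  also have "K * (p ^ card P * exp (ns i * (p * (exp (- si) - 1)) + no i * (q * (exp si - 1)) + 3
        + (ns k * (p * (exp (- sk) - 1)) + no k * (q * (exp sk - 1)) + 3)))
      = p ^ card P * exp (6 + 2 * si + 2 * sk + crude_exponent i si \<tau> + crude_exponent k sk \<tau>)"
    unfolding K_def crude_exponent_def by (simp add: exp_add[symmetric] algebra_simps)
  also have "\<dots> \<le> p ^ card P * exp (6 + 4 * T + crude_exponent i si \<tau> + crude_exponent k sk \<tau>)"
    using si sk pq by (intro mult_left_mono) auto
  finally show ?thesis by (simp add: K_def)
qed

section \<open>Inner products of rows\<close>

text \<open>
  Given row \<open>i\<close>, the entries of row \<open>k\<close> are independent of it, so the inner product is a
  weighted sum of centred Bernoulli variables whose weights are bounded by one and, for bounded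
  degree of \<open>i\<close>, have a square sum of order \<open>m * p\<close>. The probability space is split accordingly
  into the edges at \<open>k\<close> and the rest.
\<close>

lemma prob_row_product:
  assumes i: "i \<in> V" and k: "k \<in> V" and ik: "i \<noteq> k" and \<theta>: "0 \<le> \<theta>" "\<theta> \<le> 1" and \<sigma>: "\<bar>\<sigma>\<bar> = 1"
  shows "measure_pmf.prob G {f. (\<Sum>j\<in>V. adj f i j) \<le> 8 * m * p \<and> g < \<sigma> * (\<Sum>j\<in>V. W f i j * W f k j)}
    \<le> exp (9 * \<theta>\<^sup>2 * m * p\<^sup>2 - \<theta> * g)"
proof -
  let ?U = "V - {i, k}"
  define Jk where "Jk = (\<lambda>j. {k, j}) ` ?U"
  define A where "A = I - Jk"
  have JkI: "Jk \<subseteq> I"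
  proof
    fix e assume "e \<in> Jk"
    then obtain j where "e = {k, j}" "j \<in> V" "k \<noteq> j" unfolding Jk_def by blast
    then show "e \<in> I" using pairs_I[OF k] by simp
  qed
  have I: "I = A \<union> Jk" "A \<inter> Jk = {}" "finite A" "finite Jk"
    using JkI finite_I finite_subset by (auto simp: A_def)
  define glue where "glue = (\<lambda>h f :: nat set \<Rightarrow> bool. \<lambda>e. if e \<in> A then h e else f e)"
  have G: "G = bind_pmf (bernoulli_product A pe) (\<lambda>h. map_pmf (glue h) (bernoulli_product Jk pe))"
    unfolding I(1) Pi_pmf_union[OF I(3,4,2)] pair_pmf_def glue_def
    by (simp add: map_bind_pmf bind_map_pmf map_pmf_def bind_assoc_pmf bind_return_pmf case_prod_beta)
  have adji: "adj (glue h f) i j = adj h i j" if "j \<in> ?U" for h f j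
  proof -
    have j: "j \<in> V" "i \<noteq> j" "j \<noteq> k" using that by auto
    have "{i, j} \<noteq> {k, j'}" if "j' \<noteq> i" for j' using ik j that by (simp add: doubleton_eq_iff)
    then have "{i, j} \<notin> Jk" unfolding Jk_def by blast
    then have "{i, j} \<in> A" using pairs_I[OF i j(1,2)] by (simp add: A_def)
    then show ?thesis by (simp add: adj_def glue_def)
  qed
  have adjk: "adj (glue h f) k j = of_bool (f {k, j})" if "j \<in> ?U" for h f j
  proof -
    have "{k, j} \<notin> A" using that by (auto simp: A_def Jk_def)
    then show ?thesis using that by (auto simp: adj_def glue_def)
  qed
  have inner: "(\<Sum>j\<in>V. W f i j * W f k j) = (\<Sum>j\<in>?U. W f i j * W f k j)" for f
    by (rule sum.mono_neutral_right) auto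
  have "measure_pmf.prob G {f. (\<Sum>j\<in>V. adj f i j) \<le> 8 * m * p \<and> g < \<sigma> * (\<Sum>j\<in>V. W f i j * W f k j)}
    \<le> measure_pmf.expectation (bernoulli_product A pe) (\<lambda>_. exp (9 * \<theta>\<^sup>2 * m * p\<^sup>2 - \<theta> * g))"
    unfolding G
  proof (rule prob_bind_le[OF finite_set_bernoulli_product[OF I(3)]])
    fix h
    define c where "c = (\<lambda>j. \<theta> * \<sigma> * W h i j)"
    let ?mean = "mean_adj R1 R2 p q k"
    let ?Q = "{f. (\<Sum>j\<in>V. adj f i j) \<le> 8 * m * p \<and> g < \<sigma> * (\<Sum>j\<in>V. W f i j * W f k j)}"
    have eq: "measure_pmf.prob (map_pmf (glue h) (bernoulli_product Jk pe)) ?Q = measure_pmf.prob (bernoulli_product Jk pe) {f. glue h f \<in> ?Q}"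
      by (simp add: vimage_def)
    show "measure_pmf.prob (map_pmf (glue h) (bernoulli_product Jk pe)) ?Q \<le> exp (9 * \<theta>\<^sup>2 * m * p\<^sup>2 - \<theta> * g)"
    proof (cases "(\<Sum>j\<in>?U. adj h i j) \<le> 8 * m * p")
      case False
      have "glue h f \<notin> ?Q" for f
      proof
        assume "glue h f \<in> ?Q"
        then have "(\<Sum>j\<in>V. adj (glue h f) i j) \<le> 8 * m * p" by simp
        moreover have "(\<Sum>j\<in>?U. adj (glue h f) i j) \<le> (\<Sum>j\<in>V. adj (glue h f) i j)"
          by (rule sum_mono2) (auto simp: adj_bounds)
        moreover have "(\<Sum>j\<in>?U. adj (glue h f) i j) = (\<Sum>j\<in>?U. adj h i j)"
          by (intro sum.cong refl adji)
        ultimately show False using False by linarith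
      qed
      then have "{f. glue h f \<in> ?Q} = {}" by blast
      then show ?thesis unfolding eq by (simp only: measure_empty exp_ge_zero)
    next
      case True
      define mu where "mu = (\<Sum>j\<in>?U. ?mean j * c j)"
      have inj: "inj_on (\<lambda>j. {k, j}) ?U" by (auto simp: inj_on_def doubleton_eq_iff)
      have pe01': "0 \<le> pe e \<and> pe e \<le> 1" if "e \<in> Jk" for e using that JkI pe01 by auto
      have "measure_pmf.prob (bernoulli_product Jk pe) {f. glue h f \<in> ?Q}
        \<le> measure_pmf.prob (bernoulli_product Jk pe) {f. \<theta> * g + mu \<le> (\<Sum>j\<in>?U. c j * of_bool (f {k, j}))}"
      proof (rule prob_mono)
        fix f assume "glue h f \<in> ?Q"
        then have "g \<le> \<sigma> * (\<Sum>j\<in>?U. W (glue h f) i j * W (glue h f) k j)" by (simp add: inner)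
        then have "\<theta> * g \<le> \<theta> * (\<sigma> * (\<Sum>j\<in>?U. W (glue h f) i j * W (glue h f) k j))" using \<theta> by (intro mult_left_mono)
        also have "\<dots> = (\<Sum>j\<in>?U. c j * of_bool (f {k, j})) - mu"
          unfolding mu_def sum_distrib_left sum_subtractf[symmetric]
          by (intro sum.cong refl) (simp add: W_def adji adjk c_def algebra_simps)
        finally show "\<theta> * g + mu \<le> (\<Sum>j\<in>?U. c j * of_bool (f {k, j}))" by simp
      qed
      also have "\<dots> \<le> exp ((\<Sum>j\<in>?U. pe {k, j} * (exp (c j) - 1)) - (\<theta> * g + mu))"
        by (rule chernoff_bernoulli[OF I(4) pe01' _ inj]) (auto simp: Jk_def)
      also have "\<dots> \<le> exp (9 * \<theta>\<^sup>2 * m * p\<^sup>2 - \<theta> * g)"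
      proof (subst exp_le_cancel_iff)
        have "(\<Sum>j\<in>?U. pe {k, j} * (exp (c j) - 1)) - mu = (\<Sum>j\<in>?U. ?mean j * (exp (c j) - 1 - c j))"
          unfolding mu_def sum_subtractf[symmetric]
        proof (intro sum.cong refl)
          fix j assume "j \<in> ?U"
          then have "pe {k, j} = ?mean j" using k by (intro pe_mean) auto
          then show "pe {k, j} * (exp (c j) - 1) - ?mean j * c j = ?mean j * (exp (c j) - 1 - c j)" by (simp add: algebra_simps)
        qed
        also have "\<dots> \<le> (\<Sum>j\<in>?U. p * (\<theta>\<^sup>2 * (adj h i j + p\<^sup>2)))"
        proof (rule sum_mono)
          fix j
          have "\<bar>c j\<bar> = \<theta> * \<bar>W h i j\<bar>" using \<theta> \<sigma> by (simp add: c_def abs_mult)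
          also have "\<dots> \<le> 1 * 1" using \<theta> abs_W_le by (intro mult_mono) auto
          finally have "exp (c j) - 1 - c j \<le> (c j)\<^sup>2" using exp_minus_linear_le by simp
          also have "(c j)\<^sup>2 = \<theta>\<^sup>2 * (W h i j)\<^sup>2"
          proof -
            have "\<sigma>\<^sup>2 = 1" using \<sigma> by (metis power2_abs power_one)
            then show ?thesis by (simp add: c_def power_mult_distrib)
          qed
          also have "\<dots> \<le> \<theta>\<^sup>2 * (adj h i j + p\<^sup>2)" by (intro mult_left_mono W_square_le) auto
          finally have a: "exp (c j) - 1 - c j \<le> \<theta>\<^sup>2 * (adj h i j + p\<^sup>2)" .
          have "0 \<le> exp (c j) - 1 - c j" using exp_ge_add_one_self[of "c j"] by linarith
          with a show "?mean j * (exp (c j) - 1 - c j) \<le> p * (\<theta>\<^sup>2 * (adj h i j + p\<^sup>2))"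
            using mean_bounds pq by (intro mult_mono) auto
        qed
        also have "\<dots> = p * \<theta>\<^sup>2 * ((\<Sum>j\<in>?U. adj h i j) + real (card ?U) * p\<^sup>2)"
          by (simp add: sum.distrib sum_distrib_left[symmetric] mult.assoc)
        also have "\<dots> \<le> p * \<theta>\<^sup>2 * (8 * m * p + m * p)"
        proof (intro mult_left_mono add_mono True)
          have "real (card ?U) * p\<^sup>2 \<le> m * (p * 1)"
            unfolding power2_eq_square using pq by (intro mult_mono) (auto intro!: card_mono)
          then show "real (card ?U) * p\<^sup>2 \<le> m * p" by simp
        qed (use pq in auto)
        also have "\<dots> = 9 * \<theta>\<^sup>2 * m * p\<^sup>2" by (simp add: power2_eq_square)
        finally show "(\<Sum>j\<in>?U. pe {k, j} * (exp (c j) - 1)) - (\<theta> * g + mu) \<le> 9 * \<theta>\<^sup>2 * m * p\<^sup>2 - \<theta> * g" by linarith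
      qed
      finally show ?thesis unfolding eq .
    qed
  qed simp
  then show ?thesis by simp
qed

end

context two_communities
begin

section \<open>From the exceptional set to positivity\<close>

text \<open>
  Polarisation: the bound for the quadratic form is applied to the sum and the difference of the
  two vectors.
\<close>

lemma bilinear_le:
  assumes norm: "\<And>u. \<bar>\<Sum>i\<in>V. \<Sum>j\<in>V. W f i j * u i * u j\<bar> \<le> nu * (\<Sum>i\<in>V. (u i)\<^sup>2)"
  shows "\<bar>\<Sum>i\<in>V. \<Sum>j\<in>V. W f i j * a i * b j\<bar> \<le> nu / 2 * ((\<Sum>i\<in>V. (a i)\<^sup>2) + (\<Sum>i\<in>V. (b i)\<^sup>2))"
proof -
  define Q where "Q = (\<lambda>u. \<Sum>i\<in>V. \<Sum>j\<in>V. W f i j * u i * u j)"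
  define Bi where "Bi = (\<Sum>i\<in>V. \<Sum>j\<in>V. W f i j * a i * b j)"
  have sw: "(\<Sum>i\<in>V. \<Sum>j\<in>V. W f i j * b i * a j) = Bi"
    unfolding Bi_def by (subst sum.swap) (intro sum.cong refl, simp add: W_sym)
  have "Q (\<lambda>i. a i + b i) - Q (\<lambda>i. a i - b i) = (\<Sum>i\<in>V. \<Sum>j\<in>V. 2 * (W f i j * a i * b j) + 2 * (W f i j * b i * a j))"
    unfolding Q_def sum_subtractf[symmetric] by (intro sum.cong refl) (simp add: algebra_simps)
  also have "\<dots> = 2 * Bi + 2 * (\<Sum>i\<in>V. \<Sum>j\<in>V. W f i j * b i * a j)"
    unfolding Bi_def sum.distrib sum_distrib_left ..
  finally have pol: "4 * Bi = Q (\<lambda>i. a i + b i) - Q (\<lambda>i. a i - b i)" unfolding sw by simp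
  have "\<bar>Q (\<lambda>i. a i + b i)\<bar> + \<bar>Q (\<lambda>i. a i - b i)\<bar> \<le> nu * ((\<Sum>i\<in>V. (a i + b i)\<^sup>2) + (\<Sum>i\<in>V. (a i - b i)\<^sup>2))"
    using norm[of "\<lambda>i. a i + b i"] norm[of "\<lambda>i. a i - b i"] unfolding Q_def by (simp add: distrib_left)
  also have "(\<Sum>i\<in>V. (a i + b i)\<^sup>2) + (\<Sum>i\<in>V. (a i - b i)\<^sup>2) = 2 * ((\<Sum>i\<in>V. (a i)\<^sup>2) + (\<Sum>i\<in>V. (b i)\<^sup>2))"
    unfolding sum.distrib[symmetric] sum_distrib_left by (intro sum.cong refl) (simp add: power2_eq_square algebra_simps)
  finally have "\<bar>Q (\<lambda>i. a i + b i)\<bar> + \<bar>Q (\<lambda>i. a i - b i)\<bar> \<le> nu * (2 * ((\<Sum>i\<in>V. (a i)\<^sup>2) + (\<Sum>i\<in>V. (b i)\<^sup>2)))" .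
  moreover have "4 * \<bar>Bi\<bar> \<le> \<bar>Q (\<lambda>i. a i + b i)\<bar> + \<bar>Q (\<lambda>i. a i - b i)\<bar>" using pol by linarith
  ultimately show ?thesis unfolding Bi_def[symmetric] by (simp add: field_simps)
qed

text \<open>The bilinear form is tested against a constant vector on \<open>Y\<close>, scaled to the norm of \<open>u\<close>.\<close>

lemma row_sum_le:
  assumes norm: "\<And>u. \<bar>\<Sum>i\<in>V. \<Sum>j\<in>V. W f i j * u i * u j\<bar> \<le> nu * (\<Sum>i\<in>V. (u i)\<^sup>2)"
    and S: "S \<subseteq> V" and Y: "Y \<subseteq> V" and nu: "0 \<le> nu" and m: "0 < m"
  shows "(\<Sum>i\<in>S. u i * (\<Sum>j\<in>Y. W f i j))\<^sup>2 \<le> nu\<^sup>2 * m * (\<Sum>i\<in>S. (u i)\<^sup>2)"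
proof -
  define z where "z = (\<Sum>i\<in>S. u i * (\<Sum>j\<in>Y. W f i j))"
  define N where "N = (\<Sum>i\<in>S. (u i)\<^sup>2)"
  have N0: "0 \<le> N" by (simp add: N_def sum_nonneg)
  have fS: "finite S" using S finite_subset[OF S finite_V] by simp
  have eq: "(\<Sum>i\<in>V. \<Sum>j\<in>V. W f i j * (if i \<in> S then u i else 0) * (if j \<in> Y then s else 0)) = s * z" for s
  proof -
    have "(\<Sum>i\<in>V. \<Sum>j\<in>V. W f i j * (if i \<in> S then u i else 0) * (if j \<in> Y then s else 0))
      = (\<Sum>i\<in>V. if i \<in> S then s * (u i * (\<Sum>j\<in>Y. W f i j)) else 0)"
    proof (intro sum.cong refl)
      fix i
      have "(\<Sum>j\<in>V. W f i j * (if i \<in> S then u i else 0) * (if j \<in> Y then s else 0))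
        = (\<Sum>j\<in>V. if j \<in> Y then W f i j * (if i \<in> S then u i else 0) * s else 0)"
        by (intro sum.cong refl) auto
      also have "\<dots> = (\<Sum>j\<in>Y. W f i j * (if i \<in> S then u i else 0) * s)"
        using Y by (simp add: sum.inter_restrict[symmetric] Int_absorb1)
      also have "\<dots> = (if i \<in> S then s * (u i * (\<Sum>j\<in>Y. W f i j)) else 0)"
        by (simp add: sum_distrib_left mult_ac)
      finally show "(\<Sum>j\<in>V. W f i j * (if i \<in> S then u i else 0) * (if j \<in> Y then s else 0))
        = (if i \<in> S then s * (u i * (\<Sum>j\<in>Y. W f i j)) else 0)" .
    qed
    also have "\<dots> = (\<Sum>i\<in>S. s * (u i * (\<Sum>j\<in>Y. W f i j)))"
      using S by (simp add: sum.inter_restrict[symmetric] Int_absorb1)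
    finally show ?thesis by (simp add: z_def sum_distrib_left)
  qed
  have N_eq: "(\<Sum>i\<in>V. (if i \<in> S then u i else 0)\<^sup>2) = N"
  proof -
    have "(\<Sum>i\<in>V. (if i \<in> S then u i else 0)\<^sup>2) = (\<Sum>i\<in>V. if i \<in> S then (u i)\<^sup>2 else 0)"
      by (intro sum.cong refl) auto
    then show ?thesis using S by (simp add: sum.inter_restrict[symmetric] Int_absorb1 N_def)
  qed
  have Y_le: "(\<Sum>j\<in>V. (if j \<in> Y then s else 0)\<^sup>2) \<le> m * s\<^sup>2" for s :: real
  proof -
    have "(\<Sum>j\<in>V. (if j \<in> Y then s else 0)\<^sup>2) \<le> (\<Sum>j\<in>V. s\<^sup>2)" by (intro sum_mono) auto
    then show ?thesis by simp
  qed
  have key: "\<bar>s * z\<bar> \<le> nu / 2 * (N + m * s\<^sup>2)" for s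
  proof -
    have "\<bar>s * z\<bar> \<le> nu / 2 * (N + (\<Sum>j\<in>V. (if j \<in> Y then s else 0)\<^sup>2))"
      using bilinear_le[where f = f and nu = nu, OF norm, of "\<lambda>i. if i \<in> S then u i else 0" "\<lambda>j. if j \<in> Y then s else 0"] unfolding eq N_eq .
    also have "\<dots> \<le> nu / 2 * (N + m * s\<^sup>2)" using Y_le nu by (intro mult_left_mono add_left_mono) auto
    finally show ?thesis .
  qed
  show ?thesis
  proof (cases "N = 0")
    case True
    then have "u i = 0" if "i \<in> S" for i using that fS unfolding N_def by (simp add: sum_nonneg_eq_0_iff)
    then have "z = 0" by (simp add: z_def)
    then show ?thesis using True by (simp add: z_def[symmetric] N_def[symmetric])
  next
    case False
    then have Np: "0 < N" using N0 by simp
    define s where "s = sqrt (N / m)"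
    have s: "0 < s" "s\<^sup>2 = N / m" using Np m by (auto simp: s_def)
    have "a * (N / a) = N" if "0 < a" for a using that by simp
    from this[OF m] have "m * s\<^sup>2 = N" by (simp only: s(2))
    then have "\<bar>s * z\<bar> \<le> nu / 2 * (N + N)" using key[of s] by simp
    also have "nu / 2 * (N + N) = nu * N" by simp
    finally have "s * \<bar>z\<bar> \<le> nu * N" using s by (simp add: abs_mult)
    then have "(s * \<bar>z\<bar>)\<^sup>2 \<le> (nu * N)\<^sup>2" using s by (intro power_mono) auto
    then have "N / m * z\<^sup>2 \<le> nu\<^sup>2 * N * N" by (simp add: power_mult_distrib s power2_eq_square[of N])
    then have "N * z\<^sup>2 \<le> N * (nu\<^sup>2 * m * N)" using m by (simp add: field_simps)
    then show ?thesis using Np unfolding z_def[symmetric] N_def[symmetric] by (simp only: mult_le_cancel_left_pos)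
  qed
qed

text \<open>
  If distinct rows are almost orthogonal, then the square norm of a combination of few rows is
  governed by the square norms of the rows, and these are about the degrees.
\<close>

lemma gram_le:
  assumes B: "B \<subseteq> V" and g: "\<And>i k. i \<in> B \<Longrightarrow> k \<in> B \<Longrightarrow> i \<noteq> k \<Longrightarrow> \<bar>\<Sum>j\<in>V. W f i j * W f k j\<bar> \<le> g" and g0: "0 \<le> g"
  shows "(\<Sum>j\<in>V. (\<Sum>i\<in>B. W f i j * u i)\<^sup>2) \<le> (\<Sum>i\<in>B. ((\<Sum>j\<in>V. (W f i j)\<^sup>2) + real (card B) * g) * (u i)\<^sup>2)"
proof -
  have fB: "finite B" using finite_subset[OF B finite_V] .
  define Ga where "Ga = (\<lambda>i k. \<Sum>j\<in>V. W f i j * W f k j)"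
  have "(\<Sum>j\<in>V. (\<Sum>i\<in>B. W f i j * u i)\<^sup>2) = (\<Sum>j\<in>V. \<Sum>i\<in>B. \<Sum>k\<in>B. (W f i j * W f k j) * (u i * u k))"
    unfolding power2_eq_square sum_product by (intro sum.cong refl) (simp add: mult_ac)
  also have "\<dots> = (\<Sum>i\<in>B. \<Sum>k\<in>B. \<Sum>j\<in>V. (W f i j * W f k j) * (u i * u k))"
    by (subst sum.swap) (intro sum.cong refl sum.swap)
  also have "\<dots> = (\<Sum>i\<in>B. \<Sum>k\<in>B. Ga i k * (u i * u k))"
    by (simp only: Ga_def sum_distrib_right)
  also have "\<dots> \<le> (\<Sum>i\<in>B. \<Sum>k\<in>B. (if k = i then Ga i i * (u i)\<^sup>2 else 0) + (g / 2 * (u i)\<^sup>2 + g / 2 * (u k)\<^sup>2))"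
  proof (intro sum_mono)
    fix i k assume ik: "i \<in> B" "k \<in> B"
    show "Ga i k * (u i * u k) \<le> (if k = i then Ga i i * (u i)\<^sup>2 else 0) + (g / 2 * (u i)\<^sup>2 + g / 2 * (u k)\<^sup>2)"
    proof (cases "k = i")
      case True
      then show ?thesis using g0 by (simp add: power2_eq_square)
    next
      case False
      have "Ga i k * (u i * u k) \<le> \<bar>Ga i k\<bar> * \<bar>u i * u k\<bar>" by (metis abs_ge_self abs_mult)
      also have "\<dots> \<le> g * (((u i)\<^sup>2 + (u k)\<^sup>2) / 2)"
      proof (rule mult_mono)
        show "\<bar>Ga i k\<bar> \<le> g" unfolding Ga_def using g ik False by blast
        have "0 \<le> (u i - u k)\<^sup>2" "0 \<le> (u i + u k)\<^sup>2" by simp_all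
        then show "\<bar>u i * u k\<bar> \<le> ((u i)\<^sup>2 + (u k)\<^sup>2) / 2" by (simp add: abs_le_iff power2_eq_square algebra_simps)
      qed (use g0 in auto)
      finally show ?thesis using False by (simp add: field_simps)
    qed
  qed
  also have "\<dots> = (\<Sum>i\<in>B. Ga i i * (u i)\<^sup>2) + real (card B) * g * (\<Sum>i\<in>B. (u i)\<^sup>2)"
  proof -
    have "(\<Sum>i\<in>B. \<Sum>k\<in>B. if k = i then Ga i i * (u i)\<^sup>2 else 0) = (\<Sum>i\<in>B. Ga i i * (u i)\<^sup>2)"
      using fB by (intro sum.cong refl) simp
    moreover have "(\<Sum>i\<in>B. \<Sum>k\<in>B. g / 2 * (u k)\<^sup>2) = real (card B) * g / 2 * (\<Sum>i\<in>B. (u i)\<^sup>2)"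
      by (simp only: sum_distrib_left[symmetric] sum_constant) simp
    moreover have "(\<Sum>i\<in>B. \<Sum>k\<in>B. g / 2 * (u i)\<^sup>2) = (\<Sum>i\<in>B. \<Sum>k\<in>B. g / 2 * (u k)\<^sup>2)"
      by (rule sum.swap)
    ultimately show ?thesis unfolding sum.distrib by (simp add: field_simps)
  qed
  also have "\<dots> = (\<Sum>i\<in>B. ((\<Sum>j\<in>V. (W f i j)\<^sup>2) + real (card B) * g) * (u i)\<^sup>2)"
  proof -
    have a: "Ga i i = (\<Sum>j\<in>V. (W f i j)\<^sup>2)" for i by (simp add: Ga_def power2_eq_square)
    have b: "(\<Sum>i\<in>B. real (card B) * g * (u i)\<^sup>2) = real (card B) * g * (\<Sum>i\<in>B. (u i)\<^sup>2)"
      by (simp only: sum_distrib_left)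
    show ?thesis by (simp only: a distrib_right sum.distrib b)
  qed
  finally show ?thesis .
qed

lemma bad_block_le:
  assumes B: "B \<subseteq> V" and h: "\<And>i k. i \<in> B \<Longrightarrow> k \<in> B \<Longrightarrow> i \<noteq> k \<Longrightarrow> \<bar>W f i k\<bar> \<le> h" and h0: "0 \<le> h"
  shows "(\<Sum>i\<in>B. \<Sum>k\<in>B. W f i k * u i * u k) \<le> (\<Sum>i\<in>B. real (card B) * h * (u i)\<^sup>2)"
proof -
  have "(\<Sum>i\<in>B. \<Sum>k\<in>B. W f i k * u i * u k) \<le> (\<Sum>i\<in>B. \<Sum>k\<in>B. h / 2 * (u i)\<^sup>2 + h / 2 * (u k)\<^sup>2)"
  proof (intro sum_mono)
    fix i k assume ik: "i \<in> B" "k \<in> B"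
    have W: "\<bar>W f i k\<bar> \<le> h" using h[OF ik] h0 by (cases "i = k") auto
    have "W f i k * u i * u k = W f i k * (u i * u k)" by simp
    also have "\<dots> \<le> \<bar>W f i k\<bar> * \<bar>u i * u k\<bar>" by (metis abs_ge_self abs_mult)
    also have "\<dots> \<le> h * (((u i)\<^sup>2 + (u k)\<^sup>2) / 2)"
    proof (rule mult_mono[OF W])
      have "0 \<le> (u i - u k)\<^sup>2" "0 \<le> (u i + u k)\<^sup>2" by simp_all
      then show "\<bar>u i * u k\<bar> \<le> ((u i)\<^sup>2 + (u k)\<^sup>2) / 2" by (simp add: abs_le_iff power2_eq_square algebra_simps)
    qed (use h0 in auto)
    finally show "W f i k * u i * u k \<le> h / 2 * (u i)\<^sup>2 + h / 2 * (u k)\<^sup>2" by (simp add: field_simps)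
  qed
  also have "\<dots> = (\<Sum>i\<in>B. real (card B) * h * (u i)\<^sup>2)"
  proof -
    have a: "(\<Sum>i\<in>B. \<Sum>k\<in>B. h / 2 * (u k)\<^sup>2) = real (card B) * h / 2 * (\<Sum>i\<in>B. (u i)\<^sup>2)"
      by (simp only: sum_distrib_left[symmetric] sum_constant) simp
    have b: "(\<Sum>i\<in>B. \<Sum>k\<in>B. h / 2 * (u i)\<^sup>2) = (\<Sum>i\<in>B. \<Sum>k\<in>B. h / 2 * (u k)\<^sup>2)"
      by (rule sum.swap)
    have c: "(\<Sum>i\<in>B. real (card B) * h * (u i)\<^sup>2) = real (card B) * h * (\<Sum>i\<in>B. (u i)\<^sup>2)"
      by (simp only: sum_distrib_left)
    show ?thesis unfolding sum.distrib b a c by simp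
  qed
  finally show ?thesis .
qed

text \<open>The positivity that makes \<open>x x\<^sup>T\<close> the only solution.\<close>

definition sdp_good :: "(nat set \<Rightarrow> bool) \<Rightarrow> bool" where
  "sdp_good f \<longleftrightarrow> (\<forall>y :: nat \<Rightarrow> real. (\<exists>i\<in>V. \<exists>j\<in>V. y i \<noteq> y j) \<longrightarrow> signed_laplacian V (adj f) lam x y > 0)"

text \<open>
  Since \<open>u\<close> sums to zero on both communities, the entries may be shifted by any constant \<open>z\<close>.
  Both the centred entries (\<open>z = q\<close>) and the plain ones (\<open>z = 0\<close>) will be used.
\<close>

lemma coupling_sum:
  fixes Z :: "nat \<Rightarrow> nat \<Rightarrow> real"
  assumes symZ: "\<And>i j. Z i j = Z j i" and Z: "\<And>i j. i \<in> R1 \<Longrightarrow> j \<in> R2 \<Longrightarrow> Z i j = adj f i j - z"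
    and u1: "(\<Sum>i\<in>R1. u i) = 0" and u2: "(\<Sum>i\<in>R2. u i) = 0"
  shows "(\<Sum>i\<in>R1. \<Sum>j\<in>R2. (lam - adj f i j) * (u i - u j)) = (\<Sum>i\<in>V. (- x i * (\<Sum>j\<in>other i. Z i j)) * u i)"
proof -
  have c1: "(\<Sum>i\<in>R1. (- x i * (\<Sum>j\<in>other i. Z i j)) * u i) = - (\<Sum>i\<in>R1. \<Sum>j\<in>R2. Z i j * u i)"
    unfolding sum_negf[symmetric] by (intro sum.cong refl) (simp add: x_def other_def sum_distrib_right sum_negf)
  have "(\<Sum>i\<in>R2. (- x i * (\<Sum>j\<in>other i. Z i j)) * u i) = (\<Sum>i\<in>R2. \<Sum>j\<in>R1. Z i j * u i)"
    using disjoint_R by (intro sum.cong refl) (auto simp: x_def other_def sum_distrib_right)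
  also have "\<dots> = (\<Sum>i\<in>R1. \<Sum>j\<in>R2. Z i j * u j)"
    by (subst sum.swap) (intro sum.cong refl, simp add: symZ)
  finally have c2: "(\<Sum>i\<in>R2. (- x i * (\<Sum>j\<in>other i. Z i j)) * u i) = (\<Sum>i\<in>R1. \<Sum>j\<in>R2. Z i j * u j)" .
  have zero: "(\<Sum>i\<in>R1. \<Sum>j\<in>R2. (lam - z) * (u i - u j)) = 0"
  proof -
    have "(\<Sum>i\<in>R1. \<Sum>j\<in>R2. (lam - z) * (u i - u j)) = (lam - z) * (\<Sum>i\<in>R1. \<Sum>j\<in>R2. u i - u j)"
      by (simp only: sum_distrib_left)
    also have "(\<Sum>i\<in>R1. \<Sum>j\<in>R2. u i - u j) = 0"
      by (simp add: sum_subtractf u2 sum_distrib_left[symmetric] u1)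
    finally show ?thesis by simp
  qed
  have "(\<Sum>i\<in>R1. \<Sum>j\<in>R2. (lam - adj f i j) * (u i - u j))
    = (\<Sum>i\<in>R1. \<Sum>j\<in>R2. (lam - z) * (u i - u j) - Z i j * u i + Z i j * u j)"
    by (intro sum.cong refl) (simp add: Z algebra_simps)
  also have "\<dots> = - (\<Sum>i\<in>R1. \<Sum>j\<in>R2. Z i j * u i) + (\<Sum>i\<in>R1. \<Sum>j\<in>R2. Z i j * u j)"
    using zero by (simp add: sum.distrib sum_subtractf)
  finally show ?thesis using c1 c2 disjoint_R by (simp add: sum.union_disjoint)
qed

lemma split_by_community:
  fixes h :: "nat \<Rightarrow> real"
  assumes "S \<subseteq> V"
  shows "(\<Sum>i\<in>S. h i) = (\<Sum>i\<in>S \<inter> R1. h i) + (\<Sum>i\<in>S \<inter> R2. h i)"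
proof -
  have "S = (S \<inter> R1) \<union> (S \<inter> R2)" using assms by auto
  then show ?thesis
    using sum.union_disjoint[of "S \<inter> R1" "S \<inter> R2" h] disjoint_R by fastforce
qed

lemma square_add_le: "(a + b)\<^sup>2 \<le> 2 * a\<^sup>2 + 2 * (b::real)\<^sup>2"
  using zero_le_power2[of "a - b"] by (simp add: power2_eq_square algebra_simps)

text \<open>
  The form of the criterion for comparable \<open>p\<close> and \<open>q\<close>. The coupling coefficients are row sums
  of \<open>W\<close>; away from \<open>B\<close> they are controlled by the operator norm and on \<open>B\<close> by the almost
  orthogonality of the rows.
\<close>

lemma sdp_good_centred:
  assumes norm: "\<And>u. \<bar>\<Sum>i\<in>V. \<Sum>j\<in>V. W f i j * u i * u j\<bar> \<le> nu * (\<Sum>i\<in>V. (u i)\<^sup>2)"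
    and nu: "0 \<le> nu" "nu \<le> Th / 8" "2 * nu\<^sup>2 * m \<le> k1 * Th / 16" and Th: "0 < Th" and k1: "0 < k1"
    and cut: "k1 \<le> (\<Sum>i\<in>R1. \<Sum>j\<in>R2. lam - adj f i j)"
    and B: "B \<subseteq> V" and good: "\<And>i. i \<in> V - B \<Longrightarrow> Th \<le> D f i"
    and g: "\<And>i k. i \<in> B \<Longrightarrow> k \<in> B \<Longrightarrow> i \<noteq> k \<Longrightarrow> \<bar>\<Sum>j\<in>V. W f i j * W f k j\<bar> \<le> g" "0 \<le> g"
    and h: "\<And>i k. i \<in> B \<Longrightarrow> k \<in> B \<Longrightarrow> i \<noteq> k \<Longrightarrow> \<bar>W f i k\<bar> \<le> h" "0 \<le> h"
    and bad: "\<And>i. i \<in> B \<Longrightarrow> (4 / Th + 8 * m / k1) * ((\<Sum>j\<in>V. (W f i j)\<^sup>2) + real (card B) * g) + real (card B) * h < D f i"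
  shows "sdp_good f"
  unfolding sdp_good_def
proof (intro allI impI)
  fix y :: "nat \<Rightarrow> real" assume y: "\<exists>i\<in>V. \<exists>j\<in>V. y i \<noteq> y j"
  have fB: "finite B" using finite_subset[OF B finite_V] .
  have m: "0 < m" using y by (auto simp: card_gt_0_iff)
  define c where "c = (\<lambda>i. - x i * (\<Sum>j\<in>other i. W f i j))"
  show "0 < signed_laplacian V (adj f) lam x y"
  proof (rule signed_laplacian_pos[OF finite_R disjoint_R, of "adj f" x "W f" p q Th k1 lam B c y])
    show "adj f i j = adj f j i" for i j by (rule adj_sym)
    show "x = (\<lambda>i. if i \<in> R1 then 1 else - 1)" by (rule x_def)
    show "W f = (\<lambda>i j. adj f i j - mean_adj R1 R2 p q i j)" by (rule W_def)
    show "0 \<le> p" using pq by simp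
    show "\<bar>\<Sum>i\<in>V. \<Sum>j\<in>V. W f i j * u i * u j\<bar> \<le> Th / 8 * (\<Sum>i\<in>V. (u i)\<^sup>2)" for u
      using norm[of u] mult_right_mono[OF nu(2), of "\<Sum>i\<in>V. (u i)\<^sup>2"] by (simp add: sum_nonneg)
    show "(\<Sum>i\<in>R1. \<Sum>j\<in>R2. (lam - adj f i j) * (u i - u j)) = (\<Sum>i\<in>V. c i * u i)"
      if "(\<Sum>i\<in>R1. u i) = 0" "(\<Sum>i\<in>R2. u i) = 0" for u
      unfolding c_def by (rule coupling_sum[where z = q, OF W_sym _ that]) (use disjoint_R in \<open>auto simp: W_def mean_adj_def\<close>)
    show "(\<Sum>i\<in>V - B. c i * u i)\<^sup>2 \<le> k1 * Th / 16 * (\<Sum>i\<in>V - B. (u i)\<^sup>2)" for u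
    proof -
      define S1 S2 where "S1 = (V - B) \<inter> R1" and "S2 = (V - B) \<inter> R2"
      have a1: "(\<Sum>i\<in>S1. c i * u i) = (\<Sum>i\<in>S1. (- u i) * (\<Sum>j\<in>R2. W f i j))"
        by (intro sum.cong refl) (auto simp: S1_def c_def x_def other_def)
      have a2: "(\<Sum>i\<in>S2. c i * u i) = (\<Sum>i\<in>S2. u i * (\<Sum>j\<in>R1. W f i j))"
        by (intro sum.cong refl) (use disjoint_R in \<open>auto simp: S2_def c_def x_def other_def\<close>)
      have b1: "(\<Sum>i\<in>S1. c i * u i)\<^sup>2 \<le> nu\<^sup>2 * m * (\<Sum>i\<in>S1. (u i)\<^sup>2)"
        unfolding a1 using row_sum_le[where f = f, OF norm _ _ nu(1) m, of S1 R2 "\<lambda>i. - u i"] by (auto simp: S1_def)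
      have b2: "(\<Sum>i\<in>S2. c i * u i)\<^sup>2 \<le> nu\<^sup>2 * m * (\<Sum>i\<in>S2. (u i)\<^sup>2)"
        unfolding a2 using row_sum_le[where f = f, OF norm _ _ nu(1) m, of S2 R1 u] by (auto simp: S2_def)
      have "(\<Sum>i\<in>V - B. c i * u i) = (\<Sum>i\<in>S1. c i * u i) + (\<Sum>i\<in>S2. c i * u i)"
        "(\<Sum>i\<in>V - B. (u i)\<^sup>2) = (\<Sum>i\<in>S1. (u i)\<^sup>2) + (\<Sum>i\<in>S2. (u i)\<^sup>2)"
        unfolding S1_def S2_def by (rule split_by_community, blast)+
      then have "(\<Sum>i\<in>V - B. c i * u i)\<^sup>2 \<le> 2 * nu\<^sup>2 * m * (\<Sum>i\<in>V - B. (u i)\<^sup>2)"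
        using square_add_le[of "\<Sum>i\<in>S1. c i * u i" "\<Sum>i\<in>S2. c i * u i"] b1 b2 by (simp add: distrib_left)
      also have "\<dots> \<le> k1 * Th / 16 * (\<Sum>i\<in>V - B. (u i)\<^sup>2)"
        using nu(3) by (intro mult_right_mono) (auto intro: sum_nonneg)
      finally show ?thesis .
    qed
    show "4 / Th * (\<Sum>j\<in>V. (\<Sum>i\<in>B. W f i j * u i)\<^sup>2) + (\<Sum>i\<in>B. \<Sum>j\<in>B. W f i j * u i * u j) + 4 / k1 * (\<Sum>i\<in>B. c i * x i * u i)\<^sup>2
      < (\<Sum>i\<in>B. D f i * (u i)\<^sup>2)" if u: "\<exists>i\<in>B. u i \<noteq> 0" for u
    proof -
      define Gm where "Gm = (\<lambda>i. (\<Sum>j\<in>V. (W f i j)\<^sup>2) + real (card B) * g)"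
      have gram: "(\<Sum>j\<in>V. (\<Sum>i\<in>B. W f i j * u i)\<^sup>2) \<le> (\<Sum>i\<in>B. Gm i * (u i)\<^sup>2)"
        unfolding Gm_def by (rule gram_le[OF B g])
      have gramS: "(\<Sum>j\<in>V. (\<Sum>i\<in>S. W f i j * u i)\<^sup>2) \<le> (\<Sum>i\<in>S. Gm i * (u i)\<^sup>2)" if S: "S \<subseteq> B" for S
      proof -
        have "(\<Sum>j\<in>V. (\<Sum>i\<in>S. W f i j * u i)\<^sup>2) \<le> (\<Sum>i\<in>S. ((\<Sum>j\<in>V. (W f i j)\<^sup>2) + real (card S) * g) * (u i)\<^sup>2)"
        proof (rule gram_le)
          show "S \<subseteq> V" using S B by (rule subset_trans)
          show "\<bar>\<Sum>j\<in>V. W f i j * W f k j\<bar> \<le> g" if "i \<in> S" "k \<in> S" "i \<noteq> k" for i k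
            using subsetD[OF S that(1)] subsetD[OF S that(2)] that(3) by (rule g(1))
          show "0 \<le> g" by (rule g(2))
        qed
        also have "\<dots> \<le> (\<Sum>i\<in>S. Gm i * (u i)\<^sup>2)"
          unfolding Gm_def using S fB g(2) by (intro sum_mono mult_right_mono add_left_mono) (auto intro: card_mono)
        finally show ?thesis .
      qed
      have half: "(\<Sum>i\<in>S. c i * x i * u i)\<^sup>2 \<le> m * (\<Sum>i\<in>S. Gm i * (u i)\<^sup>2)"
        if S: "S \<subseteq> B" and Y: "Y \<subseteq> V" and o: "\<And>i. i \<in> S \<Longrightarrow> other i = Y" for S Y
      proof -
        have "(\<Sum>i\<in>S. c i * x i * u i) = (\<Sum>i\<in>S. \<Sum>j\<in>Y. - (W f i j * u i))"
        proof (intro sum.cong refl)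
          fix i assume "i \<in> S"
          have "c i * x i * u i = - (x i * x i) * (\<Sum>j\<in>other i. W f i j) * u i" by (simp only: c_def mult_ac mult_minus_left mult_minus_right)
          then show "c i * x i * u i = (\<Sum>j\<in>Y. - (W f i j * u i))" using o[OF \<open>i \<in> S\<close>] by (simp add: sum_negf sum_distrib_right)
        qed
        also have "\<dots> = - (\<Sum>j\<in>Y. 1 * (\<Sum>i\<in>S. W f i j * u i))"
          by (subst sum.swap) (simp add: sum_negf)
        finally have "(\<Sum>i\<in>S. c i * x i * u i)\<^sup>2 = (\<Sum>j\<in>Y. 1 * (\<Sum>i\<in>S. W f i j * u i))\<^sup>2" by simp
        also have "\<dots> \<le> (\<Sum>j\<in>Y. 1\<^sup>2) * (\<Sum>j\<in>Y. (\<Sum>i\<in>S. W f i j * u i)\<^sup>2)" by (rule Cauchy_Schwarz_ineq_sum)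
        also have "\<dots> \<le> m * (\<Sum>j\<in>V. (\<Sum>i\<in>S. W f i j * u i)\<^sup>2)"
          using Y by (intro mult_mono sum_mono2) (auto intro!: card_mono sum_nonneg)
        also have "\<dots> \<le> m * (\<Sum>i\<in>S. Gm i * (u i)\<^sup>2)" using gramS[OF S] by (intro mult_left_mono) auto
        finally show ?thesis .
      qed
      have coup: "(\<Sum>i\<in>B. c i * x i * u i)\<^sup>2 \<le> 2 * m * (\<Sum>i\<in>B. Gm i * (u i)\<^sup>2)"
      proof -
        have "(\<Sum>i\<in>B \<inter> R1. c i * x i * u i)\<^sup>2 \<le> m * (\<Sum>i\<in>B \<inter> R1. Gm i * (u i)\<^sup>2)"
          by (rule half[of _ R2]) (auto simp: other_def)
        moreover have "(\<Sum>i\<in>B \<inter> R2. c i * x i * u i)\<^sup>2 \<le> m * (\<Sum>i\<in>B \<inter> R2. Gm i * (u i)\<^sup>2)"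
          by (rule half[of _ R1]) (use disjoint_R in \<open>auto simp: other_def\<close>)
        moreover have "(\<Sum>i\<in>B. c i * x i * u i) = (\<Sum>i\<in>B \<inter> R1. c i * x i * u i) + (\<Sum>i\<in>B \<inter> R2. c i * x i * u i)"
          "(\<Sum>i\<in>B. Gm i * (u i)\<^sup>2) = (\<Sum>i\<in>B \<inter> R1. Gm i * (u i)\<^sup>2) + (\<Sum>i\<in>B \<inter> R2. Gm i * (u i)\<^sup>2)"
          by (rule split_by_community[OF B])+
        ultimately show ?thesis
          using square_add_le[of "\<Sum>i\<in>B \<inter> R1. c i * x i * u i" "\<Sum>i\<in>B \<inter> R2. c i * x i * u i"] by (simp add: distrib_left)
      qed
      have "4 / Th * (\<Sum>j\<in>V. (\<Sum>i\<in>B. W f i j * u i)\<^sup>2) + (\<Sum>i\<in>B. \<Sum>j\<in>B. W f i j * u i * u j) + 4 / k1 * (\<Sum>i\<in>B. c i * x i * u i)\<^sup>2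
        \<le> 4 / Th * (\<Sum>i\<in>B. Gm i * (u i)\<^sup>2) + (\<Sum>i\<in>B. real (card B) * h * (u i)\<^sup>2) + 4 / k1 * (2 * m * (\<Sum>i\<in>B. Gm i * (u i)\<^sup>2))"
        using Th k1 by (intro add_mono mult_left_mono gram coup bad_block_le[OF B h]) auto
      also have "\<dots> = (\<Sum>i\<in>B. ((4 / Th + 8 * m / k1) * Gm i + real (card B) * h) * (u i)\<^sup>2)"
        unfolding sum_distrib_left sum.distrib[symmetric] by (intro sum.cong refl) (simp add: algebra_simps)
      also have "\<dots> < (\<Sum>i\<in>B. D f i * (u i)\<^sup>2)"
      proof (rule sum_strict_mono_ex1[OF fB])
        show "\<forall>i\<in>B. ((4 / Th + 8 * m / k1) * Gm i + real (card B) * h) * (u i)\<^sup>2 \<le> D f i * (u i)\<^sup>2"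
          using bad by (intro ballI mult_right_mono) (auto simp: Gm_def less_imp_le)
        obtain i where i: "i \<in> B" "u i \<noteq> 0" using u by blast
        then have "((4 / Th + 8 * m / k1) * Gm i + real (card B) * h) * (u i)\<^sup>2 < D f i * (u i)\<^sup>2"
          using bad[OF i(1)] by (intro mult_strict_right_mono) (auto simp: Gm_def)
        then show "\<exists>i\<in>B. ((4 / Th + 8 * m / k1) * Gm i + real (card B) * h) * (u i)\<^sup>2 < D f i * (u i)\<^sup>2" using i by blast
      qed
      finally show ?thesis .
    qed
  qed (use Th k1 cut B good y in auto)
qed

text \<open>
  The form of the criterion for \<open>q\<close> much smaller than \<open>p\<close>. The cut \<open>k1\<close> is then too small to
  absorb a coupling of the size of the operator norm. The coupling coefficients are instead the
  numbers of edges to the other community, each of them at most \<open>E\<close>, while their sum is bounded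
  by the cut condition itself.
\<close>

lemma sdp_good_raw:
  assumes norm: "\<And>u. \<bar>\<Sum>i\<in>V. \<Sum>j\<in>V. W f i j * u i * u j\<bar> \<le> Th / 8 * (\<Sum>i\<in>V. (u i)\<^sup>2)"
    and Th: "0 < Th" and k1: "0 < k1"
    and cut: "k1 \<le> (\<Sum>i\<in>R1. \<Sum>j\<in>R2. lam - adj f i j)"
    and od: "\<And>i. i \<in> V \<Longrightarrow> (\<Sum>j\<in>other i. adj f i j) \<le> E"
    and E: "0 \<le> E" "2 * E * lam * (real (card R1) * real (card R2)) \<le> k1 * Th / 16"
    and B: "B \<subseteq> V" and good: "\<And>i. i \<in> V - B \<Longrightarrow> Th \<le> D f i"
    and g: "\<And>i k. i \<in> B \<Longrightarrow> k \<in> B \<Longrightarrow> i \<noteq> k \<Longrightarrow> \<bar>\<Sum>j\<in>V. W f i j * W f k j\<bar> \<le> g" "0 \<le> g"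
    and h: "\<And>i k. i \<in> B \<Longrightarrow> k \<in> B \<Longrightarrow> i \<noteq> k \<Longrightarrow> \<bar>W f i k\<bar> \<le> h" "0 \<le> h"
    and bad: "\<And>i. i \<in> B \<Longrightarrow> 4 / Th * ((\<Sum>j\<in>V. (W f i j)\<^sup>2) + real (card B) * g) + real (card B) * h
        + 4 / k1 * (\<Sum>k\<in>B. \<Sum>j\<in>other k. adj f k j) * (\<Sum>j\<in>other i. adj f i j) < D f i"
  shows "sdp_good f"
  unfolding sdp_good_def
proof (intro allI impI)
  fix y :: "nat \<Rightarrow> real" assume y: "\<exists>i\<in>V. \<exists>j\<in>V. y i \<noteq> y j"
  have fB: "finite B" using finite_subset[OF B finite_V] .
  define e where "e = (\<lambda>i. \<Sum>j\<in>other i. adj f i j)"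
  define c where "c = (\<lambda>i. - x i * e i)"
  have e0: "0 \<le> e i" for i by (simp add: e_def sum_nonneg adj_bounds)
  have c2: "(c i)\<^sup>2 = e i * e i" for i by (simp add: c_def power2_eq_square x_def)
  have cx: "c i * x i = - e i" for i by (simp add: c_def x_def)
  have esum: "(\<Sum>i\<in>V. e i) \<le> 2 * lam * (real (card R1) * real (card R2))"
  proof -
    have "(\<Sum>i\<in>R2. e i) = (\<Sum>i\<in>R2. \<Sum>j\<in>R1. adj f i j)"
      using disjoint_R by (intro sum.cong refl) (auto simp: e_def other_def)
    also have "\<dots> = (\<Sum>i\<in>R1. \<Sum>j\<in>R2. adj f i j)"
      by (subst sum.swap) (intro sum.cong refl, simp add: adj_sym)
    finally have "(\<Sum>i\<in>R2. e i) = (\<Sum>i\<in>R1. \<Sum>j\<in>R2. adj f i j)" .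
    moreover have "(\<Sum>i\<in>R1. e i) = (\<Sum>i\<in>R1. \<Sum>j\<in>R2. adj f i j)" by (simp add: e_def other_def)
    moreover have "(\<Sum>i\<in>R1. \<Sum>j\<in>R2. adj f i j) \<le> lam * (real (card R1) * real (card R2))"
      using cut k1 by (simp add: sum_subtractf mult_ac)
    ultimately show ?thesis using disjoint_R by (simp add: sum.union_disjoint)
  qed
  show "0 < signed_laplacian V (adj f) lam x y"
  proof (rule signed_laplacian_pos[OF finite_R disjoint_R, of "adj f" x "W f" p q Th k1 lam B c y])
    show "adj f i j = adj f j i" for i j by (rule adj_sym)
    show "x = (\<lambda>i. if i \<in> R1 then 1 else - 1)" by (rule x_def)
    show "W f = (\<lambda>i j. adj f i j - mean_adj R1 R2 p q i j)" by (rule W_def)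
    show "0 \<le> p" using pq by simp
    show "(\<Sum>i\<in>R1. \<Sum>j\<in>R2. (lam - adj f i j) * (u i - u j)) = (\<Sum>i\<in>V. c i * u i)"
      if "(\<Sum>i\<in>R1. u i) = 0" "(\<Sum>i\<in>R2. u i) = 0" for u
      unfolding c_def e_def by (rule coupling_sum[where z = 0, OF adj_sym _ that]) simp
    show "(\<Sum>i\<in>V - B. c i * u i)\<^sup>2 \<le> k1 * Th / 16 * (\<Sum>i\<in>V - B. (u i)\<^sup>2)" for u
    proof -
      have "(\<Sum>i\<in>V - B. c i * u i)\<^sup>2 \<le> (\<Sum>i\<in>V - B. (c i)\<^sup>2) * (\<Sum>i\<in>V - B. (u i)\<^sup>2)"
        by (rule Cauchy_Schwarz_ineq_sum)
      also have "\<dots> \<le> k1 * Th / 16 * (\<Sum>i\<in>V - B. (u i)\<^sup>2)"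
      proof (rule mult_right_mono)
        have "(\<Sum>i\<in>V - B. (c i)\<^sup>2) \<le> (\<Sum>i\<in>V. E * e i)"
        proof (rule order_trans[OF sum_mono2])
          show "(\<Sum>i\<in>V. (c i)\<^sup>2) \<le> (\<Sum>i\<in>V. E * e i)"
            unfolding c2 using od e0 by (intro sum_mono mult_right_mono) (auto simp: e_def)
        qed auto
        also have "\<dots> = E * (\<Sum>i\<in>V. e i)" by (simp only: sum_distrib_left)
        also have "\<dots> \<le> E * (2 * lam * (real (card R1) * real (card R2)))" using E(1) esum by (intro mult_left_mono)
        also have "\<dots> \<le> k1 * Th / 16" using E(2) by (simp add: mult_ac)
        finally show "(\<Sum>i\<in>V - B. (c i)\<^sup>2) \<le> k1 * Th / 16" .
      qed (auto intro: sum_nonneg)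
      finally show ?thesis .
    qed
    show "4 / Th * (\<Sum>j\<in>V. (\<Sum>i\<in>B. W f i j * u i)\<^sup>2) + (\<Sum>i\<in>B. \<Sum>j\<in>B. W f i j * u i * u j) + 4 / k1 * (\<Sum>i\<in>B. c i * x i * u i)\<^sup>2
      < (\<Sum>i\<in>B. D f i * (u i)\<^sup>2)" if u: "\<exists>i\<in>B. u i \<noteq> 0" for u
    proof -
      define Gm where "Gm = (\<lambda>i. (\<Sum>j\<in>V. (W f i j)\<^sup>2) + real (card B) * g)"
      define S where "S = (\<Sum>k\<in>B. e k)"
      have gram: "(\<Sum>j\<in>V. (\<Sum>i\<in>B. W f i j * u i)\<^sup>2) \<le> (\<Sum>i\<in>B. Gm i * (u i)\<^sup>2)"
        unfolding Gm_def by (rule gram_le[OF B g])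
      have coup: "(\<Sum>i\<in>B. c i * x i * u i)\<^sup>2 \<le> S * (\<Sum>i\<in>B. e i * (u i)\<^sup>2)"
      proof -
        have "(\<Sum>i\<in>B. c i * x i * u i)\<^sup>2 = (\<Sum>i\<in>B. sqrt (e i) * (sqrt (e i) * u i))\<^sup>2"
          unfolding cx using e0 by (simp add: sum_negf mult.assoc[symmetric])
        also have "\<dots> \<le> (\<Sum>i\<in>B. (sqrt (e i))\<^sup>2) * (\<Sum>i\<in>B. (sqrt (e i) * u i)\<^sup>2)" by (rule Cauchy_Schwarz_ineq_sum)
        also have "\<dots> = S * (\<Sum>i\<in>B. e i * (u i)\<^sup>2)" using e0 by (simp add: S_def power_mult_distrib)
        finally show ?thesis .
      qed
      have "4 / Th * (\<Sum>j\<in>V. (\<Sum>i\<in>B. W f i j * u i)\<^sup>2) + (\<Sum>i\<in>B. \<Sum>j\<in>B. W f i j * u i * u j) + 4 / k1 * (\<Sum>i\<in>B. c i * x i * u i)\<^sup>2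
        \<le> 4 / Th * (\<Sum>i\<in>B. Gm i * (u i)\<^sup>2) + (\<Sum>i\<in>B. real (card B) * h * (u i)\<^sup>2) + 4 / k1 * (S * (\<Sum>i\<in>B. e i * (u i)\<^sup>2))"
        using Th k1 by (intro add_mono mult_left_mono gram coup bad_block_le[OF B h]) auto
      also have "\<dots> = (\<Sum>i\<in>B. (4 / Th * Gm i + real (card B) * h + 4 / k1 * S * e i) * (u i)\<^sup>2)"
        unfolding sum_distrib_left sum.distrib[symmetric] by (intro sum.cong refl) (simp add: algebra_simps)
      also have "\<dots> < (\<Sum>i\<in>B. D f i * (u i)\<^sup>2)"
      proof (rule sum_strict_mono_ex1[OF fB])
        have bad': "4 / Th * Gm i + real (card B) * h + 4 / k1 * S * e i < D f i" if "i \<in> B" for i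
          using bad[OF that] by (simp add: Gm_def S_def e_def)
        show "\<forall>i\<in>B. (4 / Th * Gm i + real (card B) * h + 4 / k1 * S * e i) * (u i)\<^sup>2 \<le> D f i * (u i)\<^sup>2"
          using bad' by (intro ballI mult_right_mono) (auto simp: less_imp_le)
        obtain i where i: "i \<in> B" "u i \<noteq> 0" using u by blast
        then have "(4 / Th * Gm i + real (card B) * h + 4 / k1 * S * e i) * (u i)\<^sup>2 < D f i * (u i)\<^sup>2"
          using bad'[OF i(1)] by (intro mult_strict_right_mono) auto
        then show "\<exists>i\<in>B. (4 / Th * Gm i + real (card B) * h + 4 / k1 * S * e i) * (u i)\<^sup>2 < D f i * (u i)\<^sup>2" using i by blast
      qed
      finally show ?thesis .
    qed
  qed (use Th k1 cut B good y norm in auto)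
qed

end

context two_communities
begin

section \<open>Success of the program outside the failure events\<close>

text \<open>The slack of \<open>crude_exponent_small\<close> at \<open>\<eta> = 1 / 32\<close>.\<close>

definition Th :: real where "Th = m * del * sqrt p / 65536"

lemma sqrt_p: "0 < sqrt p" "sqrt p * sqrt p = p" "sqrt p \<le> 1" and sqrt_q: "0 < sqrt q" "sqrt q * sqrt q = q" "sqrt q < sqrt p"
  using pq by auto

lemma Th_pos: "0 < m \<Longrightarrow> 0 < Th"
  using del_pos sqrt_p by (simp add: Th_def)

lemma product_lower:
  assumes "\<bar>real (card R1) - real (card R2)\<bar> \<le> m / 128"
  shows "m\<^sup>2 / 5 \<le> real (card R1) * real (card R2)"
proof -
  define a b where "a = real (card R1)" and "b = real (card R2)"
  have ab: "m = a + b" "0 \<le> a" "0 \<le> b" using m_split by (auto simp: a_def b_def)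
  have "(a - b)\<^sup>2 \<le> (m / 128)\<^sup>2" using assms unfolding a_def[symmetric] b_def[symmetric]
    by (metis abs_ge_zero power2_abs power_mono)
  also have "\<dots> \<le> m\<^sup>2 / 5" by (simp add: power_divide)
  finally have "(a + b)\<^sup>2 - 4 * (a * b) \<le> m\<^sup>2 / 5" by (simp add: power2_eq_square algebra_simps)
  then show ?thesis unfolding a_def[symmetric] b_def[symmetric] ab(1)[symmetric] by simp
qed

lemma product_upper: "real (card R1) * real (card R2) \<le> m\<^sup>2 / 4"
proof -
  define a b where "a = real (card R1)" and "b = real (card R2)"
  have ab: "m = a + b" using m_split by (auto simp: a_def b_def)
  have "0 \<le> (a - b)\<^sup>2" by simp
  then have "4 * (a * b) \<le> (a + b)\<^sup>2" by (simp add: power2_eq_square algebra_simps)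
  then show ?thesis unfolding a_def[symmetric] b_def[symmetric] ab(1) by simp
qed

lemma k1_lower_similar:
  assumes bal: "\<bar>real (card R1) - real (card R2)\<bar> \<le> m / 128" and \<kappa>: "1 \<le> \<kappa>" "sqrt p \<le> \<kappa> * sqrt q"
  shows "del * sqrt p * m\<^sup>2 / (20 * \<kappa>) \<le> k1"
proof -
  have "del * sqrt p / (4 * \<kappa>) \<le> del * sqrt q / 4"
    using \<kappa> del_pos by (simp add: field_simps)
  also have "\<dots> \<le> del\<^sup>2 / (4 * t)"
    using t_mult_le t_pos del_pos by (simp add: field_simps power2_eq_square)
  finally have "del * sqrt p / (4 * \<kappa>) \<le> del\<^sup>2 / (4 * t)" .
  then have "del * sqrt p / (4 * \<kappa>) * (m\<^sup>2 / 5) \<le> k1"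
    unfolding k1_def using product_lower[OF bal] del_pos t_pos by (intro mult_mono) auto
  then show ?thesis by simp
qed

lemma sum_W_square_le:
  assumes "(\<Sum>j\<in>V. adj f i j) \<le> d"
  shows "(\<Sum>j\<in>V. (W f i j)\<^sup>2) \<le> d + m * p\<^sup>2"
proof -
  have "(\<Sum>j\<in>V. (W f i j)\<^sup>2) \<le> (\<Sum>j\<in>V. adj f i j + p\<^sup>2)" by (intro sum_mono W_square_le)
  also have "\<dots> = (\<Sum>j\<in>V. adj f i j) + m * p\<^sup>2" by (simp add: sum.distrib)
  finally show ?thesis using assms by linarith
qed

lemma mp_square_le: "m * p\<^sup>2 \<le> m * p"
  using pq by (intro mult_left_mono) (auto simp: power2_eq_square mult_left_le)

lemma nu_square: "0 \<le> e2 \<Longrightarrow> (sqrt (e2 * m * p * R))\<^sup>2 = e2 * m\<^sup>2 * p * del\<^sup>2 / 2"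
  using pq R_nonneg by (simp add: R_def power2_eq_square)

lemma nu_le_Th:
  assumes "0 \<le> e2" "e2 \<le> 1 / (32 * 65536\<^sup>2)"
  shows "sqrt (e2 * m * p * R) \<le> Th / 8"
proof (rule power2_le_imp_le)
  have X: "0 \<le> m\<^sup>2 * p * del\<^sup>2" using pq by simp
  have "(sqrt (e2 * m * p * R))\<^sup>2 = e2 * (m\<^sup>2 * p * del\<^sup>2) / 2" unfolding nu_square[OF assms(1)] by simp
  also have "\<dots> \<le> 1 / (32 * 65536\<^sup>2) * (m\<^sup>2 * p * del\<^sup>2) / 2"
    using assms X by (intro divide_right_mono mult_right_mono) auto
  also have "\<dots> = (Th / 8)\<^sup>2"
    using sqrt_p by (simp add: Th_def power_mult_distrib power_divide)
  finally show "(sqrt (e2 * m * p * R))\<^sup>2 \<le> (Th / 8)\<^sup>2" .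
  show "0 \<le> Th / 8" using del_pos sqrt_p by (simp add: Th_def)
qed

text \<open>
  For bounded \<open>p / q\<close> the cut \<open>k1\<close> is of order \<open>m\<^sup>2 * del * sqrt p\<close> and the threshold \<open>Th\<close> of
  order \<open>m * del * sqrt p\<close>. Square norms of rows are of order \<open>m * p\<close>, so an exceptional vertex
  needs a dual variable of order \<open>sqrt p / del\<close> only.
\<close>

lemma sdp_good_similar:
  assumes bal: "\<bar>real (card R1) - real (card R2)\<bar> \<le> m / 128" and \<kappa>: "1 \<le> \<kappa>" "sqrt p \<le> \<kappa> * sqrt q"
    and e2: "0 < e2" "e2 \<le> 1 / (32 * 65536\<^sup>2)" "e2 \<le> 1 / (320 * 65536 * \<kappa>)" and m: "0 < m"
    and norm: "\<And>u. \<bar>\<Sum>i\<in>V. \<Sum>j\<in>V. W f i j * u i * u j\<bar> \<le> sqrt (e2 * m * p * R) * (\<Sum>i\<in>V. (u i)\<^sup>2)"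
    and cut: "k1 \<le> (\<Sum>i\<in>R1. \<Sum>j\<in>R2. lam - adj f i j)"
    and deg: "\<And>i. i \<in> B \<Longrightarrow> (\<Sum>j\<in>V. adj f i j) \<le> 8 * m * p"
    and B: "B \<subseteq> V" and good: "\<And>i. i \<in> V - B \<Longrightarrow> Th \<le> D f i"
    and g: "\<And>i k. i \<in> B \<Longrightarrow> k \<in> B \<Longrightarrow> i \<noteq> k \<Longrightarrow> \<bar>\<Sum>j\<in>V. W f i j * W f k j\<bar> \<le> g" "0 \<le> g" "real (card B) * g \<le> m * p"
    and h: "\<And>i k. i \<in> B \<Longrightarrow> k \<in> B \<Longrightarrow> i \<noteq> k \<Longrightarrow> \<bar>W f i k\<bar> \<le> h" "0 \<le> h" "real (card B) * h \<le> sqrt p / del"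
    and bad: "\<And>i. i \<in> B \<Longrightarrow> (40 * 65536 + 1600 * \<kappa> + 1) * (sqrt p / del) < D f i"
  shows "sdp_good f"
proof -
  define nu where "nu = sqrt (e2 * m * p * R)"
  define K where "K = del * sqrt p * m\<^sup>2 / (20 * \<kappa>)"
  have Kk: "K \<le> k1" unfolding K_def by (rule k1_lower_similar[OF bal \<kappa>])
  have K: "0 < K" unfolding K_def using del_pos sqrt_p(1) m \<kappa>
    by (intro divide_pos_pos mult_pos_pos zero_less_power) auto
  have k1: "0 < k1" using K Kk by linarith
  have Th: "0 < Th" by (rule Th_pos[OF m])
  show ?thesis
  proof (rule sdp_good_centred[where nu = nu and Th = Th and B = B and g = g and h = h])
    show "\<bar>\<Sum>i\<in>V. \<Sum>j\<in>V. W f i j * u i * u j\<bar> \<le> nu * (\<Sum>i\<in>V. (u i)\<^sup>2)" for u unfolding nu_def by (rule norm)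
    show "0 \<le> nu" using e2 pq R_nonneg by (simp add: nu_def)
    show "nu \<le> Th / 8" unfolding nu_def by (rule nu_le_Th) (use e2 in auto)
    show "2 * nu\<^sup>2 * m \<le> k1 * Th / 16"
    proof -
      have X: "0 \<le> m * m\<^sup>2 * p * del\<^sup>2" using pq by simp
      have "2 * nu\<^sup>2 * m = e2 * (m * m\<^sup>2 * p * del\<^sup>2)" unfolding nu_def nu_square[OF less_imp_le[OF e2(1)]] by simp
      also have "\<dots> \<le> 1 / (320 * 65536 * \<kappa>) * (m * m\<^sup>2 * p * del\<^sup>2)" using e2 X by (intro mult_right_mono) auto
      also have "\<dots> = K * Th / 16"
      proof -
        have "K * Th / 16 = 1 / (320 * 65536 * \<kappa>) * (m * m\<^sup>2 * (sqrt p * sqrt p) * del\<^sup>2)"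
          by (simp add: K_def Th_def power2_eq_square)
        then show ?thesis unfolding sqrt_p(2) by simp
      qed
      also have "\<dots> \<le> k1 * Th / 16" using Kk Th by (intro divide_right_mono mult_right_mono) auto
      finally show ?thesis .
    qed
    show "(4 / Th + 8 * m / k1) * ((\<Sum>j\<in>V. (W f i j)\<^sup>2) + real (card B) * g) + real (card B) * h < D f i" if i: "i \<in> B" for i
    proof -
      have sp: "(m * p) / (del * sqrt p * m) = sqrt p / del"
      proof -
        have "(m * p) / (del * sqrt p * m) = (m * (sqrt p * sqrt p)) / (del * sqrt p * m)" unfolding sqrt_p(2) ..
        also have "\<dots> = (sqrt p * m * sqrt p) / (sqrt p * m * del)" by (simp only: mult_ac)
        also have "\<dots> = sqrt p / del"
        proof (rule mult_divide_mult_cancel_left)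
          show "sqrt p * m \<noteq> 0" using mult_pos_pos[OF sqrt_p(1) m] by linarith
        qed
        finally show ?thesis .
      qed
      have S: "(\<Sum>j\<in>V. (W f i j)\<^sup>2) + real (card B) * g \<le> 10 * (m * p)"
        using sum_W_square_le[OF deg[OF i]] mp_square_le g(3) by linarith
      have a1: "4 / Th + 8 * m / k1 \<le> (4 * 65536 + 160 * \<kappa>) / (del * sqrt p * m)"
      proof -
        have "8 * m / k1 \<le> 8 * m / K" using Kk K k1 m by (intro divide_left_mono) auto
        also have "\<dots> = 160 * \<kappa> / (del * sqrt p * m)"
          using m by (simp add: K_def power2_eq_square)
        finally show ?thesis by (simp add: Th_def add_divide_distrib mult_ac)
      qed
      have "(4 / Th + 8 * m / k1) * ((\<Sum>j\<in>V. (W f i j)\<^sup>2) + real (card B) * g)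
        \<le> (4 * 65536 + 160 * \<kappa>) / (del * sqrt p * m) * (10 * (m * p))"
        using a1 S \<kappa> del_pos sqrt_p m g(2) by (intro mult_mono) (auto intro!: add_nonneg_nonneg sum_nonneg)
      also have "\<dots> = (4 * 65536 + 160 * \<kappa>) * 10 * ((m * p) / (del * sqrt p * m))" by simp
      also have "\<dots> = (40 * 65536 + 1600 * \<kappa>) * (sqrt p / del)" unfolding sp by simp
      finally have "(4 / Th + 8 * m / k1) * ((\<Sum>j\<in>V. (W f i j)\<^sup>2) + real (card B) * g) + real (card B) * h
        \<le> (40 * 65536 + 1600 * \<kappa>) * (sqrt p / del) + sqrt p / del" using h(3) by linarith
      also have "\<dots> = (40 * 65536 + 1600 * \<kappa> + 1) * (sqrt p / del)" by (simp only: distrib_right mult_1)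
      finally show ?thesis using bad[OF i] by linarith
    qed
  qed (use Th k1 cut B good g h in auto)
qed

text \<open>
  If \<open>q\<close> is much smaller than \<open>p\<close>, then \<open>del\<close> is of order \<open>sqrt p\<close>, and in the critical window
  \<open>m * p\<close> is only logarithmic in \<open>m\<close>.
\<close>

lemma far_facts:
  assumes "16 * q \<le> p"
  shows "sqrt p / 2 \<le> del" "m * p \<le> 8 * R" "lam \<le> p" "lam * (real (card R1) * real (card R2)) \<le> 8 * k1"
proof -
  have "sqrt (16 * q) \<le> sqrt p" using assms by simp
  moreover have "sqrt (16 * q) = 4 * sqrt q" by (simp add: real_sqrt_mult)
  ultimately have sq: "4 * sqrt q \<le> sqrt p" by linarith
  then show d: "sqrt p / 2 \<le> del" unfolding del_def using sqrt_p by linarith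
  have "(sqrt p / 2)\<^sup>2 \<le> del\<^sup>2" using d sqrt_p by (intro power_mono) auto
  then have d2: "p / 4 \<le> del\<^sup>2" using pq by (simp add: power_divide)
  have "m * (p / 4) \<le> m * del\<^sup>2" using d2 by (intro mult_left_mono) auto
  then show "m * p \<le> 8 * R" by (simp add: R_def)
  have "1 \<le> ln (p / q)"
  proof -
    have "exp 1 * q \<le> 3 * q" using exp_le pq by (intro mult_right_mono) auto
    then have "exp 1 * q \<le> p" using assms pq by linarith
    then have "exp 1 \<le> p / q" using pq by (simp add: le_divide_eq)
    then show ?thesis using pq by (simp add: ln_ge_iff)
  qed
  then have "lam \<le> (p - q) / 1" unfolding lam_def using pq by (intro divide_left_mono) auto
  then have "lam \<le> p - q" by simp
  then show "lam \<le> p" using pq by linarith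
  have "lam \<le> 8 * (del\<^sup>2 / (4 * t))"
  proof -
    have "lam * t \<le> 2 * del\<^sup>2" unfolding lam_t using d2 pq by simp
    then show ?thesis using t_pos by (simp add: field_simps)
  qed
  then have "lam * (real (card R1) * real (card R2)) \<le> 8 * (del\<^sup>2 / (4 * t)) * (real (card R1) * real (card R2))"
    by (intro mult_right_mono) auto
  then show "lam * (real (card R1) * real (card R2)) \<le> 8 * k1" unfolding k1_def by (simp only: mult.assoc)
qed

text \<open>
  Here \<open>Th\<close> is of order \<open>m * p\<close>, so an exceptional vertex of degree \<open>d\<close> needs a dual variable of
  order \<open>d / (m * p)\<close>. The assumption \<open>cross\<close> bounds the coupling by the same quantity.
\<close>

lemma sdp_good_far:
  assumes bal: "\<bar>real (card R1) - real (card R2)\<bar> \<le> m / 128" and far: "16 * q \<le> p"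
    and e2: "0 < e2" "e2 \<le> 1 / (32 * 65536\<^sup>2)" and m: "0 < m"
    and norm: "\<And>u. \<bar>\<Sum>i\<in>V. \<Sum>j\<in>V. W f i j * u i * u j\<bar> \<le> sqrt (e2 * m * p * R) * (\<Sum>i\<in>V. (u i)\<^sup>2)"
    and cut: "k1 \<le> (\<Sum>i\<in>R1. \<Sum>j\<in>R2. lam - adj f i j)"
    and od: "\<And>i. i \<in> V \<Longrightarrow> (\<Sum>j\<in>other i. adj f i j) \<le> 1 / 33554432 * m * p"
    and B: "B \<subseteq> V" and good: "\<And>i. i \<in> V - B \<Longrightarrow> Th \<le> D f i"
    and g: "\<And>i k. i \<in> B \<Longrightarrow> k \<in> B \<Longrightarrow> i \<noteq> k \<Longrightarrow> \<bar>\<Sum>j\<in>V. W f i j * W f k j\<bar> \<le> g" "0 \<le> g"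
    and h: "\<And>i k. i \<in> B \<Longrightarrow> k \<in> B \<Longrightarrow> i \<noteq> k \<Longrightarrow> \<bar>W f i k\<bar> \<le> h" "0 \<le> h"
    and cross: "\<And>i. i \<in> B \<Longrightarrow> 20 * real (card B) * m * p * (\<Sum>j\<in>other i. adj f i j) \<le> lam * m * (\<Sum>j\<in>V. adj f i j) / p"
    and bad: "\<And>i. i \<in> B \<Longrightarrow> (8 * 65536 + 8) / (m * p) * (\<Sum>j\<in>V. adj f i j)
        + (8 * 65536 / (m * p) * (m * p\<^sup>2 + real (card B) * g) + real (card B) * h) < D f i"
  shows "sdp_good f"
proof -
  let ?M = "real (card R1) * real (card R2)"
  have mp: "0 < m * p" using m pq by simp
  have M: "m\<^sup>2 / 5 \<le> ?M" by (rule product_lower[OF bal])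
  have M0: "0 < ?M" using M m by (smt (verit) divide_pos_pos zero_less_power2)
  have lM: "lam * ?M \<le> 8 * k1" by (rule far_facts(4)[OF far])
  have k1: "0 < k1" using lM lam_pos M0 by (smt (verit) mult_pos_pos)
  have Th: "0 < Th" by (rule Th_pos[OF m])
  have Th_ge: "m * p / (2 * 65536) \<le> Th"
  proof -
    have "m * (sqrt p / 2 * sqrt p) \<le> m * (del * sqrt p)"
      using far_facts(1)[OF far] sqrt_p by (intro mult_left_mono mult_right_mono) auto
    then have "m * (sqrt p / 2 * sqrt p) / 65536 \<le> m * (del * sqrt p) / 65536" by (rule divide_right_mono) simp
    moreover have "sqrt p / 2 * sqrt p = p / 2" by (simp only: times_divide_eq_left sqrt_p(2))
    ultimately show ?thesis by (simp add: Th_def mult.assoc)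
  qed
  have Th4: "4 / Th \<le> 8 * 65536 / (m * p)"
  proof -
    have "4 / Th \<le> 4 / (m * p / (2 * 65536))" using Th_ge Th mp by (intro divide_left_mono) auto
    then show ?thesis by simp
  qed
  show ?thesis
  proof (rule sdp_good_raw[where Th = Th and B = B and g = g and h = h and E = "1 / 33554432 * m * p"])
    show "\<bar>\<Sum>i\<in>V. \<Sum>j\<in>V. W f i j * u i * u j\<bar> \<le> Th / 8 * (\<Sum>i\<in>V. (u i)\<^sup>2)" for u
      using norm[of u] mult_right_mono[OF nu_le_Th[of e2], of "\<Sum>i\<in>V. (u i)\<^sup>2"] e2 by (simp add: sum_nonneg)
    show "0 \<le> 1 / 33554432 * m * p" using mp by simp
    show "2 * (1 / 33554432 * m * p) * lam * ?M \<le> k1 * Th / 16"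
    proof -
      have "2 * (1 / 33554432 * m * p) * lam * ?M = (2 / 33554432) * (m * p) * (lam * ?M)" by simp
      also have "\<dots> \<le> (2 / 33554432) * (m * p) * (8 * k1)" using lM mp by (intro mult_left_mono) auto
      also have "\<dots> = k1 * (m * p / (2 * 65536)) / 16" by simp
      also have "\<dots> \<le> k1 * Th / 16" using Th_ge k1 by (intro divide_right_mono mult_left_mono) auto
      finally show ?thesis .
    qed
    show "4 / Th * ((\<Sum>j\<in>V. (W f i j)\<^sup>2) + real (card B) * g) + real (card B) * h
        + 4 / k1 * (\<Sum>k\<in>B. \<Sum>j\<in>other k. adj f k j) * (\<Sum>j\<in>other i. adj f i j) < D f i" if i: "i \<in> B" for i
    proof -
      define d where "d = (\<Sum>j\<in>V. adj f i j)"
      define e where "e = (\<Sum>j\<in>other i. adj f i j)"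
      have d0: "0 \<le> d" and e0: "0 \<le> e" by (auto simp: d_def e_def intro: sum_nonneg adj_bounds)
      have a: "4 / Th * ((\<Sum>j\<in>V. (W f i j)\<^sup>2) + real (card B) * g) \<le> 8 * 65536 / (m * p) * (d + m * p\<^sup>2 + real (card B) * g)"
        using Th4 sum_W_square_le[of f i d] mp g Th
        by (intro mult_mono) (auto simp: d_def intro!: add_nonneg_nonneg sum_nonneg)
      have S: "(\<Sum>k\<in>B. \<Sum>j\<in>other k. adj f k j) \<le> real (card B) * (m * p)"
      proof -
        have "(\<Sum>k\<in>B. \<Sum>j\<in>other k. adj f k j) \<le> (\<Sum>k\<in>B. m * p)"
        proof (rule sum_mono)
          fix k assume "k \<in> B"
          then have "(\<Sum>j\<in>other k. adj f k j) \<le> 1 / 33554432 * m * p" using od B by blast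
          then show "(\<Sum>j\<in>other k. adj f k j) \<le> m * p" using mp by linarith
        qed
        then show ?thesis by simp
      qed
      have k: "4 / k1 \<le> 160 / (lam * m\<^sup>2)"
      proof -
        have "lam * (m\<^sup>2 / 5) \<le> 8 * k1" using lM mult_left_mono[OF M, of lam] lam_pos by linarith
        then have "lam * m\<^sup>2 \<le> 40 * k1" by simp
        moreover have "0 < lam * m\<^sup>2" using lam_pos m by (intro mult_pos_pos zero_less_power) auto
        ultimately have "160 / (40 * k1) \<le> 160 / (lam * m\<^sup>2)" by (intro frac_le) auto
        then show ?thesis by simp
      qed
      have b: "4 / k1 * (\<Sum>k\<in>B. \<Sum>j\<in>other k. adj f k j) * e \<le> 8 / (m * p) * d"
      proof -
        have "4 / k1 * (\<Sum>k\<in>B. \<Sum>j\<in>other k. adj f k j) * e \<le> 160 / (lam * m\<^sup>2) * (real (card B) * (m * p)) * e"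
          using k S lam_pos m e0 mp k1
          by (intro mult_right_mono mult_mono) (auto intro!: sum_nonneg adj_bounds)
        also have "\<dots> = 8 / (lam * m\<^sup>2) * (20 * real (card B) * m * p * e)" by simp
        also have "\<dots> \<le> 8 / (lam * m\<^sup>2) * (lam * m * d / p)"
          using cross[OF i] lam_pos by (intro mult_left_mono) (auto simp: d_def e_def)
        also have "\<dots> = 8 / (m * p) * d" using lam_pos by (simp add: power2_eq_square)
        finally show ?thesis .
      qed
      have "8 * 65536 / (m * p) * (d + m * p\<^sup>2 + real (card B) * g) + real (card B) * h + 8 / (m * p) * d
        = (8 * 65536 + 8) / (m * p) * d + (8 * 65536 / (m * p) * (m * p\<^sup>2 + real (card B) * g) + real (card B) * h)"
        by (simp only: add_divide_distrib distrib_left distrib_right)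
      then show ?thesis using a b bad[OF i] unfolding d_def[symmetric] e_def[symmetric] by linarith
    qed
  qed (use Th k1 cut B good g h od in auto)
qed

end

section \<open>Probability of failure for a fixed sample\<close>

text \<open>
  The bound on \<open>sqrt (p / q)\<close> below which \<open>p\<close> and \<open>q\<close> count as comparable. Its square
  \<open>exp 100663296\<close> is \<open>exp (3 / e)\<close> for the fraction \<open>e = 1 / 33554432\<close> that \<open>sdp_good_far\<close>
  allows for edges to the other community.
\<close>

definition kappa :: real where "kappa = exp 50331648"
text \<open>The fraction \<open>e2\<close> for the operator norm, small enough for both forms of the criterion.\<close>

definition eps2 :: real where "eps2 = 1 / (32 * 65536\<^sup>2 * kappa)"

lemma kappa_ge: "4 \<le> kappa"
proof -
  have "1 + 50331648 \<le> exp (50331648 :: real)" by (rule exp_ge_add_one_self)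
  then show ?thesis by (simp add: kappa_def)
qed

lemma eps2_bounds: "0 < eps2" "eps2 \<le> 1" "eps2 \<le> 1 / (32 * 65536\<^sup>2)" "eps2 \<le> 1 / (320 * 65536 * kappa)"
proof -
  have k: "0 < kappa" "1 \<le> kappa" using kappa_ge by auto
  show "0 < eps2" using k by (simp add: eps2_def)
  show le: "eps2 \<le> 1 / (32 * 65536\<^sup>2)" unfolding eps2_def using k by (intro divide_left_mono) auto
  then show "eps2 \<le> 1" by simp
  show "eps2 \<le> 1 / (320 * 65536 * kappa)" unfolding eps2_def using k by (intro divide_left_mono mult_right_mono) auto
qed

context two_communities
begin

lemma prob_D_Th:
  assumes i: "i \<in> V" and bal: "\<bar>real (card R1) - real (card R2)\<bar> \<le> m / 128"
  shows "measure_pmf.prob G {f. D f i \<le> Th} \<le> 3 * exp (- (31 / 32) * R)"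
proof -
  obtain \<sigma> where \<sigma>: "0 \<le> \<sigma>" "crude_exponent i \<sigma> Th \<le> - (31 / 32) * R"
    using crude_exponent_small[of "1 / 32" i] bal i by (auto simp: Th_def power2_eq_square)
  have "measure_pmf.prob G {f. D f i \<le> Th} \<le> exp (1 + crude_exponent i \<sigma> Th)" by (rule prob_D_le[OF i \<sigma>(1)])
  also have "\<dots> \<le> exp (1 + - (31 / 32) * R)" using \<sigma>(2) by simp
  also have "\<dots> = exp 1 * exp (- (31 / 32) * R)" by (rule exp_add)
  also have "\<dots> \<le> 3 * exp (- (31 / 32) * R)" using exp_le by (intro mult_right_mono) auto
  finally show ?thesis .
qed

text \<open>
  The next four events have probability of order \<open>exp (- R)\<close>; the last one matters only if \<open>q\<close>
  is much smaller than \<open>p\<close>.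
\<close>

definition norm_fails where
  "norm_fails f \<longleftrightarrow> (\<exists>u. sqrt (eps2 * m * p * R) * (\<Sum>i\<in>V. (u i)\<^sup>2) < \<bar>\<Sum>i\<in>V. \<Sum>j\<in>V. W f i j * u i * u j\<bar>)"
definition cut_fails where
  "cut_fails f \<longleftrightarrow> (\<Sum>i\<in>R1. \<Sum>j\<in>R2. lam - adj f i j) < k1"
definition degree_fails where
  "degree_fails f \<longleftrightarrow> (\<exists>i\<in>V. 8 * m * p < (\<Sum>j\<in>V. adj f i j))"
definition other_degree_fails where
  "other_degree_fails f \<longleftrightarrow> (\<exists>i\<in>V. 1 / 33554432 * m * p < (\<Sum>j\<in>other i. adj f i j))"
text \<open>The exceptional vertices, for which the operator norm bound is not enough.\<close>

definition low :: "(nat set \<Rightarrow> bool) \<Rightarrow> nat set" where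
  "low f = {i\<in>V. D f i \<le> Th}"

definition far :: bool where "far \<longleftrightarrow> q * exp 100663296 \<le> p"

lemma not_far: "\<not> far \<Longrightarrow> sqrt p \<le> kappa * sqrt q"
proof -
  assume "\<not> far"
  then have "p \<le> q * exp 100663296" by (simp add: far_def)
  also have "exp (100663296::real) = kappa\<^sup>2" by (simp add: kappa_def power2_eq_square exp_add[symmetric])
  finally have "sqrt p \<le> sqrt (q * kappa\<^sup>2)" by simp
  then show ?thesis using kappa_ge by (simp add: real_sqrt_mult mult.commute)
qed

lemma far_16: "far \<Longrightarrow> 16 * q \<le> p"
proof -
  assume "far"
  have "1 + 100663296 \<le> exp (100663296 :: real)" by (rule exp_ge_add_one_self)
  then have "q * 16 \<le> q * exp 100663296" using pq by (intro mult_left_mono) auto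
  then show ?thesis using \<open>far\<close> by (simp add: far_def)
qed

lemma prob_basic_fails:
  assumes lnm: "ln m \<le> R" and R: "1 \<le> R" and big: "4000000 * exp (6400000 / eps2) \<le> eps2 * R" and m: "10 \<le> m"
    and bal: "\<bar>real (card R1) - real (card R2)\<bar> \<le> m / 128"
  shows "measure_pmf.prob G {f. norm_fails f \<or> cut_fails f \<or> degree_fails f \<or> (far \<and> other_degree_fails f)} \<le> 10 * exp (- R)"
proof -
  have a: "measure_pmf.prob G {f. norm_fails f} \<le> 7 * exp (- R)"
    unfolding norm_fails_def by (rule prob_norm[OF lnm R eps2_bounds(1,2) big])
  have b: "measure_pmf.prob G {f. cut_fails f} \<le> exp (- R)"
  proof -
    have "1 * R \<le> m / 10 * R" using m R by (intro mult_right_mono) auto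
    also have "\<dots> = m\<^sup>2 / 5 * (del\<^sup>2 / 4)" by (simp add: R_def power2_eq_square)
    also have "\<dots> \<le> real (card R1) * real (card R2) * (del\<^sup>2 / 4)"
      by (intro mult_right_mono product_lower[OF bal]) auto
    finally have "exp (- (real (card R1) * real (card R2) * del\<^sup>2 / 4)) \<le> exp (- R)" by simp
    then show ?thesis unfolding cut_fails_def using prob_cut by linarith
  qed
  have c: "measure_pmf.prob G {f. degree_fails f} \<le> exp (- R)"
  proof -
    have "exp (- 11 * R) \<le> exp (- R)" using R by simp
    then show ?thesis unfolding degree_fails_def using prob_degree[OF lnm R] by linarith
  qed
  have d: "measure_pmf.prob G {f. far \<and> other_degree_fails f} \<le> exp (- R)"
  proof (cases far)
    case True
    have "exp (- 3 * R) \<le> exp (- R)" using R by simp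
    moreover have "q * exp (3 / (1 / 33554432)) \<le> p" using True by (simp add: far_def)
    then have "measure_pmf.prob G {f. other_degree_fails f} \<le> exp (- 3 * R)"
      unfolding other_degree_fails_def by (intro prob_other_degree lnm R) auto
    ultimately have "measure_pmf.prob G {f. other_degree_fails f} \<le> exp (- R)" by linarith
    then show ?thesis using True by simp
  qed simp
  have "measure_pmf.prob G {f. norm_fails f \<or> cut_fails f \<or> degree_fails f \<or> (far \<and> other_degree_fails f)}
    \<le> 7 * exp (- R) + (exp (- R) + (exp (- R) + exp (- R)))"
    by (intro order_trans[OF prob_disj_le] add_mono a b c d)
  then show ?thesis by simp
qed

lemma good_without_exceptional:
  assumes m: "0 < m" and bal: "\<bar>real (card R1) - real (card R2)\<bar> \<le> m / 128"
    and ok: "\<not> norm_fails f" "\<not> cut_fails f" "\<not> (far \<and> other_degree_fails f)" "low f = {}"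
  shows "sdp_good f"
proof -
  have norm: "\<bar>\<Sum>i\<in>V. \<Sum>j\<in>V. W f i j * u i * u j\<bar> \<le> sqrt (eps2 * m * p * R) * (\<Sum>i\<in>V. (u i)\<^sup>2)" for u
    using ok(1) unfolding norm_fails_def by (auto simp: not_less)
  have cut: "k1 \<le> (\<Sum>i\<in>R1. \<Sum>j\<in>R2. lam - adj f i j)" using ok(2) by (simp add: cut_fails_def)
  have good: "Th \<le> D f i" if "i \<in> V - {}" for i using ok(4) that by (force simp: low_def)
  have k: "1 \<le> kappa" using kappa_ge by simp
  show ?thesis
  proof (cases far)
    case True
    then have od: "(\<Sum>j\<in>other i. adj f i j) \<le> 1 / 33554432 * m * p" if "i \<in> V" for i
      using ok(3) that unfolding other_degree_fails_def by (auto simp: not_less)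
    show ?thesis
      by (rule sdp_good_far[where B = "{}" and g = 0 and h = 0, OF bal far_16[OF True] eps2_bounds(1,3) m norm cut od])
         (use good in auto)
  next
    case False
    show ?thesis
      by (rule sdp_good_similar[where B = "{}" and g = 0 and h = 0, OF bal k not_far[OF False] eps2_bounds(1,3,4) m norm cut])
         (use good del_pos sqrt_p m pq in auto)
  qed
qed

text \<open>
  If \<open>R\<close> is well above \<open>ln m\<close>, the loss of a fraction of the exponent is harmless and most
  likely no vertex at all is exceptional.
\<close>

lemma prob_fail_large_R:
  assumes lnm: "3 * ln m \<le> R" and R: "1 \<le> R" and big: "4000000 * exp (6400000 / eps2) \<le> eps2 * R" and m: "10 \<le> m"
    and bal: "\<bar>real (card R1) - real (card R2)\<bar> \<le> m / 128"
  shows "measure_pmf.prob G {f. \<not> sdp_good f} \<le> 13 * exp (- R / 2)"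
proof -
  have lnm1: "ln m \<le> R" using lnm m R ln_ge_zero[of m] by linarith
  have low: "measure_pmf.prob G {f. \<exists>i\<in>V. D f i \<le> Th} \<le> (\<Sum>i\<in>V. 3 * exp (- (31 / 32) * R))"
    by (rule prob_bex_le[OF finite_V]) (rule prob_D_Th[OF _ bal])
  also have "\<dots> = 3 * (m * exp (- (31 / 32) * R))" by simp
  also have "m * exp (- (31 / 32) * R) \<le> exp (- R / 2)"
  proof -
    have "m = exp (ln m)" using m by simp
    also have "\<dots> \<le> exp (R / 3)" using lnm by simp
    finally have "m * exp (- (31 / 32) * R) \<le> exp (R / 3) * exp (- (31 / 32) * R)" by (intro mult_right_mono) auto
    also have "\<dots> \<le> exp (- R / 2)" using R by (simp add: exp_add[symmetric])
    finally show ?thesis .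
  qed
  finally have low: "measure_pmf.prob G {f. \<exists>i\<in>V. D f i \<le> Th} \<le> 3 * exp (- R / 2)" by simp
  have "measure_pmf.prob G {f. \<not> sdp_good f}
    \<le> measure_pmf.prob G {f. (norm_fails f \<or> cut_fails f \<or> degree_fails f \<or> (far \<and> other_degree_fails f)) \<or> (\<exists>i\<in>V. D f i \<le> Th)}"
  proof (rule prob_mono)
    fix f assume "\<not> sdp_good f"
    then show "(norm_fails f \<or> cut_fails f \<or> degree_fails f \<or> (far \<and> other_degree_fails f)) \<or> (\<exists>i\<in>V. D f i \<le> Th)"
      using good_without_exceptional[OF _ bal, of f] m by (auto simp: low_def)
  qed
  also have "\<dots> \<le> 10 * exp (- R) + 3 * exp (- R / 2)"
    by (intro order_trans[OF prob_disj_le] add_mono prob_basic_fails[OF lnm1 R big m bal] low)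
  also have "\<dots> \<le> 13 * exp (- R / 2)"
  proof -
    have "exp (- R) \<le> exp (- R / 2)" using R by simp
    then show ?thesis by linarith
  qed
  finally show ?thesis .
qed

lemma exp_R_powr: "0 < m \<Longrightarrow> ln m \<le> R \<Longrightarrow> 0 \<le> c \<Longrightarrow> exp (- c * R) \<le> m powr (- c)"
proof -
  assume m: "0 < m" "ln m \<le> R" and c: "0 \<le> c"
  have "exp (- c * R) \<le> exp (- c * ln m)" using mult_left_mono[OF m(2) c] by simp
  also have "\<dots> = m powr (- c)" unfolding powr_def using m(1) by (metis less_irrefl)
  finally show ?thesis .
qed

text \<open>
  Markov's inequality: the expected number is of order \<open>m * exp (- (31 / 32) * R)\<close>, which is at
  most \<open>m powr (1/32)\<close>.
\<close>

lemma prob_many_low: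
  assumes lnm: "ln m \<le> R" and m: "0 < m" and bal: "\<bar>real (card R1) - real (card R2)\<bar> \<le> m / 128"
  shows "measure_pmf.prob G {f. m powr (1/16) < real (card (low f))} \<le> 3 * m powr (- 1/32)"
proof -
  have "measure_pmf.prob G {f. m powr (1/16) < real (card (low f))} \<le> m * (3 * exp (- (31 / 32) * R)) / m powr (1/16)"
    unfolding low_def
    by (rule prob_count_le[OF finite_set_bernoulli_product[OF finite_I] finite_V _ prob_D_Th[OF _ bal]]) (use m in auto)
  also have "\<dots> \<le> m powr 1 * (3 * m powr (- (31 / 32))) / m powr (1/16)"
    using exp_R_powr[OF m lnm, of "31/32"] m by (intro divide_right_mono mult_mono) auto
  also have "\<dots> = 3 * (m powr 1 * m powr (- (31 / 32)) * m powr (- (1/16)))"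
    by (simp only: powr_minus_divide[of m "1/16"]) simp
  also have "\<dots> = 3 * m powr (- 1/32)" unfolding powr_add[symmetric] by simp
  finally show ?thesis .
qed

text \<open>Two exceptional vertices at distance at most two.\<close>

definition close_low :: "(nat set \<Rightarrow> bool) \<Rightarrow> bool" where
  "close_low f \<longleftrightarrow> (\<exists>i\<in>V. \<exists>k\<in>V. i \<noteq> k \<and> D f i \<le> Th \<and> D f k \<le> Th \<and>
     (f {i, k} \<or> (\<exists>j\<in>V - {i, k}. f {i, j} \<and> f {k, j})))"

lemma prob_low_pair:
  assumes i: "i \<in> X" "k \<in> X" "i \<noteq> k" and X: "X \<subseteq> V" "card X \<le> 3"
    and P: "P \<subseteq> {e. \<exists>a\<in>X. \<exists>b\<in>X. a \<noteq> b \<and> e = {a, b}}" and fP: "finite P"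
    and bal: "\<bar>real (card R1) - real (card R2)\<bar> \<le> m / 128"
  shows "measure_pmf.prob G {f. (\<forall>e\<in>P. f e) \<and> D f i \<le> Th \<and> D f k \<le> Th}
     \<le> p ^ card P * (exp (6 + 4 * ln 256) * exp (- (31 / 16) * R))"
proof -
  have iV: "i \<in> V" "k \<in> V" using i X by blast+
  obtain si where si: "0 \<le> si" "si \<le> ln 256" "crude_exponent i si Th \<le> - (31 / 32) * R"
    using crude_exponent_small[of "1 / 32" i] bal iV by (auto simp: Th_def power2_eq_square)
  obtain sk where sk: "0 \<le> sk" "sk \<le> ln 256" "crude_exponent k sk Th \<le> - (31 / 32) * R"
    using crude_exponent_small[of "1 / 32" k] bal iV by (auto simp: Th_def power2_eq_square)
  have "measure_pmf.prob G {f. (\<forall>e\<in>P. f e) \<and> D f i \<le> Th \<and> D f k \<le> Th}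
    \<le> p ^ card P * exp (6 + 4 * ln 256 + crude_exponent i si Th + crude_exponent k sk Th)"
    by (rule prob_two_bad[OF i X P fP si(1,2) sk(1,2)])
  also have "\<dots> \<le> p ^ card P * exp ((6 + 4 * ln 256) + (- (31 / 16) * R))"
    using si(3) sk(3) pq by (intro mult_left_mono) auto
  finally show ?thesis by (simp only: exp_add)
qed

text \<open>
  There are \<open>m ^ 2\<close> pairs, joined directly with probability \<open>p\<close> or by a path of length two with
  probability at most \<open>m * p\<^sup>2\<close>, and both ends are exceptional with probability of order
  \<open>exp (- (31 / 16) * R)\<close>, which is almost \<open>m powr (- 2)\<close>.
\<close>

lemma prob_close_low:
  assumes lnm: "ln m \<le> R" and m: "1 \<le> m" and bal: "\<bar>real (card R1) - real (card R2)\<bar> \<le> m / 128"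
    and sparse: "m * p \<le> m powr (1/4)"
  shows "measure_pmf.prob G {f. close_low f} \<le> 2 * exp (6 + 4 * ln 256) * m powr (- 7/16)"
proof -
  define K where "K = exp (6 + 4 * ln 256) * exp (- (31 / 16) * R)"
  have K0: "0 \<le> K" by (simp add: K_def)
  have mm: "0 < m" using m by linarith
  define Z where "Z = {(i, k). i \<in> V \<and> k \<in> V \<and> i \<noteq> k}"
  have fZ: "finite Z" by (rule finite_subset[of _ "V \<times> V"]) (auto simp: Z_def)
  have cZ: "real (card Z) \<le> m * m"
  proof -
    have "card Z \<le> card (V \<times> V)" by (rule card_mono) (auto simp: Z_def)
    also have "\<dots> = card V * card V" by (rule card_cartesian_product)
    finally have "real (card Z) \<le> real (card V * card V)" by (simp only: of_nat_le_iff)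
    then show ?thesis by simp
  qed
  have "measure_pmf.prob G {f. close_low f}
    \<le> measure_pmf.prob G {f. \<exists>z\<in>Z. ((\<forall>e\<in>{{fst z, snd z}}. f e) \<and> D f (fst z) \<le> Th \<and> D f (snd z) \<le> Th)
       \<or> (\<exists>j\<in>V - {fst z, snd z}. (\<forall>e\<in>{{fst z, j}, {snd z, j}}. f e) \<and> D f (fst z) \<le> Th \<and> D f (snd z) \<le> Th)}"
  proof (rule prob_mono)
    fix f assume "close_low f"
    then obtain i k where ik: "i \<in> V" "k \<in> V" "i \<noteq> k" "D f i \<le> Th" "D f k \<le> Th"
      "f {i, k} \<or> (\<exists>j\<in>V - {i, k}. f {i, j} \<and> f {k, j})" unfolding close_low_def by blast
    show "\<exists>z\<in>Z. ((\<forall>e\<in>{{fst z, snd z}}. f e) \<and> D f (fst z) \<le> Th \<and> D f (snd z) \<le> Th)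
       \<or> (\<exists>j\<in>V - {fst z, snd z}. (\<forall>e\<in>{{fst z, j}, {snd z, j}}. f e) \<and> D f (fst z) \<le> Th \<and> D f (snd z) \<le> Th)"
      by (rule bexI[of _ "(i, k)"]) (use ik in \<open>auto simp only: Z_def fst_conv snd_conv mem_Collect_eq case_prod_conv ball_simps insert_iff empty_iff\<close>)
  qed
  also have "\<dots> \<le> (\<Sum>z\<in>Z. p * K + m * (p\<^sup>2 * K))"
  proof (rule prob_bex_le[OF fZ])
    fix z assume "z \<in> Z"
    then have z: "fst z \<in> V" "snd z \<in> V" "fst z \<noteq> snd z" by (auto simp: Z_def)
    have a: "measure_pmf.prob G {f. (\<forall>e\<in>{{fst z, snd z}}. f e) \<and> D f (fst z) \<le> Th \<and> D f (snd z) \<le> Th} \<le> p ^ 1 * K"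
    proof -
      have "card {{fst z, snd z}} = 1" by simp
      then show ?thesis unfolding K_def
        using prob_low_pair[of "fst z" "{fst z, snd z}" "snd z" "{{fst z, snd z}}"] z bal by (fastforce simp: card_insert_if)
    qed
    have b: "measure_pmf.prob G {f. \<exists>j\<in>V - {fst z, snd z}. (\<forall>e\<in>{{fst z, j}, {snd z, j}}. f e) \<and> D f (fst z) \<le> Th \<and> D f (snd z) \<le> Th}
      \<le> (\<Sum>j\<in>V - {fst z, snd z}. p\<^sup>2 * K)"
    proof (rule prob_bex_le)
      fix j assume j: "j \<in> V - {fst z, snd z}"
      define P where "P = {{fst z, j}, {snd z, j}}"
      define X where "X = {fst z, snd z, j}"
      have c2: "card P = 2" unfolding P_def using z j by (auto simp: doubleton_eq_iff card_insert_if)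
      have XV: "X \<subseteq> V" "card X \<le> 3" using z j by (auto simp: X_def card_insert_if)
      have PX: "P \<subseteq> {e. \<exists>a\<in>X. \<exists>b\<in>X. a \<noteq> b \<and> e = {a, b}}"
        using j unfolding P_def X_def by blast
      have "measure_pmf.prob G {f. (\<forall>e\<in>P. f e) \<and> D f (fst z) \<le> Th \<and> D f (snd z) \<le> Th} \<le> p ^ card P * K"
        unfolding K_def by (rule prob_low_pair[OF _ _ z(3) XV PX _ bal]) (auto simp: X_def P_def)
      then show "measure_pmf.prob G {f. (\<forall>e\<in>{{fst z, j}, {snd z, j}}. f e) \<and> D f (fst z) \<le> Th \<and> D f (snd z) \<le> Th} \<le> p\<^sup>2 * K"
        unfolding c2 unfolding P_def .
    qed simp
    also have "\<dots> \<le> m * (p\<^sup>2 * K)"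
    proof -
      have "card (V - {fst z, snd z}) \<le> card V" by (rule card_mono) auto
      then show ?thesis using K0 by (simp add: mult_right_mono)
    qed
    finally have b: "measure_pmf.prob G {f. \<exists>j\<in>V - {fst z, snd z}. (\<forall>e\<in>{{fst z, j}, {snd z, j}}. f e) \<and> D f (fst z) \<le> Th \<and> D f (snd z) \<le> Th} \<le> m * (p\<^sup>2 * K)" .
    show "measure_pmf.prob G {f. ((\<forall>e\<in>{{fst z, snd z}}. f e) \<and> D f (fst z) \<le> Th \<and> D f (snd z) \<le> Th)
       \<or> (\<exists>j\<in>V - {fst z, snd z}. (\<forall>e\<in>{{fst z, j}, {snd z, j}}. f e) \<and> D f (fst z) \<le> Th \<and> D f (snd z) \<le> Th)} \<le> p * K + m * (p\<^sup>2 * K)"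
      using a b by (intro order_trans[OF prob_disj_le] add_mono) auto
  qed
  also have "\<dots> \<le> (m * m) * (p * K + m * (p\<^sup>2 * K))"
    using cZ pq K0 by (simp add: mult_right_mono)
  also have "\<dots> = (m * (m * p) + m * (m * p)\<^sup>2) * K" by (simp add: power2_eq_square algebra_simps)
  also have "\<dots> \<le> (2 * m powr (3/2)) * (exp (6 + 4 * ln 256) * m powr (- (31/16)))"
  proof (rule mult_mono)
    have s2: "(m * p)\<^sup>2 \<le> m powr (1/2)"
    proof -
      have "(m * p)\<^sup>2 \<le> (m powr (1/4))\<^sup>2" using sparse pq by (intro power_mono) auto
      also have "\<dots> = m powr (1/2)" by (simp add: power2_eq_square powr_add[symmetric])
      finally show ?thesis .
    qed
    have s1: "m * p \<le> m powr (1/2)"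
      by (rule order_trans[OF sparse powr_mono]) (use m in auto)
    have "m * (m * p) + m * (m * p)\<^sup>2 \<le> m * m powr (1/2) + m * m powr (1/2)"
      using s1 s2 by (intro add_mono mult_left_mono) auto
    also have "\<dots> = 2 * (m powr 1 * m powr (1/2))" using mm by simp
    also have "\<dots> = 2 * m powr (3/2)" unfolding powr_add[symmetric] by simp
    finally show "m * (m * p) + m * (m * p)\<^sup>2 \<le> 2 * m powr (3/2)" .
    show "K \<le> exp (6 + 4 * ln 256) * m powr (- (31/16))"
      unfolding K_def using exp_R_powr[OF mm lnm, of "31/16"] by (intro mult_left_mono) auto
  qed (use K0 in auto)
  also have "\<dots> = 2 * exp (6 + 4 * ln 256) * (m powr (3/2) * m powr (- (31/16)))" by simp
  also have "\<dots> = 2 * exp (6 + 4 * ln 256) * m powr (- 7/16)" unfolding powr_add[symmetric] by simp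
  finally show ?thesis .
qed

text \<open>
  If \<open>i\<close> and \<open>k\<close> are neither adjacent nor have a common neighbour, each product
  \<open>W f i j * W f k j\<close> has a factor that is only a mean.
\<close>

lemma far_apart_rows:
  assumes deg: "\<not> degree_fails f" and nc: "\<not> close_low f" and i: "i \<in> low f" "k \<in> low f" "i \<noteq> k"
  shows "\<bar>\<Sum>j\<in>V. W f i j * W f k j\<bar> \<le> 17 * m * p\<^sup>2" "\<bar>W f i k\<bar> \<le> p"
proof -
  have V: "i \<in> V" "k \<in> V" using i by (auto simp: low_def)
  have nik: "\<not> f {i, k}" and nj: "\<And>j. j \<in> V - {i, k} \<Longrightarrow> \<not> (f {i, j} \<and> f {k, j})"
    using nc i V unfolding close_low_def low_def by auto
  have d: "(\<Sum>j\<in>V. adj f i j) \<le> 8 * m * p" "(\<Sum>j\<in>V. adj f k j) \<le> 8 * m * p"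
    using deg V unfolding degree_fails_def by (auto simp: not_less)
  have "adj f i k = 0" using nik by (simp add: adj_def)
  then show "\<bar>W f i k\<bar> \<le> p" using abs_W_le(1)[of f i k] by simp
  have prod0: "adj f i j * adj f k j = 0" if "j \<in> V" for j
  proof (cases "j = i \<or> j = k")
    case True
    then show ?thesis by (auto simp: adj_def)
  next
    case False
    then show ?thesis using nj[of j] that by (auto simp: adj_def)
  qed
  have "\<bar>\<Sum>j\<in>V. W f i j * W f k j\<bar> \<le> (\<Sum>j\<in>V. \<bar>W f i j * W f k j\<bar>)" by (rule sum_abs)
  also have "\<dots> \<le> (\<Sum>j\<in>V. p * adj f i j + p * adj f k j + p\<^sup>2)"
  proof (rule sum_mono)
    fix j assume j: "j \<in> V"
    have "\<bar>W f i j * W f k j\<bar> \<le> (adj f i j + p) * (adj f k j + p)"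
      unfolding abs_mult by (intro mult_mono abs_W_le) (use adj_bounds pq in \<open>auto intro: add_nonneg_nonneg\<close>)
    also have "\<dots> = p * adj f i j + p * adj f k j + p\<^sup>2"
      using prod0[OF j] by (simp add: power2_eq_square algebra_simps)
    finally show "\<bar>W f i j * W f k j\<bar> \<le> p * adj f i j + p * adj f k j + p\<^sup>2" .
  qed
  also have "\<dots> = p * (\<Sum>j\<in>V. adj f i j) + p * (\<Sum>j\<in>V. adj f k j) + m * p\<^sup>2"
    by (simp add: sum.distrib sum_distrib_left)
  also have "\<dots> \<le> p * (8 * m * p) + p * (8 * m * p) + m * p\<^sup>2"
    using d pq by (intro add_mono mult_left_mono) auto
  also have "\<dots> = 17 * m * p\<^sup>2" by (simp add: power2_eq_square)
  finally show "\<bar>\<Sum>j\<in>V. W f i j * W f k j\<bar> \<le> 17 * m * p\<^sup>2" .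
qed

end

lemma powr_cancel: "0 < (y::real) \<Longrightarrow> a + b = 0 \<Longrightarrow> y powr a * y powr b = 1"
  by (simp add: powr_add[symmetric])

lemma divide_mult_cancel: "0 < (z::real) \<Longrightarrow> c / z * (z * w) = c * w"
  by simp

context two_communities
begin

section \<open>The critical window\<close>

text \<open>
  The constant in the requirement of \<open>sdp_good_similar\<close> on exceptional vertices, for
  \<open>\<kappa> = kappa\<close>.
\<close>

definition gap_const :: real where "gap_const = 40 * 65536 + 1600 * kappa + 1"

definition similar_low_fails where
  "similar_low_fails f \<longleftrightarrow> (\<exists>i\<in>V. D f i \<le> gap_const * (sqrt p / del))"

text \<open>
  For comparable \<open>p\<close> and \<open>q\<close> the product \<open>t * sqrt p / del\<close> is bounded, so the required gap
  costs only a constant factor over \<open>exp (- R)\<close>.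
\<close>

lemma prob_similar_low:
  assumes "\<not> far"
  shows "measure_pmf.prob G {f. similar_low_fails f} \<le> exp (1 + gap_const * kappa) * (m * exp (- R))"
proof -
  have tk: "t * (sqrt p / del) \<le> kappa"
  proof -
    have "t * sqrt p \<le> t * (kappa * sqrt q)" using not_far[OF assms] t_pos by (intro mult_left_mono) auto
    also have "\<dots> = kappa * (t * sqrt q)" by simp
    also have "\<dots> \<le> kappa * del" using t_mult_le kappa_ge by (intro mult_left_mono) auto
    finally show ?thesis using del_pos by (simp add: divide_le_eq)
  qed
  have g0: "0 \<le> gap_const" using kappa_ge by (simp add: gap_const_def)
  have "measure_pmf.prob G {f. similar_low_fails f} \<le> (\<Sum>i\<in>V. exp (1 + gap_const * kappa) * exp (- R))"
    unfolding similar_low_fails_def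
  proof (rule prob_bex_le[OF finite_V])
    fix i assume i: "i \<in> V"
    have "t * (gap_const * (sqrt p / del)) = gap_const * (t * (sqrt p / del))" by simp
    also have "\<dots> \<le> gap_const * kappa" using tk g0 by (intro mult_left_mono)
    finally have "exp (1 - R + t * (gap_const * (sqrt p / del))) \<le> exp ((1 + gap_const * kappa) + - R)" by simp
    then show "measure_pmf.prob G {f. D f i \<le> gap_const * (sqrt p / del)} \<le> exp (1 + gap_const * kappa) * exp (- R)"
      using prob_D_le_sharp[OF i, of "gap_const * (sqrt p / del)"] unfolding exp_add by linarith
  qed
  then show ?thesis by (simp add: mult_ac)
qed

text \<open>
  The sign in the third component of \<open>z\<close> expresses an absolute value; the degree condition is
  the one under which \<open>prob_row_product\<close> gives a bound.
\<close>

definition row_product_fails where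
  "row_product_fails f \<longleftrightarrow> (\<exists>z\<in>V \<times> V \<times> {1, -1}. fst z \<noteq> fst (snd z) \<and> (\<Sum>j\<in>V. adj f (fst z) j) \<le> 8 * m * p \<and>
     m * p * m powr (- 1/16) < snd (snd z) * (\<Sum>j\<in>V. W f (fst z) j * W f (fst (snd z)) j))"

lemma prob_row_product_fails:
  assumes m: "1 \<le> m" and dense: "m powr (1/4) \<le> m * p"
  shows "measure_pmf.prob G {f. row_product_fails f} \<le> 2 * m\<^sup>2 * exp (- (m powr (1/8)) / 36)"
proof -
  define y where "y = m powr (- 1/16)"
  have "m \<noteq> 0" using m by linarith
  then have y: "0 < y" "y \<le> 1"
    unfolding y_def using powr_mono[OF _ m, of "- 1 / 16" 0] by (simp_all only: powr_gt_zero powr_zero_eq_one) simp_all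
  have "measure_pmf.prob G {f. row_product_fails f} \<le> (\<Sum>z\<in>V \<times> V \<times> {1, -1 :: real}. exp (- (m powr (1/8)) / 36))"
    unfolding row_product_fails_def
  proof (rule prob_bex_le)
    fix z assume z: "z \<in> V \<times> V \<times> {1, -1 :: real}"
    obtain i k \<sigma> where zz: "z = (i, k, \<sigma>)" by (cases z)
    have ik: "i \<in> V" "k \<in> V" "\<bar>\<sigma>\<bar> = 1" using z by (auto simp: zz)
    show "measure_pmf.prob G {f. fst z \<noteq> fst (snd z) \<and> (\<Sum>j\<in>V. adj f (fst z) j) \<le> 8 * m * p \<and>
     m * p * m powr (- 1/16) < snd (snd z) * (\<Sum>j\<in>V. W f (fst z) j * W f (fst (snd z)) j)} \<le> exp (- (m powr (1/8)) / 36)"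
    proof (cases "i = k")
      case True
      then show ?thesis by (simp add: zz)
    next
      case False
      have "measure_pmf.prob G {f. (\<Sum>j\<in>V. adj f i j) \<le> 8 * m * p \<and> m * p * y < \<sigma> * (\<Sum>j\<in>V. W f i j * W f k j)}
        \<le> exp (9 * (y / 18)\<^sup>2 * m * p\<^sup>2 - y / 18 * (m * p * y))"
        by (rule prob_row_product[OF ik(1,2) False _ _ ik(3)]) (use y in auto)
      also have "\<dots> \<le> exp (- (m powr (1/8)) / 36)"
      proof (subst exp_le_cancel_iff)
        have "9 * (y / 18)\<^sup>2 * m * p\<^sup>2 - y / 18 * (m * p * y) = y\<^sup>2 / 36 * (m * p\<^sup>2) - y\<^sup>2 / 18 * (m * p)"
          by (simp add: power2_eq_square field_simps)
        also have "\<dots> \<le> y\<^sup>2 / 36 * (m * p) - y\<^sup>2 / 18 * (m * p)"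
          by (intro diff_right_mono mult_left_mono mp_square_le) auto
        also have "\<dots> = - (y\<^sup>2 * (m * p)) / 36" by simp
        also have "\<dots> \<le> - (m powr (1/8)) / 36"
        proof -
          have "y\<^sup>2 * m powr (1/4) \<le> y\<^sup>2 * (m * p)" using dense by (intro mult_left_mono) auto
          moreover have "y\<^sup>2 * m powr (1/4) = m powr (1/8)"
            unfolding y_def power2_eq_square powr_add[symmetric] by simp
          ultimately show ?thesis by simp
        qed
        finally show "9 * (y / 18)\<^sup>2 * m * p\<^sup>2 - y / 18 * (m * p * y) \<le> - (m powr (1/8)) / 36" .
      qed
      finally show ?thesis using False by (simp add: zz y_def)
    qed
  qed simp
  also have "\<dots> = 2 * m\<^sup>2 * exp (- (m powr (1/8)) / 36)"
    by (simp add: card_cartesian_product power2_eq_square)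
  finally show ?thesis .
qed

text \<open>
  There are at most \<open>m powr (1/16)\<close> exceptional vertices. In a sparse graph no two of them are
  within distance two, so their rows are almost orthogonal; in a dense one all rows are almost
  orthogonal by concentration. Therefore a bounded multiple of \<open>sqrt p / del\<close> is a sufficient
  gap, and the union bound over the vertices loses only a constant factor.
\<close>

lemma prob_fail_similar:
  assumes lnm: "ln m \<le> R" and R: "1 \<le> R" "R \<le> 3 * ln m"
    and big: "4000000 * exp (6400000 / eps2) \<le> eps2 * R" and m: "10 \<le> m"
    and bal: "\<bar>real (card R1) - real (card R2)\<bar> \<le> m / 128" and nf: "\<not> far"
    and A1: "17 * m powr (1/16) * m powr (- 3/4) \<le> 1"
    and A2: "m powr (1/16) \<le> sqrt (m powr (1/4) / (6 * ln m))"
    and A3: "2 * m\<^sup>2 * exp (- (m powr (1/8)) / 36) \<le> m powr (- 1/32)"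
  shows "measure_pmf.prob G {f. \<not> sdp_good f}
    \<le> 10 * exp (- R) + exp (1 + gap_const * kappa) * (m * exp (- R)) + (4 + 2 * exp (6 + 4 * ln 256)) * m powr (- 1/32)"
proof -
  have m0: "0 < m" "1 \<le> m" using m by auto
  define many where "many = (\<lambda>f. m powr (1/16) < real (card (low f)))"
  define sparse where "sparse \<longleftrightarrow> m * p \<le> m powr (1/4)"
  define pairs_fail where "pairs_fail = (\<lambda>f. if sparse then close_low f else row_product_fails f)"
  have pf: "measure_pmf.prob G {f. pairs_fail f} \<le> (1 + 2 * exp (6 + 4 * ln 256)) * m powr (- 1/32)"
  proof (cases sparse)
    case True
    have "measure_pmf.prob G {f. close_low f} \<le> 2 * exp (6 + 4 * ln 256) * m powr (- 7/16)"
      by (rule prob_close_low[OF lnm m0(2) bal]) (use True in \<open>simp add: sparse_def\<close>)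
    also have "\<dots> \<le> 2 * exp (6 + 4 * ln 256) * m powr (- 1/32)"
      using m0 by (intro mult_left_mono powr_mono) auto
    also have "\<dots> \<le> (1 + 2 * exp (6 + 4 * ln 256)) * m powr (- 1/32)" by (intro mult_right_mono) auto
    finally show ?thesis using True by (simp add: pairs_fail_def)
  next
    case False
    have "measure_pmf.prob G {f. row_product_fails f} \<le> 2 * m\<^sup>2 * exp (- (m powr (1/8)) / 36)"
      by (rule prob_row_product_fails[OF m0(2)]) (use False in \<open>simp add: sparse_def\<close>)
    also have "\<dots> \<le> 1 * m powr (- 1/32)" using A3 by simp
    also have "\<dots> \<le> (1 + 2 * exp (6 + 4 * ln 256)) * m powr (- 1/32)" by (intro mult_right_mono) auto
    finally show ?thesis using False by (simp add: pairs_fail_def)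
  qed
  have ok: "sdp_good f" if nf1: "\<not> norm_fails f" "\<not> cut_fails f" "\<not> degree_fails f" "\<not> similar_low_fails f" "\<not> many f" "\<not> pairs_fail f" for f
  proof -
    have norm: "\<bar>\<Sum>i\<in>V. \<Sum>j\<in>V. W f i j * u i * u j\<bar> \<le> sqrt (eps2 * m * p * R) * (\<Sum>i\<in>V. (u i)\<^sup>2)" for u
      using nf1(1) unfolding norm_fails_def by (auto simp: not_less)
    have cut: "k1 \<le> (\<Sum>i\<in>R1. \<Sum>j\<in>R2. lam - adj f i j)" using nf1(2) by (simp add: cut_fails_def)
    have lowV: "low f \<subseteq> V" by (auto simp: low_def)
    have deg: "(\<Sum>j\<in>V. adj f i j) \<le> 8 * m * p" if "i \<in> low f" for i
      using nf1(3) that lowV unfolding degree_fails_def by (auto simp: not_less)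
    have good: "Th \<le> D f i" if "i \<in> V - low f" for i using that by (auto simp: low_def)
    have bad: "(40 * 65536 + 1600 * kappa + 1) * (sqrt p / del) < D f i" if "i \<in> low f" for i
      using nf1(4) that lowV unfolding similar_low_fails_def gap_const_def by (auto simp: not_le)
    have cB: "real (card (low f)) \<le> m powr (1/16)" using nf1(5) by (simp add: many_def)
    have ratio: "1 \<le> sqrt p / del" using del_le del_pos by simp
    have k: "1 \<le> kappa" using kappa_ge by simp
    show ?thesis
    proof (cases sparse)
      case True
      have nc: "\<not> close_low f" using nf1(6) True by (simp add: pairs_fail_def)
      have p_le: "p \<le> m powr (- 3/4)"
      proof -
        have "p = p * (m powr 1 * m powr (- 1))" by (simp only: powr_cancel[OF m0(1)] mult_1_right)
        also have "\<dots> = (m * p) * m powr (- 1)" using m0(1) by (simp only: powr_one_gt_zero_iff[THEN iffD2] mult_ac)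
        also have "\<dots> \<le> m powr (1/4) * m powr (- 1)" using True by (intro mult_right_mono) (auto simp: sparse_def)
        also have "\<dots> = m powr (- 3/4)" unfolding powr_add[symmetric] by simp
        finally show ?thesis .
      qed
      have q17: "17 * real (card (low f)) * p \<le> 1"
      proof -
        have "17 * real (card (low f)) * p \<le> 17 * m powr (1/16) * m powr (- 3/4)"
          using cB p_le pq by (intro mult_mono) auto
        then show ?thesis using A1 by linarith
      qed
      show ?thesis
      proof (rule sdp_good_similar[where B = "low f" and g = "17 * m * p\<^sup>2" and h = p, OF bal k not_far[OF nf] eps2_bounds(1,3,4) m0(1) norm cut deg lowV good])
        show "\<bar>\<Sum>j\<in>V. W f i j * W f k j\<bar> \<le> 17 * m * p\<^sup>2" "\<bar>W f i k\<bar> \<le> p"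
          if "i \<in> low f" "k \<in> low f" "i \<noteq> k" for i k
          using far_apart_rows[OF nf1(3) nc that] by auto
        have "real (card (low f)) * (17 * m * p\<^sup>2) = (m * p) * (17 * real (card (low f)) * p)" by (simp add: power2_eq_square)
        also have "\<dots> \<le> (m * p) * 1" using q17 pq by (intro mult_left_mono) auto
        finally show "real (card (low f)) * (17 * m * p\<^sup>2) \<le> m * p" by simp
        have "0 \<le> real (card (low f)) * p" using pq by simp
        then show "real (card (low f)) * p \<le> sqrt p / del" using q17 ratio by linarith
      qed (use bad pq in auto)
    next
      case False
      then have dense: "m powr (1/4) \<le> m * p" by (simp add: sparse_def)
      have nr: "\<not> row_product_fails f" using nf1(6) False by (simp add: pairs_fail_def)
      define g where "g = m * p * m powr (- 1/16)"
      show ?thesis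
      proof (rule sdp_good_similar[where B = "low f" and g = g and h = 1, OF bal k not_far[OF nf] eps2_bounds(1,3,4) m0(1) norm cut deg lowV good])
        show "\<bar>\<Sum>j\<in>V. W f i j * W f k j\<bar> \<le> g" if ik: "i \<in> low f" "k \<in> low f" "i \<noteq> k" for i k
        proof -
          have V: "i \<in> V" "k \<in> V" using ik lowV by blast+
          have *: "\<sigma> * (\<Sum>j\<in>V. W f i j * W f k j) \<le> g" if s: "\<sigma> \<in> {1, -1}" for \<sigma>
          proof -
            have "(i, k, \<sigma>) \<in> V \<times> V \<times> {1, -1}" using V s by blast
            then show ?thesis
              using nr deg[OF ik(1)] ik(3) unfolding row_product_fails_def g_def by (force simp: not_less)
          qed
          show ?thesis using *[of 1] *[of "-1"] by (simp add: abs_le_iff)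
        qed
        show "\<bar>W f i k\<bar> \<le> 1" for i k by (rule abs_W_le)
        show "0 \<le> g" using pq by (simp add: g_def)
        have "real (card (low f)) * g \<le> m powr (1/16) * (m * p * m powr (- 1/16))"
          using cB pq unfolding g_def by (intro mult_right_mono) auto
        also have "\<dots> = m * p * (m powr (1/16) * m powr (- 1/16))" by simp
        also have "m powr (1/16) * m powr (- 1/16) = 1" by (rule powr_cancel) (use m0 in auto)
        finally show "real (card (low f)) * g \<le> m * p" by simp
        have "real (card (low f)) * 1 \<le> sqrt (m powr (1/4) / (6 * ln m))" using cB A2 by simp
        also have "\<dots> \<le> sqrt (m * p / (2 * R))"
          using dense R pq by (intro real_sqrt_le_mono frac_le) auto
        also have "m * p / (2 * R) = (m * p) / (m * del\<^sup>2)" by (simp add: R_def)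
        also have "\<dots> = p / del\<^sup>2" by (rule mult_divide_mult_cancel_left) (use m0(1) in linarith)
        also have "sqrt (p / del\<^sup>2) = sqrt p / del" using del_pos by (simp add: real_sqrt_divide)
        finally show "real (card (low f)) * 1 \<le> sqrt p / del" .
      qed (use bad in auto)
    qed
  qed
  have "measure_pmf.prob G {f. \<not> sdp_good f}
    \<le> measure_pmf.prob G {f. (norm_fails f \<or> cut_fails f \<or> degree_fails f \<or> (far \<and> other_degree_fails f)) \<or>
        (similar_low_fails f \<or> (many f \<or> pairs_fail f))}"
    by (rule prob_mono) (use ok in blast)
  also have "\<dots> \<le> 10 * exp (- R) + (exp (1 + gap_const * kappa) * (m * exp (- R)) + (3 * m powr (- 1/32) + (1 + 2 * exp (6 + 4 * ln 256)) * m powr (- 1/32)))"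
    unfolding many_def
    by (intro order_trans[OF prob_disj_le] add_mono prob_basic_fails[OF lnm R(1) big m bal] prob_similar_low[OF nf]
        prob_many_low[OF lnm m0(1) bal] pf)
  finally show ?thesis by (simp add: distrib_right)
qed

text \<open>
  The slope that \<open>sdp_good_far\<close> requires of the dual variable of an exceptional vertex, relative
  to its degree divided by \<open>m * p\<close>.
\<close>

definition rel_slope :: real where "rel_slope = 8 * 65536 + 8"

definition relative_low_fails where
  "relative_low_fails f \<longleftrightarrow> (\<exists>i\<in>V. D f i \<le> rel_slope / (m * p) * (\<Sum>j\<in>V. adj f i j) + m powr (- 1/2))"

text \<open>
  In the critical window \<open>m * p\<close> is logarithmic in \<open>m\<close>. Truncating the tilt at \<open>2 * ln m\<close> then
  costs a bounded factor, and so does the imbalance of the communities, since \<open>p * ln m\<close> times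
  \<open>m powr (3/4)\<close> is small. This is where the stronger balance condition is used.
\<close>

lemma prob_relative_low:
  assumes far and R: "2 * rel_slope \<le> R" "R \<le> 3 * ln m" and m: "10 \<le> m"
    and bal: "\<bar>real (card R1) - real (card R2)\<bar> \<le> m powr (3/4)"
    and A4: "24 * ln m \<le> m powr (1/4)"
    and A9: "2 * ln m * (m powr (- 1/2) + 24 * ln m * m powr (- 1/4)) \<le> 1"
  shows "measure_pmf.prob G {f. relative_low_fails f} \<le> exp (4 + 2 * rel_slope) * (m * exp (- R))"
proof -
  have m0: "0 < m" "1 \<le> m" using m by auto
  have mp: "0 < m * p" using m pq by simp
  note ff = far_facts[OF far_16[OF assms(1)]]
  have mpL: "m * p \<le> 24 * ln m" using ff(2) R(2) by linarith
  have pD: "p * m powr (3/4) \<le> 24 * ln m * m powr (- 1/4)"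
  proof -
    have "m powr (3/4) = m powr 1 * m powr (- 1/4)" unfolding powr_add[symmetric] by simp
    then have "p * m powr (3/4) = (m * p) * m powr (- 1/4)" using m0 by simp
    also have "\<dots> \<le> 24 * ln m * m powr (- 1/4)" using mpL by (intro mult_right_mono) auto
    finally show ?thesis .
  qed
  have pD1: "p * m powr (3/4) \<le> 1"
  proof -
    have "24 * ln m * m powr (- 1/4) \<le> m powr (1/4) * m powr (- 1/4)" using A4 by (intro mult_right_mono) auto
    also have "\<dots> = 1" by (rule powr_cancel[OF m0(1)]) simp
    finally show ?thesis using pD by linarith
  qed
  define a where "a = rel_slope / (m * p)"
  have a: "0 \<le> a" "a \<le> 1 / 4" "2 * a * m * p = 2 * rel_slope"
  proof -
    show "0 \<le> a" using mp by (simp add: a_def rel_slope_def)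
    have "4 * rel_slope \<le> m * p" using R(1) R_le by linarith
    then show "a \<le> 1 / 4" using mp by (simp add: a_def divide_le_eq)
    have "a * (m * p) = rel_slope" using mp unfolding a_def by (metis less_irrefl nonzero_eq_divide_eq)
    then show "2 * a * m * p = 2 * rel_slope" by simp
  qed
  have lnm: "0 < ln m" using m by simp
  have "measure_pmf.prob G {f. relative_low_fails f} \<le> (\<Sum>i\<in>V. exp (4 + 2 * rel_slope) * exp (- R))"
    unfolding relative_low_fails_def a_def[symmetric]
  proof (rule prob_bex_le[OF finite_V])
    fix i assume i: "i \<in> V"
    have "measure_pmf.prob G {f. D f i \<le> a * (\<Sum>j\<in>V. adj f i j) + m powr (- 1/2)}
      \<le> exp (- R + 1 + p * m powr (3/4) + 2 * ln m * (m powr (- 1/2) + p * m powr (3/4)) + 2 * a * m * p + m * p * exp (- (2 * ln m) / 2))"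
      by (rule prob_D_relative[OF i a(1,2) _ _ bal ff(3)]) (use lnm in auto)
    also have "\<dots> \<le> exp ((4 + 2 * rel_slope) + - R)"
    proof (subst exp_le_cancel_iff)
      have "exp (- (2 * ln m) / 2) = 1 / m" using m0(1) by (simp add: exp_minus inverse_eq_divide)
      moreover have "z * w * (1 / z) = w" if "0 < z" for z w :: real using that by simp
      from this[OF m0(1)] have "m * p * (1 / m) = p" .
      ultimately have "m * p * exp (- (2 * ln m) / 2) = p" by (simp only:)
      moreover have "2 * ln m * (m powr (- 1/2) + p * m powr (3/4)) \<le> 2 * ln m * (m powr (- 1/2) + 24 * ln m * m powr (- 1/4))"
        using pD lnm by (intro mult_left_mono add_left_mono) auto
      ultimately show "- R + 1 + p * m powr (3/4) + 2 * ln m * (m powr (- 1/2) + p * m powr (3/4)) + 2 * a * m * p + m * p * exp (- (2 * ln m) / 2)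
        \<le> (4 + 2 * rel_slope) + - R"
        using A9 pD1 pq a(3) by linarith
    qed
    finally show "measure_pmf.prob G {f. D f i \<le> a * (\<Sum>j\<in>V. adj f i j) + m powr (- 1/2)} \<le> exp (4 + 2 * rel_slope) * exp (- R)"
      by (simp only: exp_add)
  qed
  then show ?thesis by (simp add: mult_ac)
qed

text \<open>If \<open>lam\<close> is extremely small, the coupling can only be controlled because it is absent.\<close>

definition cross_fails where
  "cross_fails f \<longleftrightarrow> lam < m powr (- 3/2) \<and> (\<exists>i\<in>R1. \<exists>j\<in>R2. adj f i j \<noteq> 0)"

text \<open>
  A value of \<open>lam\<close> this small forces \<open>p / q\<close> to be at least \<open>exp (sqrt m)\<close>, so that most likely
  there are no edges between the communities.
\<close>

lemma prob_cross_fails: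
  assumes far and R: "1 \<le> R" and m: "10 \<le> m"
  shows "measure_pmf.prob G {f. cross_fails f} \<le> m\<^sup>2 * exp (- sqrt m)"
proof (cases "lam < m powr (- 3/2)")
  case True
  have m0: "0 < m" using m by auto
  have l: "0 < ln (p / q)" using pq by (simp add: ln_gt_zero)
  have "sqrt m \<le> ln (p / q)"
  proof -
    have "p / 2 \<le> p - q" using far_16[OF assms(1)] pq by linarith
    have "sqrt m = m powr (1/2)" using m0 by (simp add: powr_half_sqrt)
    also have "\<dots> = m powr (- 1) * m powr (3/2)" unfolding powr_add[symmetric] by simp
    also have "m powr (- 1) = 1 / m" using m0 by (simp add: powr_minus inverse_eq_divide)
    also have "1 / m \<le> p / 2"
    proof -
      have "2 \<le> m * p" using R_le R by linarith
      then show ?thesis using m0 by (simp add: divide_le_eq mult.commute)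
    qed
    also have "p / 2 \<le> p - q" by fact
    finally have a: "sqrt m \<le> (p - q) * m powr (3/2)" by (simp add: mult_right_mono)
    have "p - q = lam * ln (p / q)" using l by (simp add: lam_def)
    then have "(p - q) * m powr (3/2) = (lam * m powr (3/2)) * ln (p / q)" by simp
    also have "\<dots> \<le> (m powr (- 3/2) * m powr (3/2)) * ln (p / q)"
      using True l by (intro mult_right_mono) auto
    also have "m powr (- 3/2) * m powr (3/2) = 1" by (rule powr_cancel) (use m0 in auto)
    finally show ?thesis using a by simp
  qed
  then have "exp (sqrt m) \<le> p / q" using pq l by (simp add: ln_ge_iff)
  then have "q * exp (sqrt m) \<le> p" using pq by (simp add: le_divide_eq mult.commute)
  then have q: "q \<le> exp (- sqrt m)" using pq by (simp add: exp_minus field_simps)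
  have "measure_pmf.prob G {f. cross_fails f} \<le> 3 * (q * (real (card R1) * real (card R2)))"
    using prob_cross_edge True by (simp add: cross_fails_def)
  also have "\<dots> \<le> 3 * (exp (- sqrt m) * (m\<^sup>2 / 4))"
    using q product_upper pq by (intro mult_left_mono mult_mono) auto
  also have "\<dots> \<le> m\<^sup>2 * exp (- sqrt m)" by simp
  finally show ?thesis .
qed (simp add: cross_fails_def)

text \<open>
  In this regime the graph is sparse, so exceptional vertices are far apart, and the gap
  proportional to the degree is available at the cost of a constant factor. The coupling is
  dominated by the degree if \<open>lam \<ge> m powr (- 3/2)\<close> and is absent otherwise.
\<close>

lemma prob_fail_far:
  assumes lnm: "ln m \<le> R" and R: "2 * rel_slope \<le> R" "R \<le> 3 * ln m"
    and big: "4000000 * exp (6400000 / eps2) \<le> eps2 * R" and m: "10 \<le> m"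
    and bal: "\<bar>real (card R1) - real (card R2)\<bar> \<le> m / 128" "\<bar>real (card R1) - real (card R2)\<bar> \<le> m powr (3/4)" and far
    and A4: "24 * ln m \<le> m powr (1/4)"
    and A5: "(8 * 65536 * (1 + 17 * m powr (1/16)) + m powr (1/16)) * (24 * ln m / m) \<le> m powr (- 1/2)"
    and A6: "11520 * (ln m)\<^sup>2 * m powr (- 7/16) \<le> 1"
    and A7: "m\<^sup>2 * exp (- sqrt m) \<le> m powr (- 1/32)"
    and A9: "2 * ln m * (m powr (- 1/2) + 24 * ln m * m powr (- 1/4)) \<le> 1"
  shows "measure_pmf.prob G {f. \<not> sdp_good f}
    \<le> 10 * exp (- R) + exp (4 + 2 * rel_slope) * (m * exp (- R)) + (4 + 2 * exp (6 + 4 * ln 256)) * m powr (- 1/32)"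
proof -
  have m0: "0 < m" "1 \<le> m" using m by auto
  have R1: "1 \<le> R" using R(1) by (simp add: rel_slope_def)
  note ff = far_facts[OF far_16[OF \<open>far\<close>]]
  have mpL: "m * p \<le> 24 * ln m" using ff(2) R(2) by linarith
  have mp: "0 < m * p" using m pq by simp
  have pL: "p \<le> 24 * ln m / m" using mpL m0 by (simp add: le_divide_eq mult.commute)
  have sparse: "m * p \<le> m powr (1/4)" using mpL A4 by linarith
  define many where "many = (\<lambda>f. m powr (1/16) < real (card (low f)))"
  have ok: "sdp_good f" if nf1: "\<not> norm_fails f" "\<not> cut_fails f" "\<not> degree_fails f" "\<not> other_degree_fails f" "\<not> relative_low_fails f"
    "\<not> many f" "\<not> close_low f" "\<not> cross_fails f" for f
  proof -
    have norm: "\<bar>\<Sum>i\<in>V. \<Sum>j\<in>V. W f i j * u i * u j\<bar> \<le> sqrt (eps2 * m * p * R) * (\<Sum>i\<in>V. (u i)\<^sup>2)" for u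
      using nf1(1) unfolding norm_fails_def by (auto simp: not_less)
    have cut: "k1 \<le> (\<Sum>i\<in>R1. \<Sum>j\<in>R2. lam - adj f i j)" using nf1(2) by (simp add: cut_fails_def)
    have od: "(\<Sum>j\<in>other i. adj f i j) \<le> 1 / 33554432 * m * p" if "i \<in> V" for i
      using nf1(4) that unfolding other_degree_fails_def by (auto simp: not_less)
    have lowV: "low f \<subseteq> V" by (auto simp: low_def)
    have good: "Th \<le> D f i" if "i \<in> V - low f" for i using that by (auto simp: low_def)
    have rel: "rel_slope / (m * p) * (\<Sum>j\<in>V. adj f i j) + m powr (- 1/2) < D f i" if "i \<in> low f" for i
      using nf1(5) that lowV unfolding relative_low_fails_def by (auto simp: not_le)
    define N where "N = real (card (low f))"
    have N: "0 \<le> N" "N \<le> m powr (1/16)" using nf1(6) by (auto simp: many_def N_def)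
    show ?thesis
    proof (rule sdp_good_far[where B = "low f" and g = "17 * m * p\<^sup>2" and h = p, OF bal(1) far_16[OF \<open>far\<close>] eps2_bounds(1,3) m0(1) norm cut od lowV good])
      show "\<bar>\<Sum>j\<in>V. W f i j * W f k j\<bar> \<le> 17 * m * p\<^sup>2" "\<bar>W f i k\<bar> \<le> p"
        if "i \<in> low f" "k \<in> low f" "i \<noteq> k" for i k
        using far_apart_rows[OF nf1(3,7) that] by auto
      show "20 * real (card (low f)) * m * p * (\<Sum>j\<in>other i. adj f i j) \<le> lam * m * (\<Sum>j\<in>V. adj f i j) / p" if i: "i \<in> low f" for i
      proof (cases "lam < m powr (- 3/2)")
        case True
        then have none: "\<And>i j. i \<in> R1 \<Longrightarrow> j \<in> R2 \<Longrightarrow> adj f i j = 0" using nf1(8) by (auto simp: cross_fails_def)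
        have "(\<Sum>j\<in>other i. adj f i j) = 0"
        proof (rule sum.neutral, rule ballI)
          fix j assume "j \<in> other i"
          then show "adj f i j = 0" using none[of i j] none[of j i] i lowV adj_sym[of f i j] by (auto simp: other_def split: if_splits)
        qed
        then show ?thesis using lam_pos pq by (simp add: sum_nonneg adj_bounds)
      next
        case False
        define d where "d = (\<Sum>j\<in>V. adj f i j)"
        have d0: "0 \<le> d" by (simp add: d_def sum_nonneg adj_bounds)
        have ed: "(\<Sum>j\<in>other i. adj f i j) \<le> d"
          unfolding d_def by (rule sum_mono2) (use own_Un_other[of i] adj_bounds in auto)
        have "20 * N * p\<^sup>2 \<le> 20 * m powr (1/16) * (24 * ln m / m)\<^sup>2"
          using N pL pq by (intro mult_mono power_mono) auto
        also have "\<dots> = 11520 * (ln m)\<^sup>2 * (m powr (1/16) * m powr (- 2))"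
          using m0 by (simp add: power_divide power_mult_distrib powr_minus_divide)
        also have "m powr (1/16) * m powr (- 2) = m powr (- 7/16) * m powr (- 3/2)"
          unfolding powr_add[symmetric] by simp
        also have "11520 * (ln m)\<^sup>2 * (m powr (- 7/16) * m powr (- 3/2)) \<le> 1 * m powr (- 3/2)"
          unfolding mult.assoc[symmetric] using A6 by (intro mult_right_mono) auto
        also have "\<dots> \<le> lam" using False by simp
        finally have c: "20 * N * p\<^sup>2 \<le> lam" .
        have "20 * N * m * p * (\<Sum>j\<in>other i. adj f i j) \<le> 20 * N * m * p * d"
          using ed N pq by (intro mult_left_mono) auto
        also have "\<dots> = (20 * N * p\<^sup>2) * (m * d / p)" using pq by (simp add: power2_eq_square)
        also have "\<dots> \<le> lam * (m * d / p)" using c d0 pq by (intro mult_right_mono) auto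
        finally show ?thesis by (simp add: N_def d_def)
      qed
      show "(8 * 65536 + 8) / (m * p) * (\<Sum>j\<in>V. adj f i j)
        + (8 * 65536 / (m * p) * (m * p\<^sup>2 + real (card (low f)) * (17 * m * p\<^sup>2)) + real (card (low f)) * p) < D f i" if i: "i \<in> low f" for i
      proof -
        have "8 * 65536 / (m * p) * (m * p\<^sup>2 + N * (17 * m * p\<^sup>2)) + N * p = (8 * 65536 * (1 + 17 * N) + N) * p"
        proof -
          have "8 * 65536 / (m * p) * (m * p\<^sup>2 + N * (17 * m * p\<^sup>2)) = 8 * 65536 / (m * p) * ((m * p) * (p * (1 + 17 * N)))"
            by (simp add: power2_eq_square algebra_simps)
          also have "\<dots> = 8 * 65536 * (p * (1 + 17 * N))" by (rule divide_mult_cancel[OF mp])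
          finally show ?thesis by (simp add: algebra_simps)
        qed
        also have "\<dots> \<le> (8 * 65536 * (1 + 17 * m powr (1/16)) + m powr (1/16)) * (24 * ln m / m)"
          using N pL pq by (intro mult_mono add_mono mult_left_mono) auto
        also have "\<dots> \<le> m powr (- 1/2)" by (rule A5)
        finally show ?thesis using rel[OF i] unfolding rel_slope_def N_def by linarith
      qed
    qed (use pq in auto)
  qed
  have "measure_pmf.prob G {f. \<not> sdp_good f}
    \<le> measure_pmf.prob G {f. (norm_fails f \<or> cut_fails f \<or> degree_fails f \<or> (far \<and> other_degree_fails f)) \<or>
        (relative_low_fails f \<or> (many f \<or> (close_low f \<or> cross_fails f)))}"
    by (rule prob_mono) (use ok \<open>far\<close> in blast)
  also have "\<dots> \<le> 10 * exp (- R) + (exp (4 + 2 * rel_slope) * (m * exp (- R)) + (3 * m powr (- 1/32)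
      + (2 * exp (6 + 4 * ln 256) * m powr (- 7/16) + m\<^sup>2 * exp (- sqrt m))))"
    unfolding many_def
    by (intro order_trans[OF prob_disj_le] add_mono prob_basic_fails[OF lnm R1 big m bal(1)]
        prob_relative_low[OF \<open>far\<close> R m bal(2) A4 A9] prob_many_low[OF lnm m0(1) bal(1)]
        prob_close_low[OF lnm m0(2) bal(1) sparse] prob_cross_fails[OF \<open>far\<close> R1 m])
  also have "\<dots> \<le> 10 * exp (- R) + (exp (4 + 2 * rel_slope) * (m * exp (- R)) + (3 * m powr (- 1/32)
      + (2 * exp (6 + 4 * ln 256) * m powr (- 1/32) + m powr (- 1/32))))"
    using m0 A7 by (intro add_mono mult_left_mono powr_mono) auto
  finally show ?thesis by (simp add: distrib_right)
qed

end

section \<open>A uniform bound for a fixed sample\<close>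

text \<open>All that the analysis of the critical window requires of a large number of vertices.\<close>

lemma eventually_window_facts:
  "\<forall>\<^sub>F y :: real in at_top. 10 \<le> y \<and> 17 * y powr (1/16) * y powr (- 3/4) \<le> 1
     \<and> y powr (1/16) \<le> sqrt (y powr (1/4) / (6 * ln y))
     \<and> 2 * y\<^sup>2 * exp (- (y powr (1/8)) / 36) \<le> y powr (- 1/32)
     \<and> 24 * ln y \<le> y powr (1/4)
     \<and> (8 * 65536 * (1 + 17 * y powr (1/16)) + y powr (1/16)) * (24 * ln y / y) \<le> y powr (- 1/2)
     \<and> 11520 * (ln y)\<^sup>2 * y powr (- 7/16) \<le> 1
     \<and> y\<^sup>2 * exp (- sqrt y) \<le> y powr (- 1/32)
     \<and> 2 * ln y * (y powr (- 1/2) + 24 * ln y * y powr (- 1/4)) \<le> 1"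
  by (intro eventually_conj eventually_ge_at_top; real_asymp)

text \<open>
  The power \<open>1/64\<close> makes one statement out of several regimes. If \<open>R\<close> is bounded or below
  \<open>ln m\<close>, the right-hand side is at least one for a large \<open>C\<close>. If \<open>R > 3 * ln m\<close>, there are most
  likely no exceptional vertices. In between, errors of order \<open>m powr (- 1/32)\<close> are covered, as
  \<open>m powr (- 2) \<le> m * exp (- R)\<close>.
\<close>

theorem prob_fail_uniform:
  "\<exists>C\<ge>1. \<forall>I pe R1 R2 p q. two_communities I pe R1 R2 p q \<longrightarrow>
     (let m = real (card (R1 \<union> R2)); R = two_communities.R R1 R2 p q in
      1 \<le> m \<longrightarrow> \<bar>real (card R1) - real (card R2)\<bar> \<le> m / 128 \<longrightarrow>
      (R \<le> 3 * ln m \<longrightarrow> \<bar>real (card R1) - real (card R2)\<bar> \<le> m powr (3/4)) \<longrightarrow>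
      measure_pmf.prob (bernoulli_product I pe) {f. \<not> two_communities.sdp_good R1 R2 p q f} \<le> C * (m * exp (- R)) powr (1/64))"
proof -
  obtain y0 where y0: "\<And>y. y0 \<le> y \<Longrightarrow> 10 \<le> y \<and> 17 * y powr (1/16) * y powr (- 3/4) \<le> 1
     \<and> y powr (1/16) \<le> sqrt (y powr (1/4) / (6 * ln y))
     \<and> 2 * y\<^sup>2 * exp (- (y powr (1/8)) / 36) \<le> y powr (- 1/32)
     \<and> 24 * ln y \<le> y powr (1/4)
     \<and> (8 * 65536 * (1 + 17 * y powr (1/16)) + y powr (1/16)) * (24 * ln y / y) \<le> y powr (- 1/2)
     \<and> 11520 * (ln y)\<^sup>2 * y powr (- 7/16) \<le> 1
     \<and> y\<^sup>2 * exp (- sqrt y) \<le> y powr (- 1/32)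
     \<and> 2 * ln y * (y powr (- 1/2) + 24 * ln y * y powr (- 1/4)) \<le> (1::real)"
    using eventually_window_facts unfolding eventually_at_top_linorder by blast
  (* Beyond \<open>Rmin\<close> the number of vertices is large (as \<open>2 * R \<le> m\<close>), the norm bound applies, and \<open>R\<close> exceeds
     \<open>2 * rel_slope\<close>; below it the constant \<open>C\<close> makes the bound trivial. *)
  define Rmin where "Rmin = \<bar>y0\<bar> + 4000000 * exp (6400000 / eps2) / eps2 + 2000000"
  define C1 where "C1 = exp (1 + (40 * 65536 + 1600 * kappa + 1) * kappa) + exp (4 + 2 * (8 * 65536 + 8)) + 2 * exp (6 + 4 * ln 256) + 100"
  define C where "C = C1 + exp (Rmin / 64)"
  have C1: "100 \<le> C1" by (simp add: C1_def add_nonneg_nonneg)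
  have C: "C1 \<le> C" "exp (Rmin / 64) \<le> C" using C1 by (auto simp: C_def)
  show ?thesis
  proof (intro exI[of _ C] conjI allI impI)
    show "1 \<le> C" using C C1 by linarith
    fix I pe R1 R2 p q
    assume tc: "two_communities I pe R1 R2 p q"
    interpret two_communities I pe R1 R2 p q by (rule tc)
    define X where "X = m * exp (- R)"
    define Pf where "Pf = measure_pmf.prob G {f. \<not> sdp_good f}"
    have main: "Pf \<le> C * X powr (1/64)"
      if m1: "1 \<le> m" and bal: "\<bar>real (card R1) - real (card R2)\<bar> \<le> m / 128"
        and bal2: "R \<le> 3 * ln m \<longrightarrow> \<bar>real (card R1) - real (card R2)\<bar> \<le> m powr (3/4)"
    proof -
      have m0: "0 < m" using m1 by linarith
      have X0: "0 < X" using m0 by (simp add: X_def)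
      have P1: "Pf \<le> 1" by (simp add: Pf_def)
      have X_ge: "exp (- R) \<le> X" using mult_right_mono[OF m1, of "exp (- R)"] by (simp add: X_def)
      show ?thesis
      proof (cases "Rmin \<le> R \<and> ln m \<le> R")
        case False
        have "1 \<le> C * X powr (1/64)"
        proof (cases "ln m \<le> R")
          case True
          then have R: "R < Rmin" using False by simp
          have "exp (- R / 64) = exp (- R) powr (1/64)" by (simp add: powr_def)
          also have "\<dots> \<le> X powr (1/64)" using X_ge by (intro powr_mono2) auto
          finally have "exp (Rmin / 64) * exp (- R / 64) \<le> C * X powr (1/64)" using C(2) C1 C(1) by (intro mult_mono) auto
          moreover have "1 \<le> exp (Rmin / 64) * exp (- R / 64)" unfolding exp_add[symmetric] using R by simp
          ultimately show ?thesis by linarith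
        next
          case False
          then have "exp R \<le> exp (ln m)" by simp
          then have "exp R \<le> m" using m0 by simp
          then have "1 \<le> X" by (simp add: X_def exp_minus field_simps)
          then have "1 \<le> X powr (1/64)" by (simp add: ge_one_powr_ge_zero)
          then have "1 * 1 \<le> C * X powr (1/64)" using C C1 by (intro mult_mono) auto
          then show ?thesis by simp
        qed
        then show ?thesis using P1 by linarith
      next
        case True
        then have R: "Rmin \<le> R" and lnm: "ln m \<le> R" by auto
        have e: "0 < 4000000 * exp (6400000 / eps2) / eps2" using eps2_bounds(1) by simp
        then have R1: "1 \<le> R" "2000000 \<le> R" using R unfolding Rmin_def by linarith+
        have big: "4000000 * exp (6400000 / eps2) \<le> eps2 * R"
        proof -
          have "4000000 * exp (6400000 / eps2) / eps2 \<le> R" using R e unfolding Rmin_def by linarith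
          then show ?thesis using eps2_bounds(1) by (simp add: divide_le_eq mult.commute)
        qed
        have "y0 \<le> m" using R R_le_m e unfolding Rmin_def by linarith
        note yf = y0[OF this]
        have m10: "10 \<le> m" using yf by blast
        have X1: "X \<le> 1"
        proof -
          have "m \<le> exp R" using lnm m0 by (metis exp_le_cancel_iff exp_ln)
          then show ?thesis by (simp add: X_def exp_minus field_simps)
        qed
        have Xc: "X \<le> X powr (1/64)" using powr_mono'[of "1/64" 1 X] X0 X1 by simp
        show ?thesis
        proof (cases "R \<le> 3 * ln m")
          case False
          have "Pf \<le> 13 * exp (- R / 2)" unfolding Pf_def
            by (rule prob_fail_large_R[OF _ R1(1) big m10 bal]) (use False in simp)
          also have "exp (- R / 2) \<le> X powr (1/64)"
          proof -
            have "exp (- R / 2) \<le> exp (- R / 64)" using R1 by simp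
            also have "\<dots> = exp (- R) powr (1/64)" by (simp add: powr_def)
            also have "\<dots> \<le> X powr (1/64)" using X_ge by (intro powr_mono2) auto
            finally show ?thesis .
          qed
          also have "13 * X powr (1/64) \<le> C * X powr (1/64)" using C C1 by (intro mult_right_mono) auto
          finally show ?thesis by simp
        next
          case R3: True
          have mX: "m powr (- 1/32) \<le> X powr (1/64)"
          proof -
            have "m powr (- 2) = m powr 1 * m powr (- 3)" unfolding powr_add[symmetric] by simp
            also have "\<dots> = m * exp (- 3 * ln m)" using m0 by (simp add: powr_def less_imp_neq)
            also have "\<dots> \<le> X" unfolding X_def using R3 by (intro mult_left_mono) auto
            finally have "(m powr (- 2)) powr (1/64) \<le> X powr (1/64)" by (intro powr_mono2) auto
            then show ?thesis by (simp add: powr_powr)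
          qed
          have bound: "Pf \<le> C * X powr (1/64)"
            if P: "Pf \<le> 10 * exp (- R) + K * X + (4 + 2 * exp (6 + 4 * ln 256)) * m powr (- 1/32)"
              and K: "0 \<le> K" "10 + K + (4 + 2 * exp (6 + 4 * ln 256)) \<le> C1" for K
          proof -
            have "Pf \<le> 10 * X powr (1/64) + K * X powr (1/64) + (4 + 2 * exp (6 + 4 * ln 256)) * X powr (1/64)"
              using X_ge Xc mX K by (intro order_trans[OF P] add_mono mult_left_mono) auto
            also have "\<dots> = (10 + K + (4 + 2 * exp (6 + 4 * ln 256))) * X powr (1/64)" by (simp add: distrib_right)
            also have "\<dots> \<le> C * X powr (1/64)" using K C by (intro mult_right_mono) auto
            finally show ?thesis .
          qed
          show ?thesis
          proof (cases far)
            case True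
            have slope: "2 * rel_slope \<le> R" using R1(2) by (simp add: rel_slope_def)
            have "Pf \<le> 10 * exp (- R) + exp (4 + 2 * rel_slope) * (m * exp (- R)) + (4 + 2 * exp (6 + 4 * ln 256)) * m powr (- 1/32)"
              unfolding Pf_def
              by (rule prob_fail_far[OF lnm slope R3 big m10 bal _ True]) (use yf bal2 R3 in blast)+
            then show ?thesis unfolding X_def[symmetric]
              by (rule bound) (simp_all add: C1_def rel_slope_def)
          next
            case False
            have "Pf \<le> 10 * exp (- R) + exp (1 + gap_const * kappa) * (m * exp (- R)) + (4 + 2 * exp (6 + 4 * ln 256)) * m powr (- 1/32)"
              unfolding Pf_def
              by (rule prob_fail_similar[OF lnm R1(1) R3 big m10 bal False]) (use yf in blast)+
            then show ?thesis unfolding X_def[symmetric]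
              by (rule bound) (simp_all add: C1_def gap_const_def)
          qed
        qed
      qed
    qed
    then show "let m = m; R = R in 1 \<le> m \<longrightarrow> \<bar>real (card R1) - real (card R2)\<bar> \<le> m / 128 \<longrightarrow>
      (R \<le> 3 * ln m \<longrightarrow> \<bar>real (card R1) - real (card R2)\<bar> \<le> m powr (3/4)) \<longrightarrow>
      measure_pmf.prob G {f. \<not> sdp_good f} \<le> C * (m * exp (- R)) powr (1/64)"
      unfolding Let_def Pf_def X_def by blast
  qed
qed

section \<open>The sampled block model\<close>

text \<open>The model for a fixed planted partition. The edges and the sample \<open>V\<close> are still random.\<close>

locale sampled_sbm =
  fixes n :: nat and S1 S2 :: "nat set" and p q \<gamma> :: real
  assumes part: "S1 \<union> S2 = {..<n}" "S1 \<inter> S2 = {}" "card S1 = card S2"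
    and pq0: "0 < q" "q < p" "p \<le> 1" and \<gamma>: "0 < \<gamma>" "\<gamma> < 1"
begin

definition pe :: "nat set \<Rightarrow> real" where
  "pe e = (if e \<subseteq> S1 \<or> e \<subseteq> S2 then p else q)"
abbreviation edges where "edges \<equiv> bernoulli_product (vertex_pairs n) pe"
abbreviation nodes where "nodes \<equiv> node_sample_pmf n \<gamma>"
definition graph :: "(nat set \<Rightarrow> bool) \<Rightarrow> nat set set" where
  "graph f = {e \<in> vertex_pairs n. f e}"
definition M :: real where "M = \<gamma> * real n"
text \<open>
  In terms of \<open>\<alpha>\<close> and \<open>\<beta>\<close> this is \<open>((\<alpha> + \<beta>) * (\<gamma> / 2) - \<gamma> * sqrt (\<alpha> * \<beta>)) * ln n\<close>, so
  \<open>real n * exp (- rate)\<close> is the power of \<open>n\<close> in the theorem, up to the constant \<open>c\<close>. \<open>M\<close> is the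
  mean size of the sample.
\<close>

definition rate :: real where "rate = M * (sqrt p - sqrt q)\<^sup>2 / 2"

lemma finite_S [simp]: "finite S1" "finite S2"
  using part(1) by (metis finite_Un finite_lessThan)+

lemma finite_vertex_pairs: "finite (vertex_pairs n)"
  unfolding vertex_pairs_def by (rule finite_subset[of _ "Pow {..<n}"]) auto

lemma pair_in: "i < n \<Longrightarrow> j < n \<Longrightarrow> {i, j} \<in> vertex_pairs n \<longleftrightarrow> i \<noteq> j"
  by (auto simp: vertex_pairs_def card_insert_if)

lemma pe_bounds: "0 \<le> pe e \<and> pe e \<le> 1"
  using pq0 by (auto simp: pe_def)

lemma two_communities_sample:
  assumes V: "V \<subseteq> {..<n}"
  shows "two_communities (vertex_pairs n) pe (S1 \<inter> V) (S2 \<inter> V) p q"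
proof
  show "finite (vertex_pairs n)" by (rule finite_vertex_pairs)
  show "0 \<le> pe e \<and> pe e \<le> 1" for e by (rule pe_bounds)
  show "S1 \<inter> V \<inter> (S2 \<inter> V) = {}" using part by auto
  fix i j assume ij: "i \<in> S1 \<inter> V \<union> S2 \<inter> V" "j \<in> S1 \<inter> V \<union> S2 \<inter> V" "i \<noteq> j"
  then show "{i, j} \<in> vertex_pairs n" using V pair_in[of i j] by auto
  show "pe {i, j} = mean_adj (S1 \<inter> V) (S2 \<inter> V) p q i j"
    using ij part(2) by (auto simp: pe_def mean_adj_def)
qed (use pq0 in auto)

lemma sample_Un: "V \<subseteq> {..<n} \<Longrightarrow> S1 \<inter> V \<union> S2 \<inter> V = V"
  using part(1) by auto

definition own_side where "own_side v = (if v \<in> S1 then S1 else S2)"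
definition other_side where "other_side v = (if v \<in> S1 then S2 else S1)"

text \<open>Ties count as failures, because the strict majority rule then puts \<open>v\<close> on neither side.\<close>

definition extension_fails :: "(nat set \<Rightarrow> bool) \<Rightarrow> nat set \<Rightarrow> bool" where
  "extension_fails f V \<longleftrightarrow> (\<exists>v\<in>{..<n}. v \<notin> V \<and>
     (\<Sum>u\<in>own_side v \<inter> V. of_bool (f {v, u}) :: real) \<le> (\<Sum>u\<in>other_side v \<inter> V. of_bool (f {v, u})))"

lemma edge_count_eq:
  assumes V: "V \<subseteq> {..<n}" "v < n" "v \<notin> V" "S \<subseteq> V"
  shows "real (edge_count (graph f) v S) = (\<Sum>u\<in>S. of_bool (f {v, u}))"
proof -
  have fS: "finite S" using V finite_subset by (meson finite_lessThan subset_trans)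
  have "{u \<in> S. {v, u} \<in> graph f} = {u \<in> S. f {v, u}}"
    using V pair_in[of v] by (auto simp: graph_def)
  then show ?thesis unfolding edge_count_def using fS by (simp add: sum.If_cases of_bool_def Int_def)
qed

text \<open>The logarithms of the sample size cancel.\<close>

lemma lambda_star_eq:
  assumes "2 \<le> card V"
  shows "lambda_star p q V = (p - q) / ln (p / q)"
proof -
  define y where "y = real (card V)"
  define L where "L = ln y"
  have y: "2 \<le> y" using assms by (simp add: y_def)
  have L: "0 < L" using y by (simp add: L_def)
  have "ln (p * y / L) - ln (q * y / L) = ln ((p * y / L) / (q * y / L))"
    using pq0 y L by (subst ln_div) auto
  also have "(p * y / L) / (q * y / L) = p / q" using y L by simp
  finally have d: "ln (p * y / L) - ln (q * y / L) = ln (p / q)" .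
  have num: "p * y / L - q * y / L = (p - q) * (y / L)" by (simp add: left_diff_distrib diff_divide_distrib)
  have "lambda_star p q V = (p * y / L - q * y / L) / (ln (p * y / L) - ln (q * y / L)) * (L / y)"
    using assms by (simp add: lambda_star_def Let_def y_def L_def)
  also have "\<dots> = (p - q) / ln (p / q)"
    unfolding d num using y L by simp
  finally show ?thesis .
qed

lemma recovers_if:
  assumes V: "V \<subseteq> {..<n}" "2 \<le> card V"
    and good: "two_communities.sdp_good (S1 \<inter> V) (S2 \<inter> V) p q f" and ext: "\<not> extension_fails f V"
  shows "recovers n p q S1 S2 (graph f) V"
proof -
  interpret T: two_communities "vertex_pairs n" pe "S1 \<inter> V" "S2 \<inter> V" p q
    by (rule two_communities_sample[OF V(1)])
  note UV = sample_Un[OF V(1)]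
  let ?A = "adjacency V (induced_edges (graph f) V)"
  have A: "?A i j = T.adj f i j" if "i \<in> V" "j \<in> V" for i j
    using that V pair_in[of i j] by (auto simp: adjacency_def induced_edges_def graph_def T.adj_def)
  have lam: "lambda_star p q V = T.lam" unfolding T.lam_def by (rule lambda_star_eq[OF V(2)])
  have x: "T.x i = 1 \<or> T.x i = -1" for i by (simp add: T.x_def)
  have sol: "sdp_solutions V ?A (lambda_star p q V) = {outer V T.x}"
  proof (rule sdp_unique_solution)
    show "finite V" using V finite_subset by blast
    show "?A i j = ?A j i" if "i \<in> V" "j \<in> V" for i j using that T.adj_sym[of f i j] by (simp add: A)
    fix y :: "nat \<Rightarrow> real" assume "\<exists>i\<in>V. \<exists>j\<in>V. y i \<noteq> y j"
    then have "0 < signed_laplacian V (T.adj f) T.lam T.x y"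
      using good unfolding T.sdp_good_def UV by blast
    also have "\<dots> = signed_laplacian V ?A (lambda_star p q V) T.x y"
      unfolding signed_laplacian_def lam by (simp add: A cong: sum.cong)
    finally show "0 < signed_laplacian V ?A (lambda_star p q V) T.x y" .
  qed (rule x)
  have R1: "{i \<in> V. T.x i = 1} = S1 \<inter> V" by (auto simp: T.x_def)
  have R2: "{i \<in> V. T.x i = - 1} = S2 \<inter> V" using part V by (auto simp: T.x_def)
  have com: "sdp_communities V ?A (lambda_star p q V) (S1 \<inter> V) (S2 \<inter> V)"
    unfolding sdp_communities_def using x sol R1 R2 by (intro exI[of _ T.x]) auto
  have maj: "real (edge_count (graph f) v (other_side v \<inter> V)) < real (edge_count (graph f) v (own_side v \<inter> V))"
    if v: "v < n" "v \<notin> V" for v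
    using ext v unfolding extension_fails_def by (subst (1 2) edge_count_eq[OF V(1)]) (auto simp: not_le)
  have m1: "edge_count (graph f) v (S2 \<inter> V) < edge_count (graph f) v (S1 \<inter> V)" if "v \<in> S1" "v \<notin> V" for v
    using maj[of v] that part by (auto simp: own_side_def other_side_def)
  have m2: "edge_count (graph f) v (S1 \<inter> V) < edge_count (graph f) v (S2 \<inter> V)" if "v \<in> S2" "v \<notin> V" for v
  proof -
    have "v < n" "v \<notin> S1" using that part by auto
    then show ?thesis using maj[of v] that by (simp add: own_side_def other_side_def)
  qed
  have in_n: "v < n \<longleftrightarrow> v \<in> S1 \<or> v \<in> S2" for v using part(1) by (metis UnE UnI1 UnI2 lessThan_iff)
  have disj: "\<not> (v \<in> S1 \<and> v \<in> S2)" for v using part(2) by blast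
  have "v \<in> majority_extend n (graph f) V (S1 \<inter> V) (S2 \<inter> V) \<longleftrightarrow> v \<in> S1" for v
    unfolding majority_extend_def Un_iff Int_iff mem_Collect_eq Diff_iff lessThan_iff
    using m1[of v] m2[of v] in_n[of v] disj[of v] less_asym by metis
  then have "majority_extend n (graph f) V (S1 \<inter> V) (S2 \<inter> V) = S1" by blast
  moreover have "v \<in> majority_extend n (graph f) V (S2 \<inter> V) (S1 \<inter> V) \<longleftrightarrow> v \<in> S2" for v
    unfolding majority_extend_def Un_iff Int_iff mem_Collect_eq Diff_iff lessThan_iff
    using m1[of v] m2[of v] in_n[of v] disj[of v] less_asym by metis
  then have "majority_extend n (graph f) V (S2 \<inter> V) (S1 \<inter> V) = S2" by blast
  ultimately show ?thesis using com unfolding recovers_def Let_def by blast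
qed

text \<open>The edges are averaged first, for a fixed sample.\<close>

lemma prob_pair_le:
  assumes b: "\<And>V. V \<in> set_pmf nodes \<Longrightarrow> measure_pmf.prob edges {f. Q f V} \<le> b V" and b0: "\<And>V. (0::real) \<le> b V"
  shows "measure_pmf.prob (pair_pmf edges nodes) {(f, V). Q f V} \<le> measure_pmf.expectation nodes b"
proof -
  have eq: "pair_pmf edges nodes = bind_pmf nodes (\<lambda>V. map_pmf (\<lambda>f. (f, V)) edges)"
    unfolding pair_pmf_def by (subst bind_commute_pmf) (simp add: map_pmf_def)
  have fin: "finite (set_pmf nodes)"
    unfolding node_sample_pmf_def by (simp add: finite_set_bernoulli_product)
  show ?thesis unfolding eq
    by (rule prob_bind_le[OF fin _ b0]) (use b in \<open>simp add: vimage_def\<close>)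
qed

lemma set_nodes: "V \<in> set_pmf nodes \<Longrightarrow> V \<subseteq> {..<n}"
  by (auto simp: node_sample_pmf_def)

lemma expectation_nodes_prod:
  assumes J: "J \<subseteq> {..<n}" and h: "\<And>u. u \<in> J \<Longrightarrow> 0 \<le> h u"
  shows "measure_pmf.expectation nodes (\<lambda>V. \<Prod>u\<in>J. if u \<in> V then h u else 1) = (\<Prod>u\<in>J. h u * \<gamma> + (1 - \<gamma>))"
proof -
  have "measure_pmf.expectation nodes (\<lambda>V. \<Prod>u\<in>J. if u \<in> V then h u else 1)
    = measure_pmf.expectation (bernoulli_product {..<n} (\<lambda>_. \<gamma>)) (\<lambda>g. \<Prod>u\<in>J. if g u then h u else 1)"
    unfolding node_sample_pmf_def integral_map_pmf
    by (intro Bochner_Integration.integral_cong refl prod.cong) (use J in auto)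
  also have "\<dots> = (\<Prod>u\<in>J. h u * \<gamma> + (1 - \<gamma>))"
    using expectation_prod_bernoulli[of "{..<n}" "\<lambda>_. \<gamma>" J "\<lambda>u. u" "\<lambda>u b. if b then h u else 1"] J h \<gamma> finite_subset[OF J] by simp
  finally show ?thesis .
qed

lemma card_side: "real (card S1) = real n / 2" "real (card S2) = real n / 2"
proof -
  have "card S1 + card S2 = card (S1 \<union> S2)" using part(2) by (simp add: card_Un_disjoint)
  then have "2 * card S1 = n" using part(1,3) by simp
  then have "real (2 * card S1) = real n" by simp
  then show "real (card S1) = real n / 2" "real (card S2) = real n / 2" using part(3) by simp_all
qed

lemma geom_mean: "sqrt (p * q) \<le> p" "q \<le> sqrt (p * q)" and rate_eq: "rate = M / 2 * (p - sqrt (p * q)) + M / 2 * (q - sqrt (p * q))"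
proof -
  have a: "sqrt p * sqrt p = p" "sqrt q * sqrt q = q" "0 < sqrt q" "sqrt q \<le> sqrt p" using pq0 by auto
  have b: "sqrt (p * q) = sqrt p * sqrt q" by (rule real_sqrt_mult)
  have "sqrt p * sqrt q \<le> p" "q \<le> sqrt p * sqrt q"
    using mult_left_mono[OF a(4), of "sqrt p"] mult_right_mono[OF a(4), of "sqrt q"] a by linarith+
  then show "sqrt (p * q) \<le> p" "q \<le> sqrt (p * q)" unfolding b by simp_all
  have "(sqrt p - sqrt q)\<^sup>2 = sqrt p * sqrt p + sqrt q * sqrt q - 2 * (sqrt p * sqrt q)"
    by (simp add: power2_eq_square algebra_simps)
  also have "\<dots> = p + q - 2 * sqrt (p * q)" unfolding a b ..
  finally have d: "(sqrt p - sqrt q)\<^sup>2 = p + q - 2 * sqrt (p * q)" .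
  show "rate = M / 2 * (p - sqrt (p * q)) + M / 2 * (q - sqrt (p * q))"
    unfolding rate_def d by (simp add: field_simps)
qed

section \<open>The majority step\<close>

text \<open>
  For a fixed sample the exponential moment is a product over the sampled vertices, with the
  factor \<open>h u = 1 - p + sqrt (p * q)\<close> or \<open>1 - q + sqrt (p * q)\<close> by the choice of
  \<open>r = sqrt (q / p)\<close>. Averaging over the sample replaces \<open>h u\<close> by \<open>h u * \<gamma> + (1 - \<gamma>)\<close>, and the
  product over all vertices has the exponent \<open>rate\<close>. Only the absent edge from \<open>v\<close> to itself
  costs a constant factor.
\<close>

lemma prob_extension_vertex:
  assumes v: "v < n"
  shows "measure_pmf.prob (pair_pmf edges nodes) {(f, V). v \<notin> V \<and>
     (\<Sum>u\<in>own_side v \<inter> V. of_bool (f {v, u}) :: real) \<le> (\<Sum>u\<in>other_side v \<inter> V. of_bool (f {v, u}))} \<le> 3 * exp (- rate)"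
proof -
  define r where "r = sqrt q / sqrt p"
  have r: "0 < r" "p * r = sqrt (p * q)" "q / r = sqrt (p * q)"
  proof -
    have a: "sqrt p * sqrt p = p" "sqrt q * sqrt q = q" "0 < sqrt q" "0 < sqrt p" using pq0 by auto
    then show "0 < r" by (simp add: r_def)
    show "p * r = sqrt (p * q)" "q / r = sqrt (p * q)"
      using a unfolding r_def real_sqrt_mult by (auto simp: field_simps)
  qed
  define h where "h = (\<lambda>u. if u \<in> own_side v then 1 - p + sqrt (p * q) else 1 - q + sqrt (p * q))"
  have sq0: "0 \<le> sqrt (p * q)" using pq0 by simp
  have h0: "0 \<le> h u" for u using pq0 sq0 by (auto simp: h_def)
  have sides: "own_side v \<union> other_side v = {..<n}" "own_side v \<inter> other_side v = {}" "v \<in> own_side v"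
    "finite (own_side v)" "finite (other_side v)" "real (card (own_side v)) = real n / 2" "real (card (other_side v)) = real n / 2"
    using part v card_side by (auto simp: own_side_def other_side_def)
  let ?U = "{..<n} - {v}"
  have "measure_pmf.prob (pair_pmf edges nodes) {(f, V). v \<notin> V \<and>
     (\<Sum>u\<in>own_side v \<inter> V. of_bool (f {v, u}) :: real) \<le> (\<Sum>u\<in>other_side v \<inter> V. of_bool (f {v, u}))}
    \<le> measure_pmf.expectation nodes (\<lambda>V. \<Prod>u\<in>?U. if u \<in> V then h u else 1)"
  proof (rule prob_pair_le)
    fix V
    show "0 \<le> (\<Prod>u\<in>?U. if u \<in> V then h u else 1)" by (intro prod_nonneg) (simp add: h0)
    assume "V \<in> set_pmf nodes"
    then have V: "V \<subseteq> {..<n}" by (rule set_nodes)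
    show "measure_pmf.prob edges {f. v \<notin> V \<and>
     (\<Sum>u\<in>own_side v \<inter> V. of_bool (f {v, u}) :: real) \<le> (\<Sum>u\<in>other_side v \<inter> V. of_bool (f {v, u}))}
      \<le> (\<Prod>u\<in>?U. if u \<in> V then h u else 1)"
    proof (cases "v \<in> V")
      case True
      then show ?thesis by (simp add: prod_nonneg h0)
    next
      case False
      have fV: "finite V" using V finite_subset by blast
      define g where "g = (\<lambda>u b. if b then (if u \<in> own_side v then r else 1 / r) else 1)"
      have inj: "inj_on (\<lambda>u. {v, u}) V" by (auto simp: inj_on_def doubleton_eq_iff)
      have sub: "(\<lambda>u. {v, u}) ` V \<subseteq> vertex_pairs n" using False V v pair_in[of v] by auto
      have "measure_pmf.prob edges {f. (\<Sum>u\<in>own_side v \<inter> V. of_bool (f {v, u}) :: real) \<le> (\<Sum>u\<in>other_side v \<inter> V. of_bool (f {v, u}))}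
        \<le> measure_pmf.expectation edges (\<lambda>f. \<Prod>u\<in>V. g u (f {v, u}))"
      proof (rule prob_le_expectation[OF finite_set_bernoulli_product[OF finite_vertex_pairs]])
        fix f show "0 \<le> (\<Prod>u\<in>V. g u (f {v, u}))" using r by (intro prod_nonneg) (auto simp: g_def)
        assume le: "(\<Sum>u\<in>own_side v \<inter> V. of_bool (f {v, u}) :: real) \<le> (\<Sum>u\<in>other_side v \<inter> V. of_bool (f {v, u}))"
        define a b where "a = card {u \<in> own_side v \<inter> V. f {v, u}}" and "b = card {u \<in> other_side v \<inter> V. f {v, u}}"
        have ab: "a \<le> b"
        proof -
          have "real a \<le> real b" using le fV by (simp add: a_def b_def sum.If_cases of_bool_def Int_def)
          then show ?thesis by simp
        qed
        have Vs: "V = (own_side v \<inter> V) \<union> (other_side v \<inter> V)" using V sides by auto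
        have "(\<Prod>u\<in>V. g u (f {v, u})) = (\<Prod>u\<in>own_side v \<inter> V. g u (f {v, u})) * (\<Prod>u\<in>other_side v \<inter> V. g u (f {v, u}))"
          by (subst Vs, rule prod.union_disjoint) (use fV sides in auto)
        also have "(\<Prod>u\<in>own_side v \<inter> V. g u (f {v, u})) = r ^ a"
        proof -
          have "(\<Prod>u\<in>own_side v \<inter> V. g u (f {v, u})) = (\<Prod>u\<in>own_side v \<inter> V. if f {v, u} then r else 1)"
            by (intro prod.cong refl) (simp add: g_def)
          then show ?thesis using fV by (simp add: prod.If_cases a_def Int_def)
        qed
        also have "(\<Prod>u\<in>other_side v \<inter> V. g u (f {v, u})) = (1 / r) ^ b"
        proof -
          have "(\<Prod>u\<in>other_side v \<inter> V. g u (f {v, u})) = (\<Prod>u\<in>other_side v \<inter> V. if f {v, u} then 1 / r else 1)"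
            by (intro prod.cong refl) (use sides(2) in \<open>auto simp: g_def\<close>)
          then show ?thesis using fV by (simp add: prod.If_cases b_def Int_def)
        qed
        also have "r ^ a * (1 / r) ^ b = (1 / r) ^ (b - a)"
          using ab r by (simp add: power_diff power_divide field_simps)
        also have "1 \<le> (1 / r) ^ (b - a)"
        proof (rule one_le_power)
          have "r \<le> 1" using pq0 by (simp add: r_def divide_le_eq)
          then show "1 \<le> 1 / r" using r by simp
        qed
        finally show "1 \<le> (\<Prod>u\<in>V. g u (f {v, u}))" .
      qed
      also have "\<dots> = (\<Prod>u\<in>V. g u True * pe {v, u} + g u False * (1 - pe {v, u}))"
        by (rule expectation_prod_bernoulli[OF finite_vertex_pairs pe_bounds fV inj sub]) (use r in \<open>auto simp: g_def\<close>)
      also have "\<dots> = (\<Prod>u\<in>V. h u)"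
      proof (intro prod.cong refl)
        fix u assume u: "u \<in> V"
        have "pe {v, u} = (if u \<in> own_side v then p else q)"
          using u v V part by (auto simp: pe_def own_side_def)
        then show "g u True * pe {v, u} + g u False * (1 - pe {v, u}) = h u"
          using r by (simp add: g_def h_def mult.commute)
      qed
      also have "\<dots> = (\<Prod>u\<in>?U. if u \<in> V then h u else 1)"
      proof -
        have "(\<Prod>u\<in>?U. if u \<in> V then h u else 1) = (\<Prod>u\<in>?U \<inter> V. h u)"
          by (rule prod.inter_restrict[symmetric]) simp
        moreover have "?U \<inter> V = V" using V False by auto
        ultimately show ?thesis by simp
      qed
      finally show ?thesis using False by simp
    qed
  qed
  also have "\<dots> = (\<Prod>u\<in>?U. h u * \<gamma> + (1 - \<gamma>))"
    by (rule expectation_nodes_prod) (auto simp: h0)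
  also have "\<dots> \<le> (\<Prod>u\<in>?U. exp (- \<gamma> * (1 - h u)))"
  proof (intro prod_mono conjI)
    fix u show "0 \<le> h u * \<gamma> + (1 - \<gamma>)" using h0 \<gamma> by simp
    show "h u * \<gamma> + (1 - \<gamma>) \<le> exp (- \<gamma> * (1 - h u))"
      using exp_ge_add_one_self[of "- \<gamma> * (1 - h u)"] by (simp add: algebra_simps)
  qed
  also have "\<dots> = exp (- \<gamma> * (\<Sum>u\<in>?U. 1 - h u))"
    by (simp add: exp_sum[symmetric] sum_distrib_left)
  also have "\<dots> \<le> exp (1 - rate)"
  proof (subst exp_le_cancel_iff)
    have "(\<Sum>u\<in>?U. 1 - h u) = (\<Sum>u<n. 1 - h u) - (1 - h v)" using v by (simp add: sum_diff1)
    also have "(\<Sum>u<n. 1 - h u) = (\<Sum>u\<in>own_side v. 1 - h u) + (\<Sum>u\<in>other_side v. 1 - h u)"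
      unfolding sides(1)[symmetric] by (rule sum.union_disjoint) (use sides in auto)
    also have "(\<Sum>u\<in>own_side v. 1 - h u) = real n / 2 * (p - sqrt (p * q))"
      using sides(6) by (simp add: h_def)
    also have "(\<Sum>u\<in>other_side v. 1 - h u) = (\<Sum>u\<in>other_side v. q - sqrt (p * q))"
      using sides(2) by (intro sum.cong refl) (auto simp: h_def)
    also have "\<dots> = real n / 2 * (q - sqrt (p * q))" using sides(7) by simp
    finally have eq: "(\<Sum>u\<in>?U. 1 - h u) = real n / 2 * (p - sqrt (p * q)) + real n / 2 * (q - sqrt (p * q)) - (p - sqrt (p * q))"
      using sides(3) by (simp add: h_def)
    have "\<gamma> * (\<Sum>u\<in>?U. 1 - h u) = rate - \<gamma> * (p - sqrt (p * q))"
      unfolding eq rate_eq M_def by (simp add: algebra_simps)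
    moreover have "\<gamma> * (p - sqrt (p * q)) \<le> 1 * 1" using \<gamma> pq0 sq0 geom_mean by (intro mult_mono) auto
    ultimately show "- \<gamma> * (\<Sum>u\<in>?U. 1 - h u) \<le> 1 - rate" by simp
  qed
  also have "\<dots> = exp 1 * exp (- rate)" by (simp add: exp_add[symmetric])
  also have "\<dots> \<le> 3 * exp (- rate)" using exp_le by (intro mult_right_mono) auto
  finally show ?thesis .
qed

lemma prob_extension_fails:
  "measure_pmf.prob (pair_pmf edges nodes) {(f, V). extension_fails f V} \<le> 3 * (real n * exp (- rate))"
proof -
  have "measure_pmf.prob (pair_pmf edges nodes) {z. \<exists>v\<in>{..<n}. v \<notin> snd z \<and>
     (\<Sum>u\<in>own_side v \<inter> snd z. of_bool (fst z {v, u}) :: real) \<le> (\<Sum>u\<in>other_side v \<inter> snd z. of_bool (fst z {v, u}))} \<le> (\<Sum>v<n. 3 * exp (- rate))"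
  proof (rule prob_bex_le)
    fix v assume "v \<in> {..<n}"
    then have "v < n" by simp
    from prob_extension_vertex[OF this] show "measure_pmf.prob (pair_pmf edges nodes) {z. v \<notin> snd z \<and>
     (\<Sum>u\<in>own_side v \<inter> snd z. of_bool (fst z {v, u}) :: real) \<le> (\<Sum>u\<in>other_side v \<inter> snd z. of_bool (fst z {v, u}))} \<le> 3 * exp (- rate)"
      by (simp add: case_prod_unfold)
  qed simp
  then show ?thesis by (simp add: extension_fails_def case_prod_unfold)
qed

end

section \<open>Size and balance of the sample\<close>

context sampled_sbm
begin

lemma del_bounds: "0 < (sqrt p - sqrt q)\<^sup>2" "(sqrt p - sqrt q)\<^sup>2 \<le> 1"
proof -
  have "0 < sqrt p - sqrt q" "sqrt p \<le> 1" "0 \<le> sqrt q" using pq0 by auto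
  then have "0 < sqrt p - sqrt q" "sqrt p - sqrt q \<le> 1" by linarith+
  then show "0 < (sqrt p - sqrt q)\<^sup>2" "(sqrt p - sqrt q)\<^sup>2 \<le> 1"
    by (auto intro!: power_le_one)
qed

lemma rate_le: "2 * rate \<le> M"
  using mult_left_mono[OF del_bounds(2), of M] \<gamma> by (simp add: rate_def M_def)

lemma chernoff_nodes:
  assumes S: "S \<subseteq> {..<n}" "real (card S) = real n / 2" and \<theta>: "exp \<theta> \<le> 1 + \<theta> + \<theta>\<^sup>2"
  shows "measure_pmf.prob nodes {V. s \<le> \<theta> * (real (card (S \<inter> V)) - M / 2)} \<le> exp (M / 2 * \<theta>\<^sup>2 - s)"
proof -
  have fS: "finite S" using S finite_subset by blast
  have card: "real (card (S \<inter> {v \<in> {..<n}. f v})) = (\<Sum>u\<in>S. of_bool (f u))" for f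
  proof -
    have "S \<inter> {v \<in> {..<n}. f v} = {u \<in> S. f u}" using S by auto
    then show ?thesis using fS by (simp add: sum.If_cases of_bool_def Int_def)
  qed
  have "measure_pmf.prob nodes {V. s \<le> \<theta> * (real (card (S \<inter> V)) - M / 2)}
    = measure_pmf.prob (bernoulli_product {..<n} (\<lambda>_. \<gamma>)) {f. s + \<theta> * (M / 2) \<le> (\<Sum>u\<in>S. \<theta> * of_bool (f u))}"
    unfolding node_sample_pmf_def measure_map_pmf vimage_def mem_Collect_eq card
    by (simp add: sum_distrib_left[symmetric] algebra_simps)
  also have "\<dots> \<le> exp ((\<Sum>u\<in>S. \<gamma> * (exp \<theta> - 1)) - (s + \<theta> * (M / 2)))"
    by (rule chernoff_bernoulli[where \<phi> = "\<lambda>u. u"]) (use \<gamma> fS S in auto)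
  also have "\<dots> \<le> exp (M / 2 * \<theta>\<^sup>2 - s)"
  proof (subst exp_le_cancel_iff)
    have "(\<Sum>u\<in>S. \<gamma> * (exp \<theta> - 1)) = M / 2 * (exp \<theta> - 1)"
      unfolding sum_constant S(2) M_def by simp
    also have "\<dots> \<le> M / 2 * (\<theta> + \<theta>\<^sup>2)" using \<theta> \<gamma> by (intro mult_left_mono) (auto simp: M_def)
    finally show "(\<Sum>u\<in>S. \<gamma> * (exp \<theta> - 1)) - (s + \<theta> * (M / 2)) \<le> M / 2 * \<theta>\<^sup>2 - s" by (simp add: algebra_simps)
  qed
  finally show ?thesis .
qed

text \<open>Both community samples have mean size \<open>M / 2\<close>.\<close>

definition unbalanced :: "real \<Rightarrow> nat set \<Rightarrow> bool" where
  "unbalanced \<tau> V \<longleftrightarrow> \<tau> < \<bar>real (card (S1 \<inter> V)) - M / 2\<bar> \<or> \<tau> < \<bar>real (card (S2 \<inter> V)) - M / 2\<bar>"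

lemma prob_unbalanced:
  assumes \<tau>: "0 < \<tau>" "\<tau> \<le> M"
  shows "measure_pmf.prob nodes {V. unbalanced \<tau> V} \<le> 4 * exp (- (\<tau>\<^sup>2 / (2 * M)))"
proof -
  have M: "0 < M" using \<tau> by simp
  define \<theta> where "\<theta> = \<tau> / M"
  have \<theta>: "0 < \<theta>" "\<bar>\<theta>\<bar> \<le> 1" "\<bar>- \<theta>\<bar> \<le> 1" using \<tau> M by (auto simp: \<theta>_def)
  have e: "M / 2 * \<theta>\<^sup>2 - \<theta> * \<tau> = - (\<tau>\<^sup>2 / (2 * M))" using M by (simp add: \<theta>_def power2_eq_square field_simps)
  have q: "exp \<theta> \<le> 1 + \<theta> + \<theta>\<^sup>2" "exp (- \<theta>) \<le> 1 + (- \<theta>) + (- \<theta>)\<^sup>2"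
    using exp_minus_linear_le[OF \<theta>(2)] exp_minus_linear_le[OF \<theta>(3)] by linarith+
  have side: "measure_pmf.prob nodes {V. \<tau> < \<bar>real (card (S \<inter> V)) - M / 2\<bar>} \<le> 2 * exp (- (\<tau>\<^sup>2 / (2 * M)))"
    if S: "S \<subseteq> {..<n}" "real (card S) = real n / 2" for S
  proof -
    have "measure_pmf.prob nodes {V. \<tau> < \<bar>real (card (S \<inter> V)) - M / 2\<bar>}
      \<le> measure_pmf.prob nodes {V. \<theta> * \<tau> \<le> \<theta> * (real (card (S \<inter> V)) - M / 2) \<or> \<theta> * \<tau> \<le> (- \<theta>) * (real (card (S \<inter> V)) - M / 2)}"
    proof (rule prob_mono)
      fix V assume "\<tau> < \<bar>real (card (S \<inter> V)) - M / 2\<bar>"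
      then have "\<tau> \<le> real (card (S \<inter> V)) - M / 2 \<or> \<tau> \<le> - (real (card (S \<inter> V)) - M / 2)" by linarith
      then show "\<theta> * \<tau> \<le> \<theta> * (real (card (S \<inter> V)) - M / 2) \<or> \<theta> * \<tau> \<le> (- \<theta>) * (real (card (S \<inter> V)) - M / 2)"
        using mult_left_mono[of \<tau> "real (card (S \<inter> V)) - M / 2" \<theta>] mult_left_mono[of \<tau> "- (real (card (S \<inter> V)) - M / 2)" \<theta>] \<theta>(1)
        by fastforce
    qed
    also have "\<dots> \<le> exp (M / 2 * \<theta>\<^sup>2 - \<theta> * \<tau>) + exp (M / 2 * (- \<theta>)\<^sup>2 - \<theta> * \<tau>)"
      by (intro order_trans[OF prob_disj_le] add_mono chernoff_nodes S q)
    finally show ?thesis unfolding power2_minus e by simp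
  qed
  have sub: "S1 \<subseteq> {..<n}" "S2 \<subseteq> {..<n}" using part(1) by auto
  show ?thesis unfolding unbalanced_def
    using prob_disj_le[of nodes "\<lambda>V. \<tau> < \<bar>real (card (S1 \<inter> V)) - M / 2\<bar>" "\<lambda>V. \<tau> < \<bar>real (card (S2 \<inter> V)) - M / 2\<bar>"]
      side[OF sub(1) card_side(1)] side[OF sub(2) card_side(2)] by linarith
qed

text \<open>The second-order term in \<open>a\<close> is the price for the fluctuation of the sample size.\<close>

lemma expectation_exp_card:
  assumes a: "0 \<le> a" "a \<le> 1"
  shows "measure_pmf.expectation nodes (\<lambda>V. exp (- a * real (card V))) \<le> exp (- M * (a - a\<^sup>2))"
proof -
  have fin: "finite (set_pmf nodes)"
    unfolding node_sample_pmf_def by (simp add: finite_set_bernoulli_product)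
  have eq: "exp (- a * real (card V)) = (\<Prod>u<n. if u \<in> V then exp (- a) else 1)" if "V \<in> set_pmf nodes" for V
  proof -
    have "V \<subseteq> {..<n}" using set_nodes that by blast
    then have "{..<n} \<inter> V = V" by auto
    moreover have "(\<Prod>u<n. if u \<in> V then exp (- a) else 1) = (\<Prod>u\<in>{..<n} \<inter> V. exp (- a))"
      by (rule prod.inter_restrict[symmetric]) simp
    ultimately show ?thesis by (simp add: exp_of_nat_mult[symmetric] mult.commute)
  qed
  have "measure_pmf.expectation nodes (\<lambda>V. exp (- a * real (card V)))
    = measure_pmf.expectation nodes (\<lambda>V. \<Prod>u<n. if u \<in> V then exp (- a) else 1)"
    by (rule integral_cong_AE) (use eq in \<open>auto simp: AE_measure_pmf_iff\<close>)
  also have "\<dots> = (exp (- a) * \<gamma> + (1 - \<gamma>)) ^ n" by (subst expectation_nodes_prod) auto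
  also have "\<dots> \<le> exp (- \<gamma> * (a - a\<^sup>2)) ^ n"
  proof (rule power_mono)
    have "exp (- a) \<le> 1 - a + a\<^sup>2"
      using exp_minus_linear_le[of "- a"] a by simp
    then have "exp (- a) * \<gamma> + (1 - \<gamma>) \<le> (1 - a + a\<^sup>2) * \<gamma> + (1 - \<gamma>)" using \<gamma> by simp
    also have "\<dots> = 1 + (- \<gamma> * (a - a\<^sup>2))" by (simp add: algebra_simps)
    also have "\<dots> \<le> exp (- \<gamma> * (a - a\<^sup>2))" by (rule exp_ge_add_one_self)
    finally show "exp (- a) * \<gamma> + (1 - \<gamma>) \<le> exp (- \<gamma> * (a - a\<^sup>2))" .
  qed (use \<gamma> in auto)
  also have "\<dots> = exp (- M * (a - a\<^sup>2))"
    unfolding exp_of_nat_mult[symmetric] M_def by (simp add: algebra_simps)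
  finally show ?thesis .
qed

end

section \<open>Averaging over the sample\<close>

text \<open>Four times the bound \<open>ln z \<le> z\<close> at the fourth root.\<close>

lemma ln_square_le_sqrt:
  assumes "1 \<le> (y::real)"
  shows "(ln y)\<^sup>2 \<le> 16 * sqrt y"
proof -
  define z where "z = sqrt (sqrt y)"
  have z: "1 \<le> z" "y = z ^ 4" "sqrt y = z\<^sup>2"
  proof -
    show "1 \<le> z" "sqrt y = z\<^sup>2" using assms by (auto simp: z_def)
    then have "y = (z\<^sup>2)\<^sup>2" using assms by (metis order_trans real_sqrt_pow2 zero_le_one)
    then show "y = z ^ 4" by simp
  qed
  have "ln y = 4 * ln z" using z by (simp add: ln_realpow)
  moreover have "ln z \<le> z" "0 \<le> ln z" using ln_le_minus_one[of z] z(1) by auto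
  ultimately have "0 \<le> ln y" "ln y \<le> 4 * z" by auto
  then have "(ln y)\<^sup>2 \<le> (4 * z)\<^sup>2" by (intro power_mono)
  then show ?thesis by (simp add: z(3) power_mult_distrib)
qed

text \<open>
  The comparison of \<open>M * exp (- r)\<close> with the square root of \<open>N * exp (- r)\<close>, up to the
  fluctuation term \<open>r\<^sup>2 / (64 * M)\<close>. That term is at most a small fraction of \<open>r\<close>, which
  suffices if \<open>r\<close> is large or if \<open>ln M \<le> ln N / 2\<close>; in the remaining case \<open>M > sqrt N\<close> and
  \<open>r < 2 * ln N\<close>, so it is bounded.
\<close>

lemma sample_exponent_le:
  fixes M N r :: real
  assumes M: "1 \<le> M" "M \<le> N" and r: "ln N \<le> r" "2 * r \<le> M"
  shows "ln M - r + r\<^sup>2 / (64 * M) \<le> 1 + (ln N - r) / 2"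
proof -
  define L K z where "L = ln M" and "K = ln N" and "z = r\<^sup>2 / (64 * M)"
  have N: "1 \<le> N" and LK: "L \<le> K" and Kr: "K \<le> r" using M r by (auto simp: L_def K_def)
  have K0: "0 \<le> K" using N by (simp add: K_def)
  then have r0: "0 \<le> r" using Kr by linarith
  have q: "z \<le> r / 128"
    using mult_left_mono[OF r(2) r0] M by (simp add: z_def power2_eq_square field_simps)
  consider "2 * K \<le> r" | "r < 2 * K" "M \<le> sqrt N" | "r < 2 * K" "sqrt N < M" by linarith
  then have "L - r + z \<le> 1 + (K - r) / 2"
  proof cases
    case 1
    then show ?thesis using q LK r0 by argo
  next
    case 2
    have "ln M \<le> ln (sqrt N)" using 2 M by simp
    then have "L \<le> K / 2" using N by (simp add: ln_sqrt L_def K_def)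
    then show ?thesis using q r0 by argo
  next
    case 3
    have "r\<^sup>2 \<le> (2 * K)\<^sup>2" using 3 r0 by (intro power_mono) auto
    also have "\<dots> = 4 * K\<^sup>2" by (simp add: power_mult_distrib)
    also have "\<dots> \<le> 4 * (16 * sqrt N)" using ln_square_le_sqrt[OF N] by (simp add: K_def)
    also have "\<dots> \<le> 64 * M" using 3 by simp
    finally have "z \<le> 1" using M by (simp add: z_def)
    then show ?thesis using LK Kr by argo
  qed
  then show ?thesis by (simp add: L_def K_def z_def)
qed

lemma exp_minus_sqrt_le:
  assumes "0 \<le> (M::real)"
  shows "exp (- (sqrt M / 32)) * (2 * M) \<le> 4096"
proof -
  define s where "s = sqrt M / 32"
  have s: "0 \<le> s" "M = 1024 * s\<^sup>2" using assms by (auto simp: s_def power_divide)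
  have "1 + s + s\<^sup>2 / 2 \<le> exp s" by (rule exp_lower_Taylor_quadratic[OF s(1)])
  then have "s\<^sup>2 \<le> 2 * exp s" using s by linarith
  then have "exp (- s) * s\<^sup>2 \<le> 2" by (simp add: exp_minus field_simps)
  moreover have "exp (- (sqrt M / 32)) * (2 * M) = 2048 * (exp (- s) * s\<^sup>2)"
    unfolding s_def[symmetric] by (simp only: s(2))
  ultimately show ?thesis by simp
qed

context sampled_sbm
begin

text \<open>
  The power \<open>1/64\<close> of \<open>exp (- R)\<close> is small enough to be averaged over the random sample size:
  the fluctuations then change the exponent only at second order.
\<close>

lemma prob_sample_sdp_fails:
  assumes n: "n \<noteq> 0" and C: "1 \<le> C" and M1: "1 \<le> M" and r: "ln (real n) \<le> rate"
    and bound: "\<And>V. V \<subseteq> {..<n} \<Longrightarrow> \<not> unbalanced \<tau> V \<Longrightarrow>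
      measure_pmf.prob edges {f. \<not> two_communities.sdp_good (S1 \<inter> V) (S2 \<inter> V) p q f}
        \<le> C * (2 * M * exp (- (real (card V) * (sqrt p - sqrt q)\<^sup>2 / 2))) powr (1/64)"
  shows "measure_pmf.prob (pair_pmf edges nodes)
      {(f, V). \<not> unbalanced \<tau> V \<and> \<not> two_communities.sdp_good (S1 \<inter> V) (S2 \<inter> V) p q f}
    \<le> 3 * C * (real n * exp (- rate)) powr (1/128)"
proof -
  define a where "a = (sqrt p - sqrt q)\<^sup>2 / 128"
  have a: "0 \<le> a" "a \<le> 1" using del_bounds by (auto simp: a_def)
  have Mn: "M \<le> real n" using mult_right_mono[of \<gamma> 1 "real n"] \<gamma> by (simp add: M_def)
  have rM: "rate = M * 64 * a" by (simp add: rate_def a_def)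
  have "measure_pmf.prob (pair_pmf edges nodes)
      {(f, V). \<not> unbalanced \<tau> V \<and> \<not> two_communities.sdp_good (S1 \<inter> V) (S2 \<inter> V) p q f}
    \<le> measure_pmf.expectation nodes (\<lambda>V. C * (2 * M) powr (1/64) * exp (- a * real (card V)))"
  proof (rule prob_pair_le)
    fix V :: "nat set" show "0 \<le> C * (2 * M) powr (1/64) * exp (- a * real (card V))" using C by simp
    assume "V \<in> set_pmf nodes"
    then have V: "V \<subseteq> {..<n}" by (rule set_nodes)
    show "measure_pmf.prob edges {f. \<not> unbalanced \<tau> V \<and> \<not> two_communities.sdp_good (S1 \<inter> V) (S2 \<inter> V) p q f}
      \<le> C * (2 * M) powr (1/64) * exp (- a * real (card V))"
    proof (cases "unbalanced \<tau> V")
      case True then show ?thesis using C by simp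
    next
      case False
      have "(2 * M * exp (- (real (card V) * (sqrt p - sqrt q)\<^sup>2 / 2))) powr (1/64) = (2 * M) powr (1/64) * exp (- a * real (card V))"
        using M1 by (simp add: powr_mult exp_powr_real a_def)
      then show ?thesis using bound[OF V False] False by (simp add: mult.assoc)
    qed
  qed
  also have "\<dots> = C * (2 * M) powr (1/64) * measure_pmf.expectation nodes (\<lambda>V. exp (- a * real (card V)))" by simp
  also have "\<dots> \<le> C * (2 * M) powr (1/64) * exp (- M * (a - a\<^sup>2))"
    using C by (intro mult_left_mono expectation_exp_card a) auto
  also have "\<dots> = C * exp ((ln 2 + (ln M - rate + rate\<^sup>2 / (64 * M))) / 64)"
  proof -
    have "(2 * M) powr (1/64) = exp ((ln 2 + ln M) / 64)" using M1 by (simp add: powr_def ln_mult)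
    moreover have "- M * (a - a\<^sup>2) = (- rate + rate\<^sup>2 / (64 * M)) / 64"
      using M1 by (simp add: rM power2_eq_square field_simps)
    ultimately have "(2 * M) powr (1/64) * exp (- M * (a - a\<^sup>2)) = exp ((ln 2 + ln M) / 64 + (- rate + rate\<^sup>2 / (64 * M)) / 64)"
      by (simp only: exp_add)
    also have "(ln 2 + ln M) / 64 + (- rate + rate\<^sup>2 / (64 * M)) / 64 = (ln 2 + (ln M - rate + rate\<^sup>2 / (64 * M))) / 64"
      by argo
    finally show ?thesis by (simp only: mult.assoc)
  qed
  also have "\<dots> \<le> C * exp (1 + (ln (real n) - rate) / 128)"
  proof (intro mult_left_mono)
    have "ln M - rate + rate\<^sup>2 / (64 * M) \<le> 1 + (ln (real n) - rate) / 2"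
      using sample_exponent_le[OF M1 Mn r rate_le] .
    moreover have "ln 2 \<le> (1::real)" using ln_le_minus_one[of "2::real"] by simp
    ultimately have "(ln 2 + (ln M - rate + rate\<^sup>2 / (64 * M))) / 64 \<le> 1 + (ln (real n) - rate) / 128" by argo
    then show "exp ((ln 2 + (ln M - rate + rate\<^sup>2 / (64 * M))) / 64) \<le> exp (1 + (ln (real n) - rate) / 128)" by simp
  qed (use C in simp)
  also have "\<dots> = C * (exp 1 * (real n * exp (- rate)) powr (1/128))"
    using n by (simp add: powr_def ln_mult exp_add[symmetric])
  also have "\<dots> \<le> C * (3 * (real n * exp (- rate)) powr (1/128))"
    using C exp_le by (intro mult_left_mono mult_right_mono) auto
  finally show ?thesis by simp
qed

text \<open>
  The deviation of the community sizes that is allowed. A fraction of \<open>M\<close> would be enough,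
  except that the critical window, which can occur only if \<open>rate \<le> 4 * ln (2 * M)\<close>, requires a
  balance of order \<open>M powr (3/4)\<close>.
\<close>

definition tolerance :: real where
  "tolerance = (if rate \<le> 4 * ln (2 * M) then min (M / 600) (M powr (3/4) / 4) else M / 600)"

lemma tolerance_pos: "0 < M \<Longrightarrow> 0 < tolerance" and tolerance_le: "tolerance \<le> M / 600"
  by (auto simp: tolerance_def)

text \<open>
  The constant \<open>1 / 360000\<close> comes from here: \<open>(M / 600)\<^sup>2 / (2 * M)\<close> equals \<open>M / 720000\<close>, and
  \<open>2 * rate \<le> M\<close>. With the smaller tolerance the probability is of order \<open>exp (- sqrt M / 32)\<close>,
  which is less than every power of \<open>M\<close>, while \<open>exp (- rate)\<close> is at least \<open>(2 * M) powr (- 4)\<close>.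
\<close>

lemma prob_unbalanced_tolerance:
  assumes n: "n \<noteq> 0" and M1: "1 \<le> M"
  shows "measure_pmf.prob nodes {V. unbalanced tolerance V} \<le> 16384 * (real n * exp (- rate)) powr (1/360000)"
proof -
  define Y where "Y = real n * exp (- rate)"
  have "1 * exp (- rate) \<le> real n * exp (- rate)" using n by (intro mult_right_mono) auto
  then have Y: "exp (- rate) \<le> Y" by (simp add: Y_def)
  have r0: "0 \<le> rate" using M1 by (simp add: rate_def)
  have "measure_pmf.prob nodes {V. unbalanced tolerance V} \<le> 4 * exp (- (tolerance\<^sup>2 / (2 * M)))"
    using tolerance_pos tolerance_le M1 by (intro prob_unbalanced) (auto intro: order_trans)
  also have "exp (- (tolerance\<^sup>2 / (2 * M))) \<le> 4096 * Y powr (1/360000)"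
  proof -
    consider "tolerance = M / 600" | "rate \<le> 4 * ln (2 * M)" "tolerance = M powr (3/4) / 4"
      unfolding tolerance_def min_def by argo
    then show ?thesis
    proof cases
      case 1
      have "tolerance\<^sup>2 / (2 * M) = M / 720000" using M1 by (simp add: 1 power2_eq_square)
      then have "exp (- (tolerance\<^sup>2 / (2 * M))) \<le> exp (- rate / 360000)" using rate_le by simp
      also have "\<dots> = exp (- rate) powr (1/360000)" by (simp add: exp_powr_real)
      also have "\<dots> \<le> Y powr (1/360000)" using Y by (intro powr_mono2) auto
      finally show ?thesis using powr_ge_zero[of Y "1/360000"] by linarith
    next
      case 2
      have "(M powr (3/4))\<^sup>2 = M powr (3/2)" using M1 by (simp add: power2_eq_square powr_add[symmetric])
      also have "\<dots> = M powr 1 * M powr (1/2)" unfolding powr_add[symmetric] by simp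
      also have "\<dots> = M * sqrt M" using M1 by (simp add: powr_half_sqrt)
      finally have "tolerance\<^sup>2 / (2 * M) = sqrt M / 32" using M1 by (simp add: 2 power_divide)
      then have e: "exp (- (tolerance\<^sup>2 / (2 * M))) * (2 * M) \<le> 4096" using exp_minus_sqrt_le[of M] M1 by (simp only:)
      have "(2 * M) powr (-1) \<le> (2 * M) powr (- (4/360000))" using M1 by (intro powr_mono) auto
      also have "\<dots> = exp (- (4 * ln (2 * M)) / 360000)" using M1 by (simp add: powr_def)
      also have "\<dots> \<le> exp (- rate / 360000)" using 2 by simp
      also have "\<dots> = exp (- rate) powr (1/360000)" by (simp add: exp_powr_real)
      also have "\<dots> \<le> Y powr (1/360000)" using Y by (intro powr_mono2) auto
      finally have y: "1 / (2 * M) \<le> Y powr (1/360000)" using M1 by (simp add: powr_minus_divide)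
      have "exp (- (tolerance\<^sup>2 / (2 * M))) \<le> 4096 * (1 / (2 * M))" using e M1 by (simp add: field_simps)
      also have "\<dots> \<le> 4096 * Y powr (1/360000)" using y by simp
      finally show ?thesis .
    qed
  qed
  finally show ?thesis by (simp add: Y_def)
qed

lemma balanced_sample:
  assumes V: "V \<subseteq> {..<n}" "\<not> unbalanced tolerance V" and M3: "3 \<le> M"
  defines "m \<equiv> real (card V)" and "d \<equiv> \<bar>real (card (S1 \<inter> V)) - real (card (S2 \<inter> V))\<bar>"
  shows "2 \<le> card V" "m \<le> 2 * M" "d \<le> m / 128"
    "m * (sqrt p - sqrt q)\<^sup>2 / 2 \<le> 3 * ln m \<Longrightarrow> d \<le> m powr (3/4)"
proof -
  have fV: "finite V" using V finite_subset by blast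
  have "card V = card (S1 \<inter> V) + card (S2 \<inter> V)"
  proof -
    have "card (S1 \<inter> V \<union> S2 \<inter> V) = card (S1 \<inter> V) + card (S2 \<inter> V)"
      using part(2) fV by (intro card_Un_disjoint) auto
    then show ?thesis by (simp only: sample_Un[OF V(1)])
  qed
  then have m: "m = real (card (S1 \<inter> V)) + real (card (S2 \<inter> V))" by (simp add: m_def)
  have b: "\<bar>real (card (S1 \<inter> V)) - M / 2\<bar> \<le> tolerance" "\<bar>real (card (S2 \<inter> V)) - M / 2\<bar> \<le> tolerance"
    using V(2) by (auto simp: unbalanced_def)
  have d: "d \<le> 2 * tolerance" using b unfolding d_def by linarith
  have mM: "M - M / 300 \<le> m" "m \<le> M + M / 300" using b tolerance_le unfolding m by linarith+
  have "2 < m" using mM M3 by linarith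
  then show "2 \<le> card V" by (simp add: m_def)
  show m2: "m \<le> 2 * M" using mM M3 by linarith
  show "d \<le> m / 128" using d tolerance_le mM M3 by linarith
  assume R: "m * (sqrt p - sqrt q)\<^sup>2 / 2 \<le> 3 * ln m"
  have m0: "0 < m" using \<open>2 < m\<close> by simp
  have "rate * (3/4) \<le> m * (sqrt p - sqrt q)\<^sup>2 / 2"
  proof -
    have "(M * (3/4)) * (sqrt p - sqrt q)\<^sup>2 \<le> m * (sqrt p - sqrt q)\<^sup>2"
      using mM M3 by (intro mult_right_mono) auto
    then show ?thesis by (simp add: rate_def)
  qed
  also note R
  also have "3 * ln m \<le> 3 * ln (2 * M)" using m2 m0 by simp
  finally have "rate \<le> 4 * ln (2 * M)" by simp
  then have "tolerance \<le> M powr (3/4) / 4" by (simp add: tolerance_def)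
  then have "d \<le> M powr (3/4) / 2" using d by simp
  also have "\<dots> \<le> m powr (3/4)"
  proof -
    have "M powr (3/4) \<le> (2 * m) powr (3/4)" using mM M3 by (intro powr_mono2) auto
    also have "\<dots> = 2 powr (3/4) * m powr (3/4)" using m0 by (simp add: powr_mult)
    also have "\<dots> \<le> 2 powr 1 * m powr (3/4)" by (intro mult_right_mono powr_mono) auto
    finally show ?thesis by simp
  qed
  finally show "d \<le> m powr (3/4)" .
qed

text \<open>
  If \<open>real n * exp (- rate)\<close> is at least one or the mean sample size is bounded, the right-hand
  side is at least one. Otherwise recovery fails only if the majority step fails, the sample is
  unbalanced, or the program fails on a balanced sample.
\<close>

lemma prob_not_recovers_le:
  assumes n: "n \<noteq> 0" and C1: "1 \<le> C"
    and C: "\<And>I pe R1 R2 p q. two_communities I pe R1 R2 p q \<Longrightarrow>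
     let m = real (card (R1 \<union> R2)); R = two_communities.R R1 R2 p q in
      1 \<le> m \<longrightarrow> \<bar>real (card R1) - real (card R2)\<bar> \<le> m / 128 \<longrightarrow>
      (R \<le> 3 * ln m \<longrightarrow> \<bar>real (card R1) - real (card R2)\<bar> \<le> m powr (3/4)) \<longrightarrow>
      measure_pmf.prob (bernoulli_product I pe) {f. \<not> two_communities.sdp_good R1 R2 p q f} \<le> C * (m * exp (- R)) powr (1/64)"
  shows "measure_pmf.prob (pair_pmf edges nodes) {(f, V). \<not> recovers n p q S1 S2 (graph f) V}
    \<le> (16387 + 3 * C) * (real n * exp (- rate)) powr (1/360000)"
proof -
  define Y where "Y = real n * exp (- rate)"
  define P where "P = measure_pmf.prob (pair_pmf edges nodes) {(f, V). \<not> recovers n p q S1 S2 (graph f) V}"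
  have P1: "P \<le> 1" by (simp add: P_def)
  have Y0: "0 < Y" using n by (simp add: Y_def)
  have "P \<le> (16387 + 3 * C) * Y powr (1/360000)"
  proof (cases "Y < 1 \<and> 3 \<le> M")
    case False
    have "exp (- 2) \<le> Y powr (1/360000)"
    proof (cases "Y < 1")
      case True
      then have "rate \<le> 2" using False rate_le by linarith
      then have "exp (- 2) \<le> exp (- rate)" by simp
      also have "\<dots> = 1 * exp (- rate)" by simp
      also have "\<dots> \<le> Y" unfolding Y_def using n by (intro mult_right_mono) auto
      also have "Y = Y powr 1" using Y0 by simp
      also have "\<dots> \<le> Y powr (1/360000)" using True Y0 by (intro powr_mono') auto
      finally show ?thesis .
    next
      case False
      have "exp (- 2) \<le> (1::real)" by simp
      also have "\<dots> \<le> Y powr (1/360000)" using False by (intro ge_one_powr_ge_zero) auto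
      finally show ?thesis .
    qed
    moreover have "1 \<le> 9 * exp (- 2 :: real)"
    proof -
      have "exp (2::real) = exp 1 * exp 1" by (simp add: exp_add[symmetric])
      also have "\<dots> \<le> 3 * 3" using exp_le by (intro mult_mono) auto
      finally show ?thesis by (simp add: exp_minus field_simps)
    qed
    ultimately have "1 \<le> 9 * Y powr (1/360000)" by linarith
    also have "\<dots> \<le> (16387 + 3 * C) * Y powr (1/360000)" using C1 by (intro mult_right_mono) auto
    finally show ?thesis using P1 by linarith
  next
    case True
    then have Y1: "Y \<le> 1" and M3: "3 \<le> M" by auto
    have r: "ln (real n) \<le> rate"
    proof -
      have "ln Y \<le> 0" using Y0 Y1 by simp
      moreover have "ln Y = ln (real n) - rate" using n by (simp add: Y_def ln_mult)
      ultimately show ?thesis by simp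
    qed
    let ?G = "pair_pmf edges nodes"
    let ?bad = "\<lambda>f V. \<not> unbalanced tolerance V \<and> \<not> two_communities.sdp_good (S1 \<inter> V) (S2 \<inter> V) p q f"
    have sdp: "measure_pmf.prob ?G {(f, V). ?bad f V} \<le> 3 * C * Y powr (1/128)"
      unfolding Y_def
    proof (rule prob_sample_sdp_fails[OF n C1 _ r])
      fix V assume V: "V \<subseteq> {..<n}" "\<not> unbalanced tolerance V"
      note b = balanced_sample[OF V M3]
      interpret T: two_communities "vertex_pairs n" pe "S1 \<inter> V" "S2 \<inter> V" p q
        by (rule two_communities_sample[OF V(1)])
      have R: "T.R = real (card V) * (sqrt p - sqrt q)\<^sup>2 / 2"
        unfolding T.R_def T.del_def sample_Un[OF V(1)] ..
      have m1: "1 \<le> real (card V)" using b(1) by linarith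
      have "measure_pmf.prob edges {f. \<not> T.sdp_good f} \<le> C * (real (card V) * exp (- T.R)) powr (1/64)"
        using C[OF T.two_communities_axioms] m1 b(3,4) unfolding Let_def sample_Un[OF V(1)] R by blast
      also have "\<dots> \<le> C * (2 * M * exp (- T.R)) powr (1/64)"
        using C1 b(2) by (intro mult_left_mono powr_mono2 mult_right_mono) auto
      finally show "measure_pmf.prob edges {f. \<not> T.sdp_good f}
        \<le> C * (2 * M * exp (- (real (card V) * (sqrt p - sqrt q)\<^sup>2 / 2))) powr (1/64)" unfolding R .
    qed (use M3 in simp)
    have unb: "measure_pmf.prob ?G {(f, V). unbalanced tolerance V} \<le> 16384 * Y powr (1/360000)"
    proof -
      have "measure_pmf.prob ?G {(f, V). unbalanced tolerance V} = measure_pmf.prob (map_pmf snd ?G) {V. unbalanced tolerance V}"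
        unfolding measure_map_pmf by (simp add: vimage_def case_prod_unfold)
      then show ?thesis using prob_unbalanced_tolerance[OF n] M3 by (simp add: map_snd_pair_pmf Y_def)
    qed
    have ext: "measure_pmf.prob ?G {(f, V). extension_fails f V} \<le> 3 * Y"
      unfolding Y_def by (rule prob_extension_fails)
    have "P \<le> measure_pmf.prob ?G {z. (extension_fails (fst z) (snd z) \<or> unbalanced tolerance (snd z)) \<or> ?bad (fst z) (snd z)}"
    proof -
      have "P = measure_pmf.prob ?G {z. \<not> recovers n p q S1 S2 (graph (fst z)) (snd z)}"
        by (simp add: P_def case_prod_unfold)
      also have "\<dots> \<le> measure_pmf.prob ?G {z. (extension_fails (fst z) (snd z) \<or> unbalanced tolerance (snd z)) \<or> ?bad (fst z) (snd z)}"
      proof (rule prob_mono)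
        fix z assume z: "z \<in> set_pmf ?G" "\<not> recovers n p q S1 S2 (graph (fst z)) (snd z)"
        have V: "snd z \<subseteq> {..<n}" using z(1) set_nodes by (cases z) (simp only: set_pair_pmf mem_Sigma_iff snd_conv)
        show "(extension_fails (fst z) (snd z) \<or> unbalanced tolerance (snd z)) \<or> ?bad (fst z) (snd z)"
          using recovers_if[OF V balanced_sample(1)[OF V _ M3]] z(2) by blast
      qed
      finally show ?thesis .
    qed
    also have "\<dots> \<le> 3 * Y + 16384 * Y powr (1/360000) + 3 * C * Y powr (1/128)"
      using ext unb sdp
      by (intro order_trans[OF prob_disj_le] add_mono) (simp_all add: case_prod_unfold)
    also have "\<dots> \<le> 3 * Y powr (1/360000) + 16384 * Y powr (1/360000) + 3 * C * Y powr (1/360000)"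
    proof (intro add_mono mult_left_mono order_refl)
      have "Y powr 1 \<le> Y powr (1/360000)" using Y0 Y1 by (intro powr_mono') auto
      then show "Y \<le> Y powr (1/360000)" using Y0 by simp
      show "Y powr (1/128) \<le> Y powr (1/360000)" using Y0 Y1 by (intro powr_mono') auto
    qed (use C1 in auto)
    finally show ?thesis by (simp add: algebra_simps)
  qed
  then show ?thesis by (simp add: P_def Y_def)
qed

end

section \<open>Averaging over the planted partition\<close>

lemma (in sampled_sbm) prob_edge_pmf:
  "measure_pmf.prob (pair_pmf (edge_pmf n p q S1 S2) nodes) {(E, V). \<not> recovers n p q S1 S2 E V}
    = measure_pmf.prob (pair_pmf edges nodes) {(f, V). \<not> recovers n p q S1 S2 (graph f) V}"
proof -
  have "edge_pmf n p q S1 S2 = map_pmf graph edges"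
    unfolding edge_pmf_def pe_def[abs_def] graph_def[abs_def] ..
  then show ?thesis
    by (simp add: pair_map_pmf1 vimage_def case_prod_unfold)
qed

lemma balanced_partitions_nonempty:
  assumes "even n"
  shows "balanced_partitions n \<noteq> {}"
proof -
  have "card {n div 2..<n} = n div 2" using assms by auto
  then have "({..<n div 2}, {n div 2..<n}) \<in> balanced_partitions n"
    by (auto simp: balanced_partitions_def)
  then show ?thesis by blast
qed

lemma finite_balanced_partitions: "finite (balanced_partitions n)"
  by (rule finite_subset[of _ "Pow {..<n} \<times> Pow {..<n}"]) (auto simp: balanced_partitions_def)

text \<open>The partition is chosen first, so a bound that holds for every partition carries over.\<close>

lemma recovery_prob_ge:
  assumes n: "even n" and b0: "0 \<le> b"
    and b: "\<And>S1 S2. (S1, S2) \<in> balanced_partitions n \<Longrightarrow>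
      measure_pmf.prob (pair_pmf (edge_pmf n p q S1 S2) (node_sample_pmf n \<gamma>)) {(E, V). \<not> recovers n p q S1 S2 E V} \<le> b"
  shows "1 - b \<le> recovery_prob n p q \<gamma>"
proof -
  let ?S = "{(((S1, S2), E), V). recovers n p q S1 S2 E V}"
  let ?F = "\<lambda>S E V. \<not> recovers n p q (fst S) (snd S) E V"
  let ?N = "\<lambda>S. map_pmf (\<lambda>(E, V). ((S, E), V)) (pair_pmf (edge_pmf n p q (fst S) (snd S)) (node_sample_pmf n \<gamma>))"
  have eq: "sampled_sbm_pmf n p q \<gamma> = bind_pmf (pmf_of_set (balanced_partitions n)) ?N"
    unfolding sampled_sbm_pmf_def sbm_pmf_def pair_pmf_def map_pmf_def
    by (simp add: bind_assoc_pmf bind_return_pmf case_prod_unfold)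
  have "1 - recovery_prob n p q \<gamma> = measure_pmf.prob (sampled_sbm_pmf n p q \<gamma>) (- ?S)"
    unfolding recovery_prob_def using measure_pmf.prob_compl[of ?S "sampled_sbm_pmf n p q \<gamma>"] by (simp add: Compl_eq_Diff_UNIV)
  also have "\<dots> \<le> measure_pmf.expectation (pmf_of_set (balanced_partitions n)) (\<lambda>_. b)"
    unfolding eq
  proof (rule prob_bind_le)
    show "finite (set_pmf (pmf_of_set (balanced_partitions n)))"
      using finite_balanced_partitions balanced_partitions_nonempty[OF n] by simp
    fix S assume "S \<in> set_pmf (pmf_of_set (balanced_partitions n))"
    then have S: "(fst S, snd S) \<in> balanced_partitions n"
      using finite_balanced_partitions balanced_partitions_nonempty[OF n] by simp
    show "measure_pmf.prob (?N S) (- ?S) \<le> b"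
      using b[OF S] by (simp add: vimage_def case_prod_unfold Compl_eq)
  qed (rule b0)
  finally show ?thesis by simp
qed

theorem recovery_prob_exponent:
  "\<exists>C > (0::real). \<exists>c > (0::real).
      \<forall>(n::nat) (\<alpha>::real) (\<beta>::real) (\<gamma>::real) (p::real) (q::real).
        even n \<longrightarrow> 0 < \<gamma> \<longrightarrow> \<gamma> < 1 \<longrightarrow> \<beta> > 0 \<longrightarrow>
        p = \<alpha> * (ln (real n) / real n) \<longrightarrow> q = \<beta> * (ln (real n) / real n) \<longrightarrow>
        0 \<le> q \<longrightarrow> q < p \<longrightarrow> p \<le> 1 \<longrightarrow>
        recovery_prob n p q \<gamma>
          \<ge> 1 - C * real n powr (- c * ((\<alpha> + \<beta>) * (\<gamma> / 2) - \<gamma> * sqrt (\<alpha> * \<beta>) - 1))"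
proof -
  obtain C where C1: "1 \<le> C" and C: "\<And>I pe R1 R2 p q. two_communities I pe R1 R2 p q \<Longrightarrow>
     let m = real (card (R1 \<union> R2)); R = two_communities.R R1 R2 p q in
      1 \<le> m \<longrightarrow> \<bar>real (card R1) - real (card R2)\<bar> \<le> m / 128 \<longrightarrow>
      (R \<le> 3 * ln m \<longrightarrow> \<bar>real (card R1) - real (card R2)\<bar> \<le> m powr (3/4)) \<longrightarrow>
      measure_pmf.prob (bernoulli_product I pe) {f. \<not> two_communities.sdp_good R1 R2 p q f} \<le> C * (m * exp (- R)) powr (1/64)"
    using prob_fail_uniform by blast
  define c :: real where "c = 1/360000"
  have main: "1 - (16387 + 3 * C) * real n powr (- c * ((\<alpha> + \<beta>) * (\<gamma> / 2) - \<gamma> * sqrt (\<alpha> * \<beta>) - 1)) \<le> recovery_prob n p q \<gamma>"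
    if A: "even n" "0 < \<gamma>" "\<gamma> < 1" "0 < \<beta>" "p = \<alpha> * (ln (real n) / real n)" "q = \<beta> * (ln (real n) / real n)"
      "0 \<le> q" "q < p" "p \<le> 1" for n :: nat and \<alpha> \<beta> \<gamma> p q
  proof (rule recovery_prob_ge[OF A(1)])
    define l where "l = ln (real n) / real n"
    have l0: "l \<noteq> 0"
    proof
      assume "l = 0"
      then show False using A(8) unfolding A(5)[folded l_def] A(6)[folded l_def] by simp
    qed
    have n0: "n \<noteq> 0"
    proof
      assume "n = 0"
      then have "l = 0" by (simp add: l_def)
      then show False using l0 by simp
    qed
    have "0 \<le> l" using n0 by (simp add: l_def)
    then have l: "0 < l" using l0 by simp
    have q0: "0 < q" using A(4,6) l by (simp add: l_def[symmetric])
    have \<alpha>: "0 < \<alpha>" using A(5,8) q0 l by (simp add: l_def[symmetric] zero_less_mult_iff) (metis less_trans zero_less_mult_pos2)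
    show "0 \<le> (16387 + 3 * C) * real n powr (- c * ((\<alpha> + \<beta>) * (\<gamma> / 2) - \<gamma> * sqrt (\<alpha> * \<beta>) - 1))" using C1 by simp
    fix S1 S2 assume S: "(S1, S2) \<in> balanced_partitions n"
    interpret S: sampled_sbm n S1 S2 p q \<gamma>
      by unfold_locales (use S A q0 in \<open>auto simp: balanced_partitions_def\<close>)
    have rate: "S.rate = ((\<alpha> + \<beta>) * (\<gamma> / 2) - \<gamma> * sqrt (\<alpha> * \<beta>)) * ln (real n)"
    proof -
      have "sqrt (p * q) = sqrt ((\<alpha> * \<beta>) * l\<^sup>2)" using A(5,6) by (simp add: l_def power2_eq_square mult_ac)
      also have "\<dots> = sqrt (\<alpha> * \<beta>) * l" using l by (simp add: real_sqrt_mult)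
      finally have sq: "sqrt (p * q) = sqrt (\<alpha> * \<beta>) * l" .
      have "ln (real n) = real n * l" using n0 by (simp add: l_def)
      moreover have "S.rate = \<gamma> * real n / 2 * (\<alpha> * l - sqrt (\<alpha> * \<beta>) * l) + \<gamma> * real n / 2 * (\<beta> * l - sqrt (\<alpha> * \<beta>) * l)"
        using S.rate_eq unfolding S.M_def sq by (simp only: A(5,6) l_def)
      ultimately show ?thesis by (simp add: field_simps)
    qed
    have "(real n * exp (- S.rate)) powr c = real n powr (- c * ((\<alpha> + \<beta>) * (\<gamma> / 2) - \<gamma> * sqrt (\<alpha> * \<beta>) - 1))"
    proof -
      have "(real n * exp (- S.rate)) powr c = exp (c * (ln (real n) - S.rate))"
        using n0 by (simp add: powr_def ln_mult)
      also have "c * (ln (real n) - S.rate) = - c * ((\<alpha> + \<beta>) * (\<gamma> / 2) - \<gamma> * sqrt (\<alpha> * \<beta>) - 1) * ln (real n)"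
        unfolding rate by (simp add: field_simps)
      finally show ?thesis using n0 by (simp add: powr_def)
    qed
    moreover have "measure_pmf.prob (pair_pmf (edge_pmf n p q S1 S2) (node_sample_pmf n \<gamma>)) {(E, V). \<not> recovers n p q S1 S2 E V}
      \<le> (16387 + 3 * C) * (real n * exp (- S.rate)) powr c"
      unfolding S.prob_edge_pmf c_def by (rule S.prob_not_recovers_le[OF n0 C1 C])
    ultimately show "measure_pmf.prob (pair_pmf (edge_pmf n p q S1 S2) (node_sample_pmf n \<gamma>)) {(E, V). \<not> recovers n p q S1 S2 E V}
      \<le> (16387 + 3 * C) * real n powr (- c * ((\<alpha> + \<beta>) * (\<gamma> / 2) - \<gamma> * sqrt (\<alpha> * \<beta>) - 1))" by simp
  qed
  show ?thesis
  proof (intro exI conjI allI impI)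
    show "0 < 16387 + 3 * C" using C1 by simp
    show "0 < c" by (simp add: c_def)
  qed (rule main)
qed

theorem theorem2:
  "(\<exists>C > (0::real). \<exists>c > (0::real).
      \<forall>(n::nat) (\<alpha>::real) (\<beta>::real) (\<gamma>::real) (p::real) (q::real).
        even n \<longrightarrow> 0 < \<gamma> \<longrightarrow> \<gamma> < 1 \<longrightarrow> \<beta> > 0 \<longrightarrow>
        p = \<alpha> * (ln (real n) / real n) \<longrightarrow> q = \<beta> * (ln (real n) / real n) \<longrightarrow>
        0 \<le> q \<longrightarrow> q < p \<longrightarrow> p \<le> 1 \<longrightarrow>
        recovery_prob n p q \<gamma>
          \<ge> 1 - C * real n powr (- c * ((\<alpha> + \<beta>) * (\<gamma> / 2) - \<gamma> * sqrt (\<alpha> * \<beta>) - 1)))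
   \<and> (\<forall>(\<alpha>::real) (\<beta>::real) (\<gamma>::real).
        0 < \<gamma> \<longrightarrow> \<gamma> < 1 \<longrightarrow> \<beta> > 0 \<longrightarrow> \<alpha> > \<beta> \<longrightarrow>
        \<gamma> > 2 / (sqrt \<alpha> - sqrt \<beta>)\<^sup>2 \<longrightarrow>
        ((\<lambda>n. recovery_prob n (\<alpha> * (ln (real n) / real n)) (\<beta> * (ln (real n) / real n)) \<gamma>)
          \<longlongrightarrow> 1) (inf sequentially (principal {n. even n})))"
proof (intro conjI allI impI)
  show "\<exists>C > (0::real). \<exists>c > (0::real).
      \<forall>(n::nat) (\<alpha>::real) (\<beta>::real) (\<gamma>::real) (p::real) (q::real).
        even n \<longrightarrow> 0 < \<gamma> \<longrightarrow> \<gamma> < 1 \<longrightarrow> \<beta> > 0 \<longrightarrow>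
        p = \<alpha> * (ln (real n) / real n) \<longrightarrow> q = \<beta> * (ln (real n) / real n) \<longrightarrow>
        0 \<le> q \<longrightarrow> q < p \<longrightarrow> p \<le> 1 \<longrightarrow>
        recovery_prob n p q \<gamma>
          \<ge> 1 - C * real n powr (- c * ((\<alpha> + \<beta>) * (\<gamma> / 2) - \<gamma> * sqrt (\<alpha> * \<beta>) - 1))"
    by (rule recovery_prob_exponent)
next
  fix \<alpha> \<beta> \<gamma> :: real
  assume A: "0 < \<gamma>" "\<gamma> < 1" "\<beta> > 0" "\<alpha> > \<beta>" and g: "\<gamma> > 2 / (sqrt \<alpha> - sqrt \<beta>)\<^sup>2"
  obtain C c :: real where C: "0 < C" "0 < c" and rec: "\<And>n \<alpha> \<beta> \<gamma> p q.
        even n \<Longrightarrow> 0 < \<gamma> \<Longrightarrow> \<gamma> < 1 \<Longrightarrow> \<beta> > 0 \<Longrightarrow>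
        p = \<alpha> * (ln (real n) / real n) \<Longrightarrow> q = \<beta> * (ln (real n) / real n) \<Longrightarrow>
        0 \<le> q \<Longrightarrow> q < p \<Longrightarrow> p \<le> 1 \<Longrightarrow>
        recovery_prob n p q \<gamma>
          \<ge> 1 - C * real n powr (- c * ((\<alpha> + \<beta>) * (\<gamma> / 2) - \<gamma> * sqrt (\<alpha> * \<beta>) - 1))"
    using recovery_prob_exponent by blast
  define J where "J = (\<alpha> + \<beta>) * (\<gamma> / 2) - \<gamma> * sqrt (\<alpha> * \<beta>) - 1"
  have J: "0 < J"
  proof -
    have "sqrt \<alpha> - sqrt \<beta> > 0" using A by simp
    then have "0 < (sqrt \<alpha> - sqrt \<beta>)\<^sup>2" by simp
    then have "2 < \<gamma> * (sqrt \<alpha> - sqrt \<beta>)\<^sup>2" using g by (simp add: pos_divide_less_eq)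
    also have "(sqrt \<alpha> - sqrt \<beta>)\<^sup>2 = \<alpha> + \<beta> - 2 * sqrt (\<alpha> * \<beta>)"
      using A by (simp add: power2_eq_square algebra_simps real_sqrt_mult)
    finally show ?thesis by (simp add: J_def algebra_simps)
  qed
  let ?f = "\<lambda>n. recovery_prob n (\<alpha> * (ln (real n) / real n)) (\<beta> * (ln (real n) / real n)) \<gamma>"
  have small: "eventually (\<lambda>n. \<alpha> * (ln (real n) / real n) \<le> 1) sequentially"
  proof -
    have "(\<lambda>n. \<alpha> * (ln (real n) / real n)) \<longlonglongrightarrow> 0" by real_asymp
    then show ?thesis by (rule eventually_mono[OF order_tendstoD(2), of _ _ _ 1]) auto
  qed
  have low: "eventually (\<lambda>n. 1 - C * real n powr (- c * J) \<le> ?f n) (inf sequentially (principal {n. even n}))"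
    unfolding eventually_inf_principal
    using small eventually_ge_at_top[of 2]
  proof eventually_elim
    case (elim n)
    have l: "0 < ln (real n) / real n" using elim by simp
    have "\<beta> * (ln (real n) / real n) < \<alpha> * (ln (real n) / real n)" "0 \<le> \<beta> * (ln (real n) / real n)"
      using mult_strict_right_mono[OF A(4) l] mult_nonneg_nonneg[of \<beta> "ln (real n) / real n"] A(3) l by linarith+
    then show ?case unfolding J_def using rec[OF _ A(1-3) refl refl] elim by blast
  qed
  have lim: "(\<lambda>n. 1 - C * real n powr (- c * J)) \<longlonglongrightarrow> 1"
  proof -
    define e where "e = c * J"
    have "0 < e" using C J by (simp add: e_def)
    then have "(\<lambda>n. 1 - C * real n powr (- e)) \<longlonglongrightarrow> 1" by real_asymp
    then show ?thesis by (simp add: e_def)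
  qed
  show "(?f \<longlongrightarrow> 1) (inf sequentially (principal {n. even n}))"
  proof (rule tendsto_sandwich[OF low])
    show "eventually (\<lambda>n. ?f n \<le> 1) (inf sequentially (principal {n. even n}))"
      by (simp add: recovery_prob_def)
    show "((\<lambda>n. 1 - C * real n powr (- c * J)) \<longlongrightarrow> 1) (inf sequentially (principal {n. even n}))"
      using lim by (rule filterlim_mono) auto
  qed auto
qed

end
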